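(* If $\mathcal{E}$ is an atomic (Grothendieck) topos, then its category of points $\mathsf{pt}(\mathcal{E})$ is a candidate category of saturated objects.
   Context: For a Grothendieck topos $\mathcal{E}$, $\mathsf{pt}(\mathcal{E})$ is the category of geometric morphisms $\mathbf{Set}\to\mathcal{E}$, with natural transformations between inverse images as morphisms; it is an accessible category with directed colimits. A Grothendieck topos is atomic if every object is a disjoint union (coproduct) of atoms; equivalently the subobject lattice of every object is a complete atomic boolean algebra; equivalently it is the category of sheaves on an atomic site. $\text{Acc}_\omega$ is the $2$-category of accessible categories having directed colimits, functors preserving directed colimits, and natural transformations. An object $s$ of an accessible category $\mathcal{K}$ is $\omega$-saturated if for each map $p\to p'$ between finitely presentable objects, every map $p\to s$ extends along $p\to p'$. $\text{Sat}_\omega(\mathcal{K})$ is the full subcategory of $\omega$-saturated objects, and $\mathcal{K}_\omega$ is the full subcategory of finitely presentable objects. $\mathcal{A}\in\text{Acc}_\omega$ is a candidate category of saturated objects if there is a functor $j:\mathcal{A}\to\mathcal{K}$ in $\text{Acc}_\omega$ such that: (1) $\mathcal{K}$ is a finitely accessible category; (2) $j\mathcal{A}\subset\text{Sat}_\omega(\mathcal{K})$; (3) $\mathcal{K}_\omega$ has the amalgamation property (every span can be completed to a commutative square). *)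

theory Defs
  imports "HOL-Library.Equipollence" "HOL-Library.Countable_Set" "HOL-Library.FuncSet"
begin

text \<open>
  Size conventions.  The type \<open>'u\<close> plays the role of a fixed Grothendieck universe: if
  \<open>inaccessible TYPE('u)\<close> holds, then the sets of cardinality below that of \<open>'u\<close> are the small ones,
  and the small subsets of \<open>'u\<close>, with all functions between them, are (up to equivalence) the
  category of small sets.  HOL proves no type to be inaccessible, so this is an assumption of any
  theorem that uses it, as the existence of a universe is an assumption over ZFC.
\<close>

text \<open>The cardinal number \<open>\<kappa>\<close> is represented by any set \<open>K\<close> of that cardinality; a set has fewer than
  \<open>\<kappa>\<close> elements iff it is strictly dominated by \<open>K\<close>.\<close>

definition regular_cardinal :: "'k set \<Rightarrow> bool" where
  "regular_cardinal K \<longleftrightarrow> infinite K \<and>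
     (\<forall>X (A :: 'k \<Rightarrow> 'k set). X \<subseteq> K \<and> X \<prec> K \<and> (\<forall>x\<in>X. A x \<subseteq> K \<and> A x \<prec> K) \<longrightarrow> (\<Union>x\<in>X. A x) \<prec> K)"

definition inaccessible :: "'u itself \<Rightarrow> bool" where
  "inaccessible U \<longleftrightarrow> uncountable (UNIV :: 'u set) \<and> regular_cardinal (UNIV :: 'u set) \<and>
     (\<forall>A :: 'u set. A \<prec> (UNIV :: 'u set) \<longrightarrow> Pow A \<prec> (UNIV :: 'u set))"

definition small :: "'u itself \<Rightarrow> 'a set \<Rightarrow> bool" where
  "small U A \<longleftrightarrow> A \<prec> (UNIV :: 'u set)"

text \<open>\<open>Comp C g f\<close> is \<open>g\<close> after \<open>f\<close>.\<close>

record ('o, 'm) cat =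
  Obj :: "'o set"
  Arr :: "'m set"
  Dom :: "'m \<Rightarrow> 'o"
  Cod :: "'m \<Rightarrow> 'o"
  Ident :: "'o \<Rightarrow> 'm"
  Comp :: "'m \<Rightarrow> 'm \<Rightarrow> 'm"

definition hom :: "('o, 'm) cat \<Rightarrow> 'o \<Rightarrow> 'o \<Rightarrow> 'm set" where
  "hom C a b = {f \<in> Arr C. Dom C f = a \<and> Cod C f = b}"

definition category :: "('o, 'm) cat \<Rightarrow> bool" where
  "category C \<longleftrightarrow>
     (\<forall>f\<in>Arr C. Dom C f \<in> Obj C \<and> Cod C f \<in> Obj C) \<and>
     (\<forall>a\<in>Obj C. Ident C a \<in> hom C a a) \<and>
     (\<forall>f\<in>Arr C. \<forall>g\<in>Arr C. Dom C g = Cod C f \<longrightarrow> Comp C g f \<in> hom C (Dom C f) (Cod C g)) \<and>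
     (\<forall>f\<in>Arr C. Comp C f (Ident C (Dom C f)) = f \<and> Comp C (Ident C (Cod C f)) f = f) \<and>
     (\<forall>f\<in>Arr C. \<forall>g\<in>Arr C. \<forall>h\<in>Arr C. Dom C g = Cod C f \<and> Dom C h = Cod C g \<longrightarrow>
        Comp C h (Comp C g f) = Comp C (Comp C h g) f)"

definition small_category :: "'u itself \<Rightarrow> ('o, 'm) cat \<Rightarrow> bool" where
  "small_category U C \<longleftrightarrow> category C \<and> small U (Obj C) \<and> small U (Arr C)"

definition locally_small :: "'u itself \<Rightarrow> ('o, 'm) cat \<Rightarrow> bool" where
  "locally_small U C \<longleftrightarrow> (\<forall>a\<in>Obj C. \<forall>b\<in>Obj C. small U (hom C a b))"

definition is_iso :: "('o, 'm) cat \<Rightarrow> 'm \<Rightarrow> bool" where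
  "is_iso C f \<longleftrightarrow> f \<in> Arr C \<and> (\<exists>g \<in> hom C (Cod C f) (Dom C f).
     Comp C g f = Ident C (Dom C f) \<and> Comp C f g = Ident C (Cod C f))"

definition monic :: "('o, 'm) cat \<Rightarrow> 'm \<Rightarrow> bool" where
  "monic C m \<longleftrightarrow> m \<in> Arr C \<and> (\<forall>x\<in>Obj C. \<forall>f \<in> hom C x (Dom C m). \<forall>g \<in> hom C x (Dom C m).
     Comp C m f = Comp C m g \<longrightarrow> f = g)"

definition initial :: "('o, 'm) cat \<Rightarrow> 'o \<Rightarrow> bool" where
  "initial C a \<longleftrightarrow> a \<in> Obj C \<and> (\<forall>b\<in>Obj C. \<exists>!f. f \<in> hom C a b)"

definition op_cat :: "('o, 'm) cat \<Rightarrow> ('o, 'm) cat" where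
  "op_cat C = \<lparr>Obj = Obj C, Arr = Arr C, Dom = Cod C, Cod = Dom C, Ident = Ident C,
     Comp = (\<lambda>g f. Comp C f g)\<rparr>"

definition full_subcat :: "('o, 'm) cat \<Rightarrow> 'o set \<Rightarrow> ('o, 'm) cat" where
  "full_subcat C X = \<lparr>Obj = Obj C \<inter> X, Arr = {f \<in> Arr C. Dom C f \<in> X \<and> Cod C f \<in> X},
     Dom = Dom C, Cod = Cod C, Ident = Ident C, Comp = Comp C\<rparr>"

definition discrete_cat :: "'i set \<Rightarrow> ('i, 'i) cat" where
  "discrete_cat I = \<lparr>Obj = I, Arr = I, Dom = (\<lambda>i. i), Cod = (\<lambda>i. i), Ident = (\<lambda>i. i),
     Comp = (\<lambda>j i. i)\<rparr>"

definition poset_cat :: "'i set \<Rightarrow> 'i rel \<Rightarrow> ('i, 'i \<times> 'i) cat" where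
  "poset_cat I r = \<lparr>Obj = I, Arr = r, Dom = fst, Cod = snd, Ident = (\<lambda>i. (i, i)),
     Comp = (\<lambda>q p. (fst p, snd q))\<rparr>"

text \<open>The category of the subsets of \<open>'a\<close> that satisfy \<open>P\<close>, and all functions between them.\<close>

type_synonym 'a setarr = "'a set \<times> ('a \<Rightarrow> 'a) \<times> 'a set"

definition sets_cat :: "('a set \<Rightarrow> bool) \<Rightarrow> ('a set, 'a setarr) cat" where
  "sets_cat P = \<lparr>Obj = {A. P A}, Arr = {(A, f, B). P A \<and> P B \<and> f \<in> A \<rightarrow>\<^sub>E B},
     Dom = (\<lambda>(A, f, B). A), Cod = (\<lambda>(A, f, B). B), Ident = (\<lambda>A. (A, \<lambda>x\<in>A. x, A)),
     Comp = (\<lambda>(B', g, C) (A, f, B). (A, compose A g f, C))\<rparr>"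

definition Set_cat :: "'u itself \<Rightarrow> ('u set, 'u setarr) cat" where
  "Set_cat U = sets_cat (small U)"

definition app :: "'a setarr \<Rightarrow> 'a \<Rightarrow> 'a" where
  "app s = fst (snd s)"

record ('o, 'm, 'p, 'n) fctr =
  on_obj :: "'o \<Rightarrow> 'p"
  on_arr :: "'m \<Rightarrow> 'n"

definition is_functor :: "('o, 'm) cat \<Rightarrow> ('p, 'n) cat \<Rightarrow> ('o, 'm, 'p, 'n) fctr \<Rightarrow> bool" where
  "is_functor C D F \<longleftrightarrow> category C \<and> category D \<and>
     on_obj F \<in> extensional (Obj C) \<and> on_arr F \<in> extensional (Arr C) \<and>
     (\<forall>a\<in>Obj C. on_obj F a \<in> Obj D) \<and>
     (\<forall>f\<in>Arr C. on_arr F f \<in> hom D (on_obj F (Dom C f)) (on_obj F (Cod C f))) \<and>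
     (\<forall>a\<in>Obj C. on_arr F (Ident C a) = Ident D (on_obj F a)) \<and>
     (\<forall>f\<in>Arr C. \<forall>g\<in>Arr C. Dom C g = Cod C f \<longrightarrow>
        on_arr F (Comp C g f) = Comp D (on_arr F g) (on_arr F f))"

definition id_functor :: "('o, 'm) cat \<Rightarrow> ('o, 'm, 'o, 'm) fctr" where
  "id_functor C = \<lparr>on_obj = (\<lambda>a\<in>Obj C. a), on_arr = (\<lambda>f\<in>Arr C. f)\<rparr>"

definition comp_functor ::
  "('o, 'm) cat \<Rightarrow> ('p, 'n, 'q, 'l) fctr \<Rightarrow> ('o, 'm, 'p, 'n) fctr \<Rightarrow> ('o, 'm, 'q, 'l) fctr" where
  "comp_functor C G F = \<lparr>on_obj = compose (Obj C) (on_obj G) (on_obj F),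
     on_arr = compose (Arr C) (on_arr G) (on_arr F)\<rparr>"

definition nat_trans :: "('o, 'm) cat \<Rightarrow> ('p, 'n) cat \<Rightarrow>
    ('o, 'm, 'p, 'n) fctr \<Rightarrow> ('o, 'm, 'p, 'n) fctr \<Rightarrow> ('o \<Rightarrow> 'n) set" where
  "nat_trans C D F G = {\<eta> \<in> extensional (Obj C).
     (\<forall>a\<in>Obj C. \<eta> a \<in> hom D (on_obj F a) (on_obj G a)) \<and>
     (\<forall>f\<in>Arr C. Comp D (on_arr G f) (\<eta> (Dom C f)) = Comp D (\<eta> (Cod C f)) (on_arr F f))}"

definition nat_isos :: "('o, 'm) cat \<Rightarrow> ('p, 'n) cat \<Rightarrow>
    ('o, 'm, 'p, 'n) fctr \<Rightarrow> ('o, 'm, 'p, 'n) fctr \<Rightarrow> ('o \<Rightarrow> 'n) set" where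
  "nat_isos C D F G = {\<eta> \<in> nat_trans C D F G. \<forall>a\<in>Obj C. is_iso D (\<eta> a)}"

text \<open>The category with set of objects \<open>X\<close> whose arrows \<open>x \<rightarrow> y\<close> are the natural transformations
  \<open>T x \<Rightarrow> T y\<close> between the underlying functors \<open>C \<rightarrow> D\<close>.\<close>

definition functor_cat :: "('o, 'm) cat \<Rightarrow> ('p, 'n) cat \<Rightarrow> 'x set \<Rightarrow> ('x \<Rightarrow> ('o, 'm, 'p, 'n) fctr) \<Rightarrow>
    ('x, 'x \<times> ('o \<Rightarrow> 'n) \<times> 'x) cat" where
  "functor_cat C D X T = \<lparr>Obj = X,
     Arr = {(x, \<eta>, y). x \<in> X \<and> y \<in> X \<and> \<eta> \<in> nat_trans C D (T x) (T y)},
     Dom = (\<lambda>(x, \<eta>, y). x), Cod = (\<lambda>(x, \<eta>, y). y),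
     Ident = (\<lambda>x. (x, \<lambda>a\<in>Obj C. Ident D (on_obj (T x) a), x)),
     Comp = (\<lambda>(y', \<theta>, z) (x, \<eta>, y). (x, \<lambda>a\<in>Obj C. Comp D (\<theta> a) (\<eta> a), z))\<rparr>"

definition equivalent_cats :: "('o, 'm) cat \<Rightarrow> ('p, 'n) cat \<Rightarrow> bool" where
  "equivalent_cats C D \<longleftrightarrow> (\<exists>F G. is_functor C D F \<and> is_functor D C G \<and>
     nat_isos C C (id_functor C) (comp_functor C G F) \<noteq> {} \<and>
     nat_isos D D (comp_functor D F G) (id_functor D) \<noteq> {})"

definition hom_functor :: "('o, 'm) cat \<Rightarrow> 'o \<Rightarrow> ('o, 'm, 'm set, 'm setarr) fctr" where
  "hom_functor C a = \<lparr>on_obj = (\<lambda>b\<in>Obj C. hom C a b),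
     on_arr = (\<lambda>f\<in>Arr C. (hom C a (Dom C f), \<lambda>g\<in>hom C a (Dom C f). Comp C f g, hom C a (Cod C f)))\<rparr>"

definition is_cocone :: "('i, 'k) cat \<Rightarrow> ('o, 'm) cat \<Rightarrow> ('i, 'k, 'o, 'm) fctr \<Rightarrow> 'o \<Rightarrow> ('i \<Rightarrow> 'm) \<Rightarrow> bool"
  where "is_cocone J C D c \<tau> \<longleftrightarrow> c \<in> Obj C \<and> (\<forall>i\<in>Obj J. \<tau> i \<in> hom C (on_obj D i) c) \<and>
     (\<forall>f\<in>Arr J. Comp C (\<tau> (Cod J f)) (on_arr D f) = \<tau> (Dom J f))"

definition is_colimit ::
  "('i, 'k) cat \<Rightarrow> ('o, 'm) cat \<Rightarrow> ('i, 'k, 'o, 'm) fctr \<Rightarrow> 'o \<Rightarrow> ('i \<Rightarrow> 'm) \<Rightarrow> bool"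
  where "is_colimit J C D c \<tau> \<longleftrightarrow> is_cocone J C D c \<tau> \<and>
     (\<forall>d \<sigma>. is_cocone J C D d \<sigma> \<longrightarrow> (\<exists>!h. h \<in> hom C c d \<and> (\<forall>i\<in>Obj J. Comp C h (\<tau> i) = \<sigma> i)))"

definition is_cone :: "('i, 'k) cat \<Rightarrow> ('o, 'm) cat \<Rightarrow> ('i, 'k, 'o, 'm) fctr \<Rightarrow> 'o \<Rightarrow> ('i \<Rightarrow> 'm) \<Rightarrow> bool"
  where "is_cone J C D c \<tau> \<longleftrightarrow> c \<in> Obj C \<and> (\<forall>i\<in>Obj J. \<tau> i \<in> hom C c (on_obj D i)) \<and>
     (\<forall>f\<in>Arr J. Comp C (on_arr D f) (\<tau> (Dom J f)) = \<tau> (Cod J f))"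

definition is_limit ::
  "('i, 'k) cat \<Rightarrow> ('o, 'm) cat \<Rightarrow> ('i, 'k, 'o, 'm) fctr \<Rightarrow> 'o \<Rightarrow> ('i \<Rightarrow> 'm) \<Rightarrow> bool"
  where "is_limit J C D c \<tau> \<longleftrightarrow> is_cone J C D c \<tau> \<and>
     (\<forall>d \<sigma>. is_cone J C D d \<sigma> \<longrightarrow> (\<exists>!h. h \<in> hom C d c \<and> (\<forall>i\<in>Obj J. Comp C (\<tau> i) h = \<sigma> i)))"

text \<open>Every finite category is isomorphic to one whose objects and arrows are natural numbers.\<close>

definition preserves_finite_limits ::
  "('o, 'm) cat \<Rightarrow> ('p, 'n) cat \<Rightarrow> ('o, 'm, 'p, 'n) fctr \<Rightarrow> bool" where
  "preserves_finite_limits C D F \<longleftrightarrow>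
     (\<forall>(J :: (nat, nat) cat) G c \<tau>. category J \<and> finite (Obj J) \<and> finite (Arr J) \<and>
        is_functor J C G \<and> is_limit J C G c \<tau> \<longrightarrow>
        is_limit J D (comp_functor J F G) (on_obj F c) (\<lambda>i. on_arr F (\<tau> i)))"

definition adjunction :: "('o, 'm) cat \<Rightarrow> ('p, 'n) cat \<Rightarrow> ('o, 'm, 'p, 'n) fctr \<Rightarrow>
    ('p, 'n, 'o, 'm) fctr \<Rightarrow> ('o \<Rightarrow> 'm) \<Rightarrow> ('p \<Rightarrow> 'n) \<Rightarrow> bool" where
  "adjunction C D L R \<eta> \<epsilon> \<longleftrightarrow> is_functor C D L \<and> is_functor D C R \<and>
     \<eta> \<in> nat_trans C C (id_functor C) (comp_functor C R L) \<and>
     \<epsilon> \<in> nat_trans D D (comp_functor D L R) (id_functor D) \<and>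
     (\<forall>c\<in>Obj C. Comp D (\<epsilon> (on_obj L c)) (on_arr L (\<eta> c)) = Ident D (on_obj L c)) \<and>
     (\<forall>d\<in>Obj D. Comp C (on_arr R (\<epsilon> d)) (\<eta> (on_obj R d)) = Ident C (on_obj R d))"

text \<open>Small diagrams may be taken to be indexed by small subsets of \<open>'u\<close>.  The empty subset has an
  upper bound, so directed posets are nonempty.\<close>

definition directed_poset :: "'u itself \<Rightarrow> 'k set \<Rightarrow> 'u set \<Rightarrow> 'u rel \<Rightarrow> bool" where
  "directed_poset U K I r \<longleftrightarrow> small U I \<and> partial_order_on I r \<and>
     (\<forall>X. X \<subseteq> I \<and> X \<prec> K \<longrightarrow> (\<exists>u\<in>I. \<forall>x\<in>X. (x, u) \<in> r))"

definition has_directed_colimits :: "'u itself \<Rightarrow> 'k set \<Rightarrow> ('o, 'm) cat \<Rightarrow> bool" where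
  "has_directed_colimits U K C \<longleftrightarrow>
     (\<forall>(I :: 'u set) r D. directed_poset U K I r \<and> is_functor (poset_cat I r) C D \<longrightarrow>
        (\<exists>c \<tau>. is_colimit (poset_cat I r) C D c \<tau>))"

definition preserves_directed_colimits :: "'u itself \<Rightarrow> 'k set \<Rightarrow> ('o, 'm) cat \<Rightarrow> ('p, 'n) cat \<Rightarrow>
    ('o, 'm, 'p, 'n) fctr \<Rightarrow> bool" where
  "preserves_directed_colimits U K C D F \<longleftrightarrow>
     (\<forall>(I :: 'u set) r G c \<tau>. directed_poset U K I r \<and> is_functor (poset_cat I r) C G \<and>
        is_colimit (poset_cat I r) C G c \<tau> \<longrightarrow>
        is_colimit (poset_cat I r) D (comp_functor (poset_cat I r) F G)
          (on_obj F c) (\<lambda>i. on_arr F (\<tau> i)))"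

text \<open>The hom-sets of \<open>C\<close> are subsets of the arrow type \<open>'m\<close>, so the hom-functor takes values in the
  category of all subsets of \<open>'m\<close>.  A directed diagram of hom-sets has the same colimit cocones with
  vertex in \<open>'m\<close> there as among all sets: if \<open>'m\<close> has two elements, mapping into a two-element set
  detects bijections, and if \<open>'m\<close> has one, all hom-sets and their directed colimits have at most one
  element and mapping into the empty set does.\<close>

definition presentable :: "'u itself \<Rightarrow> 'k set \<Rightarrow> ('o, 'm) cat \<Rightarrow> 'o \<Rightarrow> bool" where
  "presentable U K C a \<longleftrightarrow> a \<in> Obj C \<and>
     preserves_directed_colimits U K C (sets_cat (\<lambda>_ :: 'm set. True)) (hom_functor C a)"

definition accessible_at :: "'u itself \<Rightarrow> 'k set \<Rightarrow> ('o, 'm) cat \<Rightarrow> bool" where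
  "accessible_at U K C \<longleftrightarrow> category C \<and> locally_small U C \<and> has_directed_colimits U K C \<and>
     (\<exists>S. S \<subseteq> Obj C \<and> small U S \<and> (\<forall>s\<in>S. presentable U K C s) \<and>
        (\<forall>c\<in>Obj C. \<exists>(I :: 'u set) r D \<tau>. directed_poset U K I r \<and> is_functor (poset_cat I r) C D \<and>
           (\<forall>i\<in>I. on_obj D i \<in> S) \<and> is_colimit (poset_cat I r) C D c \<tau>))"

definition accessible :: "'u itself \<Rightarrow> ('o, 'm) cat \<Rightarrow> bool" where
  "accessible U C \<longleftrightarrow> (\<exists>K :: 'u set. small U K \<and> regular_cardinal K \<and> accessible_at U K C)"

abbreviation omega :: "nat set" where
  "omega \<equiv> UNIV"

definition finitely_accessible :: "'u itself \<Rightarrow> ('o, 'm) cat \<Rightarrow> bool" where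
  "finitely_accessible U C \<longleftrightarrow> accessible_at U omega C"

definition finitely_presentable :: "'u itself \<Rightarrow> ('o, 'm) cat \<Rightarrow> 'o \<Rightarrow> bool" where
  "finitely_presentable U C a \<longleftrightarrow> presentable U omega C a"

definition Acc_omega :: "'u itself \<Rightarrow> ('o, 'm) cat \<Rightarrow> bool" where
  "Acc_omega U C \<longleftrightarrow> accessible U C \<and> has_directed_colimits U omega C"

definition Acc_omega_functor :: "'u itself \<Rightarrow> ('o, 'm) cat \<Rightarrow> ('p, 'n) cat \<Rightarrow>
    ('o, 'm, 'p, 'n) fctr \<Rightarrow> bool" where
  "Acc_omega_functor U C D F \<longleftrightarrow> Acc_omega U C \<and> Acc_omega U D \<and> is_functor C D F \<and>
     preserves_directed_colimits U omega C D F"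

definition saturated :: "'u itself \<Rightarrow> ('o, 'm) cat \<Rightarrow> 'o \<Rightarrow> bool" where
  "saturated U C s \<longleftrightarrow> s \<in> Obj C \<and>
     (\<forall>p p'. finitely_presentable U C p \<and> finitely_presentable U C p' \<longrightarrow>
        (\<forall>u \<in> hom C p p'. \<forall>f \<in> hom C p s. \<exists>g \<in> hom C p' s. Comp C g u = f))"

definition Sat_omega :: "'u itself \<Rightarrow> ('o, 'm) cat \<Rightarrow> ('o, 'm) cat" where
  "Sat_omega U C = full_subcat C {s. saturated U C s}"

definition fp_subcat :: "'u itself \<Rightarrow> ('o, 'm) cat \<Rightarrow> ('o, 'm) cat" where
  "fp_subcat U C = full_subcat C {p. finitely_presentable U C p}"

definition amalgamation_property :: "('o, 'm) cat \<Rightarrow> bool" where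
  "amalgamation_property C \<longleftrightarrow> (\<forall>f\<in>Arr C. \<forall>g\<in>Arr C. Dom C f = Dom C g \<longrightarrow>
     (\<exists>w\<in>Obj C. \<exists>h \<in> hom C (Cod C f) w. \<exists>k \<in> hom C (Cod C g) w. Comp C h f = Comp C k g))"

text \<open>An accessible category is locally small and has at most \<open>'u\<close>-many objects up to isomorphism, and
  is therefore equivalent to one with objects and arrows in \<open>'u\<close>; so the existential quantifier
  ranges over all finitely accessible categories, up to equivalence.\<close>

definition candidate_saturated :: "'u itself \<Rightarrow> ('o, 'm) cat \<Rightarrow> bool" where
  "candidate_saturated U A \<longleftrightarrow> Acc_omega U A \<and>
     (\<exists>(K :: ('u, 'u) cat) j. Acc_omega_functor U A K j \<and>
        finitely_accessible U K \<and>
        on_obj j ` Obj A \<subseteq> Obj (Sat_omega U K) \<and>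
        amalgamation_property (fp_subcat U K))"

definition sieve :: "('o, 'm) cat \<Rightarrow> 'o \<Rightarrow> 'm set \<Rightarrow> bool" where
  "sieve C c S \<longleftrightarrow> S \<subseteq> {f \<in> Arr C. Cod C f = c} \<and>
     (\<forall>f\<in>S. \<forall>g\<in>Arr C. Cod C g = Dom C f \<longrightarrow> Comp C f g \<in> S)"

definition maximal_sieve :: "('o, 'm) cat \<Rightarrow> 'o \<Rightarrow> 'm set" where
  "maximal_sieve C c = {f \<in> Arr C. Cod C f = c}"

definition pullback_sieve :: "('o, 'm) cat \<Rightarrow> 'm \<Rightarrow> 'm set \<Rightarrow> 'm set" where
  "pullback_sieve C h S = {g \<in> Arr C. Cod C g = Dom C h \<and> Comp C h g \<in> S}"

definition grothendieck_topology :: "('o, 'm) cat \<Rightarrow> ('o \<Rightarrow> 'm set set) \<Rightarrow> bool" where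
  "grothendieck_topology C J \<longleftrightarrow>
     (\<forall>c\<in>Obj C. \<forall>S \<in> J c. sieve C c S) \<and>
     (\<forall>c\<in>Obj C. maximal_sieve C c \<in> J c) \<and>
     (\<forall>h\<in>Arr C. \<forall>S \<in> J (Cod C h). pullback_sieve C h S \<in> J (Dom C h)) \<and>
     (\<forall>c\<in>Obj C. \<forall>S \<in> J c. \<forall>R. sieve C c R \<and> (\<forall>h\<in>S. pullback_sieve C h R \<in> J (Dom C h)) \<longrightarrow> R \<in> J c)"

definition presheaf :: "'u itself \<Rightarrow> ('o, 'm) cat \<Rightarrow> ('o, 'm, 'u set, 'u setarr) fctr \<Rightarrow> bool" where
  "presheaf U C P \<longleftrightarrow> is_functor (op_cat C) (Set_cat U) P"

definition matching_family ::
  "('o, 'm) cat \<Rightarrow> ('o, 'm, 'u set, 'u setarr) fctr \<Rightarrow> 'm set \<Rightarrow> ('m \<Rightarrow> 'u) \<Rightarrow> bool" where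
  "matching_family C P S x \<longleftrightarrow> (\<forall>f\<in>S. x f \<in> on_obj P (Dom C f)) \<and>
     (\<forall>f\<in>S. \<forall>g\<in>Arr C. Cod C g = Dom C f \<longrightarrow> app (on_arr P g) (x f) = x (Comp C f g))"

definition is_sheaf :: "'u itself \<Rightarrow> ('o, 'm) cat \<Rightarrow> ('o \<Rightarrow> 'm set set) \<Rightarrow>
    ('o, 'm, 'u set, 'u setarr) fctr \<Rightarrow> bool" where
  "is_sheaf U C J P \<longleftrightarrow> presheaf U C P \<and>
     (\<forall>c\<in>Obj C. \<forall>S \<in> J c. \<forall>x. matching_family C P S x \<longrightarrow>
        (\<exists>!y. y \<in> on_obj P c \<and> (\<forall>f\<in>S. app (on_arr P f) y = x f)))"

definition sheaf_cat :: "'u itself \<Rightarrow> ('o, 'm) cat \<Rightarrow> ('o \<Rightarrow> 'm set set) \<Rightarrow>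
    (('o, 'm, 'u set, 'u setarr) fctr, ('o, 'm, 'u set, 'u setarr) fctr \<times> ('o \<Rightarrow> 'u setarr) \<times>
      ('o, 'm, 'u set, 'u setarr) fctr) cat" where
  "sheaf_cat U C J = functor_cat (op_cat C) (Set_cat U) {P. is_sheaf U C J P} (\<lambda>P. P)"

text \<open>Every small category is isomorphic to one with objects and arrows in \<open>'u\<close>.\<close>

definition grothendieck_topos :: "'u itself \<Rightarrow> ('o, 'm) cat \<Rightarrow> bool" where
  "grothendieck_topos U E \<longleftrightarrow> category E \<and>
     (\<exists>(C :: ('u, 'u) cat) J. small_category U C \<and> grothendieck_topology C J \<and>
        equivalent_cats E (sheaf_cat U C J))"

definition atom :: "('o, 'm) cat \<Rightarrow> 'o \<Rightarrow> bool" where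
  "atom E a \<longleftrightarrow> a \<in> Obj E \<and> \<not> initial E a \<and>
     (\<forall>m. monic E m \<and> Cod E m = a \<longrightarrow> initial E (Dom E m) \<or> is_iso E m)"

definition atomic_topos :: "'u itself \<Rightarrow> ('o, 'm) cat \<Rightarrow> bool" where
  "atomic_topos U E \<longleftrightarrow> grothendieck_topos U E \<and>
     (\<forall>x\<in>Obj E. \<exists>(I :: 'u set) A \<iota>. small U I \<and> is_functor (discrete_cat I) E A \<and>
        (\<forall>i\<in>I. atom E (on_obj A i)) \<and> is_colimit (discrete_cat I) E A x \<iota>)"

text \<open>A geometric morphism \<open>F \<rightarrow> E\<close> consists of its inverse image \<open>E \<rightarrow> F\<close>, its direct image \<open>F \<rightarrow> E\<close> and
  the adjunction between them.\<close>

record ('o, 'm, 'p, 'n) geom =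
  inverse_image :: "('o, 'm, 'p, 'n) fctr"
  direct_image :: "('p, 'n, 'o, 'm) fctr"
  adj_unit :: "'o \<Rightarrow> 'm"
  adj_counit :: "'p \<Rightarrow> 'n"

definition geometric_morphism ::
  "('p, 'n) cat \<Rightarrow> ('o, 'm) cat \<Rightarrow> ('o, 'm, 'p, 'n) geom \<Rightarrow> bool" where
  "geometric_morphism F E f \<longleftrightarrow>
     adjunction E F (inverse_image f) (direct_image f) (adj_unit f) (adj_counit f) \<and>
     preserves_finite_limits E F (inverse_image f)"

definition pt :: "'u itself \<Rightarrow> ('o, 'm) cat \<Rightarrow>
    (('o, 'm, 'u set, 'u setarr) geom, ('o, 'm, 'u set, 'u setarr) geom \<times> ('o \<Rightarrow> 'u setarr) \<times>
      ('o, 'm, 'u set, 'u setarr) geom) cat" where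
  "pt U E = functor_cat E (Set_cat U) {f. geometric_morphism (Set_cat U) E f} inverse_image"

end

theory Submission
 imports Defs
begin

text \<open>
 Choose a small set of atoms that is jointly epic, and let \<open>A\<close> be the full subcategory on it. Arrows between
 atoms are epic, and two arrows into the same atom can be completed to a commutative square in \<open>A\<close>. Call a
 functor from \<open>A\<close> to sets flat if its category of elements is cofiltered; it is encoded as one set of elements
 labelled by atoms, with a partial action. Maps between flat sets are injective, the small flat sets form a finitely
 accessible category \<open>K\<close> whose finitely presentable objects are generated by one element, and the completion of
 squares in \<open>A\<close> gives amalgamation in \<open>K\<close>. The inverse image of a point restricts to a flat set, on which arrows of
 \<open>A\<close> act surjectively because they are epic; this surjectivity is saturation. Conversely a saturated flat set \<open>R\<close>
 extends to a left exact functor, the filtered colimit of the functors represented by the labels of the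
 elements of \<open>R\<close>, and surjectivity makes it preserve covers, which yields the right adjoint. So the points are
 the saturated objects of \<open>K\<close>, which are closed under directed colimits and accessible by a downward closure
 argument.
\<close>

section \<open>Small sets and regular cardinals\<close>

text \<open>The topos is known only up to equivalence with sheaves on some site, and its objects
  live in an arbitrary type. Everything is therefore tested on generalized elements, the arrows from
  the images \<open>y0 c\<close> of the sheafified representables: equality, factorization, finite
  limits and subobjects are all handled through them. The objects \<open>y0 c\<close> need not be
  atoms and the site need not be subcanonical, which is why statements about arrows of the site hold
  only locally, on a cover. The category \<open>K\<close> must have its objects and arrows in
  \<open>'u\<close>, whereas points live in a type built over that of \<open>E\<close>; so flat
  sets, and not points, are encoded in \<open>'u\<close>, and the functor to \<open>K\<close> is
  obtained by transport. Injectivity of all maps of flat sets makes directed colimits in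
  \<open>K\<close> behave like unions and reduces presentability to generation by few elements. The
  accessibility index of the category of points is a regular cardinal above both
  \<open>omega\<close> and the number of arrows of \<open>A\<close>, because the closure argument
  takes countably many steps and applies one operation per arrow in each.\<close>

context
 includes cardinal_syntax
begin

lemma lepoll_iff_ordLeq: "A \<lesssim> B \<longleftrightarrow> |A| \<le>o |B|" unfolding lepoll_def card_of_ordLeq ..

lemma lesspoll_iff_ordLess: "A \<prec> B \<longleftrightarrow> |A| <o |B|"
 by (meson lepoll_iff_ordLeq lepoll_iff_leqpoll lesspoll_def not_ordLeq_iff_ordLess card_of_Well_order
   lepoll_antisym ordLess_imp_ordLeq eqpoll_imp_lepoll eqpoll_sym)

lemma infinite_Times_self_lepoll: "infinite A ==> A \<times> A \<lesssim> A"
 unfolding lepoll_iff_ordLeq by (metis card_of_Times_same_infinite ordIso_imp_ordLeq)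

lemma lesspoll_obtain_inj:
 assumes "A \<prec> K"
 obtains e where "inj_on e A" "e ` A \<subseteq> K" "e ` A \<prec> K"
proof -
 obtain e where "inj_on e A" "e ` A \<subseteq> K" using assms unfolding lesspoll_def lepoll_def by blast
 moreover have "e ` A \<prec> K" using image_lepoll lesspoll_trans1 assms by blast
 ultimately show thesis using that by blast
qed

text \<open>The definition of regularity speaks only of subsets of \<open>K\<close> indexed by a
  subset of \<open>K\<close>. An arbitrary family is moved there by encoding every member in
  \<open>K\<close> and tagging the codes with the code of the index, through an injection of
  \<open>K \<times> K\<close> into \<open>K\<close>; the tags keep codes from different members
  apart.\<close>

lemma regular_UN_lesspoll:
 assumes K: "regular_cardinal K" and X: "X \<prec> K" and A: "!!x. x : X ==> A x \<prec> K"
 shows "(\<Union>x\<in>X. A x) \<prec> K"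
proof -
 have inf: "infinite K" using K by (simp add: regular_cardinal_def)
 obtain p where p: "inj_on p (K \<times> K)" "p ` (K \<times> K) \<subseteq> K"
  using infinite_Times_self_lepoll[OF inf] unfolding lepoll_def by blast
 obtain e where e: "inj_on e X" "e ` X \<subseteq> K" "e ` X \<prec> K" using lesspoll_obtain_inj[OF X] .
 have "\<exists>h. inj_on h (A x) \<and> h ` A x \<subseteq> K \<and> h ` A x \<prec> K" if "x : X" for x
  using lesspoll_obtain_inj[OF A[OF that]] by metis
 then obtain h where h: "!!x. x : X ==> inj_on (h x) (A x) \<and> h x ` A x \<subseteq> K \<and> h x ` A x \<prec> K" by metis
 define B where "B k = (\<lambda>y. p (k, y)) ` h (inv_into X e k) ` A (inv_into X e k)" for k
 have B: "B k \<subseteq> K \<and> B k \<prec> K" if k: "k : e ` X" for k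
 proof -
  let ?x = "inv_into X e k"
  have x: "?x : X" using inv_into_into[OF k] .
  have "k : K" using k e by blast
  then show ?thesis using h[OF x] p(2) unfolding B_def by (fastforce intro: lesspoll_trans1[OF image_lepoll])
 qed
 have UB: "(\<Union>k\<in>e`X. B k) \<prec> K" using K e(2,3) B unfolding regular_cardinal_def by blast
 have "(\<Union>x\<in>X. A x) \<lesssim> (\<Union>k\<in>e`X. B k)"
 proof -
  have "\<exists>x. x : X \<and> y : A x" if "y : (\<Union>x\<in>X. A x)" for y using that by blast
  then obtain c where c: "!!y. y : (\<Union>x\<in>X. A x) ==> c y : X \<and> y : A (c y)" by metis
  define g where "g y = p (e (c y), h (c y) y)" for y
  have "inj_on g (\<Union>x\<in>X. A x)"
  proof (rule inj_onI)
   fix y z assume y: "y : (\<Union>x\<in>X. A x)" and z: "z : (\<Union>x\<in>X. A x)" and eq: "g y = g z"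
   have m: "(e (c y), h (c y) y) : K \<times> K" "(e (c z), h (c z) z) : K \<times> K" using c[OF y] c[OF z] e h by blast+
   have "e (c y) = e (c z)" "h (c y) y = h (c z) z" using inj_onD[OF p(1) eq[unfolded g_def] m] by auto
   moreover then have "c y = c z" using e(1) c[OF y] c[OF z] by (meson inj_onD)
   ultimately show "y = z" using h c[OF y] c[OF z] by (metis inj_onD)
  qed
  moreover have "g ` (\<Union>x\<in>X. A x) \<subseteq> (\<Union>k\<in>e`X. B k)"
  proof
   fix k assume "k : g ` (\<Union>x\<in>X. A x)"
   then obtain y where y: "y : (\<Union>x\<in>X. A x)" "k = g y" by blast
   have "g y : B (e (c y))" unfolding B_def g_def using c[OF y(1)] e(1) by auto
   then show "k : (\<Union>k\<in>e`X. B k)" using c[OF y(1)] y by blast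
  qed
  ultimately show ?thesis unfolding lepoll_def by blast
 qed
 then show ?thesis using UB lesspoll_trans1 by blast
qed

lemma regular_finite_lesspoll: "regular_cardinal K ==> finite A ==> A \<prec> K"
 by (simp add: finite_lesspoll_infinite regular_cardinal_def)

lemma regular_Un_lesspoll:
 assumes "regular_cardinal K" "A \<prec> K" "B \<prec> K" shows "A \<union> B \<prec> K"
 using regular_UN_lesspoll[OF assms(1) regular_finite_lesspoll[OF assms(1)], of "{True, False}" "\<lambda>b. if b then A else B"] assms
 by (auto simp: Un_commute split: if_splits)

lemma regular_Times_lesspoll:
 assumes "regular_cardinal K" "A \<prec> K" "B \<prec> K" shows "A \<times> B \<prec> K"
proof -
 have "A \<times> B = (\<Union>a\<in>A. Pair a ` B)" by auto
 then show ?thesis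
  using regular_UN_lesspoll[OF assms(1,2), of "\<lambda>a. Pair a ` B"] assms(3) by (metis image_lepoll lesspoll_trans1)
qed

lemma regular_omega: "regular_cardinal omega" unfolding regular_cardinal_def
 by (auto simp: finite_lesspoll_infinite dest: lesspoll_imp_lepoll)
  (metis (no_types, lifting) finite_UN_I finite_lesspoll_infinite infinite_UNIV_nat infinite_le_lepoll lesspoll_def lepoll_antisym)

lemma regular_cardinal_eqpoll:
 assumes K: "regular_cardinal K" and KL: "K \<approx> L"
 shows "regular_cardinal L" unfolding regular_cardinal_def
proof (intro conjI allI impI)
 show "infinite L" using K KL eqpoll_finite_iff unfolding regular_cardinal_def by blast
 fix X and A :: "'b => 'b set"
 assume "X \<subseteq> L \<and> X \<prec> L \<and> (\<forall>x\<in>X. A x \<subseteq> L \<and> A x \<prec> L)"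
 then have "(\<Union>x\<in>X. A x) \<prec> K" by (intro regular_UN_lesspoll[OF K]) (meson KL eqpoll_sym lesspoll_eq_trans)+
 then show "(\<Union>x\<in>X. A x) \<prec> L" using KL lesspoll_eq_trans by blast
qed

text \<open>The witness is the field of the cardinal successor of \<open>M\<close>; infinite
  successors are regular. The bound by \<open>Pow M\<close> is what keeps it small later,
  inaccessibility being a statement about power sets.\<close>

lemma regular_cardinal_successor:
 assumes "infinite M"
 shows "\<exists>K :: 'm set set. regular_cardinal K \<and> (M :: 'm set) \<prec> K \<and> K \<lesssim> Pow M"
proof -
 let ?r = "cardSuc |M|" let ?K = "Field ?r"
 have CM: "Card_order |M|" by (rule card_of_Card_order)
 have C: "Card_order ?r" by (rule cardSuc_Card_order[OF CM])
 have K: "|?K| =o ?r" using card_of_Field_ordIso[OF C] .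
 have fin: "infinite (Field |M| )" using assms by (simp add: Field_card_of)
 have inf: "infinite ?K" using cardSuc_finite[OF CM] fin by blast
 have reg: "regularCard ?r" using infinite_cardSuc_regularCard[OF fin CM] .
 have Cinf: "Cinfinite ?r" using inf C unfolding cinfinite_def by blast
 have less: "A \<prec> ?K \<longleftrightarrow> |A| <o ?r" for A :: "'x set"
  using K by (metis lesspoll_iff_ordLess ordLess_ordIso_trans ordIso_symmetric)
 have "regular_cardinal ?K" unfolding regular_cardinal_def
  using inf card_of_UNION_ordLess_infinite_Field_regularCard[OF reg Cinf] by (auto simp: less)
 moreover have "M \<prec> ?K" using cardSuc_greater[OF CM] by (simp add: less)
 moreover have "?K \<lesssim> Pow M"
 proof -
  have "|M| <o |Pow M|" by (rule card_of_Pow)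
  then have "?r \<le>o |Pow M|" using cardSuc_least[OF CM card_of_Card_order] by blast
  then show ?thesis unfolding lepoll_iff_ordLeq using K ordIso_ordLeq_trans by blast
 qed
 ultimately show ?thesis by blast
qed

end

section \<open>Closure properties of small sets\<close>

locale universe =
 fixes U :: "'u itself"
 assumes inacc: "inaccessible U"
begin

abbreviation sm :: "'a set => bool" where "sm A \<equiv> small U A"

lemma regular_univ: "regular_cardinal (UNIV :: 'u set)" using inacc unfolding inaccessible_def by blast

lemma infinite_univ: "infinite (UNIV :: 'u set)" using regular_univ unfolding regular_cardinal_def by blast

lemma sm_lepoll: "A \<lesssim> B ==> sm B ==> sm A" unfolding small_def using lesspoll_trans1 by blast

lemma sm_subset: "sm B ==> A \<subseteq> B ==> sm A" using sm_lepoll subset_imp_lepoll by blast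

lemma sm_image: "sm A ==> sm (f ` A)" using sm_lepoll image_lepoll by blast

lemma sm_inj: "inj_on f A ==> f ` A \<subseteq> B ==> sm B ==> sm A" by (rule sm_lepoll) (auto simp: lepoll_def)

lemma sm_finite: "finite A ==> sm A" unfolding small_def by (rule regular_finite_lesspoll[OF regular_univ])

lemma sm_UN: "sm X ==> (!!x. x : X ==> sm (A x)) ==> sm (\<Union>x\<in>X. A x)"
 unfolding small_def by (rule regular_UN_lesspoll[OF regular_univ])

lemma sm_Times: "sm A ==> sm B ==> sm (A \<times> B)" unfolding small_def by (rule regular_Times_lesspoll[OF regular_univ])

lemma sm_Un: "sm A ==> sm B ==> sm (A \<union> B)" unfolding small_def by (rule regular_Un_lesspoll[OF regular_univ])

lemma sm_Sigma: "sm A ==> (!!a. a : A ==> sm (B a)) ==> sm (Sigma A B)"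
proof -
 assume "sm A" "!!a. a : A ==> sm (B a)"
 moreover have "Sigma A B = (\<Union>a\<in>A. Pair a ` B a)" by auto
 ultimately show ?thesis using sm_UN[of A "\<lambda>a. Pair a ` B a"] sm_image by metis
qed

lemma sm_obtain_inj:
 assumes "sm A"
 obtains e :: "'a => 'u" where "inj_on e A" "sm (e ` A)" using assms lesspoll_obtain_inj unfolding small_def by metis

lemma sm_Pow: assumes "sm A" shows "sm (Pow A)"
proof -
 obtain e :: "'a => 'u" where e: "inj_on e A" "sm (e ` A)" using sm_obtain_inj[OF assms] .
 have "sm (Pow (e ` A))" using inacc e(2) unfolding inaccessible_def small_def by blast
 moreover have "inj_on ((`) e) (Pow A)" using e(1) by (simp add: inj_on_image_Pow)
 ultimately show ?thesis by (rule_tac sm_inj) auto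
qed

lemma sm_PiE: assumes "sm A" "!!a. a : A ==> sm (B a)" shows "sm (PiE A B)"
proof -
 have "inj_on (\<lambda>f. (\<lambda>a. (a, f a)) ` A) (PiE A B)"
 proof (rule inj_onI)
  fix f g assume f: "f : PiE A B" and g: "g : PiE A B" and eq: "(\<lambda>a. (a, f a)) ` A = (\<lambda>a. (a, g a)) ` A"
  have "f a = g a" if "a : A" for a using eq that by auto
  then show "f = g" using f g by (meson PiE_ext)
 qed
 moreover have "(\<lambda>f. (\<lambda>a. (a, f a)) ` A) ` PiE A B \<subseteq> Pow (Sigma A B)" by auto
 ultimately show ?thesis by (rule sm_inj) (intro sm_Pow sm_Sigma assms)
qed

lemma sm_omega: "sm omega"
proof -
 have "omega \<lesssim> (UNIV :: 'u set)" using infinite_univ infinite_le_lepoll by blast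
 moreover have "\<not> omega \<approx> (UNIV :: 'u set)"
  using inacc unfolding inaccessible_def by (metis countable_eqpoll countableI_type eqpoll_sym)
 ultimately show ?thesis unfolding small_def lesspoll_def by blast
qed

lemma Times_univ:
 assumes "A \<lesssim> (UNIV :: 'u set)" "B \<lesssim> (UNIV :: 'u set)" shows "A \<times> B \<lesssim> (UNIV :: 'u set)"
 by (rule lepoll_trans[OF times_lepoll_mono[OF assms] infinite_Times_self_lepoll[OF infinite_univ]])

lemma sm_imp_lepoll: "sm A ==> A \<lesssim> (UNIV :: 'u set)" unfolding small_def by (rule lesspoll_imp_lepoll)

text \<open>An inaccessible cardinal has only as many small subsets as elements. In the initial
  well-order of \<open>'u\<close> every segment is small; a small set not contained in any closed
  segment would exhibit \<open>'u\<close> as a small union of small segments, against regularity. So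
  a small set lies in the closed segment of some \<open>b\<close>, and is coded by \<open>b\<close>
  together with a code of it in the small power set of that segment.\<close>

lemma small_subsets_univ: "{A :: 'u set. sm A} \<lesssim> (UNIV :: 'u set)"
proof -
 let ?r = "card_of (UNIV :: 'u set)"
 have F: "Field ?r = UNIV" by (rule Field_card_of)
 have under_sm: "sm (underS ?r b)" for b using card_of_underS[OF card_of_Card_order, of b UNIV] F
  by (simp add: small_def lesspoll_iff_ordLess)
 have wo: "Well_order ?r" by (rule card_of_Well_order)
 have tot: "a = b \<or> (a, b) : ?r \<or> (b, a) : ?r" for a b
  using wo F unfolding well_order_on_def linear_order_on_def total_on_def by (metis UNIV_I)
 have "\<exists>b. A \<subseteq> insert b (underS ?r b)" if A: "sm A" for A :: "'u set"
 proof (rule ccontr)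
  assume neg: "\<nexists>b. A \<subseteq> insert b (underS ?r b)"
  have "\<exists>a\<in>A. b : underS ?r a" for b
  proof -
   obtain a where "a : A" "a \<noteq> b" "a \<notin> underS ?r b" using neg by blast
   then show ?thesis using tot[of a b] by (auto simp: underS_def)
  qed
  then have eq: "(\<Union>a\<in>A. underS ?r a) = (UNIV :: 'u set)" by blast
  have "sm (UNIV :: 'u set)" using sm_UN[OF A under_sm, of "\<lambda>a. a"] unfolding eq .
  then show False by (simp add: small_def)
 qed
 then obtain b where b: "!!A :: 'u set. sm A ==> A \<subseteq> insert (b A) (underS ?r (b A))" by metis
 have "sm (Pow (insert c (underS ?r c)))" for c by (rule sm_Pow) (rule sm_Un[OF sm_finite[of "{c}"] under_sm, simplified])
 then have "\<exists>e :: 'u set => 'u. inj_on e (Pow (insert c (underS ?r c)))" for c using sm_obtain_inj by metis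
 then obtain e :: "'u => 'u set => 'u" where e: "!!c. inj_on (e c) (Pow (insert c (underS ?r c)))" by metis
 have "inj_on (\<lambda>A. (b A, e (b A) A)) {A :: 'u set. sm A}"
 proof (rule inj_onI)
  fix A B :: "'u set" assume "A : {A. sm A}" "B : {A. sm A}" "(b A, e (b A) A) = (b B, e (b B) B)"
  then have s: "sm A" "sm B" and eq: "b A = b B" "e (b A) A = e (b A) B" by auto
  have "A : Pow (insert (b A) (underS ?r (b A)))" "B : Pow (insert (b A) (underS ?r (b A)))"
   using b[OF s(1)] b[OF s(2)] eq(1) by auto
  then show "A = B" using inj_onD[OF e eq(2)] by blast
 qed
 then have "{A :: 'u set. sm A} \<lesssim> (UNIV :: ('u \<times> 'u) set)" unfolding lepoll_def by blast
 moreover have "(UNIV :: ('u \<times> 'u) set) \<lesssim> (UNIV :: 'u set)"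
  using infinite_Times_self_lepoll[OF infinite_univ] by simp
 ultimately show ?thesis by (rule lepoll_trans)
qed

lemma small_subsets_lepoll:
 assumes "B \<lesssim> (UNIV :: 'u set)" shows "{A. A \<subseteq> B \<and> sm A} \<lesssim> (UNIV :: 'u set)"
proof -
 obtain e :: "'a => 'u" where e: "inj_on e B" using assms unfolding lepoll_def by blast
 have "inj_on ((`) e) {A. A \<subseteq> B \<and> sm A}" by (rule inj_on_subset[OF inj_on_image_Pow[OF e]]) blast
 moreover have "(`) e ` {A. A \<subseteq> B \<and> sm A} \<subseteq> {A. sm A}" using sm_image by blast
 ultimately have "{A. A \<subseteq> B \<and> sm A} \<lesssim> {A :: 'u set. sm A}" unfolding lepoll_def by blast
 then show ?thesis using small_subsets_univ by (rule lepoll_trans)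
qed

text \<open>The disjoint sum with \<open>omega\<close> is infinite and dominates both sets, so one
  successor cardinal exceeds both. It is bounded by the power set of a small set, hence small, and
  can be copied into \<open>'u\<close>.\<close>

lemma regular_above:
 assumes "sm M"
 obtains K :: "'u set" where "regular_cardinal K" "sm K" "M \<prec> K" "omega \<prec> K"
proof -
 let ?M = "M <+> omega"
 have sM: "sm ?M" unfolding Plus_def using assms by (intro sm_Un sm_image sm_omega)
 have inf: "infinite ?M" by simp
 obtain K0 :: "('a + nat) set set" where K0: "regular_cardinal K0" "?M \<prec> K0" "K0 \<lesssim> Pow ?M"
  using regular_cardinal_successor[OF inf] by blast
 have sK0: "sm K0" using K0(3) sm_Pow[OF sM] sm_lepoll by blast
 obtain e :: "_ => 'u" where e: "inj_on e K0" "sm (e ` K0)" using sm_obtain_inj[OF sK0] .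
 have eq: "K0 \<approx> e ` K0" using e(1) by (simp add: eqpoll_sym inj_on_image_eqpoll_self)
 have M: "M \<lesssim> ?M" unfolding lepoll_def by (intro exI[of _ Inl]) auto
 have o: "omega \<lesssim> ?M" unfolding lepoll_def by (intro exI[of _ Inr]) auto
 have "M \<prec> e ` K0" "omega \<prec> e ` K0"
  using lesspoll_eq_trans[OF lesspoll_trans1[OF M K0(2)] eq] lesspoll_eq_trans[OF lesspoll_trans1[OF o K0(2)] eq] by auto
 then show thesis using that regular_cardinal_eqpoll[OF K0(1) eq] e(2) by blast
qed

text \<open>Accessibility asks for a cardinal inside \<open>'u\<close>, finite accessibility is
  stated with the natural numbers; this copy links the two.\<close>

lemma countable_regular:
 obtains K :: "'u set" where "regular_cardinal K" "sm K" "K \<approx> omega"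
proof -
 obtain e :: "nat => 'u" where e: "inj_on e omega" "sm (e ` omega)" using sm_obtain_inj[OF sm_omega] .
 have eq: "omega \<approx> e ` omega" using e(1) by (simp add: eqpoll_sym inj_on_image_eqpoll_self)
 show thesis using that[OF regular_cardinal_eqpoll[OF regular_omega eq] e(2)] eq eqpoll_sym by blast
qed

end

section \<open>Categories, directed colimits and accessibility\<close>

abbreviation "fapp F g \<equiv> app (on_arr F g)"

lemma homD: "f : hom C a b ==> f : Arr C" "f : hom C a b ==> Dom C f = a" "f : hom C a b ==> Cod C f = b"
 by (simp_all add: hom_def)

lemma hom_self: "f : Arr C ==> f : hom C (Dom C f) (Cod C f)" by (simp add: hom_def)

lemma cat_hom_obj:
 assumes "category C" "f : hom C a b" shows "a : Obj C" "b : Obj C" using assms unfolding category_def hom_def by auto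

lemma cat_ident: "category C ==> a : Obj C ==> Ident C a : hom C a a" unfolding category_def by blast

lemma cat_comp: "category C ==> f : hom C a b ==> g : hom C b c ==> Comp C g f : hom C a c" unfolding category_def hom_def by simp

lemma cat_assoc:
 "category C ==> f : hom C a b ==> g : hom C b c ==> h : hom C c d ==>
  Comp C h (Comp C g f) = Comp C (Comp C h g) f" unfolding category_def hom_def by simp

lemma cat_ident_right: "category C ==> f : hom C a b ==> Comp C f (Ident C a) = f" unfolding category_def hom_def by auto

lemma cat_ident_left: "category C ==> f : hom C a b ==> Comp C (Ident C b) f = f" unfolding category_def hom_def by auto

lemma categoryI:
 assumes "!!f. f : Arr C ==> Dom C f : Obj C \<and> Cod C f : Obj C"
  and "!!a. a : Obj C ==> Ident C a : hom C a a"
  and "!!f g a b c. f : hom C a b ==> g : hom C b c ==> Comp C g f : hom C a c"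
  and "!!f a b. f : hom C a b ==> Comp C f (Ident C a) = f \<and> Comp C (Ident C b) f = f"
  and "!!f g h a b c d. f : hom C a b ==> g : hom C b c ==> h : hom C c d ==>
   Comp C h (Comp C g f) = Comp C (Comp C h g) f"
 shows "category C" unfolding category_def
proof (intro conjI ballI impI)
 fix f assume f: "f : Arr C"
 then have fh: "f : hom C (Dom C f) (Cod C f)" by (rule hom_self)
 show "Dom C f : Obj C" "Cod C f : Obj C" using assms(1)[OF f] by auto
 show "Comp C f (Ident C (Dom C f)) = f" "Comp C (Ident C (Cod C f)) f = f" using assms(4)[OF fh] by auto
 fix g assume g: "g : Arr C"
 then have gh: "g : hom C (Dom C g) (Cod C g)" by (rule hom_self)
 show "Comp C g f : hom C (Dom C f) (Cod C g)" if "Dom C g = Cod C f" using assms(3)[OF fh] gh that by metis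
 fix h assume h: "h : Arr C" and eq: "Dom C g = Cod C f \<and> Dom C h = Cod C g"
 show "Comp C h (Comp C g f) = Comp C (Comp C h g) f" using assms(5)[OF fh, of g "Cod C g" h] gh hom_self[OF h] eq by simp
qed (use assms(2) in blast)

lemma is_isoI:
 assumes "f : hom C a b" "g : hom C b a" "Comp C g f = Ident C a" "Comp C f g = Ident C b"
 shows "is_iso C f" using assms unfolding is_iso_def hom_def by auto

lemma is_isoE:
 assumes "is_iso C f" "f : hom C a b"
 obtains g where "g : hom C b a" "Comp C g f = Ident C a" "Comp C f g = Ident C b"
 using assms unfolding is_iso_def hom_def by auto

lemma functorI:
 assumes "category C" "category D" "on_obj F : extensional (Obj C)" "on_arr F : extensional (Arr C)"
  and "!!a. a : Obj C ==> on_obj F a : Obj D"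
  and "!!f a b. f : hom C a b ==> on_arr F f : hom D (on_obj F a) (on_obj F b)"
  and "!!a. a : Obj C ==> on_arr F (Ident C a) = Ident D (on_obj F a)"
  and "!!f g a b c. f : hom C a b ==> g : hom C b c ==>
   on_arr F (Comp C g f) = Comp D (on_arr F g) (on_arr F f)"
 shows "is_functor C D F" using assms unfolding is_functor_def hom_def by auto

lemma functor_cats: "is_functor C D F ==> category C" "is_functor C D F ==> category D" unfolding is_functor_def by blast+

lemma functor_obj: "is_functor C D F ==> a : Obj C ==> on_obj F a : Obj D" unfolding is_functor_def by blast

lemma functor_hom: "is_functor C D F ==> f : hom C a b ==> on_arr F f : hom D (on_obj F a) (on_obj F b)"
 unfolding is_functor_def hom_def by auto

lemma functor_ident: "is_functor C D F ==> a : Obj C ==> on_arr F (Ident C a) = Ident D (on_obj F a)"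
 unfolding is_functor_def by blast

lemma functor_comp:
 "is_functor C D F ==> f : hom C a b ==> g : hom C b c ==>
  on_arr F (Comp C g f) = Comp D (on_arr F g) (on_arr F f)" unfolding is_functor_def hom_def by auto

lemma comp_functor_obj: "a : Obj C ==> on_obj (comp_functor C G F) a = on_obj G (on_obj F a)"
 by (simp add: comp_functor_def compose_def)

lemma comp_functor_arr: "f : Arr C ==> on_arr (comp_functor C G F) f = on_arr G (on_arr F f)"
 by (simp add: comp_functor_def compose_def)

lemma is_functor_comp:
 assumes F: "is_functor C D F" and G: "is_functor D B G"
 shows "is_functor C B (comp_functor C G F)"
proof (rule functorI)
 note C = functor_cats(1)[OF F]
 show "category C" "category B" using functor_cats F G by blast+
 show "on_obj (comp_functor C G F) : extensional (Obj C)" "on_arr (comp_functor C G F) : extensional (Arr C)"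
  by (simp_all add: comp_functor_def)
 show "on_obj (comp_functor C G F) a : Obj B" if "a : Obj C" for a
  using that by (simp add: comp_functor_obj functor_obj[OF F] functor_obj[OF G])
 show "on_arr (comp_functor C G F) f : hom B (on_obj (comp_functor C G F) a) (on_obj (comp_functor C G F) b)"
  if f: "f : hom C a b" for f a b using functor_hom[OF G functor_hom[OF F f]] f cat_hom_obj[OF C f]
  by (simp add: comp_functor_obj comp_functor_arr homD(1))
 show "on_arr (comp_functor C G F) (Ident C a) = Ident B (on_obj (comp_functor C G F) a)" if a: "a : Obj C" for a
  using homD(1)[OF cat_ident[OF C a]] a functor_obj[OF F a]
  by (simp add: comp_functor_obj comp_functor_arr functor_ident[OF F] functor_ident[OF G])
 show "on_arr (comp_functor C G F) (Comp C g f) = Comp B (on_arr (comp_functor C G F) g) (on_arr (comp_functor C G F) f)"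
  if f: "f : hom C a b" and g: "g : hom C b c" for f g a b c using homD(1)[OF cat_comp[OF C f g]] homD(1)[OF f] homD(1)[OF g]
  by (simp add: comp_functor_arr functor_comp[OF F f g] functor_comp[OF G functor_hom[OF F f] functor_hom[OF F g]])
qed

section \<open>Diagrams indexed by directed posets\<close>

lemma poset_cat_simps [simp]:
 "Obj (poset_cat I r) = I" "Arr (poset_cat I r) = r" "Dom (poset_cat I r) = fst" "Cod (poset_cat I r) = snd"
 "Ident (poset_cat I r) i = (i, i)" "Comp (poset_cat I r) q p = (fst p, snd q)" by (simp_all add: poset_cat_def)

lemma hom_poset_cat: "p : hom (poset_cat I r) i k \<longleftrightarrow> p = (i, k) \<and> (i, k) : r" by (auto simp: hom_def)

lemma directed_posetD:
 assumes "directed_poset U K I r"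
 shows "(i, k) : r ==> i : I" "(i, k) : r ==> k : I" "i : I ==> (i, i) : r"
  "(i, k) : r ==> (k, l) : r ==> (i, l) : r" "small U I"
proof -
 have *: "small U I" "r \<subseteq> I \<times> I" "refl_on I r" "trans r"
  using assms unfolding directed_poset_def partial_order_on_def preorder_on_def by auto
 show "(i, k) : r ==> i : I" "(i, k) : r ==> k : I" using *(2) by auto
 show "i : I ==> (i, i) : r" using *(3) unfolding refl_on_def by blast
 show "(i, k) : r ==> (k, l) : r ==> (i, l) : r" using *(4) by (rule transD)
 show "small U I" by (rule *(1))
qed

lemma directed_poset_ub:
 assumes "directed_poset U K I r" "X \<subseteq> I" "X \<prec> K"
 obtains u where "u : I" "\<forall>x\<in>X. (x, u) : r"
proof -
 have "\<exists>u\<in>I. \<forall>x\<in>X. (x, u) : r" using assms(1)[unfolded directed_poset_def] assms(2,3) by simp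
 then show thesis using that by blast
qed

lemma directed_poset_ub2:
 assumes "directed_poset U K I r" "infinite K" "i : I" "k : I"
 obtains u where "u : I" "(i, u) : r" "(k, u) : r"
proof -
 have lt: "{i, k} \<prec> K" using finite_lesspoll_infinite[OF assms(2), of "{i, k}"] by simp
 have sub: "{i, k} \<subseteq> I" using assms(3,4) by simp
 obtain u where "u : I" "\<forall>x\<in>{i, k}. (x, u) : r" using directed_poset_ub[OF assms(1) sub lt] .
 then show thesis using that[of u] by simp
qed

lemma directed_poset_omega:
 assumes "directed_poset U K I r" "infinite K" shows "directed_poset U omega I r"
proof -
 have "X \<prec> K" if "X \<prec> omega" for X :: "'a set" using that assms(2) by (metis infinite_le_lepoll lesspoll_trans2)
 then show ?thesis using assms(1) unfolding directed_poset_def by blast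
qed

lemma category_poset_cat:
 assumes "partial_order_on I r" shows "category (poset_cat I r)"
 using assms unfolding partial_order_on_def preorder_on_def refl_on_def trans_def category_def hom_def by auto

lemma poset_functor_comp:
 assumes "is_functor (poset_cat I r) C D" "(i, k) : r" "(k, l) : r"
 shows "Comp C (on_arr D (k, l)) (on_arr D (i, k)) = on_arr D (i, l)"
 using functor_comp[OF assms(1), of "(i, k)" i k "(k, l)" l] assms(2,3) by (simp add: hom_poset_cat)

lemma poset_functor_hom:
 assumes "is_functor (poset_cat I r) C D" "(i, k) : r"
 shows "on_arr D (i, k) : hom C (on_obj D i) (on_obj D k)" using functor_hom[OF assms(1)] assms(2) by (simp add: hom_poset_cat)

definition poset_functor :: "'i set => 'i rel => ('i => 'o) => ('i => 'i => 'm) => ('i, 'i \<times> 'i, 'o, 'm) fctr" where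
 "poset_functor I r d delta = \<lparr>on_obj = restrict d I, on_arr = (\<lambda>p\<in>r. delta (fst p) (snd p))\<rparr>"

lemma poset_functor_simps [simp]:
 "i : I ==> on_obj (poset_functor I r d delta) i = d i"
 "(i, k) : r ==> on_arr (poset_functor I r d delta) (i, k) = delta i k" by (simp_all add: poset_functor_def)

lemma is_functor_poset_functor:
 assumes dp: "directed_poset U K I r" and C: "category C"
  and obj: "!!i. i : I ==> d i : Obj C"
  and arr: "!!i k. (i, k) : r ==> delta i k : hom C (d i) (d k)"
  and ident: "!!i. i : I ==> delta i i = Ident C (d i)"
  and comp: "!!i k l. (i, k) : r ==> (k, l) : r ==> delta i l = Comp C (delta k l) (delta i k)"
 shows "is_functor (poset_cat I r) C (poset_functor I r d delta)"
proof (rule functorI)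
 show "category (poset_cat I r)" using dp category_poset_cat unfolding directed_poset_def by blast
 show "category C" by (rule C)
 show "on_obj (poset_functor I r d delta) : extensional (Obj (poset_cat I r))"
  "on_arr (poset_functor I r d delta) : extensional (Arr (poset_cat I r))" by (simp_all add: poset_functor_def)
 show "on_obj (poset_functor I r d delta) a : Obj C" if "a : Obj (poset_cat I r)" for a using that obj by simp
 show "on_arr (poset_functor I r d delta) f : hom C (on_obj (poset_functor I r d delta) a) (on_obj (poset_functor I r d delta) b)"
  if "f : hom (poset_cat I r) a b" for f a b using that arr directed_posetD(1,2)[OF dp, of a b] by (auto simp: hom_poset_cat)
 show "on_arr (poset_functor I r d delta) (Ident (poset_cat I r) a) = Ident C (on_obj (poset_functor I r d delta) a)"
  if "a : Obj (poset_cat I r)" for a using that ident directed_posetD(3)[OF dp] by simp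
 show "on_arr (poset_functor I r d delta) (Comp (poset_cat I r) g f) =
   Comp C (on_arr (poset_functor I r d delta) g) (on_arr (poset_functor I r d delta) f)"
  if "f : hom (poset_cat I r) a b" "g : hom (poset_cat I r) b c" for f g a b c
  using that comp directed_posetD(4)[OF dp, of a b c] by (auto simp: hom_poset_cat)
qed

section \<open>Cocones and colimits\<close>

lemma poset_cocone_iff:
 "is_cocone (poset_cat I r) C D c tau \<longleftrightarrow> c : Obj C \<and> (\<forall>i\<in>I. tau i : hom C (on_obj D i) c) \<and>
   (\<forall>i k. (i, k) : r --> Comp C (tau k) (on_arr D (i, k)) = tau i)" by (auto simp: is_cocone_def)

lemma is_colimitD:
 assumes "is_colimit J C D c tau"
 shows "is_cocone J C D c tau" "c : Obj C" "!!i. i : Obj J ==> tau i : hom C (on_obj D i) c"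
 using assms unfolding is_colimit_def is_cocone_def by blast+

lemma is_colimit_factor:
 assumes "is_colimit J C D c tau" "is_cocone J C D d sigma"
 obtains h where "h : hom C c d" "!!i. i : Obj J ==> Comp C h (tau i) = sigma i" using assms unfolding is_colimit_def by blast

lemma cocone_comp:
 assumes J: "category J" and C: "category C" and D: "is_functor J C D"
  and cc: "is_cocone J C D c tau" and h: "h : hom C c d"
 shows "is_cocone J C D d (\<lambda>i. Comp C h (tau i))" unfolding is_cocone_def
proof (intro conjI ballI)
 show "d : Obj C" using cat_hom_obj(2)[OF C h] .
 show "Comp C h (tau i) : hom C (on_obj D i) d" if "i : Obj J" for i
  using cat_comp[OF C _ h] cc that unfolding is_cocone_def by blast
 show "Comp C (Comp C h (tau (Cod J f))) (on_arr D f) = Comp C h (tau (Dom J f))" if f: "f : Arr J" for f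
 proof -
  have "Cod J f : Obj J" using J f unfolding category_def by blast
  then show ?thesis using cat_assoc[OF C functor_hom[OF D hom_self[OF f]] _ h] cc f unfolding is_cocone_def by metis
 qed
qed

lemma is_colimit_ext:
 assumes J: "category J" and C: "category C" and D: "is_functor J C D"
  and cl: "is_colimit J C D c tau" and h: "h : hom C c d" "k : hom C c d"
  and eq: "!!i. i : Obj J ==> Comp C h (tau i) = Comp C k (tau i)"
 shows "h = k"
proof -
 have "is_cocone J C D d (\<lambda>i. Comp C k (tau i))" using cocone_comp[OF J C D is_colimitD(1)[OF cl] h(2)] .
 then show ?thesis using cl h eq unfolding is_colimit_def by blast
qed

lemma is_colimit_unique:
 assumes J: "category J" and C: "category C" and D: "is_functor J C D"
  and cl: "is_colimit J C D c tau" "is_colimit J C D c' tau'"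
 obtains h where "h : hom C c c'" "is_iso C h" "!!i. i : Obj J ==> Comp C h (tau i) = tau' i"
proof -
 obtain h where h: "h : hom C c c'" "!!i. i : Obj J ==> Comp C h (tau i) = tau' i"
  using is_colimit_factor[OF cl(1) is_colimitD(1)[OF cl(2)]] by blast
 obtain k where k: "k : hom C c' c" "!!i. i : Obj J ==> Comp C k (tau' i) = tau i"
  using is_colimit_factor[OF cl(2) is_colimitD(1)[OF cl(1)]] by blast
 note t = is_colimitD(3)[OF cl(1)] is_colimitD(3)[OF cl(2)] and o = is_colimitD(2)[OF cl(1)] is_colimitD(2)[OF cl(2)]
 have "Comp C k h = Ident C c" by (rule is_colimit_ext[OF J C D cl(1) cat_comp[OF C h(1) k(1)] cat_ident[OF C o(1)]])
   (simp add: cat_assoc[OF C t(1) h(1) k(1), symmetric] h(2) k(2) cat_ident_left[OF C t(1)])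
 moreover have "Comp C h k = Ident C c'" by (rule is_colimit_ext[OF J C D cl(2) cat_comp[OF C k(1) h(1)] cat_ident[OF C o(2)]])
   (simp add: cat_assoc[OF C t(2) k(1) h(1), symmetric] h(2) k(2) cat_ident_left[OF C t(2)])
 ultimately have "is_iso C h" using is_isoI[OF h(1) k(1)] by blast
 then show thesis using that h by blast
qed

lemma is_colimit_iso:
 assumes J: "category J" and C: "category C" and D: "is_functor J C D"
  and cl: "is_colimit J C D c tau" and h: "h : hom C c c'" "is_iso C h"
 shows "is_colimit J C D c' (\<lambda>i. Comp C h (tau i))" unfolding is_colimit_def
proof (intro conjI allI impI)
 show "is_cocone J C D c' (\<lambda>i. Comp C h (tau i))" using cocone_comp[OF J C D is_colimitD(1)[OF cl] h(1)] .
 fix d sigma assume s: "is_cocone J C D d sigma"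
 obtain k where k: "k : hom C c' c" "Comp C k h = Ident C c" "Comp C h k = Ident C c'" using is_isoE[OF h(2,1)] .
 obtain l where l: "l : hom C c d" "!!i. i : Obj J ==> Comp C l (tau i) = sigma i" using is_colimit_factor[OF cl s] by blast
 note t = is_colimitD(3)[OF cl]
 have lk: "Comp C l k : hom C c' d" using cat_comp[OF C k(1) l(1)] .
 show "\<exists>!m. m : hom C c' d \<and> (\<forall>i\<in>Obj J. Comp C m (Comp C h (tau i)) = sigma i)"
 proof (rule ex1I[of _ "Comp C l k"])
  have "Comp C (Comp C l k) (Comp C h (tau i)) = sigma i" if i: "i : Obj J" for i
   using cat_assoc[OF C t[OF i] h(1) lk] cat_assoc[OF C h(1) k(1) l(1)] k l cat_ident_right[OF C l(1)] i by simp
  then show "Comp C l k : hom C c' d \<and> (\<forall>i\<in>Obj J. Comp C (Comp C l k) (Comp C h (tau i)) = sigma i)"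
   using lk by blast
  fix m assume m: "m : hom C c' d \<and> (\<forall>i\<in>Obj J. Comp C m (Comp C h (tau i)) = sigma i)"
  then have m1: "m : hom C c' d" by blast
  have "Comp C m h = l" by (rule is_colimit_ext[OF J C D cl cat_comp[OF C h(1) m1] l(1)])
    (use m cat_assoc[OF C t h(1) m1] l(2) in simp)
  then have "Comp C l k = Comp C m (Comp C h k)" using cat_assoc[OF C k(1) h(1) m1] by simp
  then show "m = Comp C l k" using k(3) cat_ident_right[OF C m1] by simp
 qed
qed

lemma is_cocone_cong:
 assumes J: "category J"
  and "!!i. i : Obj J ==> on_obj D i = on_obj D' i" "!!f. f : Arr J ==> on_arr D f = on_arr D' f"
  and "!!i. i : Obj J ==> tau i = tau' i"
 shows "is_cocone J C D c tau \<longleftrightarrow> is_cocone J C D' c tau'"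
 using assms unfolding is_cocone_def category_def by auto

lemma is_colimit_cong:
 assumes J: "category J"
  and "!!i. i : Obj J ==> on_obj D i = on_obj D' i" "!!f. f : Arr J ==> on_arr D f = on_arr D' f"
  and "!!i. i : Obj J ==> tau i = tau' i"
 shows "is_colimit J C D c tau \<longleftrightarrow> is_colimit J C D' c tau'"
proof -
 have "is_cocone J C D d sigma \<longleftrightarrow> is_cocone J C D' d sigma" for d sigma
  using is_cocone_cong[OF assms(1-3)] by blast
 moreover have "is_cocone J C D c tau \<longleftrightarrow> is_cocone J C D' c tau'" using is_cocone_cong[OF assms] .
 moreover have "(\<forall>i\<in>Obj J. Comp C h (tau i) = sigma i) \<longleftrightarrow> (\<forall>i\<in>Obj J. Comp C h (tau' i) = sigma i)" for h sigma
  using assms(4) by simp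
 ultimately show ?thesis unfolding is_colimit_def by presburger
qed

section \<open>Presentable objects in terms of elements\<close>

lemma sets_cat_simps [simp]:
 "Obj (sets_cat P) = {A. P A}" "Dom (sets_cat P) (A, f, B) = A" "Cod (sets_cat P) (A, f, B) = B"
 "Ident (sets_cat P) A = (A, \<lambda>x\<in>A. x, A)" "Comp (sets_cat P) (B', g, C) (A, f, B) = (A, compose A g f, C)"
 by (simp_all add: sets_cat_def)

lemma hom_sets_cat: "s : hom (sets_cat P) A B \<longleftrightarrow> P A \<and> P B \<and> (\<exists>f. f : A \<rightarrow>\<^sub>E B \<and> s = (A, f, B))"
 by (auto simp: hom_def sets_cat_def)

lemma hom_sets_catD:
 assumes "s : hom (sets_cat P) A B"
 shows "s = (A, app s, B)" "app s : A \<rightarrow>\<^sub>E B" "P A" "P B" using assms unfolding hom_sets_cat app_def by auto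

text \<open>The usual elementwise form of presentability: arrows into a directed colimit factor
  through a stage, and two factorizations through the same stage agree at a later one. This form can
  be verified on flat sets and transported along full embeddings; the form with the hom-functor is
  derived from it.\<close>

definition elem_presentable :: "'u itself => 'k set => ('o, 'm) cat => 'o => bool" where
 "elem_presentable U K C a \<longleftrightarrow> a : Obj C \<and>
   (\<forall>(I :: 'u set) r D c tau. directed_poset U K I r \<and> is_functor (poset_cat I r) C D \<and>
    is_colimit (poset_cat I r) C D c tau -->
    (\<forall>h\<in>hom C a c. \<exists>i\<in>I. \<exists>g\<in>hom C a (on_obj D i). Comp C (tau i) g = h) \<and>
    (\<forall>i\<in>I. \<forall>g\<in>hom C a (on_obj D i). \<forall>g'\<in>hom C a (on_obj D i). Comp C (tau i) g = Comp C (tau i) g' -->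
     (\<exists>k. (i, k) : r \<and> Comp C (on_arr D (i, k)) g = Comp C (on_arr D (i, k)) g')))"

lemma hom_functor_simps:
 "b : Obj C ==> on_obj (hom_functor C a) b = hom C a b"
 "f : hom C b d ==> on_arr (hom_functor C a) f = (hom C a b, \<lambda>g\<in>hom C a b. Comp C f g, hom C a d)"
 by (simp_all add: hom_functor_def hom_def)

lemma hom_functor_cocone:
 assumes dp: "directed_poset U K I r" and D: "is_functor (poset_cat I r) C D"
  and cc: "is_cocone (poset_cat I r) C D c tau"
 shows "is_cocone (poset_cat I r) (sets_cat (\<lambda>_. True)) (comp_functor (poset_cat I r) (hom_functor C a) D)
  (on_obj (hom_functor C a) c) (\<lambda>i. on_arr (hom_functor C a) (tau i))"
proof -
 note C = functor_cats(2)[OF D]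
 have t: "c : Obj C" "!!i. i : I ==> tau i : hom C (on_obj D i) c"
  "!!i k. (i, k) : r ==> Comp C (tau k) (on_arr D (i, k)) = tau i" using cc unfolding poset_cocone_iff by blast+
 have d: "!!i. i : I ==> on_obj D i : Obj C" using functor_obj[OF D] by simp
 show ?thesis unfolding poset_cocone_iff
 proof (intro conjI ballI allI impI)
  show "on_obj (hom_functor C a) c : Obj (sets_cat (\<lambda>_. True))" by simp
  fix i assume i: "i : I"
  show "on_arr (hom_functor C a) (tau i) : hom (sets_cat (\<lambda>_. True))
   (on_obj (comp_functor (poset_cat I r) (hom_functor C a) D) i) (on_obj (hom_functor C a) c)"
   using i by (auto simp: hom_sets_cat comp_functor_obj hom_functor_simps(1)[OF d] hom_functor_simps(1)[OF t(1)]
     hom_functor_simps(2)[OF t(2)] intro: cat_comp[OF C _ t(2)])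
 next
  fix i k assume ik: "(i, k) : r"
  note i = directed_posetD(1)[OF dp ik] and k = directed_posetD(2)[OF dp ik]
  note Dik = poset_functor_hom[OF D ik]
  have "compose (hom C a (on_obj D i)) (\<lambda>g\<in>hom C a (on_obj D k). Comp C (tau k) g) (\<lambda>g\<in>hom C a (on_obj D i). Comp C (on_arr D (i, k)) g)
   = (\<lambda>g\<in>hom C a (on_obj D i). Comp C (tau i) g)"
   using cat_comp[OF C _ Dik] cat_assoc[OF C _ Dik t(2)[OF k]] t(3)[OF ik] by (auto simp: compose_def fun_eq_iff)
  then show "Comp (sets_cat (\<lambda>_. True)) (on_arr (hom_functor C a) (tau k))
   (on_arr (comp_functor (poset_cat I r) (hom_functor C a) D) (i, k)) = on_arr (hom_functor C a) (tau i)"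
   using ik by (simp add: comp_functor_arr hom_functor_simps(2)[OF t(2)[OF k]] hom_functor_simps(2)[OF t(2)[OF i]]
     hom_functor_simps(2)[OF Dik])
 qed
qed

text \<open>The map from \<open>hom C a c\<close> into the vertex of another cocone takes an arrow
  to the value of the cocone on a chosen factorization. Two factorizations are compared at a common
  later stage, which an infinite \<open>K\<close> provides, and become equal at a still later one;
  so the choice does not affect the value.\<close>

lemma elem_presentable_imp_presentable:
 fixes C :: "('o, 'm) cat" and U :: "'u itself"
 assumes ep: "elem_presentable U K C a" and K: "infinite K"
 shows "presentable U K C a" unfolding presentable_def preserves_directed_colimits_def
proof (intro conjI allI impI)
 show "a : Obj C" using ep unfolding elem_presentable_def by blast
 fix I :: "'u set" and r D c tau
 let ?P = "poset_cat I r" and ?S = "sets_cat (\<lambda>_ :: 'm set. True)"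
 let ?H = "comp_functor ?P (hom_functor C a) D"
 assume *: "directed_poset U K I r \<and> is_functor ?P C D \<and> is_colimit ?P C D c tau"
 then have dp: "directed_poset U K I r" and D: "is_functor ?P C D" and cl: "is_colimit ?P C D c tau" by auto
 note C = functor_cats(2)[OF D]
 have surj: "\<exists>i\<in>I. \<exists>g\<in>hom C a (on_obj D i). Comp C (tau i) g = h" if "h : hom C a c" for h
  using ep * that unfolding elem_presentable_def by blast
 have inj: "\<exists>k. (i, k) : r \<and> Comp C (on_arr D (i, k)) g = Comp C (on_arr D (i, k)) g'"
  if "i : I" "g : hom C a (on_obj D i)" "g' : hom C a (on_obj D i)" "Comp C (tau i) g = Comp C (tau i) g'" for i g g'
  using ep * that unfolding elem_presentable_def by blast
 have t: "c : Obj C" "!!i. i : I ==> tau i : hom C (on_obj D i) c"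
  "!!i k. (i, k) : r ==> Comp C (tau k) (on_arr D (i, k)) = tau i"
  using is_colimitD(1)[OF cl] unfolding poset_cocone_iff by blast+
 have d: "!!i. i : I ==> on_obj D i : Obj C" using functor_obj[OF D] by simp
 show "is_colimit ?P ?S ?H (on_obj (hom_functor C a) c) (\<lambda>i. on_arr (hom_functor C a) (tau i))" unfolding is_colimit_def
 proof (intro conjI allI impI)
  show "is_cocone ?P ?S ?H (on_obj (hom_functor C a) c) (\<lambda>i. on_arr (hom_functor C a) (tau i))"
   using hom_functor_cocone[OF dp D is_colimitD(1)[OF cl]] .
  fix Y sigma assume s: "is_cocone ?P ?S ?H Y sigma"
  have s1: "sigma i = (hom C a (on_obj D i), app (sigma i), Y)" "app (sigma i) : hom C a (on_obj D i) \<rightarrow>\<^sub>E Y" if i: "i : I" for i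
  proof -
   have "sigma i : hom ?S (hom C a (on_obj D i)) Y"
    using s i unfolding poset_cocone_iff by (simp add: comp_functor_obj hom_functor_simps(1)[OF d])
   then show "sigma i = (hom C a (on_obj D i), app (sigma i), Y)" "app (sigma i) : hom C a (on_obj D i) \<rightarrow>\<^sub>E Y"
    by (rule hom_sets_catD)+
  qed
  have s2: "app (sigma k) (Comp C (on_arr D (i, k)) g) = app (sigma i) g"
   if ik: "(i, k) : r" and g: "g : hom C a (on_obj D i)" for i k g
  proof -
   note i = directed_posetD(1)[OF dp ik] and k = directed_posetD(2)[OF dp ik]
   have "Comp ?S (sigma k) (on_arr ?H (i, k)) = sigma i" using s ik unfolding poset_cocone_iff by blast
   then have "app (Comp ?S (hom C a (on_obj D k), app (sigma k), Y)
     (hom C a (on_obj D i), \<lambda>g\<in>hom C a (on_obj D i). Comp C (on_arr D (i, k)) g, hom C a (on_obj D k))) g = app (sigma i) g"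
    using ik s1(1)[OF k] by (simp add: comp_functor_arr hom_functor_simps(2)[OF poset_functor_hom[OF D ik]])
   then show ?thesis using g by (simp add: app_def compose_def)
  qed
  define P where "P h p \<longleftrightarrow> fst p : I \<and> snd p : hom C a (on_obj D (fst p)) \<and> Comp C (tau (fst p)) (snd p) = h" for h p
  define k where "k = (\<lambda>h\<in>hom C a c. let p = SOME p. P h p in app (sigma (fst p)) (snd p))"
  have k1: "k (Comp C (tau i) g) = app (sigma i) g" if i: "i : I" and g: "g : hom C a (on_obj D i)" for i g
  proof -
   let ?h = "Comp C (tau i) g"
   define p where "p = (SOME p. P ?h p)"
   have h: "?h : hom C a c" using cat_comp[OF C g t(2)[OF i]] .
   have "P ?h (i, g)" using i g by (simp add: P_def)
   then have "P ?h p" unfolding p_def by (rule someI)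
   then have p: "fst p : I" "snd p : hom C a (on_obj D (fst p))" "Comp C (tau (fst p)) (snd p) = ?h" by (simp_all add: P_def)
   obtain l where l: "l : I" "(i, l) : r" "(fst p, l) : r" using directed_poset_ub2[OF dp K i p(1)] .
   let ?g = "Comp C (on_arr D (i, l)) g" and ?g' = "Comp C (on_arr D (fst p, l)) (snd p)"
   have gg: "?g : hom C a (on_obj D l)" "?g' : hom C a (on_obj D l)"
    using cat_comp[OF C g poset_functor_hom[OF D l(2)]] cat_comp[OF C p(2) poset_functor_hom[OF D l(3)]] by auto
   have "Comp C (tau l) ?g = Comp C (tau l) ?g'" using cat_assoc[OF C g poset_functor_hom[OF D l(2)] t(2)[OF l(1)]]
     cat_assoc[OF C p(2) poset_functor_hom[OF D l(3)] t(2)[OF l(1)]] t(3)[OF l(2)] t(3)[OF l(3)] p(3) by simp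
   then obtain m where m: "(l, m) : r" "Comp C (on_arr D (l, m)) ?g = Comp C (on_arr D (l, m)) ?g'"
    using inj[OF l(1) gg] by blast
   have "app (sigma i) g = app (sigma m) (Comp C (on_arr D (l, m)) ?g)" using s2[OF m(1) gg(1)] s2[OF l(2) g] by simp
   also have "\<dots> = app (sigma (fst p)) (snd p)" using s2[OF m(1) gg(2)] s2[OF l(3) p(2)] m(2) by simp
   finally show ?thesis using h by (simp add: k_def Let_def p_def)
  qed
  have kY: "k : hom C a c \<rightarrow>\<^sub>E Y"
  proof
   show "k h : Y" if "h : hom C a c" for h using surj[OF that] k1 s1(2) by (metis PiE_E)
   show "k h = undefined" if "h \<notin> hom C a c" for h using that by (simp add: k_def)
  qed
  have comp_eq: "Comp ?S (hom C a c, k', Y) (on_arr (hom_functor C a) (tau i)) = sigma i \<longleftrightarrow>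
   (\<forall>g\<in>hom C a (on_obj D i). k' (Comp C (tau i) g) = app (sigma i) g)" if i: "i : I" for i k'
  proof -
   have "Comp ?S (hom C a c, k', Y) (on_arr (hom_functor C a) (tau i)) = sigma i \<longleftrightarrow>
    compose (hom C a (on_obj D i)) k' (\<lambda>g\<in>hom C a (on_obj D i). Comp C (tau i) g) = app (sigma i)"
    by (subst s1(1)[OF i]) (simp add: hom_functor_simps(2)[OF t(2)[OF i]])
   also have "\<dots> \<longleftrightarrow> (\<forall>g\<in>hom C a (on_obj D i). k' (Comp C (tau i) g) = app (sigma i) g)"
    using s1(2)[OF i] by (auto simp: compose_def fun_eq_iff PiE_def extensional_def)
   finally show ?thesis .
  qed
  show "\<exists>!h. h : hom ?S (on_obj (hom_functor C a) c) Y \<and>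
   (\<forall>i\<in>Obj ?P. Comp ?S h (on_arr (hom_functor C a) (tau i)) = sigma i)"
  proof (rule ex1I[of _ "(hom C a c, k, Y)"])
   show "(hom C a c, k, Y) : hom ?S (on_obj (hom_functor C a) c) Y \<and>
    (\<forall>i\<in>Obj ?P. Comp ?S (hom C a c, k, Y) (on_arr (hom_functor C a) (tau i)) = sigma i)"
    using kY comp_eq k1 by (simp add: hom_sets_cat hom_functor_simps(1)[OF t(1)])
   fix h assume h: "h : hom ?S (on_obj (hom_functor C a) c) Y \<and>
    (\<forall>i\<in>Obj ?P. Comp ?S h (on_arr (hom_functor C a) (tau i)) = sigma i)"
   then obtain k' where k': "k' : hom C a c \<rightarrow>\<^sub>E Y" "h = (hom C a c, k', Y)"
    by (auto simp: hom_sets_cat hom_functor_simps(1)[OF t(1)])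
   have "k' (Comp C (tau i) g) = k (Comp C (tau i) g)" if "i : I" "g : hom C a (on_obj D i)" for i g
   proof -
    have "Comp ?S (hom C a c, k', Y) (on_arr (hom_functor C a) (tau i)) = sigma i" using h that(1) unfolding k'(2) by simp
    then show ?thesis using iffD1[OF comp_eq[OF that(1)]] k1 that by simp
   qed
   then have "k' h = k h" if "h : hom C a c" for h using surj[OF that] by metis
   then show "h = (hom C a c, k, Y)" using k' kY by (metis PiE_ext)
  qed
 qed
qed

text \<open>The arrows that factor through a stage form a set \<open>W\<close>, and the colimit
  cocone of hom-sets corestricts to \<open>W\<close>. The induced map into \<open>W\<close>,
  followed by the inclusion, agrees with the identity on the cocone, so it is the identity and
  \<open>W\<close> contains every arrow.\<close>

lemma presentable_factor:
 fixes C :: "('o, 'm) cat" and I :: "'u set" and U :: "'u itself"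
 assumes p: "presentable U K C a" and dp: "directed_poset U K I r" and D: "is_functor (poset_cat I r) C D"
  and cl: "is_colimit (poset_cat I r) C D c tau" and h: "h : hom C a c"
 obtains i g where "i : I" "g : hom C a (on_obj D i)" "Comp C (tau i) g = h"
proof -
 let ?P = "poset_cat I r" and ?S = "sets_cat (\<lambda>_ :: 'm set. True)"
 let ?H = "comp_functor ?P (hom_functor C a) D"
 note C = functor_cats(2)[OF D]
 have t: "c : Obj C" "!!i. i : I ==> tau i : hom C (on_obj D i) c" using is_colimitD[OF cl] by auto
 have d: "!!i. i : I ==> on_obj D i : Obj C" using functor_obj[OF D] by simp
 have cl': "is_colimit ?P ?S ?H (hom C a c) (\<lambda>i. on_arr (hom_functor C a) (tau i))"
  using p dp D cl hom_functor_simps(1)[OF t(1)] unfolding presentable_def preserves_directed_colimits_def by metis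
 define W where "W = (\<Union>i\<in>I. Comp C (tau i) ` hom C a (on_obj D i))"
 define sigma where "sigma i = (hom C a (on_obj D i), \<lambda>g\<in>hom C a (on_obj D i). Comp C (tau i) g, W)" for i
 have WW: "W \<subseteq> hom C a c" unfolding W_def using cat_comp[OF C _ t(2)] by blast
 have s: "is_cocone ?P ?S ?H W sigma" unfolding poset_cocone_iff
 proof (intro conjI ballI allI impI)
  show "W : Obj ?S" by simp
  show "sigma i : hom ?S (on_obj ?H i) W" if "i : I" for i
   using that by (auto simp: hom_sets_cat comp_functor_obj hom_functor_simps(1)[OF d] sigma_def W_def)
  fix i k assume ik: "(i, k) : r"
  note i = directed_posetD(1)[OF dp ik] and k = directed_posetD(2)[OF dp ik]
  have "Comp ?S (on_arr (hom_functor C a) (tau k)) (on_arr ?H (i, k)) = on_arr (hom_functor C a) (tau i)"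
   using is_colimitD(1)[OF cl'] ik unfolding poset_cocone_iff by blast
  then show "Comp ?S (sigma k) (on_arr ?H (i, k)) = sigma i"
   using ik by (simp add: sigma_def comp_functor_arr hom_functor_simps(2)[OF poset_functor_hom[OF D ik]]
     hom_functor_simps(2)[OF t(2)[OF i]] hom_functor_simps(2)[OF t(2)[OF k]])
 qed
 obtain q where q: "q : hom ?S (hom C a c) W" "!!i. i : I ==> Comp ?S q (on_arr (hom_functor C a) (tau i)) = sigma i"
  using is_colimit_factor[OF cl' s] by auto
 obtain k where k: "k : hom C a c \<rightarrow>\<^sub>E W" "q = (hom C a c, k, W)" using q(1) by (auto simp: hom_sets_cat)
 have k2: "k (Comp C (tau i) g) = Comp C (tau i) g" if i: "i : I" "g : hom C a (on_obj D i)" for i g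
 proof -
  have "compose (hom C a (on_obj D i)) k (\<lambda>g\<in>hom C a (on_obj D i). Comp C (tau i) g) = (\<lambda>g\<in>hom C a (on_obj D i). Comp C (tau i) g)"
   using q(2)[OF i(1)] unfolding k(2) hom_functor_simps(2)[OF t(2)[OF i(1)]] sigma_def by simp
  from fun_cong[OF this, of g] show ?thesis using i(2) by (simp add: compose_def)
 qed
 let ?id = "(hom C a c, \<lambda>x\<in>hom C a c. x, hom C a c)" and ?k = "(hom C a c, k, hom C a c)"
 have m: "?id : hom ?S (hom C a c) (hom C a c)" "?k : hom ?S (hom C a c) (hom C a c)"
  using k(1) WW by (auto simp: hom_sets_cat PiE_def Pi_def)
 have e: "Comp ?S ?k (on_arr (hom_functor C a) (tau i)) = on_arr (hom_functor C a) (tau i)"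
  "Comp ?S ?id (on_arr (hom_functor C a) (tau i)) = on_arr (hom_functor C a) (tau i)" if i: "i : I" for i
  using k2[OF i] cat_comp[OF C _ t(2)[OF i]] by (auto simp: hom_functor_simps(2)[OF t(2)[OF i]] compose_def fun_eq_iff)
 have "is_cocone ?P ?S ?H (hom C a c) (\<lambda>i. on_arr (hom_functor C a) (tau i))" using is_colimitD(1)[OF cl'] .
 then have "?id = ?k" using cl' m e unfolding is_colimit_def by (metis poset_cat_simps(1))
 then have "k h = h" using h by (metis Pair_inject restrict_apply')
 then have "h : W" using k(1) h by (metis PiE_E)
 then show thesis using that unfolding W_def by blast
qed

section \<open>Full embeddings, directed colimits and accessibility\<close>

definition fully_faithful :: "('x, 'y) cat => ('k, 'n) cat => ('x, 'y, 'k, 'n) fctr => bool" where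
 "fully_faithful X K j \<longleftrightarrow> is_functor X K j \<and>
   (\<forall>x\<in>Obj X. \<forall>y\<in>Obj X. bij_betw (on_arr j) (hom X x y) (hom K (on_obj j x) (on_obj j y)))"

lemma fully_faithfulD:
 assumes "fully_faithful X K j"
 shows "is_functor X K j"
  "f : hom X x y ==> g : hom X x y ==> on_arr j f = on_arr j g ==> f = g"
  "x : Obj X ==> y : Obj X ==> h : hom K (on_obj j x) (on_obj j y) ==> \<exists>f\<in>hom X x y. on_arr j f = h"
proof -
 show j: "is_functor X K j" using assms unfolding fully_faithful_def by blast
 show "f = g" if f: "f : hom X x y" and "g : hom X x y" "on_arr j f = on_arr j g"
  using assms cat_hom_obj[OF functor_cats(1)[OF j] f] that unfolding fully_faithful_def bij_betw_def by (meson inj_onD)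
 show "\<exists>f\<in>hom X x y. on_arr j f = h" if "x : Obj X" "y : Obj X" "h : hom K (on_obj j x) (on_obj j y)"
 proof -
  have "h : on_arr j ` hom X x y" using assms that unfolding fully_faithful_def bij_betw_def by blast
  then show ?thesis by blast
 qed
qed

lemma functor_cocone:
 assumes D: "is_functor J X D" and j: "is_functor X K j" and cc: "is_cocone J X D c tau"
 shows "is_cocone J K (comp_functor J j D) (on_obj j c) (\<lambda>i. on_arr j (tau i))"
proof -
 note J = functor_cats(1)[OF D]
 have t: "c : Obj X" "!!i. i : Obj J ==> tau i : hom X (on_obj D i) c"
  "!!f. f : Arr J ==> Comp X (tau (Cod J f)) (on_arr D f) = tau (Dom J f)" using cc unfolding is_cocone_def by blast+
 show ?thesis unfolding is_cocone_def
 proof (intro conjI ballI)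
  show "on_obj j c : Obj K" using functor_obj[OF j t(1)] .
  show "on_arr j (tau i) : hom K (on_obj (comp_functor J j D) i) (on_obj j c)" if "i : Obj J" for i
   using functor_hom[OF j t(2)[OF that]] that by (simp add: comp_functor_obj)
  show "Comp K (on_arr j (tau (Cod J f))) (on_arr (comp_functor J j D) f) = on_arr j (tau (Dom J f))"
   if f: "f : Arr J" for f
  proof -
   have "Cod J f : Obj J" using J f unfolding category_def by blast
   then show ?thesis
    using functor_comp[OF j functor_hom[OF D hom_self[OF f]] t(2)] t(3)[OF f] f by (simp add: comp_functor_arr)
  qed
 qed
qed

lemma fully_faithful_reflects_colimit:
 assumes ff: "fully_faithful X K j" and D: "is_functor J X D" and cc: "is_cocone J X D c tau"
  and cl: "is_colimit J K (comp_functor J j D) (on_obj j c) (\<lambda>i. on_arr j (tau i))"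
 shows "is_colimit J X D c tau" unfolding is_colimit_def
proof (intro conjI allI impI)
 note j = fully_faithfulD(1)[OF ff] note X = functor_cats(1)[OF j] and K = functor_cats(2)[OF j]
 note J = functor_cats(1)[OF D]
 show "is_cocone J X D c tau" by (rule cc)
 fix d sigma assume s: "is_cocone J X D d sigma"
 have c: "c : Obj X" and d: "d : Obj X" using cc s unfolding is_cocone_def by auto
 have t: "!!i. i : Obj J ==> tau i : hom X (on_obj D i) c" using cc unfolding is_cocone_def by blast
 have s1: "!!i. i : Obj J ==> sigma i : hom X (on_obj D i) d" using s unfolding is_cocone_def by blast
 obtain h where h: "h : hom K (on_obj j c) (on_obj j d)"
  "!!i. i : Obj J ==> Comp K h (on_arr j (tau i)) = on_arr j (sigma i)"
  using is_colimit_factor[OF cl functor_cocone[OF D j s]] by blast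
 obtain f where f: "f : hom X c d" "on_arr j f = h" using fully_faithfulD(3)[OF ff c d h(1)] by blast
 show "\<exists>!h. h : hom X c d \<and> (\<forall>i\<in>Obj J. Comp X h (tau i) = sigma i)"
 proof (rule ex1I[of _ f])
  have "Comp X f (tau i) = sigma i" if i: "i : Obj J" for i
   by (rule fully_faithfulD(2)[OF ff cat_comp[OF X t[OF i] f(1)] s1[OF i]])
    (simp add: functor_comp[OF j t[OF i] f(1)] f(2) h(2)[OF i])
  then show "f : hom X c d \<and> (\<forall>i\<in>Obj J. Comp X f (tau i) = sigma i)" using f by blast
  fix g assume g: "g : hom X c d \<and> (\<forall>i\<in>Obj J. Comp X g (tau i) = sigma i)"
  then have g1: "g : hom X c d" by blast
  show "g = f"
  proof (rule fully_faithfulD(2)[OF ff g1 f(1)])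
   show "on_arr j g = on_arr j f"
    by (rule is_colimit_ext[OF J K is_functor_comp[OF D j] cl functor_hom[OF j g1] functor_hom[OF j f(1)]])
     (use g functor_comp[OF j t g1] h(2) f(2) in simp)
  qed
 qed
qed

text \<open>The hypothesis \<open>closed\<close> puts the vertex of the colimit in the image of
  \<open>j\<close>; fullness lifts the cocone and full faithfulness reflects its universal property.
  Any other colimit in \<open>X\<close> is isomorphic to the one so obtained, hence it is preserved
  too.\<close>

lemma fully_faithful_directed_colimits:
 fixes U :: "'u itself"
 assumes ff: "fully_faithful X K j"
  and closed: "!!(I :: 'u set) r D. directed_poset U L I r ==> is_functor (poset_cat I r) X D ==>
   \<exists>x\<in>Obj X. \<exists>tau. is_colimit (poset_cat I r) K (comp_functor (poset_cat I r) j D) (on_obj j x) tau"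
 shows "has_directed_colimits U L X" "preserves_directed_colimits U L X K j"
proof -
 note j = fully_faithfulD(1)[OF ff] note X = functor_cats(1)[OF j] and K = functor_cats(2)[OF j]
 have ex: "\<exists>x tau. is_colimit (poset_cat I r) X D x tau \<and>
  is_colimit (poset_cat I r) K (comp_functor (poset_cat I r) j D) (on_obj j x) (\<lambda>i. on_arr j (tau i))"
  if dp: "directed_poset U L I r" and D: "is_functor (poset_cat I r) X D" for I :: "'u set" and r D
 proof -
  let ?P = "poset_cat I r" and ?D = "comp_functor (poset_cat I r) j D"
  obtain x tau' where x: "x : Obj X" and cl: "is_colimit ?P K ?D (on_obj j x) tau'" using closed[OF dp D] by blast
  have "\<exists>f\<in>hom X (on_obj D i) x. on_arr j f = tau' i" if "i : I" for i
   using fully_faithfulD(3)[OF ff functor_obj[OF D] x, of i] is_colimitD(3)[OF cl, of i] that by (simp add: comp_functor_obj)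
  then obtain tau where t: "!!i. i : I ==> tau i : hom X (on_obj D i) x" "!!i. i : I ==> on_arr j (tau i) = tau' i" by metis
  have cl': "is_colimit ?P K ?D (on_obj j x) (\<lambda>i. on_arr j (tau i))"
   using cl t(2) by (subst is_colimit_cong[OF functor_cats(1)[OF D] refl refl, where tau' = tau']) simp_all
  have "is_cocone ?P X D x tau" unfolding poset_cocone_iff
  proof (intro conjI ballI allI impI x t(1))
   fix i k assume ik: "(i, k) : r"
   note i = directed_posetD(1)[OF dp ik] and k = directed_posetD(2)[OF dp ik]
   note Dik = poset_functor_hom[OF D ik]
   have "Comp K (tau' k) (on_arr j (on_arr D (i, k))) = tau' i"
    using is_colimitD(1)[OF cl] ik unfolding poset_cocone_iff by (simp add: comp_functor_arr)
   then show "Comp X (tau k) (on_arr D (i, k)) = tau i"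
    by (intro fully_faithfulD(2)[OF ff cat_comp[OF X Dik t(1)[OF k]] t(1)[OF i]])
     (simp add: functor_comp[OF j Dik t(1)[OF k]] t(2) i k)
  qed
  then show ?thesis using fully_faithful_reflects_colimit[OF ff D] cl' by blast
 qed
 show "has_directed_colimits U L X" unfolding has_directed_colimits_def using ex by blast
 show "preserves_directed_colimits U L X K j" unfolding preserves_directed_colimits_def
 proof (intro allI impI)
  fix I :: "'u set" and r D c tau
  let ?P = "poset_cat I r" and ?D = "comp_functor (poset_cat I r) j D"
  assume *: "directed_poset U L I r \<and> is_functor ?P X D \<and> is_colimit ?P X D c tau"
  then have dp: "directed_poset U L I r" and D: "is_functor ?P X D" and cl: "is_colimit ?P X D c tau" by auto
  obtain x sigma where x: "is_colimit ?P X D x sigma" "is_colimit ?P K ?D (on_obj j x) (\<lambda>i. on_arr j (sigma i))"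
   using ex[OF dp D] by blast
  note P = functor_cats(1)[OF D]
  obtain h where h: "h : hom X x c" "is_iso X h" "!!i. i : I ==> Comp X h (sigma i) = tau i"
   using is_colimit_unique[OF P X D x(1) cl] by auto
  obtain g where g: "g : hom X c x" "Comp X g h = Ident X x" "Comp X h g = Ident X c" using is_isoE[OF h(2,1)] .
  have "is_iso K (on_arr j h)"
   using functor_hom[OF j h(1)] functor_hom[OF j g(1)] functor_comp[OF j h(1) g(1)] functor_comp[OF j g(1) h(1)] g(2,3)
    functor_ident[OF j] cat_hom_obj[OF X h(1)] by (intro is_isoI[of _ _ "on_obj j x" "on_obj j c" "on_arr j g"]) simp_all
  then have "is_colimit ?P K ?D (on_obj j c) (\<lambda>i. Comp K (on_arr j h) (on_arr j (sigma i)))"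
   using is_colimit_iso[OF P K is_functor_comp[OF D j] x(2) functor_hom[OF j h(1)]] by blast
  moreover have "Comp K (on_arr j h) (on_arr j (sigma i)) = on_arr j (tau i)" if "i : I" for i
   using functor_comp[OF j is_colimitD(3)[OF x(1)] h(1)] h(3) that by simp
  ultimately show "is_colimit ?P K ?D (on_obj j c) (\<lambda>i. on_arr j (tau i))"
   by (subst is_colimit_cong[OF P refl refl, where tau' = "\<lambda>i. Comp K (on_arr j h) (on_arr j (sigma i))"]) simp_all
 qed
qed

text \<open>Since \<open>s\<close> is only isomorphic to the image of \<open>x\<close>, arrows out
  of \<open>x\<close> are turned into arrows out of \<open>s\<close> by applying \<open>j\<close>
  and precomposing with \<open>theta\<close>, and brought back with the inverse of
  \<open>theta\<close> and fullness.\<close>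

lemma elem_presentable_reflect:
 fixes U :: "'u itself"
 assumes ff: "fully_faithful X K j" and pres: "preserves_directed_colimits U L X K j"
  and s: "elem_presentable U L K s" and x: "x : Obj X" and theta: "theta : hom K s (on_obj j x)" "is_iso K theta"
 shows "elem_presentable U L X x" unfolding elem_presentable_def
proof (intro conjI allI impI x)
 note j = fully_faithfulD(1)[OF ff] note X = functor_cats(1)[OF j] and K = functor_cats(2)[OF j]
 obtain theta' where theta': "theta' : hom K (on_obj j x) s" "Comp K theta' theta = Ident K s" "Comp K theta theta' = Ident K (on_obj j x)"
  using is_isoE[OF theta(2,1)] .
 fix I :: "'u set" and r D c tau
 let ?P = "poset_cat I r" and ?D = "comp_functor (poset_cat I r) j D"
 assume *: "directed_poset U L I r \<and> is_functor ?P X D \<and> is_colimit ?P X D c tau"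
 then have dp: "directed_poset U L I r" and D: "is_functor ?P X D" and cl: "is_colimit ?P X D c tau" by auto
 have t: "c : Obj X" "!!i. i : I ==> tau i : hom X (on_obj D i) c" using is_colimitD[OF cl] by auto
 have clK: "is_colimit ?P K ?D (on_obj j c) (\<lambda>i. on_arr j (tau i))"
  using pres * unfolding preserves_directed_colimits_def by blast
 have DK: "is_functor ?P K ?D" using is_functor_comp[OF D j] .
 have surj: "\<exists>i\<in>I. \<exists>g\<in>hom K s (on_obj ?D i). Comp K (on_arr j (tau i)) g = h" if "h : hom K s (on_obj j c)" for h
  using s dp DK clK that unfolding elem_presentable_def by blast
 have inj: "\<exists>k. (i, k) : r \<and> Comp K (on_arr ?D (i, k)) g = Comp K (on_arr ?D (i, k)) g'"
  if "i : I" "g : hom K s (on_obj ?D i)" "g' : hom K s (on_obj ?D i)"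
   "Comp K (on_arr j (tau i)) g = Comp K (on_arr j (tau i)) g'" for i g g'
  using s dp DK clK that unfolding elem_presentable_def by blast
 show "\<forall>h\<in>hom X x c. \<exists>i\<in>I. \<exists>g\<in>hom X x (on_obj D i). Comp X (tau i) g = h"
 proof
  fix h assume h: "h : hom X x c"
  obtain i g where i: "i : I" and g: "g : hom K s (on_obj j (on_obj D i))"
   "Comp K (on_arr j (tau i)) g = Comp K (on_arr j h) theta"
   using surj[OF cat_comp[OF K theta(1) functor_hom[OF j h]]] by (auto simp: comp_functor_obj)
  have d: "on_obj D i : Obj X" using functor_obj[OF D] i by simp
  obtain f where f: "f : hom X x (on_obj D i)" "on_arr j f = Comp K g theta'"
   using fully_faithfulD(3)[OF ff x d cat_comp[OF K theta'(1) g(1)]] by blast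
  have "on_arr j (Comp X (tau i) f) = on_arr j h"
   using functor_comp[OF j f(1) t(2)[OF i]] f(2) g(2) cat_assoc[OF K theta'(1) g(1) functor_hom[OF j t(2)[OF i]]]
    cat_assoc[OF K theta'(1) theta(1) functor_hom[OF j h]] theta'(3) cat_ident_right[OF K functor_hom[OF j h]] by simp
  then have "Comp X (tau i) f = h" using fully_faithfulD(2)[OF ff cat_comp[OF X f(1) t(2)[OF i]] h] by blast
  then show "\<exists>i\<in>I. \<exists>g\<in>hom X x (on_obj D i). Comp X (tau i) g = h" using i f(1) by blast
 qed
 show "\<forall>i\<in>I. \<forall>g\<in>hom X x (on_obj D i). \<forall>g'\<in>hom X x (on_obj D i). Comp X (tau i) g = Comp X (tau i) g' -->
  (\<exists>k. (i, k) : r \<and> Comp X (on_arr D (i, k)) g = Comp X (on_arr D (i, k)) g')"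
 proof (intro ballI impI)
  fix i g g' assume i: "i : I" and g: "g : hom X x (on_obj D i)" and g': "g' : hom X x (on_obj D i)"
   and eq: "Comp X (tau i) g = Comp X (tau i) g'"
  note jg = functor_hom[OF j g] and jg' = functor_hom[OF j g'] and jt = functor_hom[OF j t(2)[OF i]]
  have "Comp K (on_arr j (tau i)) (Comp K (on_arr j g) theta) = Comp K (on_arr j (tau i)) (Comp K (on_arr j g') theta)"
   using cat_assoc[OF K theta(1) jg jt] cat_assoc[OF K theta(1) jg' jt]
    functor_comp[OF j g t(2)[OF i]] functor_comp[OF j g' t(2)[OF i]] eq by simp
  then obtain k where k: "(i, k) : r"
   "Comp K (on_arr ?D (i, k)) (Comp K (on_arr j g) theta) = Comp K (on_arr ?D (i, k)) (Comp K (on_arr j g') theta)"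
   using inj[OF i, of "Comp K (on_arr j g) theta" "Comp K (on_arr j g') theta"] cat_comp[OF K theta(1) jg] cat_comp[OF K theta(1) jg'] i
   by (auto simp: comp_functor_obj)
  note Dik = poset_functor_hom[OF D k(1)] note jD = functor_hom[OF j Dik]
  have Dg: "Comp X (on_arr D (i, k)) g : hom X x (on_obj D k)" "Comp X (on_arr D (i, k)) g' : hom X x (on_obj D k)"
   using cat_comp[OF X g Dik] cat_comp[OF X g' Dik] by auto
  have cancel: "Comp K (Comp K u theta) theta' = u" if "u : hom K (on_obj j x) z" for u z
   using cat_assoc[OF K theta'(1) theta(1) that] theta'(3) cat_ident_right[OF K that] by simp
  have e: "Comp K (on_arr j (Comp X (on_arr D (i, k)) g)) theta = Comp K (on_arr j (Comp X (on_arr D (i, k)) g')) theta"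
   using k functor_comp[OF j g Dik] functor_comp[OF j g' Dik] cat_assoc[OF K theta(1) jg jD] cat_assoc[OF K theta(1) jg' jD]
   by (simp add: comp_functor_arr)
  have "on_arr j (Comp X (on_arr D (i, k)) g) = on_arr j (Comp X (on_arr D (i, k)) g')"
   using trans[OF cancel[OF functor_hom[OF j Dg(1)], symmetric]
     trans[OF arg_cong[OF e, of "\<lambda>u. Comp K u theta'"] cancel[OF functor_hom[OF j Dg(2)]]]] .
  then have "Comp X (on_arr D (i, k)) g = Comp X (on_arr D (i, k)) g'" using fully_faithfulD(2)[OF ff Dg] by blast
  then show "\<exists>k. (i, k) : r \<and> Comp X (on_arr D (i, k)) g = Comp X (on_arr D (i, k)) g'" using k(1) by blast
 qed
qed

lemma has_directed_colimits_mono: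
 assumes "has_directed_colimits U omega C" "infinite L" shows "has_directed_colimits U L C"
 using assms directed_poset_omega unfolding has_directed_colimits_def by blast

lemma preserves_directed_colimits_mono:
 assumes "preserves_directed_colimits U omega C D F" "infinite L" shows "preserves_directed_colimits U L C D F"
 using assms directed_poset_omega unfolding preserves_directed_colimits_def by blast

text \<open>Generators and diagrams are produced in \<open>K\<close>, where they can be built by
  hand, and their objects are merely isomorphic to images under \<open>j\<close>. A diagram is
  conjugated by chosen isomorphisms, lifted along \<open>j\<close>, and its colimit is
  reflected.\<close>

lemma (in universe) fully_faithful_accessible:
 fixes S :: "'k set" and X :: "('x, 'y) cat"
 assumes ff: "fully_faithful X K j"
  and dc: "has_directed_colimits U omega X" and pres: "preserves_directed_colimits U omega X K j"
  and L: "infinite L" and ls: "locally_small U K"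
  and S: "sm S" "!!s. s : S ==> elem_presentable U L K s"
   "!!s. s : S ==> \<exists>x\<in>Obj X. \<exists>theta\<in>hom K s (on_obj j x). is_iso K theta"
  and gen: "!!x. x : Obj X ==> \<exists>(I :: 'u set) r D tau. directed_poset U L I r \<and> is_functor (poset_cat I r) K D \<and>
   (\<forall>i\<in>I. on_obj D i : S) \<and> is_colimit (poset_cat I r) K D (on_obj j x) tau"
 shows "accessible_at U L X" unfolding accessible_at_def
proof (intro conjI)
 note j = fully_faithfulD(1)[OF ff] note X = functor_cats(1)[OF j] and K = functor_cats(2)[OF j]
 show "category X" by (rule X)
 show "has_directed_colimits U L X" using has_directed_colimits_mono[OF dc L] .
 show "locally_small U X" unfolding locally_small_def
 proof (intro ballI)
  fix a b assume a: "a : Obj X" and b: "b : Obj X"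
  have "inj_on (on_arr j) (hom X a b)" "on_arr j ` hom X a b \<subseteq> hom K (on_obj j a) (on_obj j b)"
   using fully_faithfulD(2)[OF ff] functor_hom[OF j] by (blast intro: inj_onI)+
  then show "sm (hom X a b)" using sm_inj ls functor_obj[OF j a] functor_obj[OF j b] unfolding locally_small_def by blast
 qed
 obtain x theta where x: "!!s. s : S ==> x s : Obj X" "!!s. s : S ==> theta s : hom K s (on_obj j (x s))"
  "!!s. s : S ==> is_iso K (theta s)" using S(3) by metis
 have "\<exists>t. t : hom K (on_obj j (x s)) s \<and> Comp K t (theta s) = Ident K s \<and> Comp K (theta s) t = Ident K (on_obj j (x s))"
  if "s : S" for s using is_isoE[OF x(3)[OF that] x(2)[OF that]] by metis
 then obtain t where t: "!!s. s : S ==> t s : hom K (on_obj j (x s)) s"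
  "!!s. s : S ==> Comp K (t s) (theta s) = Ident K s" "!!s. s : S ==> Comp K (theta s) (t s) = Ident K (on_obj j (x s))"
  by metis
 show "\<exists>S\<subseteq>Obj X. sm S \<and> (\<forall>s\<in>S. presentable U L X s) \<and>
  (\<forall>c\<in>Obj X. \<exists>(I :: 'u set) r D tau. directed_poset U L I r \<and> is_functor (poset_cat I r) X D \<and>
   (\<forall>i\<in>I. on_obj D i : S) \<and> is_colimit (poset_cat I r) X D c tau)"
 proof (intro exI[of _ "x ` S"] conjI ballI)
  show "x ` S \<subseteq> Obj X" using x(1) by blast
  show "sm (x ` S)" using S(1) sm_image by blast
  fix y assume "y : x ` S"
  then obtain s where s: "s : S" "y = x s" by blast
  show "presentable U L X y" unfolding s(2)
   by (rule elem_presentable_imp_presentable[OF elem_presentable_reflect[OF ff preserves_directed_colimits_mono[OF pres L]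
      S(2)[OF s(1)] x(1)[OF s(1)] x(2)[OF s(1)] x(3)[OF s(1)]] L])
 next
  fix c assume c: "c : Obj X"
  obtain I :: "'u set" and r D tau where dp: "directed_poset U L I r" and D: "is_functor (poset_cat I r) K D"
   and DS: "\<forall>i\<in>I. on_obj D i : S" and cl: "is_colimit (poset_cat I r) K D (on_obj j c) tau" using gen[OF c] by blast
  let ?P = "poset_cat I r" let ?x = "\<lambda>i. x (on_obj D i)" let ?theta = "\<lambda>i. theta (on_obj D i)" let ?t = "\<lambda>i. t (on_obj D i)"
  have x': "!!i. i : I ==> ?x i : Obj X" "!!i. i : I ==> ?theta i : hom K (on_obj D i) (on_obj j (?x i))"
   "!!i. i : I ==> ?t i : hom K (on_obj j (?x i)) (on_obj D i)" using x t DS by auto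
  have tt: "Comp K (?t i) (Comp K (?theta i) u) = u" if "i : I" "u : hom K z (on_obj D i)" for i u z
   using cat_assoc[OF K that(2) x'(2)[OF that(1)] x'(3)[OF that(1)]] t(2) DS that(1) cat_ident_left[OF K that(2)] by simp
  note P = functor_cats(1)[OF D]
  \<comment> \<open>The transition arrow of \<open>D\<close> conjugated by the isomorphisms, so that
    source and target are images under \<open>j\<close> and the arrow can be lifted to
    \<open>X\<close>.\<close>
  let ?e = "\<lambda>i k. Comp K (?theta k) (Comp K (on_arr D (i, k)) (?t i))"
  have e: "?e i k : hom K (on_obj j (?x i)) (on_obj j (?x k))" if "(i, k) : r" for i k
   using cat_comp[OF K cat_comp[OF K x'(3) poset_functor_hom[OF D that]] x'(2)] directed_posetD(1,2)[OF dp that] by blast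
  have "\<exists>f\<in>hom X (?x i) (?x k). on_arr j f = ?e i k" if "(i, k) : r" for i k
   using fully_faithfulD(3)[OF ff x'(1) x'(1) e[OF that]] directed_posetD(1,2)[OF dp that] by blast
  then obtain delta where delta: "!!i k. (i, k) : r ==> delta i k : hom X (?x i) (?x k)" "!!i k. (i, k) : r ==> on_arr j (delta i k) = ?e i k"
   by metis
  let ?D = "poset_functor I r ?x delta"
  have fD: "is_functor ?P X ?D"
  proof (rule is_functor_poset_functor[OF dp X x'(1) delta(1)])
   fix i assume i: "i : I"
   have ii: "(i, i) : r" using directed_posetD(3)[OF dp i] .
   have "on_arr D (i, i) = Ident K (on_obj D i)" using functor_ident[OF D, of i] i by simp
   then have "?e i i = Ident K (on_obj j (?x i))" using cat_ident_left[OF K x'(3)[OF i]] t(3) DS i by simp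
   then show "delta i i = Ident X (?x i)"
    using fully_faithfulD(2)[OF ff delta(1)[OF ii] cat_ident[OF X x'(1)[OF i]]] delta(2)[OF ii] functor_ident[OF j x'(1)[OF i]] by simp
  next
   fix i k l assume ik: "(i, k) : r" and kl: "(k, l) : r"
   have il: "(i, l) : r" using directed_posetD(4)[OF dp ik kl] .
   note i = directed_posetD(1)[OF dp ik] and k = directed_posetD(1)[OF dp kl] and l = directed_posetD(2)[OF dp kl]
   note Dik = poset_functor_hom[OF D ik] and Dkl = poset_functor_hom[OF D kl]
   note Dt = cat_comp[OF K x'(3)[OF i] Dik]
   have "Comp K (?e k l) (?e i k) = ?e i l"
    using cat_assoc[OF K e[OF ik] cat_comp[OF K x'(3)[OF k] Dkl] x'(2)[OF l]] cat_assoc[OF K e[OF ik] x'(3)[OF k] Dkl]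
     tt[OF k Dt] cat_assoc[OF K x'(3)[OF i] Dik Dkl] poset_functor_comp[OF D ik kl] by simp
   then show "delta i l = Comp X (delta k l) (delta i k)"
    by (intro fully_faithfulD(2)[OF ff delta(1)[OF il] cat_comp[OF X delta(1)[OF ik] delta(1)[OF kl]]])
     (simp add: delta(2)[OF il] delta(2)[OF ik] delta(2)[OF kl] functor_comp[OF j delta(1)[OF ik] delta(1)[OF kl]])
  qed
  have s: "tau i : hom K (on_obj D i) (on_obj j c)" if "i : I" for i using is_colimitD(3)[OF cl] that by simp
  have "\<exists>f\<in>hom X (?x i) c. on_arr j f = Comp K (tau i) (?t i)" if "i : I" for i
   using fully_faithfulD(3)[OF ff x'(1) c cat_comp[OF K x'(3) s]] that by blast
  then obtain sigma where sigma: "!!i. i : I ==> sigma i : hom X (?x i) c" "!!i. i : I ==> on_arr j (sigma i) = Comp K (tau i) (?t i)"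
   by metis
  have "is_colimit ?P X ?D c sigma"
  proof (rule fully_faithful_reflects_colimit[OF ff fD])
   let ?jD = "comp_functor ?P j ?D"
   have taue: "Comp K (Comp K (tau k) (?t k)) (?e i k) = Comp K (tau i) (?t i)" if ik: "(i, k) : r" for i k
   proof -
    note i = directed_posetD(1)[OF dp ik] and k = directed_posetD(2)[OF dp ik] note Dik = poset_functor_hom[OF D ik]
    have "Comp K (tau k) (on_arr D (i, k)) = tau i" using is_colimitD(1)[OF cl] ik unfolding poset_cocone_iff by blast
    then show ?thesis using cat_assoc[OF K e[OF ik] x'(3)[OF k] s[OF k]] tt[OF k cat_comp[OF K x'(3)[OF i] Dik]]
      cat_assoc[OF K x'(3)[OF i] Dik s[OF k]] by simp
   qed
   show "is_cocone ?P X ?D c sigma" unfolding poset_cocone_iff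
   proof (intro conjI ballI allI impI c)
    show "sigma i : hom X (on_obj ?D i) c" if "i : I" for i using sigma(1)[OF that] that by simp
    fix i k assume ik: "(i, k) : r"
    note i = directed_posetD(1)[OF dp ik] and k = directed_posetD(2)[OF dp ik]
    show "Comp X (sigma k) (on_arr ?D (i, k)) = sigma i"
     using fully_faithfulD(2)[OF ff cat_comp[OF X delta(1)[OF ik] sigma(1)[OF k]] sigma(1)[OF i]] taue[OF ik]
     by (simp add: ik functor_comp[OF j delta(1)[OF ik] sigma(1)[OF k]] sigma(2) i k delta(2)[OF ik])
   qed
   then have cc: "is_cocone ?P K ?jD (on_obj j c) (\<lambda>i. on_arr j (sigma i))" using functor_cocone[OF fD j] by blast
   show "is_colimit ?P K ?jD (on_obj j c) (\<lambda>i. on_arr j (sigma i))" unfolding is_colimit_def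
   proof (intro conjI allI impI cc)
    fix d rho assume rho: "is_cocone ?P K ?jD d rho"
    have rho1: "rho i : hom K (on_obj j (?x i)) d" if "i : I" for i
     using rho that unfolding poset_cocone_iff by (simp add: comp_functor_obj)
    have rho2: "Comp K (rho k) (?e i k) = rho i" if "(i, k) : r" for i k
     using rho that unfolding poset_cocone_iff by (simp add: comp_functor_arr delta(2))
    have ttheta: "Comp K (?t i) (?theta i) = Ident K (on_obj D i)" if "i : I" for i using t(2) DS that by blast
    have thetat: "Comp K (?theta i) (?t i) = Ident K (on_obj j (?x i))" if "i : I" for i using t(3) DS that by blast
    \<comment> \<open>Undoing the conjugation turns a factorization of \<open>rho\<close> into a
      factorization of a cocone over \<open>D\<close>, for which the universal property is
      known.\<close>
    have iff: "Comp K h (on_arr j (sigma i)) = rho i \<longleftrightarrow> Comp K h (tau i) = Comp K (rho i) (?theta i)"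
     if h: "h : hom K (on_obj j c) d" and i: "i : I" for h i
    proof -
     have htau: "Comp K h (tau i) : hom K (on_obj D i) d" using cat_comp[OF K s[OF i] h] .
     have a: "Comp K h (on_arr j (sigma i)) = Comp K (Comp K h (tau i)) (?t i)"
      using sigma(2)[OF i] cat_assoc[OF K x'(3)[OF i] s[OF i] h] by simp
     have b: "Comp K (Comp K (Comp K h (tau i)) (?t i)) (?theta i) = Comp K h (tau i)"
      using cat_assoc[OF K x'(2)[OF i] x'(3)[OF i] htau] ttheta[OF i] cat_ident_right[OF K htau] by simp
     have c: "Comp K (Comp K (rho i) (?theta i)) (?t i) = rho i"
      using cat_assoc[OF K x'(3)[OF i] x'(2)[OF i] rho1[OF i]] thetat[OF i] cat_ident_right[OF K rho1[OF i]] by simp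
     show ?thesis using a b c by metis
    qed
    have "is_cocone ?P K D d (\<lambda>i. Comp K (rho i) (?theta i))" unfolding poset_cocone_iff
    proof (intro conjI ballI allI impI)
     show "d : Obj K" using rho unfolding is_cocone_def by blast
     show "Comp K (rho i) (?theta i) : hom K (on_obj D i) d" if "i : I" for i
      using cat_comp[OF K x'(2)[OF that] rho1[OF that]] .
     fix i k assume ik: "(i, k) : r"
     note i = directed_posetD(1)[OF dp ik] and k = directed_posetD(2)[OF dp ik] note Dik = poset_functor_hom[OF D ik]
     have "Comp K (?e i k) (?theta i) = Comp K (?theta k) (on_arr D (i, k))"
      using cat_assoc[OF K x'(2)[OF i] cat_comp[OF K x'(3)[OF i] Dik] x'(2)[OF k]]
       cat_assoc[OF K x'(2)[OF i] x'(3)[OF i] Dik] ttheta[OF i] cat_ident_right[OF K Dik] by simp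
     then show "Comp K (Comp K (rho k) (?theta k)) (on_arr D (i, k)) = Comp K (rho i) (?theta i)"
      using cat_assoc[OF K Dik x'(2)[OF k] rho1[OF k]] cat_assoc[OF K x'(2)[OF i] e[OF ik] rho1[OF k]] rho2[OF ik] by simp
    qed
    then have "\<exists>!h. h : hom K (on_obj j c) d \<and> (\<forall>i\<in>I. Comp K h (tau i) = Comp K (rho i) (?theta i))"
     using cl unfolding is_colimit_def by simp
    then show "\<exists>!h. h : hom K (on_obj j c) d \<and> (\<forall>i\<in>Obj ?P. Comp K h (on_arr j (sigma i)) = rho i)"
     using iff by (simp cong: conj_cong)
   qed
  qed
  moreover have "\<forall>i\<in>I. on_obj ?D i : x ` S" using DS by simp
  ultimately show "\<exists>(I :: 'u set) r D tau. directed_poset U L I r \<and> is_functor (poset_cat I r) X D \<and>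
   (\<forall>i\<in>I. on_obj D i : x ` S) \<and> is_colimit (poset_cat I r) X D c tau" using dp fD by blast
 qed
qed

section \<open>Flat sets with an action of a category of epimorphisms\<close>

lemma (in universe) sm_Obj_if_sm_Arr:
 assumes C: "category C" and s: "sm (Arr C)" shows "sm (Obj C)"
proof (rule sm_lepoll[OF _ s])
 have i: "Ident C a : Arr C \<and> Dom C (Ident C a) = a" if "a : Obj C" for a using cat_ident[OF C that] by (simp add: hom_def)
 have "inj_on (Ident C) (Obj C)" by (rule inj_on_inverseI[where g = "Dom C"]) (simp add: i)
 moreover have "Ident C ` Obj C \<subseteq> Arr C" using i by blast
 ultimately show "Obj C \<lesssim> Arr C" unfolding lepoll_def by blast
qed

text \<open>A functor from \<open>A\<close> to sets, given as the disjoint union of its values. With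
  a single carrier, size, images and unions are those of plain sets, and the whole functor can be
  copied into \<open>'u\<close> at once.\<close>

record ('x, 'a, 'b) aset =
 El :: "'x set"
 lab :: "'x => 'a"
 act :: "'b => 'x => 'x"

text \<open>The two conditions on the category of atoms that matter for flat sets:
  \<open>epi\<close> will make their maps injective, and \<open>ore\<close>, a completion of
  cospans, becomes a completion of spans for the representable functors, which reverse
  arrows.\<close>

locale epi_site = universe U for U :: "'u itself" +
 fixes A :: "('a, 'b) cat"
 assumes catA: "category A" and sm_Arr: "sm (Arr A)"
  and epi: "f : hom A a b ==> g : hom A b c ==> h : hom A b c ==> Comp A g f = Comp A h f ==> g = h"
  and ore: "f : hom A a c ==> g : hom A b c ==> \<exists>d. \<exists>h\<in>hom A d a. \<exists>k\<in>hom A d b. Comp A f h = Comp A g k"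
begin

definition acts :: "('x, 'a, 'b) aset => 'b => 'x => bool" where
 "acts R g x \<longleftrightarrow> g : Arr A \<and> x : El R \<and> Dom A g = lab R x"

text \<open>Cofilteredness of the category of elements, with the clause on parallel arrows
  sharpened: the usual form asks for an element over \<open>x\<close> and an arrow that equalizes
  \<open>g\<close> and \<open>h\<close>, and as arrows of \<open>A\<close> are epic this forces
  \<open>g = h\<close>.\<close>

definition flat :: "('x, 'a, 'b) aset => bool" where
 "flat R \<longleftrightarrow>
   (\<forall>x\<in>El R. lab R x : Obj A \<and> act R (Ident A (lab R x)) x = x) \<and>
   (\<forall>g x. acts R g x --> act R g x : El R \<and> lab R (act R g x) = Cod A g) \<and>
   (\<forall>g h x. acts R g x \<and> h : Arr A \<and> Dom A h = Cod A g --> act R (Comp A h g) x = act R h (act R g x)) \<and>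
   El R \<noteq> {} \<and>
   (\<forall>x\<in>El R. \<forall>y\<in>El R. \<exists>z g h. acts R g z \<and> acts R h z \<and> act R g z = x \<and> act R h z = y) \<and>
   (\<forall>g h x. acts R g x \<and> acts R h x \<and> act R g x = act R h x --> g = h)"

text \<open>Fixes the values off the domain of the action, so that isomorphic structure on the same
  carrier means equal records and flat sets can be counted by their graphs.\<close>

definition norm :: "('x, 'a, 'b) aset => bool" where
 "norm R \<longleftrightarrow> lab R : extensional (El R) \<and> (\<forall>g x. \<not> acts R g x --> act R g x = undefined)"

definition sat :: "('x, 'a, 'b) aset => bool" where
 "sat R \<longleftrightarrow> (\<forall>g\<in>Arr A. \<forall>y\<in>El R. lab R y = Cod A g --> (\<exists>x. acts R g x \<and> act R g x = y))"

definition ahom :: "('x, 'a, 'b) aset => ('y, 'a, 'b) aset => ('x => 'y) set" where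
 "ahom R S = {phi : El R \<rightarrow> El S. (\<forall>x\<in>El R. lab S (phi x) = lab R x) \<and>
   (\<forall>g x. acts R g x --> phi (act R g x) = act S g (phi x))}"

lemma actsD: "acts R g x ==> g : Arr A" "acts R g x ==> x : El R" "acts R g x ==> Dom A g = lab R x" by (simp_all add: acts_def)

lemma flatD:
 assumes "flat R"
 shows "x : El R ==> lab R x : Obj A" "x : El R ==> act R (Ident A (lab R x)) x = x"
  "acts R g x ==> act R g x : El R" "acts R g x ==> lab R (act R g x) = Cod A g"
  "acts R g x ==> h : Arr A ==> Dom A h = Cod A g ==> act R (Comp A h g) x = act R h (act R g x)"
  "El R \<noteq> {}" "acts R g x ==> acts R h x ==> act R g x = act R h x ==> g = h" using assms unfolding flat_def by blast+

lemma flat_join: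
 assumes "flat R" "x : El R" "y : El R"
 obtains z g h where "acts R g z" "acts R h z" "act R g z = x" "act R h z = y" using assms unfolding flat_def by blast

lemma flatI:
 assumes "!!x. x : El R ==> lab R x : Obj A \<and> act R (Ident A (lab R x)) x = x"
  and "!!g x. acts R g x ==> act R g x : El R \<and> lab R (act R g x) = Cod A g"
  and "!!g h x. acts R g x ==> h : Arr A ==> Dom A h = Cod A g ==> act R (Comp A h g) x = act R h (act R g x)"
  and "El R \<noteq> {}"
  and "!!x y. x : El R ==> y : El R ==> \<exists>z g h. acts R g z \<and> acts R h z \<and> act R g z = x \<and> act R h z = y"
  and "!!g h x. acts R g x ==> acts R h x ==> act R g x = act R h x ==> g = h"
 shows "flat R" unfolding flat_def using assms by blast

lemma ahomD:
 assumes "phi : ahom R S"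
 shows "x : El R ==> phi x : El S" "x : El R ==> lab S (phi x) = lab R x"
  "acts R g x ==> phi (act R g x) = act S g (phi x)" "acts R g x ==> acts S g (phi x)"
 using assms unfolding ahom_def acts_def by auto

lemma ahomI:
 assumes "!!x. x : El R ==> phi x : El S" "!!x. x : El R ==> lab S (phi x) = lab R x"
  "!!g x. acts R g x ==> phi (act R g x) = act S g (phi x)"
 shows "phi : ahom R S" using assms unfolding ahom_def by auto

lemma ahom_comp:
 assumes "phi : ahom R S" "psi : ahom S Q" shows "(\<lambda>x. psi (phi x)) : ahom R Q"
 by (rule ahomI) (simp_all add: ahomD[OF assms(1)] ahomD[OF assms(2)])

lemma ahom_cong:
 assumes "flat R" "phi : ahom R S" "!!x. x : El R ==> psi x = phi x" shows "psi : ahom R S" by (rule ahomI)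
  (simp_all add: assms(3) ahomD[OF assms(2)] flatD(3)[OF assms(1)] actsD(2))

text \<open>A common preimage of two elements identified by a homomorphism shows that they are equal already.\<close>

lemma ahom_inj_on:
 assumes R: "flat R" and S: "flat S" and phi: "phi : ahom R S" shows "inj_on phi (El R)"
proof (rule inj_onI)
 fix x y assume xy: "x : El R" "y : El R" "phi x = phi y"
 obtain z g h where z: "acts R g z" "acts R h z" "act R g z = x" "act R h z = y" using flat_join[OF R xy(1,2)] .
 have "act S g (phi z) = act S h (phi z)" using ahomD(3)[OF phi z(1)] ahomD(3)[OF phi z(2)] z(3,4) xy(3) by simp
 then have "g = h" using flatD(7)[OF S ahomD(4)[OF phi z(1)] ahomD(4)[OF phi z(2)]] by blast
 then show "x = y" using z by simp
qed

text \<open>Homomorphisms of flat sets are injective, so the lift through \<open>m\<close> is forced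
  elementwise, and injectivity of \<open>m\<close> carries equivariance of \<open>phi\<close> back
  to it. An inclusion of images is thus all that a factorization requires.\<close>

lemma ahom_factor:
 assumes R: "flat R" and Q: "flat Q" and S: "flat S" and phi: "phi : ahom R S" and m: "m : ahom Q S"
  and sub: "phi ` El R \<subseteq> m ` El Q"
 obtains psi where "psi : ahom R Q" "!!x. x : El R ==> m (psi x) = phi x"
proof -
 have "\<forall>x\<in>El R. \<exists>y\<in>El Q. m y = phi x"
 proof
  fix x assume "x : El R"
  then have "phi x : m ` El Q" using sub by blast
  then show "\<exists>y\<in>El Q. m y = phi x" by force
 qed
 then obtain psi where psi: "!!x. x : El R ==> psi x : El Q" "!!x. x : El R ==> m (psi x) = phi x" by metis
 have l: "lab Q (psi x) = lab R x" if "x : El R" for x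
  using ahomD(2)[OF m psi(1)[OF that]] psi(2)[OF that] ahomD(2)[OF phi that] by simp
 have "psi : ahom R Q"
 proof (rule ahomI[OF psi(1) l])
  fix g x assume gx: "acts R g x"
  then have x: "x : El R" by (rule actsD)
  have aq: "acts Q g (psi x)" using gx psi(1)[OF x] l[OF x] by (simp add: acts_def)
  have "m (psi (act R g x)) = m (act Q g (psi x))"
   using psi(2)[OF flatD(3)[OF R gx]] ahomD(3)[OF phi gx] ahomD(3)[OF m aq] psi(2)[OF x] by simp
  then show "psi (act R g x) = act Q g (psi x)"
   using inj_onD[OF ahom_inj_on[OF Q S m]] psi(1)[OF flatD(3)[OF R gx]] flatD(3)[OF Q aq] by blast
 qed
 then show thesis using that psi(2) by blast
qed

section \<open>Flat subsets, copies and graphs\<close>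

definition sub :: "('x, 'a, 'b) aset => 'x set => ('x, 'a, 'b) aset" where
 "sub R W = \<lparr>El = W, lab = lab R, act = act R\<rparr>"

lemma sub_simps [simp]: "El (sub R W) = W" "lab (sub R W) = lab R" "act (sub R W) = act R" by (simp_all add: sub_def)

text \<open>Closure under the action and under common preimages of pairs; the equational clauses of
  \<open>flat\<close> then pass from the whole set to the subset.\<close>

definition flat_sub :: "('x, 'a, 'b) aset => 'x set => bool" where
 "flat_sub R W \<longleftrightarrow> W \<subseteq> El R \<and> W \<noteq> {} \<and> (\<forall>g x. acts R g x \<and> x : W --> act R g x : W) \<and>
   (\<forall>x\<in>W. \<forall>y\<in>W. \<exists>z\<in>W. \<exists>g h. acts R g z \<and> acts R h z \<and> act R g z = x \<and> act R h z = y)"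

lemma acts_sub: "W \<subseteq> El R ==> acts (sub R W) g x \<longleftrightarrow> acts R g x \<and> x : W" by (auto simp: acts_def)

lemma flat_subD:
 assumes R: "flat R" and W: "flat_sub R W"
 shows "flat (sub R W)" "(\<lambda>x. x) : ahom (sub R W) R"
proof -
 have WR: "W \<subseteq> El R" using W by (simp add: flat_sub_def)
 note a = acts_sub[OF WR]
 show "flat (sub R W)"
 proof (rule flatI)
  show "lab (sub R W) x : Obj A \<and> act (sub R W) (Ident A (lab (sub R W) x)) x = x" if "x : El (sub R W)" for x
   using flatD(1,2)[OF R] that WR by auto
  show "act (sub R W) g x : El (sub R W) \<and> lab (sub R W) (act (sub R W) g x) = Cod A g" if "acts (sub R W) g x" for g x
   using that flatD(4)[OF R] W by (simp add: a flat_sub_def)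
  show "act (sub R W) (Comp A h g) x = act (sub R W) h (act (sub R W) g x)"
   if "acts (sub R W) g x" "h : Arr A" "Dom A h = Cod A g" for g h x using that flatD(5)[OF R] by (simp add: a)
  show "El (sub R W) \<noteq> {}" using W by (simp add: flat_sub_def)
  show "\<exists>z g h. acts (sub R W) g z \<and> acts (sub R W) h z \<and> act (sub R W) g z = x \<and> act (sub R W) h z = y"
   if xy: "x : El (sub R W)" "y : El (sub R W)" for x y
  proof -
   obtain z g h where "z : W" "acts R g z" "acts R h z" "act R g z = x" "act R h z = y"
    using bspec[OF bspec[OF conjunct2[OF conjunct2[OF conjunct2[OF W[unfolded flat_sub_def]]]]], of x y] xy by auto
   then show ?thesis by (intro exI[of _ z] exI[of _ g] exI[of _ h]) (simp add: a)
  qed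
  show "g = h" if "acts (sub R W) g x" "acts (sub R W) h x" "act (sub R W) g x = act (sub R W) h x" for g h x
   using flatD(7)[OF R, of g x h] that by (simp add: a)
 qed
 show "(\<lambda>x. x) : ahom (sub R W) R" by (rule ahomI) (use WR in \<open>auto simp: a\<close>)
qed

text \<open>Transport of structure along an injection, in normalized form. It is the way in which a
  flat set on an arbitrary type becomes an object of \<open>K\<close>.\<close>

definition copy :: "('x => 'y) => ('x, 'a, 'b) aset => ('y, 'a, 'b) aset" where
 "copy e R = \<lparr>El = e ` El R, lab = (\<lambda>y\<in>e ` El R. lab R (inv_into (El R) e y)),
   act = (\<lambda>g y. if y : e ` El R \<and> acts R g (inv_into (El R) e y) then e (act R g (inv_into (El R) e y)) else undefined)\<rparr>"

lemma copy_props: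
 assumes R: "flat R" and e: "inj_on e (El R)"
 shows "flat (copy e R)" "norm (copy e R)" "El (copy e R) = e ` El R" "e : ahom R (copy e R)"
  "inv_into (El R) e : ahom (copy e R) R" "sat R ==> sat (copy e R)"
proof -
 show E: "El (copy e R) = e ` El R" by (simp add: copy_def)
 have l: "lab (copy e R) (e x) = lab R x" if "x : El R" for x using that e by (simp add: copy_def inv_into_f_f)
 have a: "acts (copy e R) g (e x) \<longleftrightarrow> acts R g x" if "x : El R" for g x using that l by (simp add: acts_def E)
 have t: "act (copy e R) g (e x) = e (act R g x)" if "acts R g x" for g x
  using that actsD(2)[OF that] e by (simp add: copy_def inv_into_f_f)
 have ex: "\<exists>x. y = e x \<and> acts R g x" if gy: "acts (copy e R) g y" for g y
 proof -
  obtain x where "y = e x" "x : El R" using actsD(2)[OF gy] unfolding E by blast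
  then show ?thesis using gy a by blast
 qed
 show "flat (copy e R)"
 proof (rule flatI)
  show "lab (copy e R) y : Obj A \<and> act (copy e R) (Ident A (lab (copy e R) y)) y = y" if "y : El (copy e R)" for y
  proof -
   obtain x where x: "y = e x" "x : El R" using \<open>y : El (copy e R)\<close> unfolding E by blast
   have "acts R (Ident A (lab R x)) x" using cat_ident[OF catA flatD(1)[OF R x(2)]] x(2) by (simp add: acts_def hom_def)
   then show ?thesis using t l[OF x(2)] flatD(1,2)[OF R x(2)] x(1) by simp
  qed
  show "act (copy e R) g y : El (copy e R) \<and> lab (copy e R) (act (copy e R) g y) = Cod A g" if gy: "acts (copy e R) g y" for g y
   using ex[OF gy] t flatD(3,4)[OF R] l by (auto simp: E)
  show "act (copy e R) (Comp A h g) y = act (copy e R) h (act (copy e R) g y)"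
   if gy: "acts (copy e R) g y" and h: "h : Arr A" "Dom A h = Cod A g" for g h y
  proof -
   obtain x where x: "y = e x" "acts R g x" using ex[OF gy] by blast
   have "acts R h (act R g x)" using h flatD(3,4)[OF R x(2)] by (simp add: acts_def)
   moreover have "acts R (Comp A h g) x" using cat_comp[OF catA, of g _ _ h] x(2) h by (simp add: acts_def hom_def)
   ultimately show ?thesis using t x flatD(5)[OF R x(2) h] by simp
  qed
  show "El (copy e R) \<noteq> {}" using flatD(6)[OF R] E by simp
  show "\<exists>z g h. acts (copy e R) g z \<and> acts (copy e R) h z \<and> act (copy e R) g z = y \<and> act (copy e R) h z = y'"
   if "y : El (copy e R)" "y' : El (copy e R)" for y y'
  proof -
   obtain x x' where x: "y = e x" "x : El R" "y' = e x'" "x' : El R" using \<open>y : El (copy e R)\<close> \<open>y' : El (copy e R)\<close> unfolding E by blast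
   obtain z g h where "acts R g z" "acts R h z" "act R g z = x" "act R h z = x'" using flat_join[OF R x(2,4)] .
   then have "acts (copy e R) g (e z) \<and> acts (copy e R) h (e z) \<and> act (copy e R) g (e z) = y \<and> act (copy e R) h (e z) = y'"
    using a t x(1,3) actsD(2)[of R g z] by simp
   then show ?thesis by blast
  qed
  show "g = h" if g: "acts (copy e R) g y" and h: "acts (copy e R) h y" and eq: "act (copy e R) g y = act (copy e R) h y" for g h y
  proof -
   obtain x where x: "y = e x" "acts R g x" using ex[OF g] by blast
   have h': "acts R h x" using h a[OF actsD(2)[OF x(2)]] x(1) by simp
   have "e (act R g x) = e (act R h x)" using eq t[OF x(2)] t[OF h'] x(1) by simp
   then show ?thesis using flatD(7)[OF R x(2) h'] inj_onD[OF e _ flatD(3)[OF R x(2)] flatD(3)[OF R h']] by blast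
  qed
 qed
 show "norm (copy e R)" unfolding norm_def
 proof (intro conjI allI impI)
  show "lab (copy e R) : extensional (El (copy e R))" by (simp add: copy_def)
  fix g y assume "\<not> acts (copy e R) g y"
  then have "\<not> (y : e ` El R \<and> acts R g (inv_into (El R) e y))" using a by (metis f_inv_into_f inv_into_into)
  then show "act (copy e R) g y = undefined" by (auto simp: copy_def)
 qed
 show "e : ahom R (copy e R)" by (rule ahomI) (simp_all add: E l t)
 have inv: "inv_into (El R) e (e x) = x" if "x : El R" for x using that e by simp
 show "inv_into (El R) e : ahom (copy e R) R"
 proof (rule ahomI)
  fix y assume "y : El (copy e R)"
  then obtain x where x: "y = e x" "x : El R" unfolding E by blast
  then show "inv_into (El R) e y : El R" "lab R (inv_into (El R) e y) = lab (copy e R) y" by (simp_all add: inv l)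
 next
  fix g y assume "acts (copy e R) g y"
  then obtain x where x: "y = e x" "acts R g x" using ex by blast
  then show "inv_into (El R) e (act (copy e R) g y) = act R g (inv_into (El R) e y)"
   by (simp add: t inv flatD(3)[OF R] actsD(2))
 qed
 show "sat (copy e R)" if s: "sat R" unfolding sat_def
 proof (intro ballI impI)
  fix g y assume g: "g : Arr A" and y: "y : El (copy e R)" "lab (copy e R) y = Cod A g"
  obtain x where x: "y = e x" "x : El R" using y(1) unfolding E by blast
  obtain w where w: "acts R g w" "act R g w = x" using s g x y(2) l unfolding sat_def by metis
  then show "\<exists>w. acts (copy e R) g w \<and> act (copy e R) g w = y" using a actsD(2)[OF w(1)] t x(1) by blast
 qed
qed

definition graph :: "('x, 'a, 'b) aset => ('b \<times> 'x \<times> 'x) set" where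
 "graph R = {(g, x, act R g x) | g x. acts R g x}"

lemma graph_subset: "flat R ==> graph R \<subseteq> Arr A \<times> El R \<times> El R"
 by (auto simp: graph_def dest: actsD flatD(3))

text \<open>Identities act, so the graph records the carrier as the set of elements on which
  something acts, and the label of an element as the common source of the arrows acting on it;
  \<open>norm\<close> settles the values elsewhere.\<close>

lemma graph_inj:
 fixes R S :: "('x, 'a, 'b) aset"
 assumes R: "flat R" "norm R" and S: "flat S" "norm S" and eq: "graph R = graph S"
 shows "R = S"
proof -
 have acts: "acts R g x \<longleftrightarrow> acts S g x" for g x
 proof -
  have "acts R g x \<longleftrightarrow> (\<exists>y. (g, x, y) : graph R)" for R :: "('x, 'a, 'b) aset" by (auto simp: graph_def)
  then show ?thesis using eq by metis
 qed
 have act: "act R g x = act S g x" for g x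
 proof (cases "acts R g x")
  case True
  then have "(g, x, act R g x) : graph R" by (auto simp: graph_def)
  then have "(g, x, act R g x) : graph S" unfolding eq .
  then show ?thesis by (auto simp: graph_def)
 next
  case False
  then show ?thesis using R(2) S(2) acts unfolding norm_def by metis
 qed
 have idt: "x : El R \<longleftrightarrow> (\<exists>g. acts R g x)" if "flat R" for R :: "('x, 'a, 'b) aset" and x
 proof
  assume x: "x : El R"
  have "acts R (Ident A (lab R x)) x" using cat_ident[OF catA flatD(1)[OF that x]] x by (simp add: acts_def hom_def)
  then show "\<exists>g. acts R g x" by blast
 qed (auto dest: actsD)
 have El: "El R = El S" using idt[OF R(1)] idt[OF S(1)] acts by blast
 have "lab R x = lab S x" for x
 proof (cases "x : El R")
  case True
  then obtain g where g: "acts R g x" using idt[OF R(1)] by blast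
  then show ?thesis using acts actsD(3) by metis
 next
  case False
  then show ?thesis using R(2) S(2) El unfolding norm_def extensional_def by simp
 qed
 then have "lab R = lab S" "act R = act S" using act by (simp_all add: fun_eq_iff)
 then show ?thesis using El by (simp add: aset.equality)
qed

end

text \<open>Describes \<open>K\<close> by decoding: \<open>T\<close> reads an object as a small
  normalized flat set and \<open>fn\<close> reads an arrow as a function, meaningful only on the
  carrier of its source. The encoding in \<open>'u\<close> can be forgotten once this locale is
  known to be inhabited.\<close>

locale flat_cat = epi_site U A for U :: "'u itself" and A :: "('a, 'b) cat" +
 fixes K :: "('u, 'u) cat" and T :: "'u => ('u, 'a, 'b) aset" and fn :: "'u => 'u => 'u"
 assumes catK: "category K"
  and T_flat: "a : Obj K ==> flat (T a)" and T_norm: "a : Obj K ==> norm (T a)" and T_sm: "a : Obj K ==> sm (El (T a))"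
  and T_inj: "inj_on T (Obj K)"
  and T_surj: "flat R ==> norm R ==> sm (El R) ==> \<exists>a\<in>Obj K. T a = R"
  and fn_hom: "f : hom K a b ==> fn f : ahom (T a) (T b)"
  and fn_inj: "f : hom K a b ==> g : hom K a b ==> (!!x. x : El (T a) ==> fn f x = fn g x) ==> f = g"
  and fn_surj: "a : Obj K ==> b : Obj K ==> phi : ahom (T a) (T b) ==> \<exists>f\<in>hom K a b. \<forall>x\<in>El (T a). fn f x = phi x"
  and fn_ident: "a : Obj K ==> x : El (T a) ==> fn (Ident K a) x = x"
  and fn_comp: "f : hom K a b ==> g : hom K b c ==> x : El (T a) ==> fn (Comp K g f) x = fn g (fn f x)"

context epi_site
begin

text \<open>A counting argument. A normalized flat set is determined by its graph, a small subset of
  \<open>Arr A \<times> UNIV \<times> UNIV\<close>, and a homomorphism by its graph with source and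
  target. A set no larger than \<open>'u\<close> has no more small subsets than \<open>'u\<close>
  has elements, so objects and arrows inject into \<open>'u\<close>.\<close>

lemma flat_cat_exists: "\<exists>(K :: ('u, 'u) cat) T fn. flat_cat U A K T fn"
proof -
 define F where "F = {R :: ('u, 'a, 'b) aset. flat R \<and> norm R \<and> sm (El R)}"
 define M where "M = {(R, phi, S). R : F \<and> S : F \<and> phi : ahom R S \<and> phi : extensional (El R)}"
 have Arr_u: "Arr A \<lesssim> (UNIV :: 'u set)" using sm_imp_lepoll sm_Arr by blast
 have B: "Arr A \<times> (UNIV :: 'u set) \<times> (UNIV :: 'u set) \<lesssim> (UNIV :: 'u set)" by (intro Times_univ Arr_u lepoll_refl)
 have C: "(UNIV :: 'u set) \<times> (UNIV :: 'u set) \<lesssim> (UNIV :: 'u set)" by (intro Times_univ lepoll_refl)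
 have gF: "inj_on graph F" using graph_inj unfolding F_def inj_on_def by blast
 have gF2: "graph ` F \<subseteq> {X. X \<subseteq> Arr A \<times> (UNIV :: 'u set) \<times> (UNIV :: 'u set) \<and> sm X}"
 proof
  fix X assume "X : graph ` F"
  then obtain R where R: "R : F" "X = graph R" by blast
  have "sm (El R)" using R(1) by (simp add: F_def)
  then have "sm (Arr A \<times> El R \<times> El R)" by (intro sm_Times sm_Arr)
  then show "X : {X. X \<subseteq> Arr A \<times> (UNIV :: 'u set) \<times> (UNIV :: 'u set) \<and> sm X}"
   using graph_subset[of R] R sm_subset unfolding F_def by auto
 qed
 have Fu: "F \<lesssim> (UNIV :: 'u set)"
  by (rule lepoll_trans[OF _ small_subsets_lepoll[OF B]]) (use gF gF2 in \<open>auto simp: lepoll_def\<close>)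
 let ?gr = "\<lambda>(R :: ('u, 'a, 'b) aset, phi :: 'u => 'u, S :: ('u, 'a, 'b) aset). (R, (\<lambda>x. (x, phi x)) ` El R, S)"
 have "inj_on ?gr M"
 proof (rule inj_onI)
  fix p q assume p: "p : M" and q: "q : M" and eq: "?gr p = ?gr q"
  obtain R phi S where p': "p = (R, phi, S)" by (cases p)
  obtain psi where q': "q = (R, psi, S)" and e2: "(\<lambda>x. (x, phi x)) ` El R = (\<lambda>x. (x, psi x)) ` El R"
   using eq p' by (cases q) auto
  have "phi x = psi x" for x
  proof (cases "x : El R")
   case True
   then have "(x, phi x) : (\<lambda>x. (x, psi x)) ` El R" using e2 by blast
   then show ?thesis by auto
  qed (use p q p' q' in \<open>auto simp: M_def extensional_def\<close>)
  then show "p = q" using p' q' by (simp add: fun_eq_iff)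
 qed
 moreover have "?gr ` M \<subseteq> F \<times> {X. X \<subseteq> (UNIV :: 'u set) \<times> (UNIV :: 'u set) \<and> sm X} \<times> F"
  by (auto simp: M_def F_def intro: sm_image)
 ultimately have "M \<lesssim> F \<times> {X. X \<subseteq> (UNIV :: 'u set) \<times> (UNIV :: 'u set) \<and> sm X} \<times> F"
  unfolding lepoll_def by blast
 then have Mu: "M \<lesssim> (UNIV :: 'u set)" by (rule lepoll_trans) (intro Times_univ Fu small_subsets_lepoll[OF C])
 obtain enc :: "('u, 'a, 'b) aset => 'u" where enc: "inj_on enc F" using Fu unfolding lepoll_def by blast
 obtain ena :: "('u, 'a, 'b) aset \<times> ('u => 'u) \<times> ('u, 'a, 'b) aset => 'u" where ena: "inj_on ena M"
  using Mu unfolding lepoll_def by blast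
 define T where "T = inv_into F enc"
 define dec where "dec = inv_into M ena"
 define K :: "('u, 'u) cat" where "K = \<lparr>Obj = enc ` F, Arr = ena ` M, Dom = (\<lambda>f. enc (fst (dec f))), Cod = (\<lambda>f. enc (snd (snd (dec f)))),
   Ident = (\<lambda>a. ena (T a, \<lambda>x\<in>El (T a). x, T a)),
   Comp = (\<lambda>g f. ena (fst (dec f), compose (El (fst (dec f))) (fst (snd (dec g))) (fst (snd (dec f))), snd (snd (dec g))))\<rparr>"
 define fn where "fn f = fst (snd (dec f))" for f
 have Te: "T (enc R) = R" if "R : F" for R unfolding T_def using enc that by simp
 have de: "dec (ena p) = p" if "p : M" for p unfolding dec_def using ena that by simp
 have TF: "T a : F" "enc (T a) = a" if "a : Obj K" for a using that Te by (auto simp: K_def)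
 have hom_iff: "f : hom K a b \<longleftrightarrow> (\<exists>phi. a : Obj K \<and> b : Obj K \<and> phi : ahom (T a) (T b) \<and> phi : extensional (El (T a)) \<and> f = ena (T a, phi, T b))" for f a b
 proof
  assume "f : hom K a b"
  then obtain p where p: "p : M" "f = ena p" "enc (fst p) = a" "enc (snd (snd p)) = b" by (auto simp: hom_def K_def de)
  obtain R phi S where p': "p = (R, phi, S)" by (cases p)
  have RS: "R : F" "S : F" "phi : ahom R S" "phi : extensional (El R)" using p(1) p' by (auto simp: M_def)
  have "T a = R" "T b = S" "a : Obj K" "b : Obj K" using p p' RS Te by (auto simp: K_def)
  then show "\<exists>phi. a : Obj K \<and> b : Obj K \<and> phi : ahom (T a) (T b) \<and> phi : extensional (El (T a)) \<and> f = ena (T a, phi, T b)"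
   using RS p(2) p' by blast
 next
  assume "\<exists>phi. a : Obj K \<and> b : Obj K \<and> phi : ahom (T a) (T b) \<and> phi : extensional (El (T a)) \<and> f = ena (T a, phi, T b)"
  then obtain phi where phi: "a : Obj K" "b : Obj K" "phi : ahom (T a) (T b)" "phi : extensional (El (T a))" "f = ena (T a, phi, T b)"
   by blast
  have "(T a, phi, T b) : M" using phi TF by (auto simp: M_def)
  then show "f : hom K a b" using phi(5) TF(2)[OF phi(1)] TF(2)[OF phi(2)] de by (auto simp: hom_def K_def)
 qed
 have homE: "a : Obj K" "b : Obj K" "fn f : ahom (T a) (T b)" "fn f : extensional (El (T a))" "f = ena (T a, fn f, T b)" "dec f = (T a, fn f, T b)"
  if f: "f : hom K a b" for f a b
 proof -
  obtain phi where phi: "a : Obj K" "b : Obj K" "phi : ahom (T a) (T b)" "phi : extensional (El (T a))" "f = ena (T a, phi, T b)"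
   using f hom_iff by blast
  have "(T a, phi, T b) : M" using phi TF by (auto simp: M_def)
  then have "dec f = (T a, phi, T b)" using de phi(5) by simp
  then show "a : Obj K" "b : Obj K" "fn f : ahom (T a) (T b)" "fn f : extensional (El (T a))" "f = ena (T a, fn f, T b)" "dec f = (T a, fn f, T b)"
   using phi by (simp_all add: fn_def)
 qed
 have fn_ena: "ena (T a, phi, T b) : hom K a b" "fn (ena (T a, phi, T b)) = phi"
  if "a : Obj K" "b : Obj K" "phi : ahom (T a) (T b)" "phi : extensional (El (T a))" for a b phi
 proof -
  show "ena (T a, phi, T b) : hom K a b" using hom_iff that by blast
  have "(T a, phi, T b) : M" using that TF by (auto simp: M_def)
  then show "fn (ena (T a, phi, T b)) = phi" using de by (simp add: fn_def)
 qed
 have flatT: "flat (T a)" "norm (T a)" "sm (El (T a))" if "a : Obj K" for a using TF[OF that] by (auto simp: F_def)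
 have restr: "restrict phi (El (T a)) : ahom (T a) S" if "a : Obj K" "phi : ahom (T a) S" for a phi S
  by (rule ahom_cong[OF flatT(1)[OF that(1)] that(2)]) simp
 have idh: "(\<lambda>x\<in>El (T a). x) : ahom (T a) (T a)" if "a : Obj K" for a by (rule restr[OF that]) (rule ahomI, simp_all)
 have id: "Ident K a : hom K a a" "fn (Ident K a) = (\<lambda>x\<in>El (T a). x)" if "a : Obj K" for a
  using fn_ena[OF that that idh[OF that]] by (simp_all add: K_def)
 have cmp: "Comp K g f : hom K a c" "fn (Comp K g f) = compose (El (T a)) (fn g) (fn f)"
  if f: "f : hom K a b" and g: "g : hom K b c" for f g a b c
 proof -
  have "(\<lambda>x. fn g (fn f x)) : ahom (T a) (T c)" by (rule ahom_comp[OF homE(3)[OF f] homE(3)[OF g]])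
  then have h: "compose (El (T a)) (fn g) (fn f) : ahom (T a) (T c)" unfolding compose_def by (rule restr[OF homE(1)[OF f]])
  have "Comp K g f = ena (T a, compose (El (T a)) (fn g) (fn f), T c)" by (simp add: K_def homE(6)[OF f] homE(6)[OF g])
  then show "Comp K g f : hom K a c" "fn (Comp K g f) = compose (El (T a)) (fn g) (fn f)"
   using fn_ena[OF homE(1)[OF f] homE(2)[OF g] h] by simp_all
 qed
 have ext: "f = g" if f: "f : hom K a b" and g: "g : hom K a b" and eq: "!!x. x : El (T a) ==> fn f x = fn g x" for f g a b
 proof -
  have "fn f = fn g" using homE(4)[OF f] homE(4)[OF g] eq by (rule extensionalityI)
  then show ?thesis using homE(5)[OF f] homE(5)[OF g] by simp
 qed
 have fel: "fn f x : El (T b)" if "f : hom K a b" "x : El (T a)" for f a b x using ahomD(1)[OF homE(3)] that by blast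
 have catK: "category K"
 proof (rule categoryI)
  show "Dom K f : Obj K \<and> Cod K f : Obj K" if "f : Arr K" for f using that by (auto simp: K_def de M_def)
  show "Ident K a : hom K a a" if "a : Obj K" for a using id[OF that] by blast
  show "Comp K g f : hom K a c" if "f : hom K a b" "g : hom K b c" for f g a b c using cmp that by blast
  show "Comp K f (Ident K a) = f \<and> Comp K (Ident K b) f = f" if f: "f : hom K a b" for f a b
  proof -
   note ia = id[OF homE(1)[OF f]] and ib = id[OF homE(2)[OF f]]
   show ?thesis
    using ext[OF cmp(1)[OF ia(1) f] f] ext[OF cmp(1)[OF f ib(1)] f] cmp(2)[OF ia(1) f] cmp(2)[OF f ib(1)] ia(2) ib(2) fel[OF f]
    by (simp add: compose_def)
  qed
  show "Comp K h (Comp K g f) = Comp K (Comp K h g) f"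
   if f: "f : hom K a b" and g: "g : hom K b c" and h: "h : hom K c d" for f g h a b c d
   by (rule ext[OF cmp(1)[OF cmp(1)[OF f g] h] cmp(1)[OF f cmp(1)[OF g h]]])
    (simp add: cmp(2)[OF cmp(1)[OF f g] h] cmp(2)[OF f cmp(1)[OF g h]] cmp(2)[OF f g] cmp(2)[OF g h] fel[OF f] compose_def)
 qed
 have "flat_cat U A K T fn"
 proof
  show "category K" by (rule catK)
  show "inj_on T (Obj K)" by (rule inj_onI) (metis TF(2))
  show "\<exists>a\<in>Obj K. T a = R" if "flat R" "norm R" "sm (El R)" for R
   using that Te[of R] by (intro bexI[of _ "enc R"]) (auto simp: F_def K_def)
  show "\<exists>f\<in>hom K a b. \<forall>x\<in>El (T a). fn f x = phi x" if ab: "a : Obj K" "b : Obj K" and phi: "phi : ahom (T a) (T b)" for a b phi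
   using fn_ena[OF ab restr[OF ab(1) phi]] by (intro bexI[of _ "ena (T a, restrict phi (El (T a)), T b)"]) auto
  show "fn f : ahom (T a) (T b)" if "f : hom K a b" for f a b using homE(3)[OF that] .
  show "f = g" if "f : hom K a b" "g : hom K a b" "!!x. x : El (T a) ==> fn f x = fn g x" for f g a b using ext that by blast
  show "fn (Ident K a) x = x" if "a : Obj K" "x : El (T a)" for a x using id(2)[OF that(1)] that(2) by simp
  show "fn (Comp K g f) x = fn g (fn f x)" if "f : hom K a b" "g : hom K b c" "x : El (T a)" for f g a b c x
   using cmp(2)[OF that(1,2)] that(3) by (simp add: compose_def)
 qed (use flatT in auto)
 then show ?thesis by blast
qed

end

section \<open>Working in \<open>K\<close> through flat sets\<close>

context flat_cat
begin

lemma hom_objs: "f : hom K a b ==> a : Obj K" "f : hom K a b ==> b : Obj K" using cat_hom_obj[OF catK] by blast+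

lemma fn_El: "f : hom K a b ==> x : El (T a) ==> fn f x : El (T b)" using ahomD(1)[OF fn_hom] .

lemma fn_inj_on: "f : hom K a b ==> inj_on (fn f) (El (T a))" using ahom_inj_on[OF T_flat T_flat fn_hom] hom_objs by blast

lemma fn_cancel: "f : hom K a b ==> x : El (T a) ==> y : El (T a) ==> fn f x = fn f y ==> x = y"
 using inj_onD[OF fn_inj_on] by blast

text \<open>The control on the carrier by \<open>B\<close> is for the accessibility of points: flat
  sets of size below \<open>L\<close> can all be realized with carrier inside \<open>L\<close>, and
  these form a small set of objects.\<close>

lemma realize_within:
 fixes R :: "('x, 'a, 'b) aset" and B :: "'u set"
 assumes R: "flat R" and B: "El R \<lesssim> B" "sm (El R)"
 obtains a phi psi where "a : Obj K" "phi : ahom R (T a)" "psi : ahom (T a) R" "phi ` El R = El (T a)"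
  "!!x. x : El R ==> psi (phi x) = x" "El (T a) \<subseteq> B" "sat R ==> sat (T a)"
proof -
 obtain e where e: "inj_on e (El R)" "e ` El R \<subseteq> B" using B(1) unfolding lepoll_def by blast
 note c = copy_props[OF R e(1)]
 have "sm (El (copy e R))" unfolding c(3) by (rule sm_image[OF B(2)])
 then obtain a where a: "a : Obj K" "T a = copy e R" using T_surj[OF c(1,2)] by blast
 show thesis by (rule that[of a e "inv_into (El R) e"]) (use a c e in auto)
qed

lemma realize:
 fixes R :: "('x, 'a, 'b) aset"
 assumes R: "flat R" and s: "sm (El R)"
 obtains a phi psi where "a : Obj K" "phi : ahom R (T a)" "psi : ahom (T a) R" "phi ` El R = El (T a)"
  "!!x. x : El R ==> psi (phi x) = x" "sat R ==> sat (T a)" using realize_within[OF R sm_imp_lepoll[OF s] s] by metis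

text \<open>Homomorphisms of flat sets are injective, so surjectivity suffices; the inverse is the
  factorization of the identity through \<open>phi\<close>.\<close>

lemma bij_is_iso:
 assumes a: "a : Obj K" and b: "b : Obj K" and phi: "phi : ahom (T a) (T b)" and s: "El (T b) \<subseteq> phi ` El (T a)"
 obtains f where "f : hom K a b" "is_iso K f" "!!x. x : El (T a) ==> fn f x = phi x"
proof -
 have "(\<lambda>x. x) : ahom (T b) (T b)" by (rule ahomI) auto
 then obtain psi where psi: "psi : ahom (T b) (T a)" "!!x. x : El (T b) ==> phi (psi x) = x"
  using ahom_factor[OF T_flat[OF b] T_flat[OF a] T_flat[OF b] _ phi] s by (metis image_ident)
 obtain f where f: "f : hom K a b" "!!x. x : El (T a) ==> fn f x = phi x" using fn_surj[OF a b phi] by blast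
 obtain g where g: "g : hom K b a" "!!x. x : El (T b) ==> fn g x = psi x" using fn_surj[OF b a psi(1)] by blast
 have fg: "Comp K f g = Ident K b" by (rule fn_inj[OF cat_comp[OF catK g(1) f(1)] cat_ident[OF catK b]])
   (simp add: fn_comp[OF g(1) f(1)] g(2) f(2) ahomD(1)[OF psi(1)] psi(2) fn_ident[OF b])
 have "psi (phi x) = x" if x: "x : El (T a)" for x
  using inj_onD[OF ahom_inj_on[OF T_flat[OF a] T_flat[OF b] phi]] psi(2)[OF ahomD(1)[OF phi x]] x
   ahomD(1)[OF psi(1) ahomD(1)[OF phi x]] by blast
 then have "Comp K g f = Ident K a" by (intro fn_inj[OF cat_comp[OF catK f(1) g(1)] cat_ident[OF catK a]])
   (simp add: fn_comp[OF f(1) g(1)] g(2) f(2) ahomD(1)[OF phi] fn_ident[OF a])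
 then show thesis using that is_isoI[OF f(1) g(1)] fg f by blast
qed

lemma locally_small_K: "locally_small U K" unfolding locally_small_def
proof (intro ballI)
 fix a b assume a: "a : Obj K" and b: "b : Obj K"
 have "inj_on (\<lambda>f. restrict (fn f) (El (T a))) (hom K a b)" by (rule inj_onI) (metis fn_inj restrict_apply')
 moreover have "(\<lambda>f. restrict (fn f) (El (T a))) ` hom K a b \<subseteq> El (T a) \<rightarrow>\<^sub>E El (T b)"
  using fn_El by auto
 ultimately show "sm (hom K a b)" by (rule sm_inj) (intro sm_PiE T_sm a b)
qed

section \<open>Directed colimits in \<open>K\<close>\<close>

context
 fixes I :: "'u set" and r and D and L :: "'l set"
 assumes dp: "directed_poset U L I r" and L: "infinite L" and D: "is_functor (poset_cat I r) K D"
begin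

lemma diagram_obj: "i : I ==> on_obj D i : Obj K" using functor_obj[OF D] by simp

lemma cocone_fn:
 assumes cc: "is_cocone (poset_cat I r) K D c tau" and ik: "(i, k) : r" and x: "x : El (T (on_obj D i))"
 shows "fn (tau k) (fn (on_arr D (i, k)) x) = fn (tau i) x"
proof -
 have "tau k : hom K (on_obj D k) c" "Comp K (tau k) (on_arr D (i, k)) = tau i"
  using cc ik directed_posetD(2)[OF dp ik] unfolding poset_cocone_iff by blast+
 then show ?thesis using fn_comp[OF poset_functor_hom[OF D ik] _ x] by metis
qed

text \<open>All arrows of \<open>K\<close> are injective: two elements of stages with the same image
  in \<open>c\<close> already coincide at any common later stage. Hence another cocone induces a
  well-defined function on \<open>c\<close>, and equivariance is checked on preimages.\<close>

lemma jointly_surjective_colimit: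
 assumes cc: "is_cocone (poset_cat I r) K D c tau"
  and js: "!!y. y : El (T c) ==> \<exists>i\<in>I. \<exists>x\<in>El (T (on_obj D i)). fn (tau i) x = y"
 shows "is_colimit (poset_cat I r) K D c tau" unfolding is_colimit_def
proof (intro conjI allI impI cc)
 fix d sigma assume s: "is_cocone (poset_cat I r) K D d sigma"
 have c: "c : Obj K" and t: "!!i. i : I ==> tau i : hom K (on_obj D i) c" using cc unfolding poset_cocone_iff by auto
 have d: "d : Obj K" and s1: "!!i. i : I ==> sigma i : hom K (on_obj D i) d" using s unfolding poset_cocone_iff by auto
 have wd: "fn (sigma i) x = fn (sigma k) y"
  if i: "i : I" "x : El (T (on_obj D i))" and k: "k : I" "y : El (T (on_obj D k))" and eq: "fn (tau i) x = fn (tau k) y" for i k x y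
 proof -
  obtain l where l: "l : I" "(i, l) : r" "(k, l) : r" using directed_poset_ub2[OF dp L i(1) k(1)] .
  have "fn (on_arr D (i, l)) x = fn (on_arr D (k, l)) y"
   by (rule fn_cancel[OF t[OF l(1)] fn_El[OF poset_functor_hom[OF D l(2)] i(2)] fn_El[OF poset_functor_hom[OF D l(3)] k(2)]])
    (simp add: cocone_fn[OF cc l(2) i(2)] cocone_fn[OF cc l(3) k(2)] eq)
  then show ?thesis using cocone_fn[OF s l(2) i(2)] cocone_fn[OF s l(3) k(2)] by simp
 qed
 have "\<exists>z. \<forall>i\<in>I. \<forall>x\<in>El (T (on_obj D i)). fn (tau i) x = y --> fn (sigma i) x = z" if "y : El (T c)" for y
 proof -
  obtain i x where "i : I" "x : El (T (on_obj D i))" "fn (tau i) x = y" using js[OF \<open>y : El (T c)\<close>] by blast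
  then show ?thesis using wd by (intro exI[of _ "fn (sigma i) x"]) metis
 qed
 then have "\<exists>phi. \<forall>y\<in>El (T c). \<forall>i\<in>I. \<forall>x\<in>El (T (on_obj D i)). fn (tau i) x = y --> fn (sigma i) x = phi y" by (intro bchoice) blast
 then obtain phi where "\<forall>y\<in>El (T c). \<forall>i\<in>I. \<forall>x\<in>El (T (on_obj D i)). fn (tau i) x = y --> fn (sigma i) x = phi y" by blast
 then have phi: "phi (fn (tau i) x) = fn (sigma i) x" if "i : I" "x : El (T (on_obj D i))" for i x
  using that fn_El[OF t] by metis
 have "phi : ahom (T c) (T d)"
 proof (rule ahomI)
  fix y assume "y : El (T c)"
  then obtain i x where i: "i : I" "x : El (T (on_obj D i))" "y = fn (tau i) x" using js by blast
  show "phi y : El (T d)" "lab (T d) (phi y) = lab (T c) y"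
   using phi[OF i(1,2)] i fn_El[OF s1] ahomD(2)[OF fn_hom[OF s1]] ahomD(2)[OF fn_hom[OF t]] by simp_all
 next
  fix g y assume gy: "acts (T c) g y"
  obtain i x where i: "i : I" "x : El (T (on_obj D i))" "y = fn (tau i) x" using js[OF actsD(2)[OF gy]] by metis
  have gx: "acts (T (on_obj D i)) g x" using gy i ahomD(2)[OF fn_hom[OF t[OF i(1)]] i(2)] by (simp add: acts_def)
  show "phi (act (T c) g y) = act (T d) g (phi y)"
   using ahomD(3)[OF fn_hom[OF t[OF i(1)]] gx] ahomD(3)[OF fn_hom[OF s1[OF i(1)]] gx] phi[OF i(1,2)]
    phi[OF i(1) flatD(3)[OF T_flat[OF diagram_obj[OF i(1)]] gx]] i(3) by simp
 qed
 then obtain h where h: "h : hom K c d" "!!y. y : El (T c) ==> fn h y = phi y" using fn_surj[OF c d] by blast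
 show "\<exists>!h. h : hom K c d \<and> (\<forall>i\<in>Obj (poset_cat I r). Comp K h (tau i) = sigma i)"
 proof (rule ex1I[of _ h])
  have "Comp K h (tau i) = sigma i" if i: "i : I" for i by (rule fn_inj[OF cat_comp[OF catK t[OF i] h(1)] s1[OF i]])
    (simp add: fn_comp[OF t[OF i] h(1)] h(2) fn_El[OF t[OF i]] phi[OF i])
  then show "h : hom K c d \<and> (\<forall>i\<in>Obj (poset_cat I r). Comp K h (tau i) = sigma i)" using h(1) by simp
  fix k assume k: "k : hom K c d \<and> (\<forall>i\<in>Obj (poset_cat I r). Comp K k (tau i) = sigma i)"
  then have k1: "k : hom K c d" by blast
  show "k = h"
  proof (rule fn_inj[OF k1 h(1)])
   fix y assume y: "y : El (T c)"
   obtain i x where i: "i : I" "x : El (T (on_obj D i))" "fn (tau i) x = y" using js[OF y] by blast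
   have "Comp K k (tau i) = sigma i" using k i(1) by simp
   then have "fn k y = fn (sigma i) x" using fn_comp[OF t[OF i(1)] k1 i(2)] i(3) by simp
   then show "fn k y = fn h y" using h(2)[OF y] phi[OF i(1,2)] i(3) by simp
  qed
 qed
qed

text \<open>The union \<open>W\<close> of the images is closed under the action and, by
  directedness, under common preimages, so it is a flat set. The cocone factors through it, and the
  induced arrow from \<open>c\<close> followed by the inclusion is the identity of \<open>c\<close>;
  so \<open>W\<close> is the whole carrier.\<close>

lemma colimit_jointly_surjective:
 assumes cl: "is_colimit (poset_cat I r) K D c tau" and y: "y : El (T c)"
 shows "\<exists>i\<in>I. \<exists>x\<in>El (T (on_obj D i)). fn (tau i) x = y"
proof -
 note cc = is_colimitD(1)[OF cl] and c = is_colimitD(2)[OF cl]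
 have t: "!!i. i : I ==> tau i : hom K (on_obj D i) c" using is_colimitD(3)[OF cl] by simp
 define W where "W = (\<Union>i\<in>I. fn (tau i) ` El (T (on_obj D i)))"
 have WI: "fn (tau i) x : W" if "i : I" "x : El (T (on_obj D i))" for i x using that unfolding W_def by blast
 have WE: "\<exists>i x. i : I \<and> x : El (T (on_obj D i)) \<and> y = fn (tau i) x" if "y : W" for y using that unfolding W_def by blast
 have "flat_sub (T c) W" unfolding flat_sub_def
 proof (intro conjI allI impI ballI)
  show sub: "W \<subseteq> El (T c)" unfolding W_def using fn_El[OF t] by blast
  obtain u where u: "u : I" using directed_poset_ub[OF dp, of "{}"] L finite_lesspoll_infinite[OF L] by (metis empty_subsetI finite.emptyI)
  show "W \<noteq> {}" using WI[OF u] flatD(6)[OF T_flat[OF diagram_obj[OF u]]] by blast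
  show "act (T c) g x : W" if gx: "acts (T c) g x \<and> x : W" for g x
  proof -
   obtain i z where i: "i : I" "z : El (T (on_obj D i))" "x = fn (tau i) z" using WE gx by blast
   have gz: "acts (T (on_obj D i)) g z" using gx i ahomD(2)[OF fn_hom[OF t[OF i(1)]] i(2)] by (simp add: acts_def)
   show ?thesis using WI[OF i(1) flatD(3)[OF T_flat[OF diagram_obj[OF i(1)]] gz]] ahomD(3)[OF fn_hom[OF t[OF i(1)]] gz] i(3) by simp
  qed
  show "\<exists>z\<in>W. \<exists>g h. acts (T c) g z \<and> acts (T c) h z \<and> act (T c) g z = x \<and> act (T c) h z = y" if "x : W" "y : W" for x y
  proof -
   obtain i x' k y' where i: "i : I" "x' : El (T (on_obj D i))" "x = fn (tau i) x'"
    and k: "k : I" "y' : El (T (on_obj D k))" "y = fn (tau k) y'" using WE[OF \<open>x : W\<close>] WE[OF \<open>y : W\<close>] by blast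
   obtain l where l: "l : I" "(i, l) : r" "(k, l) : r" using directed_poset_ub2[OF dp L i(1) k(1)] .
   let ?x = "fn (on_arr D (i, l)) x'" and ?y = "fn (on_arr D (k, l)) y'"
   have xy: "?x : El (T (on_obj D l))" "?y : El (T (on_obj D l))"
    using fn_El[OF poset_functor_hom[OF D l(2)] i(2)] fn_El[OF poset_functor_hom[OF D l(3)] k(2)] by auto
   obtain z g h where z: "acts (T (on_obj D l)) g z" "acts (T (on_obj D l)) h z" "act (T (on_obj D l)) g z = ?x" "act (T (on_obj D l)) h z = ?y"
    using flat_join[OF T_flat[OF diagram_obj[OF l(1)]] xy] .
   note f = fn_hom[OF t[OF l(1)]]
   have "acts (T c) g (fn (tau l) z) \<and> acts (T c) h (fn (tau l) z) \<and> act (T c) g (fn (tau l) z) = x \<and> act (T c) h (fn (tau l) z) = y"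
    using ahomD(4)[OF f z(1)] ahomD(4)[OF f z(2)] ahomD(3)[OF f z(1)] ahomD(3)[OF f z(2)] z(3,4)
     cocone_fn[OF cc l(2) i(2)] cocone_fn[OF cc l(3) k(2)] i(3) k(3) by simp
   then show ?thesis using WI[OF l(1) actsD(2)[OF z(1)]] by blast
  qed
 qed
 then have W: "flat (sub (T c) W)" "(\<lambda>x. x) : ahom (sub (T c) W) (T c)" and Wc: "W \<subseteq> El (T c)"
  using flat_subD[OF T_flat[OF c]] unfolding flat_sub_def by auto
 have "sm (El (sub (T c) W))" using sm_subset[OF T_sm[OF c] Wc] by simp
 then obtain w phi psi where w: "w : Obj K" "phi : ahom (sub (T c) W) (T w)" "psi : ahom (T w) (sub (T c) W)"
  "!!x. x : W ==> psi (phi x) = x" using realize[OF W(1)] by (metis sub_simps(1))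
 have psic: "psi : ahom (T w) (T c)" using ahom_comp[OF w(3) W(2)] .
 obtain iota where iota: "iota : hom K w c" "!!x. x : El (T w) ==> fn iota x = psi x" using fn_surj[OF w(1) c psic] by blast
 have "\<exists>s\<in>hom K (on_obj D i) w. Comp K iota s = tau i" if i: "i : I" for i
 proof -
  have "fn (tau i) : ahom (T (on_obj D i)) (sub (T c) W)" using fn_hom[OF t[OF i]] WI[OF i] unfolding ahom_def by auto
  from ahom_comp[OF this w(2)] obtain s where s: "s : hom K (on_obj D i) w" "!!x. x : El (T (on_obj D i)) ==> fn s x = phi (fn (tau i) x)"
   using fn_surj[OF diagram_obj[OF i] w(1)] by blast
  have "Comp K iota s = tau i" by (rule fn_inj[OF cat_comp[OF catK s(1) iota(1)] t[OF i]])
    (use fn_comp[OF s(1) iota(1)] iota(2)[OF fn_El[OF s(1)]] s(2) w(4) WI[OF i] in simp)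
  then show ?thesis using s(1) by blast
 qed
 then obtain sigma where sigma: "!!i. i : I ==> sigma i : hom K (on_obj D i) w" "!!i. i : I ==> Comp K iota (sigma i) = tau i" by metis
 have iotac: "g = h" if g: "g : hom K d w" and h: "h : hom K d w" and eq: "Comp K iota g = Comp K iota h" for g h d
 proof (rule fn_inj[OF g h])
  fix x assume x: "x : El (T d)"
  show "fn g x = fn h x" by (rule fn_cancel[OF iota(1) fn_El[OF g x] fn_El[OF h x]])
    (use fn_comp[OF g iota(1) x] fn_comp[OF h iota(1) x] eq in simp)
 qed
 have "is_cocone (poset_cat I r) K D w sigma" unfolding poset_cocone_iff
 proof (intro conjI ballI allI impI w(1) sigma(1))
  fix i k assume ik: "(i, k) : r"
  note i = directed_posetD(1)[OF dp ik] and k = directed_posetD(2)[OF dp ik] note Dik = poset_functor_hom[OF D ik]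
  show "Comp K (sigma k) (on_arr D (i, k)) = sigma i" by (rule iotac[OF cat_comp[OF catK Dik sigma(1)[OF k]] sigma(1)[OF i]])
    (use cat_assoc[OF catK Dik sigma(1)[OF k] iota(1)] sigma(2)[OF k] sigma(2)[OF i] cc ik in \<open>simp add: poset_cocone_iff\<close>)
 qed
 then obtain h where h: "h : hom K c w" "!!i. i : I ==> Comp K h (tau i) = sigma i" using is_colimit_factor[OF cl] by auto
 have "Comp K iota h = Ident K c"
  by (rule is_colimit_ext[OF functor_cats(1)[OF D] catK D cl cat_comp[OF catK h(1) iota(1)] cat_ident[OF catK c]])
   (simp add: cat_assoc[OF catK t h(1) iota(1), symmetric] h(2) sigma(2) cat_ident_left[OF catK t])
 then have "y = psi (fn h y)" using fn_comp[OF h(1) iota(1) y] fn_ident[OF c y] iota(2)[OF fn_El[OF h(1) y]] by simp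
 then have "y : W" using ahomD(1)[OF w(3) fn_El[OF h(1) y]] by simp
 then show ?thesis using WE by blast
qed

text \<open>Elements of the stages modulo agreement at a later stage, with the action read off a
  chosen representative. The last clause of flatness holds because an equality of classes is an
  equality at a later stage, and the injective transition maps bring it back to the stage where the
  arrows act.\<close>

lemma colimit_exists: "\<exists>c tau. is_colimit (poset_cat I r) K D c tau"
proof -
 let ?E = "\<lambda>i. El (T (on_obj D i))" and ?d = "\<lambda>i k. fn (on_arr D (i, k))"
 define P where "P = Sigma I ?E"
 define e where "e p q \<longleftrightarrow> (\<exists>l. (fst p, l) : r \<and> (fst q, l) : r \<and> ?d (fst p) l (snd p) = ?d (fst q) l (snd q))" for p q
 define cl where "cl p = {q : P. e p q}" for p
 have d: "?d i k x : ?E k" if "(i, k) : r" "x : ?E i" for i k x using fn_El[OF poset_functor_hom[OF D that(1)] that(2)] .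
 have dd: "?d k l (?d i k x) = ?d i l x" if "(i, k) : r" "(k, l) : r" "x : ?E i" for i k l x
  using fn_comp[OF poset_functor_hom[OF D that(1)] poset_functor_hom[OF D that(2)] that(3)] poset_functor_comp[OF D that(1,2)] by simp
 have refl: "e p p" if "p : P" for p
  using that directed_posetD(3)[OF dp, of "fst p"] unfolding e_def P_def by (intro exI[of _ "fst p"]) auto
 have sym: "e q p" if "e p q" for p q using that unfolding e_def by metis
 have trans: "e p s" if p: "p : P" and q: "q : P" and s: "s : P" and pq: "e p q" and qs: "e q s" for p q s
 proof -
  obtain l m where l: "(fst p, l) : r" "(fst q, l) : r" "?d (fst p) l (snd p) = ?d (fst q) l (snd q)"
   and m: "(fst q, m) : r" "(fst s, m) : r" "?d (fst q) m (snd q) = ?d (fst s) m (snd s)" using pq qs unfolding e_def by blast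
  have x: "snd p : ?E (fst p)" "snd q : ?E (fst q)" "snd s : ?E (fst s)" using p q s unfolding P_def by auto
  obtain n where n: "(l, n) : r" "(m, n) : r"
   using directed_poset_ub2[OF dp L directed_posetD(2)[OF dp l(1)] directed_posetD(2)[OF dp m(1)]] .
  have "?d (fst p) n (snd p) = ?d (fst s) n (snd s)"
   using dd[OF l(1) n(1) x(1)] dd[OF l(2) n(1) x(2)] dd[OF m(1) n(2) x(2)] dd[OF m(2) n(2) x(3)] l(3) m(3) by simp
  then show ?thesis using directed_posetD(4)[OF dp l(1) n(1)] directed_posetD(4)[OF dp m(2) n(2)] unfolding e_def by blast
 qed
 have cl_eq: "cl p = cl q \<longleftrightarrow> e p q" if p: "p : P" and q: "q : P" for p q
 proof
  assume "cl p = cl q"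
  then have "q : cl p" using refl[OF q] q unfolding cl_def by simp
  then show "e p q" unfolding cl_def by simp
 next
  assume "e p q"
  then show "cl p = cl q" unfolding cl_def using trans[OF q p] trans[OF p q] sym p q by blast
 qed
 define rep where "rep C = (SOME p. p : P \<and> cl p = C)" for C
 have rep: "rep (cl p) : P" "e (rep (cl p)) p" if p: "p : P" for p
 proof -
  have "rep (cl p) : P \<and> cl (rep (cl p)) = cl p" unfolding rep_def by (rule someI[of _ p]) (simp add: p)
  then show "rep (cl p) : P" "e (rep (cl p)) p" using cl_eq[OF _ p, of "rep (cl p)"] by blast+
 qed
 define R where "R = \<lparr>El = cl ` P, lab = (\<lambda>C. lab (T (on_obj D (fst (rep C)))) (snd (rep C))),
  act = (\<lambda>g C. cl (fst (rep C), act (T (on_obj D (fst (rep C)))) g (snd (rep C))))\<rparr>"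
 let ?T = "\<lambda>i. T (on_obj D i)"
 have fT: "flat (?T i)" if "i : I" for i using T_flat[OF diagram_obj[OF that]] .
 have dh: "?d i k : ahom (?T i) (?T k)" if "(i, k) : r" for i k using fn_hom[OF poset_functor_hom[OF D that]] .
 have Rl: "lab R (cl (i, x)) = lab (?T i) x" if i: "i : I" and x: "x : ?E i" for i x
 proof -
  have p: "(i, x) : P" using i x unfolding P_def by simp
  obtain k y where q: "rep (cl (i, x)) = (k, y)" by (cases "rep (cl (i, x))")
  have y: "k : I" "y : ?E k" using rep(1)[OF p] q unfolding P_def by auto
  obtain l where l: "(k, l) : r" "(i, l) : r" "?d k l y = ?d i l x" using rep(2)[OF p] q unfolding e_def by auto
  show ?thesis using ahomD(2)[OF dh[OF l(1)] y(2)] ahomD(2)[OF dh[OF l(2)] x] l(3) q by (simp add: R_def)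
 qed
 have Ra: "act R g (cl (i, x)) = cl (i, act (?T i) g x)" if i: "i : I" and gx: "acts (?T i) g x" for i x g
 proof -
  note x = actsD(2)[OF gx]
  have p: "(i, x) : P" using i x unfolding P_def by simp
  obtain k y where q: "rep (cl (i, x)) = (k, y)" by (cases "rep (cl (i, x))")
  have y: "k : I" "y : ?E k" using rep(1)[OF p] q unfolding P_def by auto
  obtain l where l: "(k, l) : r" "(i, l) : r" "?d k l y = ?d i l x" using rep(2)[OF p] q unfolding e_def by auto
  have gy: "acts (?T k) g y" using gx y ahomD(2)[OF dh[OF l(1)] y(2)] ahomD(2)[OF dh[OF l(2)] x] l(3) by (simp add: acts_def)
  have "?d k l (act (?T k) g y) = ?d i l (act (?T i) g x)"
   using ahomD(3)[OF dh[OF l(1)] gy] ahomD(3)[OF dh[OF l(2)] gx] l(3) by simp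
  then have "e (k, act (?T k) g y) (i, act (?T i) g x)" using l unfolding e_def by auto
  then have "cl (k, act (?T k) g y) = cl (i, act (?T i) g x)"
   by (subst cl_eq) (simp_all add: P_def i y(1) flatD(3)[OF fT[OF i] gx] flatD(3)[OF fT[OF y(1)] gy])
  then show ?thesis using q by (simp add: R_def)
 qed
 have RE: "\<exists>i x. i : I \<and> x : ?E i \<and> C = cl (i, x)" if "C : El R" for C using that by (auto simp: R_def P_def)
 have RI: "cl (i, x) : El R" if "i : I" "x : ?E i" for i x using that by (auto simp: R_def P_def)
 have Rs: "acts R g (cl (i, x)) \<longleftrightarrow> acts (?T i) g x" if "i : I" "x : ?E i" for i x g
  using Rl[OF that] RI[OF that] that by (simp add: acts_def)
 have shift: "cl (k, ?d i k x) = cl (i, x)" if ik: "(i, k) : r" and x: "x : ?E i" for i k x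
 proof -
  note i = directed_posetD(1)[OF dp ik] and k = directed_posetD(2)[OF dp ik]
  have kk: "(k, k) : r" using directed_posetD(3)[OF dp k] .
  have "e (k, ?d i k x) (i, x)" using dd[OF ik kk x] kk ik unfolding e_def by auto
  then show ?thesis by (subst cl_eq) (simp_all add: P_def i k x d[OF ik x])
 qed
 have flatR: "flat R"
 proof (rule flatI)
  fix C assume "C : El R"
  then obtain i x where i: "i : I" "x : ?E i" "C = cl (i, x)" using RE by blast
  have "acts (?T i) (Ident A (lab (?T i) x)) x"
   using cat_ident[OF catA flatD(1)[OF fT[OF i(1)] i(2)]] i(2) by (simp add: acts_def hom_def)
  then show "lab R C : Obj A \<and> act R (Ident A (lab R C)) C = C"
   using Rl[OF i(1,2)] Ra[OF i(1)] flatD(1,2)[OF fT[OF i(1)] i(2)] i(3) by simp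
 next
  fix g C assume gC: "acts R g C"
  obtain i x where i: "i : I" "x : ?E i" "C = cl (i, x)" using RE[OF actsD(2)[OF gC]] by blast
  have gx: "acts (?T i) g x" using gC Rs i by simp
  note f = flatD(3,4)[OF fT[OF i(1)] gx]
  show "act R g C : El R \<and> lab R (act R g C) = Cod A g" using Ra[OF i(1) gx] RI[OF i(1) f(1)] Rl[OF i(1) f(1)] f(2) i(3) by simp
  fix h assume h: "h : Arr A" "Dom A h = Cod A g"
  have hg: "acts (?T i) h (act (?T i) g x)" using f h by (simp add: acts_def)
  have "acts (?T i) (Comp A h g) x" using cat_comp[OF catA, of g _ _ h] gx h by (simp add: acts_def hom_def)
  then show "act R (Comp A h g) C = act R h (act R g C)" using Ra[OF i(1)] gx hg flatD(5)[OF fT[OF i(1)] gx h] i(3) by simp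
 next
  obtain u where u: "u : I" using directed_poset_ub[OF dp, of "{}"] L finite_lesspoll_infinite[OF L] by (metis empty_subsetI finite.emptyI)
  show "El R \<noteq> {}" using RI[OF u] flatD(6)[OF fT[OF u]] by blast
 next
  fix C C' assume "C : El R" "C' : El R"
  then obtain i x k y where i: "i : I" "x : ?E i" "C = cl (i, x)" and k: "k : I" "y : ?E k" "C' = cl (k, y)" using RE by metis
  obtain l where l: "l : I" "(i, l) : r" "(k, l) : r" using directed_poset_ub2[OF dp L i(1) k(1)] .
  obtain z g h where z: "acts (?T l) g z" "acts (?T l) h z" "act (?T l) g z = ?d i l x" "act (?T l) h z = ?d k l y"
   using flat_join[OF fT[OF l(1)] d[OF l(2) i(2)] d[OF l(3) k(2)]] .
  have "acts R g (cl (l, z)) \<and> acts R h (cl (l, z)) \<and> act R g (cl (l, z)) = C \<and> act R h (cl (l, z)) = C'"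
   using Rs[OF l(1) actsD(2)[OF z(1)]] Ra[OF l(1)] z shift[OF l(2) i(2)] shift[OF l(3) k(2)] i(3) k(3) by simp
  then show "\<exists>z g h. acts R g z \<and> acts R h z \<and> act R g z = C \<and> act R h z = C'" by blast
 next
  fix g h C assume gC: "acts R g C" and hC: "acts R h C" and eq: "act R g C = act R h C"
  obtain i x where i: "i : I" "x : ?E i" "C = cl (i, x)" using RE[OF actsD(2)[OF gC]] by blast
  have gx: "acts (?T i) g x" and hx: "acts (?T i) h x" using gC hC Rs i by auto
  note f = flatD(3)[OF fT[OF i(1)] gx] flatD(3)[OF fT[OF i(1)] hx]
  have "cl (i, act (?T i) g x) = cl (i, act (?T i) h x)" using eq Ra[OF i(1)] gx hx i(3) by simp
  then have "e (i, act (?T i) g x) (i, act (?T i) h x)" by (subst (asm) cl_eq) (simp_all add: P_def i(1) f)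
  then obtain l where l: "(i, l) : r" "?d i l (act (?T i) g x) = ?d i l (act (?T i) h x)" unfolding e_def by auto
  have "act (?T i) g x = act (?T i) h x" using fn_cancel[OF poset_functor_hom[OF D l(1)] f l(2)] .
  then show "g = h" using flatD(7)[OF fT[OF i(1)] gx hx] by blast
 qed
 have "sm (El R)" unfolding R_def P_def by (simp, intro sm_image sm_Sigma directed_posetD(5)[OF dp]) (rule T_sm[OF diagram_obj])
 then obtain c phi where c: "c : Obj K" "phi : ahom R (T c)" "phi ` El R = El (T c)" using realize[OF flatR] by metis
 have "\<exists>t\<in>hom K (on_obj D i) c. \<forall>x\<in>?E i. fn t x = phi (cl (i, x))" if i: "i : I" for i
 proof -
  have "(\<lambda>x. cl (i, x)) : ahom (?T i) R" by (rule ahomI) (simp_all add: RI[OF i] Rl[OF i] Ra[OF i])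
  from ahom_comp[OF this c(2)] show ?thesis using fn_surj[OF diagram_obj[OF i] c(1)] by blast
 qed
 then obtain tau where t: "!!i. i : I ==> tau i : hom K (on_obj D i) c" "!!i x. i : I ==> x : ?E i ==> fn (tau i) x = phi (cl (i, x))" by metis
 have "is_cocone (poset_cat I r) K D c tau" unfolding poset_cocone_iff
 proof (intro conjI ballI allI impI c(1) t(1))
  fix i k assume ik: "(i, k) : r"
  note i = directed_posetD(1)[OF dp ik] and k = directed_posetD(2)[OF dp ik] note Dik = poset_functor_hom[OF D ik]
  show "Comp K (tau k) (on_arr D (i, k)) = tau i" by (rule fn_inj[OF cat_comp[OF catK Dik t(1)[OF k]] t(1)[OF i]])
    (simp add: fn_comp[OF Dik t(1)[OF k]] t(2)[OF k d[OF ik]] t(2)[OF i] shift[OF ik])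
 qed
 moreover have "\<exists>i\<in>I. \<exists>x\<in>?E i. fn (tau i) x = y" if "y : El (T c)" for y
 proof -
  obtain C where "C : El R" "y = phi C" using \<open>y : El (T c)\<close> c(3) by blast
  then show ?thesis using RE t(2) by metis
 qed
 ultimately show ?thesis using jointly_surjective_colimit by blast
qed

text \<open>Every element of the colimit comes from a stage, where a preimage under \<open>g\<close>
  is already available.\<close>

lemma colimit_sat:
 assumes cl: "is_colimit (poset_cat I r) K D c tau" and s: "!!i. i : I ==> sat (T (on_obj D i))"
 shows "sat (T c)" unfolding sat_def
proof (intro ballI impI)
 fix g y assume g: "g : Arr A" and y: "y : El (T c)" "lab (T c) y = Cod A g"
 obtain i x where i: "i : I" "x : El (T (on_obj D i))" "fn (tau i) x = y" using colimit_jointly_surjective[OF cl y(1)] by blast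
 have t: "tau i : hom K (on_obj D i) c" using is_colimitD(3)[OF cl] i(1) by simp
 note h = fn_hom[OF t]
 obtain z where z: "acts (T (on_obj D i)) g z" "act (T (on_obj D i)) g z = x"
  using s[OF i(1)] g i(2,3) y(2) ahomD(2)[OF h i(2)] unfolding sat_def by metis
 then show "\<exists>x. acts (T c) g x \<and> act (T c) g x = y" using ahomD(3)[OF h z(1)] ahomD(4)[OF h z(1)] i(3) by metis
qed

end

lemma has_directed_colimits_K: "has_directed_colimits U omega K"
 unfolding has_directed_colimits_def using colimit_exists[OF _ infinite_UNIV_nat] by blast

text \<open>The images of fewer than \<open>L\<close> generators come from stages that have a common
  upper bound \<open>u\<close>. The action spreads this to the whole carrier, so the image of the
  arrow lies in that of stage \<open>u\<close> and the arrow factors. Essential uniqueness is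
  immediate, the arrows of the colimit cocone being injective.\<close>

lemma generated_elem_presentable:
 assumes s: "s : Obj K" and L: "infinite L" and G: "G \<subseteq> El (T s)" "G \<prec> L"
  and gen: "!!x. x : El (T s) ==> \<exists>g z. z : G \<and> acts (T s) g z \<and> act (T s) g z = x"
 shows "elem_presentable U L K s" unfolding elem_presentable_def
proof (intro conjI allI impI s)
 fix I :: "'u set" and r D c tau
 assume *: "directed_poset U L I r \<and> is_functor (poset_cat I r) K D \<and> is_colimit (poset_cat I r) K D c tau"
 then have dp: "directed_poset U L I r" and D: "is_functor (poset_cat I r) K D" and cl: "is_colimit (poset_cat I r) K D c tau" by auto
 note cc = is_colimitD(1)[OF cl] and c = is_colimitD(2)[OF cl]
 have t: "!!i. i : I ==> tau i : hom K (on_obj D i) c" using is_colimitD(3)[OF cl] by simp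
 note dobj = diagram_obj[OF dp L D]
 show "\<forall>h\<in>hom K s c. \<exists>i\<in>I. \<exists>g\<in>hom K s (on_obj D i). Comp K (tau i) g = h"
 proof
  fix h assume h: "h : hom K s c"
  have "\<exists>i x. i : I \<and> x : El (T (on_obj D i)) \<and> fn (tau i) x = fn h z" if "z : G" for z
  proof -
   have "fn h z : El (T c)" using fn_El[OF h] G(1) that by blast
   then show ?thesis using colimit_jointly_surjective[OF dp L D cl] by blast
  qed
  then obtain i x where ix: "!!z. z : G ==> i z : I" "!!z. z : G ==> x z : El (T (on_obj D (i z)))" "!!z. z : G ==> fn (tau (i z)) (x z) = fn h z"
   by metis
  have "i ` G \<subseteq> I" "i ` G \<prec> L" using ix(1) lesspoll_trans1[OF image_lepoll G(2)] by auto
  then obtain u where u: "u : I" "\<forall>k\<in>i ` G. (k, u) : r" using directed_poset_ub[OF dp] by metis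
  have "fn h ` El (T s) \<subseteq> fn (tau u) ` El (T (on_obj D u))"
  proof
   fix y assume "y : fn h ` El (T s)"
   then obtain w where w: "w : El (T s)" "y = fn h w" by blast
   obtain g z where z: "z : G" "acts (T s) g z" "act (T s) g z = w" using gen[OF w(1)] by blast
   have iu: "(i z, u) : r" using u(2) z(1) by blast
   let ?x = "fn (on_arr D (i z, u)) (x z)"
   have x: "?x : El (T (on_obj D u))" "fn (tau u) ?x = fn h z"
    using fn_El[OF poset_functor_hom[OF D iu] ix(2)[OF z(1)]] cocone_fn[OF dp L D cc iu ix(2)[OF z(1)]] ix(3)[OF z(1)] by auto
   have "lab (T (on_obj D u)) ?x = lab (T s) z"
    using ahomD(2)[OF fn_hom[OF t[OF u(1)]] x(1)] x(2) ahomD(2)[OF fn_hom[OF h] actsD(2)[OF z(2)]] by simp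
   then have gx: "acts (T (on_obj D u)) g ?x" using z(2) x(1) by (simp add: acts_def)
   have "fn (tau u) (act (T (on_obj D u)) g ?x) = y"
    using ahomD(3)[OF fn_hom[OF t[OF u(1)]] gx] x(2) ahomD(3)[OF fn_hom[OF h] z(2)] z(3) w(2) by simp
   then show "y : fn (tau u) ` El (T (on_obj D u))" using flatD(3)[OF T_flat[OF dobj[OF u(1)]] gx] by blast
  qed
  then obtain psi where psi: "psi : ahom (T s) (T (on_obj D u))" "!!x. x : El (T s) ==> fn (tau u) (psi x) = fn h x"
   using ahom_factor[OF T_flat[OF s] T_flat[OF dobj[OF u(1)]] T_flat[OF c] fn_hom[OF h] fn_hom[OF t[OF u(1)]]] by metis
  obtain g where g: "g : hom K s (on_obj D u)" "!!x. x : El (T s) ==> fn g x = psi x" using fn_surj[OF s dobj[OF u(1)] psi(1)] by blast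
  have "Comp K (tau u) g = h"
   by (rule fn_inj[OF cat_comp[OF catK g(1) t[OF u(1)]] h]) (simp add: fn_comp[OF g(1) t[OF u(1)]] g(2) psi(2))
  then show "\<exists>i\<in>I. \<exists>g\<in>hom K s (on_obj D i). Comp K (tau i) g = h" using u(1) g(1) by blast
 qed
 show "\<forall>i\<in>I. \<forall>g\<in>hom K s (on_obj D i). \<forall>g'\<in>hom K s (on_obj D i). Comp K (tau i) g = Comp K (tau i) g' -->
  (\<exists>k. (i, k) : r \<and> Comp K (on_arr D (i, k)) g = Comp K (on_arr D (i, k)) g')"
 proof (intro ballI impI)
  fix i g g' assume i: "i : I" and g: "g : hom K s (on_obj D i)" and g': "g' : hom K s (on_obj D i)"
   and eq: "Comp K (tau i) g = Comp K (tau i) g'"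
  have "g = g'"
  proof (rule fn_inj[OF g g'])
   fix x assume x: "x : El (T s)"
   show "fn g x = fn g' x" by (rule fn_cancel[OF t[OF i] fn_El[OF g x] fn_El[OF g' x]])
     (use fn_comp[OF g t[OF i] x] fn_comp[OF g' t[OF i] x] eq in simp)
  qed
  then show "\<exists>k. (i, k) : r \<and> Comp K (on_arr D (i, k)) g = Comp K (on_arr D (i, k)) g'"
   using directed_posetD(3)[OF dp i] by blast
 qed
qed

text \<open>Inclusion of images yields factorizations, and these are unique because arrows of
  \<open>K\<close> are injective; so the transition arrows are automatically functorial. The family
  itself, encoded in \<open>'u\<close> and ordered by inclusion, serves as the index poset.\<close>

lemma directed_union:
 assumes c: "c : Obj K" and W: "!!V. V : \<W> ==> V \<subseteq> El (T c)" "\<Union>\<W> = El (T c)"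
  and dir: "!!\<X>. \<X> \<subseteq> \<W> ==> \<X> \<prec> L ==> \<exists>V\<in>\<W>. \<Union>\<X> \<subseteq> V" and L: "infinite L"
  and S: "!!V. V : \<W> ==> \<exists>s\<in>S. \<exists>m\<in>hom K s c. fn m ` El (T s) = V"
 shows "\<exists>(I :: 'u set) r D tau. directed_poset U L I r \<and> is_functor (poset_cat I r) K D \<and>
   (\<forall>i\<in>I. on_obj D i : S) \<and> is_colimit (poset_cat I r) K D c tau"
proof -
 have "sm \<W>" by (rule sm_subset[OF sm_Pow[OF T_sm[OF c]]]) (use W(1) in blast)
 then obtain e :: "'u set => 'u" where e: "inj_on e \<W>" "sm (e ` \<W>)" using sm_obtain_inj by blast
 define I where "I = e ` \<W>"
 define w where "w = inv_into \<W> e"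
 have w: "w i : \<W>" if "i : I" for i using that unfolding w_def I_def by (rule inv_into_into)
 have we: "w (e V) = V" if "V : \<W>" for V using that e(1) by (simp add: w_def)
 have winj: "i = k" if "i : I" "k : I" "w i = w k" for i k using that unfolding I_def w_def by (metis f_inv_into_f)
 define r where "r = {(i, k). i : I \<and> k : I \<and> w i \<subseteq> w k}"
 obtain s m where sm: "!!V. V : \<W> ==> s V : S" "!!V. V : \<W> ==> m V : hom K (s V) c" "!!V. V : \<W> ==> fn (m V) ` El (T (s V)) = V"
  using S by metis
 have sK: "s V : Obj K" if "V : \<W>" for V using hom_objs(1)[OF sm(2)[OF that]] .
 have dp: "directed_poset U L I r" unfolding directed_poset_def
 proof (intro conjI allI impI)
  show "sm I" using e(2) unfolding I_def .
  show "partial_order_on I r"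
   unfolding partial_order_on_def preorder_on_def refl_on_def trans_def antisym_def r_def using winj by auto
  fix X assume X: "X \<subseteq> I \<and> X \<prec> L"
  have "w ` X \<subseteq> \<W>" "w ` X \<prec> L" using X w lesspoll_trans1[OF image_lepoll] by auto
  then obtain V where V: "V : \<W>" "\<Union>(w ` X) \<subseteq> V" using dir by blast
  then show "\<exists>u\<in>I. \<forall>x\<in>X. (x, u) : r"
   using X we[OF V(1)] by (intro bexI[of _ "e V"]) (auto simp: r_def I_def)
 qed
 let ?s = "\<lambda>i. s (w i)" and ?m = "\<lambda>i. m (w i)"
 have s': "?s i : Obj K" "?m i : hom K (?s i) c" "fn (?m i) ` El (T (?s i)) = w i" if "i : I" for i using sK sm w that by auto
 have mono: "f = g" if i: "i : I" and f: "f : hom K d (?s i)" and g: "g : hom K d (?s i)" and eq: "Comp K (?m i) f = Comp K (?m i) g" for i d f g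
 proof (rule fn_inj[OF f g])
  fix x assume x: "x : El (T d)"
  show "fn f x = fn g x" by (rule fn_cancel[OF s'(2)[OF i] fn_El[OF f x] fn_El[OF g x]])
    (use fn_comp[OF f s'(2)[OF i] x] fn_comp[OF g s'(2)[OF i] x] eq in simp)
 qed
 have "\<exists>f\<in>hom K (?s i) (?s k). Comp K (?m k) f = ?m i" if ik: "(i, k) : r" for i k
 proof -
  have i: "i : I" and k: "k : I" and sub: "w i \<subseteq> w k" using ik by (auto simp: r_def)
  obtain psi where psi: "psi : ahom (T (?s i)) (T (?s k))" "!!x. x : El (T (?s i)) ==> fn (?m k) (psi x) = fn (?m i) x"
   using ahom_factor[OF T_flat[OF s'(1)[OF i]] T_flat[OF s'(1)[OF k]] T_flat[OF c] fn_hom[OF s'(2)[OF i]] fn_hom[OF s'(2)[OF k]]]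
    s'(3)[OF i] s'(3)[OF k] sub by metis
  obtain f where f: "f : hom K (?s i) (?s k)" "!!x. x : El (T (?s i)) ==> fn f x = psi x" using fn_surj[OF s'(1)[OF i] s'(1)[OF k] psi(1)] by blast
  have "Comp K (?m k) f = ?m i"
   by (rule fn_inj[OF cat_comp[OF catK f(1) s'(2)[OF k]] s'(2)[OF i]]) (simp add: fn_comp[OF f(1) s'(2)[OF k]] f(2) psi(2))
  then show ?thesis using f(1) by blast
 qed
 then obtain delta where delta: "!!i k. (i, k) : r ==> delta i k : hom K (?s i) (?s k)" "!!i k. (i, k) : r ==> Comp K (?m k) (delta i k) = ?m i" by metis
 let ?D = "poset_functor I r ?s delta"
 have D: "is_functor (poset_cat I r) K ?D"
 proof (rule is_functor_poset_functor[OF dp catK s'(1) delta(1)])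
  fix i assume i: "i : I"
  have ii: "(i, i) : r" using i by (simp add: r_def)
  show "delta i i = Ident K (?s i)"
   by (rule mono[OF i delta(1)[OF ii] cat_ident[OF catK s'(1)[OF i]]]) (simp add: delta(2)[OF ii] cat_ident_right[OF catK s'(2)[OF i]])
 next
  fix i k l assume ik: "(i, k) : r" and kl: "(k, l) : r"
  have il: "(i, l) : r" using directed_posetD(4)[OF dp ik kl] .
  have l: "l : I" using directed_posetD(2)[OF dp kl] .
  show "delta i l = Comp K (delta k l) (delta i k)"
   by (rule mono[OF l delta(1)[OF il] cat_comp[OF catK delta(1)[OF ik] delta(1)[OF kl]]])
    (simp add: delta(2)[OF il] cat_assoc[OF catK delta(1)[OF ik] delta(1)[OF kl] s'(2)[OF l]] delta(2)[OF kl] delta(2)[OF ik])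
 qed
 have cc: "is_cocone (poset_cat I r) K ?D c ?m" unfolding poset_cocone_iff using c s'(2) delta(2) by auto
 have "is_colimit (poset_cat I r) K ?D c ?m"
 proof (rule jointly_surjective_colimit[OF dp L D cc])
  fix y assume "y : El (T c)"
  then obtain V where V: "V : \<W>" "y : V" using W(2) by blast
  have i: "e V : I" using V(1) by (simp add: I_def)
  have "y : fn (?m (e V)) ` El (T (?s (e V)))" using s'(3)[OF i] we[OF V(1)] V(2) by simp
  then obtain x where "x : El (T (on_obj ?D (e V)))" "fn (?m (e V)) x = y" using i by auto
  then show "\<exists>i\<in>I. \<exists>x\<in>El (T (on_obj ?D i)). fn (?m i) x = y" using i by blast
 qed
 moreover have "\<forall>i\<in>I. on_obj ?D i : S" using sm(1) w by simp
 ultimately show ?thesis using dp D by blast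
qed

end

section \<open>Representable flat sets and finite accessibility\<close>

context flat_cat
begin

text \<open>\<open>s\<close> is the representable functor of \<open>a\<close> and \<open>x\<close>
  its universal element. Freeness of \<open>x\<close> is contained in flatness: arrows with the same
  effect on \<open>x\<close> are equal.\<close>

definition is_rep :: "'a => 'u => 'u => bool" where
 "is_rep a s x \<longleftrightarrow> a : Obj A \<and> s : Obj K \<and> x : El (T s) \<and> lab (T s) x = a \<and>
   (\<forall>y\<in>El (T s). \<exists>g. acts (T s) g x \<and> act (T s) g x = y)"

text \<open>The arrows out of \<open>a\<close>, acted on by composition. Any two of them are
  obtained from the identity, which gives common preimages, and the last clause of flatness is
  precisely that arrows of \<open>A\<close> are epic.\<close>

lemma is_rep_exists:
 assumes a: "a : Obj A" shows "\<exists>s x. is_rep a s x"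
proof -
 define R where "R = \<lparr>El = {g : Arr A. Dom A g = a}, lab = Cod A, act = Comp A\<rparr>"
 have El: "x : El R \<longleftrightarrow> x : hom A a (lab R x)" for x by (auto simp: R_def hom_def)
 have acts: "acts R g x \<longleftrightarrow> x : hom A a (lab R x) \<and> g : hom A (lab R x) (Cod A g)" for g x
  by (auto simp: acts_def El R_def hom_def)
 have comp: "act R g x : hom A a (Cod A g)" "lab R (act R g x) = Cod A g" if "acts R g x" for g x
  using cat_comp[OF catA, of x a "lab R x" g "Cod A g"] that acts by (auto simp: R_def hom_def)
 have id: "Ident A a : hom A a a" using cat_ident[OF catA a] .
 have "flat R"
 proof (rule flatI)
  show "lab R x : Obj A \<and> act R (Ident A (lab R x)) x = x" if "x : El R" for x
   using that cat_hom_obj(2)[OF catA] cat_ident_left[OF catA] unfolding El by (auto simp: R_def)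
  show "act R g x : El R \<and> lab R (act R g x) = Cod A g" if "acts R g x" for g x using comp[OF that] El by simp
  show "act R (Comp A h g) x = act R h (act R g x)" if "acts R g x" "h : Arr A" "Dom A h = Cod A g" for g h x
   using cat_assoc[OF catA, of x a "lab R x" g "Cod A g" h "Cod A h"] that acts by (simp add: R_def hom_def)
  show "El R \<noteq> {}" using id by (auto simp: R_def hom_def)
  show "\<exists>z g h. acts R g z \<and> acts R h z \<and> act R g z = x \<and> act R h z = y" if x: "x : El R" and y: "y : El R" for x y
  proof -
   have "acts R x (Ident A a)" "acts R y (Ident A a)" using x y id by (auto simp: acts_def R_def hom_def)
   moreover have "act R x (Ident A a) = x" "act R y (Ident A a) = y"
    using x y cat_ident_right[OF catA] unfolding El by (auto simp: R_def)
   ultimately show ?thesis by blast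
  qed
  show "g = h" if g: "acts R g x" and h: "acts R h x" and eq: "act R g x = act R h x" for g h x
  proof -
   have "Cod A g = Cod A h" using comp(2)[OF g] comp(2)[OF h] eq by simp
   then show ?thesis using epi[of x a "lab R x" g "Cod A g" h] g h acts eq by (simp add: R_def)
  qed
 qed
 moreover have "sm (El R)" by (rule sm_subset[OF sm_Arr]) (auto simp: R_def)
 ultimately obtain s phi where s: "s : Obj K" "phi : ahom R (T s)" "phi ` El R = El (T s)" using realize by metis
 have iE: "Ident A a : El R" "lab R (Ident A a) = a" using id by (auto simp: R_def hom_def)
 have "is_rep a s (phi (Ident A a))" unfolding is_rep_def
 proof (intro conjI ballI a s(1))
  show "phi (Ident A a) : El (T s)" "lab (T s) (phi (Ident A a)) = a" using ahomD(1,2)[OF s(2) iE(1)] iE(2) by auto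
  fix y assume "y : El (T s)"
  then obtain g where g: "g : El R" "y = phi g" using s(3) by blast
  have "acts R g (Ident A a)" using g(1) iE by (auto simp: acts_def R_def)
  moreover have "act R g (Ident A a) = g" using g(1) cat_ident_right[OF catA] unfolding El by (auto simp: R_def)
  ultimately show "\<exists>g. acts (T s) g (phi (Ident A a)) \<and> act (T s) g (phi (Ident A a)) = y"
   using ahomD(3,4)[OF s(2)] g(2) by metis
 qed
 then show ?thesis by blast
qed

definition rep :: "'a => 'u" where "rep a = fst (SOME p. is_rep a (fst p) (snd p))"
definition gen :: "'a => 'u" where "gen a = snd (SOME p. is_rep a (fst p) (snd p))"

lemma is_rep_rep: "a : Obj A ==> is_rep a (rep a) (gen a)"
 unfolding rep_def gen_def using is_rep_exists[of a] by (metis (mono_tags, lifting) fst_conv snd_conv someI_ex)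

lemma repD:
 assumes "a : Obj A"
 shows "rep a : Obj K" "gen a : El (T (rep a))" "lab (T (rep a)) (gen a) = a"
  "y : El (T (rep a)) ==> \<exists>g. acts (T (rep a)) g (gen a) \<and> act (T (rep a)) g (gen a) = y"
 using is_rep_rep[OF assms] unfolding is_rep_def by blast+

lemma rep_ext:
 assumes a: "a : Obj A" and f: "f : hom K (rep a) s" and g: "g : hom K (rep a) s" and eq: "fn f (gen a) = fn g (gen a)"
 shows "f = g"
proof (rule fn_inj[OF f g])
 fix y assume "y : El (T (rep a))"
 then obtain h where "acts (T (rep a)) h (gen a)" "act (T (rep a)) h (gen a) = y" using repD(4)[OF a] by blast
 then show "fn f y = fn g y" using ahomD(3)[OF fn_hom[OF f]] ahomD(3)[OF fn_hom[OF g]] eq by metis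
qed

text \<open>Yoneda: each element of the representable is \<open>g\<close> acting on
  \<open>gen\<close> for exactly one \<open>g\<close>, and is sent to \<open>g\<close> acting on
  \<open>x\<close>.\<close>

lemma rep_hom:
 assumes s: "s : Obj K" and x: "x : El (T s)"
 shows "\<exists>f\<in>hom K (rep (lab (T s) x)) s. fn f (gen (lab (T s) x)) = x"
proof -
 let ?a = "lab (T s) x"
 have a: "?a : Obj A" using flatD(1)[OF T_flat[OF s] x] .
 note R = repD[OF a]
 let ?R = "T (rep ?a)"
 have fR: "flat ?R" using T_flat[OF R(1)] .
 define phi where "phi y = act (T s) (SOME g. acts ?R g (gen ?a) \<and> act ?R g (gen ?a) = y) x" for y
 have phi: "phi (act ?R g (gen ?a)) = act (T s) g x" if g: "acts ?R g (gen ?a)" for g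
 proof -
  have "(SOME h. acts ?R h (gen ?a) \<and> act ?R h (gen ?a) = act ?R g (gen ?a)) = g"
   by (rule some_equality) (use g flatD(7)[OF fR] in blast)+
  then show ?thesis by (simp add: phi_def)
 qed
 have ax: "acts (T s) g x" if "acts ?R g (gen ?a)" for g using that x R(3) by (simp add: acts_def)
 have "phi : ahom ?R (T s)"
 proof (rule ahomI)
  fix y assume "y : El ?R"
  then obtain g where g: "acts ?R g (gen ?a)" "act ?R g (gen ?a) = y" using R(4) by blast
  show "phi y : El (T s)" "lab (T s) (phi y) = lab ?R y"
   using phi[OF g(1)] g flatD(3,4)[OF T_flat[OF s] ax[OF g(1)]] flatD(4)[OF fR g(1)] by auto
 next
  fix h y assume hy: "acts ?R h y"
  obtain g where g: "acts ?R g (gen ?a)" "act ?R g (gen ?a) = y" using R(4) actsD(2)[OF hy] by blast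
  have h: "h : Arr A" "Dom A h = Cod A g" using hy g(2) flatD(4)[OF fR g(1)] by (auto simp: acts_def)
  have hg: "acts ?R (Comp A h g) (gen ?a)" using cat_comp[OF catA, of g _ _ h] g(1) h by (simp add: acts_def hom_def)
  show "phi (act ?R h y) = act (T s) h (phi y)"
   using phi[OF hg] phi[OF g(1)] flatD(5)[OF fR g(1) h] flatD(5)[OF T_flat[OF s] ax[OF g(1)] h] g(2) by simp
 qed
 then obtain f where f: "f : hom K (rep ?a) s" "!!y. y : El ?R ==> fn f y = phi y" using fn_surj[OF R(1) s] by blast
 have "acts ?R (Ident A ?a) (gen ?a)" using cat_ident[OF catA a] R(2,3) by (simp add: acts_def hom_def)
 then have "fn f (gen ?a) = x" using f(2)[OF R(2)] phi flatD(2)[OF fR R(2)] flatD(2)[OF T_flat[OF s] x] R(3) by metis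
 then show ?thesis using f(1) by blast
qed

lemma elem_presentable_rep:
 assumes a: "a : Obj A" and L: "infinite L" shows "elem_presentable U L K (rep a)"
 by (rule generated_elem_presentable[OF repD(1)[OF a] L, of "{gen a}"])
  (use repD[OF a] finite_lesspoll_infinite[OF L, of "{gen a}"] in auto)

text \<open>The orbit of \<open>x\<close> is the image of the representable functor at the label of
  \<open>x\<close>, and it contains the orbit of everything reached from \<open>x\<close>. Common
  preimages make the orbits of a flat set directed, so the representables generate \<open>K\<close>
  under directed colimits.\<close>

lemma orbits_directed_union:
 assumes c: "c : Obj K"
 shows "\<exists>(I :: 'u set) r D tau. directed_poset U omega I r \<and> is_functor (poset_cat I r) K D \<and>
   (\<forall>i\<in>I. on_obj D i : rep ` Obj A) \<and> is_colimit (poset_cat I r) K D c tau"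
proof -
 note fc = T_flat[OF c]
 define orb where "orb x = {act (T c) g x | g. acts (T c) g x}" for x
 have self: "x : orb x" if x: "x : El (T c)" for x
 proof -
  have "acts (T c) (Ident A (lab (T c) x)) x" using cat_ident[OF catA flatD(1)[OF fc x]] x by (simp add: acts_def hom_def)
  moreover have "act (T c) (Ident A (lab (T c) x)) x = x" using flatD(2)[OF fc x] .
  ultimately show ?thesis unfolding orb_def by force
 qed
 have mono: "orb y \<subseteq> orb x" if "acts (T c) g x" "y = act (T c) g x" for x y g
 proof
  fix z assume "z : orb y"
  then obtain h where h: "acts (T c) h y" "z = act (T c) h y" unfolding orb_def by blast
  have h': "h : Arr A" "Dom A h = Cod A g" using h(1) that flatD(4)[OF fc that(1)] by (auto simp: acts_def)
  have "acts (T c) (Comp A h g) x" using cat_comp[OF catA, of g _ _ h] that(1) h' by (simp add: acts_def hom_def)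
  then show "z : orb x" using flatD(5)[OF fc that(1) h'] h(2) that(2) unfolding orb_def by force
 qed
 have ub: "\<exists>x\<in>El (T c). \<Union>(orb ` Y) \<subseteq> orb x" if "finite Y" "Y \<subseteq> El (T c)" for Y using that
 proof (induction Y)
  case empty
  then show ?case using flatD(6)[OF fc] by blast
 next
  case (insert y Y)
  then obtain x where x: "x : El (T c)" "\<Union>(orb ` Y) \<subseteq> orb x" by auto
  have yc: "y : El (T c)" using insert.prems by blast
  obtain z g h where z: "acts (T c) g z" "acts (T c) h z" "act (T c) g z = x" "act (T c) h z = y"
   using flat_join[OF fc x(1) yc] .
  have "orb x \<subseteq> orb z" "orb y \<subseteq> orb z" using mono z by metis+
  then show ?case using x(2) actsD(2)[OF z(1)] by (intro bexI[of _ z]) auto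
 qed
 show ?thesis
 proof (rule directed_union[OF c, where \<W> = "orb ` El (T c)"])
  show "V \<subseteq> El (T c)" if "V : orb ` El (T c)" for V using that flatD(3)[OF fc] unfolding orb_def by auto
  then show "\<Union>(orb ` El (T c)) = El (T c)" using self by blast
  show "infinite omega" by simp
  fix \<X> assume X: "\<X> \<subseteq> orb ` El (T c)" "\<X> \<prec> omega"
  have fin: "finite \<X>" using X(2) unfolding lesspoll_def by (metis infinite_le_lepoll lepoll_antisym)
  obtain Y where Y: "Y \<subseteq> El (T c)" "finite Y" "\<X> = orb ` Y" using finite_subset_image[OF fin X(1)] by blast
  then show "\<exists>V\<in>orb ` El (T c). \<Union>\<X> \<subseteq> V" using ub[OF Y(2,1)] by auto
 next
  fix V assume "V : orb ` El (T c)"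
  then obtain x where x: "x : El (T c)" "V = orb x" by blast
  let ?a = "lab (T c) x"
  obtain f where f: "f : hom K (rep ?a) c" "fn f (gen ?a) = x" using rep_hom[OF c x(1)] by blast
  have a: "?a : Obj A" using flatD(1)[OF fc x(1)] .
  have "fn f ` El (T (rep ?a)) = V"
  proof
   show "fn f ` El (T (rep ?a)) \<subseteq> V"
   proof
    fix y assume "y : fn f ` El (T (rep ?a))"
    then obtain g where g: "acts (T (rep ?a)) g (gen ?a)" "y = fn f (act (T (rep ?a)) g (gen ?a))" using repD(4)[OF a] by blast
    then show "y : V" using ahomD(3,4)[OF fn_hom[OF f(1)] g(1)] f(2) x(2) unfolding orb_def by auto
   qed
   show "V \<subseteq> fn f ` El (T (rep ?a))"
   proof
    fix y assume "y : V"
    then obtain g where g: "acts (T c) g x" "y = act (T c) g x" unfolding x(2) orb_def by blast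
    have g': "acts (T (rep ?a)) g (gen ?a)" using g(1) repD(2,3)[OF a] by (simp add: acts_def)
    show "y : fn f ` El (T (rep ?a))" using ahomD(3)[OF fn_hom[OF f(1)] g'] f(2) g(2)
     by (intro image_eqI[OF _ flatD(3)[OF T_flat[OF repD(1)[OF a]] g']]) simp
   qed
  qed
  then show "\<exists>s\<in>rep ` Obj A. \<exists>m\<in>hom K s c. fn m ` El (T s) = V" using f(1) a by blast
 qed
qed

lemma finitely_accessible_K: "finitely_accessible U K"
proof -
 have "presentable U omega K s" if "s : rep ` Obj A" for s
  using that elem_presentable_imp_presentable[OF elem_presentable_rep] by blast
 moreover have "rep ` Obj A \<subseteq> Obj K" using repD(1) by blast
 moreover have "sm (rep ` Obj A)" by (rule sm_image[OF sm_Obj_if_sm_Arr[OF catA sm_Arr]])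
 ultimately have "\<exists>S. S \<subseteq> Obj K \<and> small U S \<and> (\<forall>s\<in>S. presentable U omega K s) \<and>
    (\<forall>c\<in>Obj K. \<exists>(I :: 'u set) r D tau. directed_poset U omega I r \<and> is_functor (poset_cat I r) K D \<and>
      (\<forall>i\<in>I. on_obj D i : S) \<and> is_colimit (poset_cat I r) K D c tau)"
  using orbits_directed_union by (intro exI[where x = "rep ` Obj A" and P = "\<lambda>S. S \<subseteq> Obj K \<and> _ S"] conjI ballI) blast+
 then show ?thesis
  unfolding finitely_accessible_def accessible_at_def by (intro conjI catK locally_small_K has_directed_colimits_K)
qed

text \<open>The cardinal enters the definitions only through \<open>X \<prec> K\<close>, so
  equipollent sets are interchangeable; this allows \<open>omega\<close> to be replaced by a set in
  \<open>'u\<close>.\<close>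

lemma accessible_at_eqpoll:
 fixes L :: "'l set" and M :: "'n set" and C :: "('o, 'm) cat"
 assumes eq: "L \<approx> M" and acc: "accessible_at U L C" shows "accessible_at U M C"
proof -
 have l: "X \<prec> M \<longleftrightarrow> X \<prec> L" for X :: "'u set" using eq by (meson eqpoll_sym lesspoll_eq_trans)
 have d: "directed_poset U M I r \<longleftrightarrow> directed_poset U L I r" for I :: "'u set" and r
  unfolding directed_poset_def l ..
 show ?thesis using acc unfolding accessible_at_def has_directed_colimits_def presentable_def preserves_directed_colimits_def d .
qed

lemma Acc_omega_K: "Acc_omega U K"
proof -
 obtain L :: "'u set" where L: "regular_cardinal L" "sm L" "L \<approx> omega" using countable_regular .
 have "accessible_at U L K"
  using accessible_at_eqpoll[OF eqpoll_sym[OF L(3)]] finitely_accessible_K unfolding finitely_accessible_def by blast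
 then show ?thesis using L has_directed_colimits_K unfolding Acc_omega_def accessible_def by blast
qed

text \<open>Presentability factors the identity of \<open>p\<close> through one stage of its
  expression as a directed union of orbits. Questions about finitely presentable objects thereby
  become questions about arrows of \<open>A\<close>.\<close>

lemma fp_retract:
 assumes p: "finitely_presentable U K p"
 obtains a i q where "a : Obj A" "i : hom K p (rep a)" "q : hom K (rep a) p" "Comp K q i = Ident K p"
proof -
 have pK: "p : Obj K" using p unfolding finitely_presentable_def presentable_def by blast
 obtain I :: "'u set" and r D tau where dp: "directed_poset U omega I r" and D: "is_functor (poset_cat I r) K D"
  and S: "\<forall>i\<in>I. on_obj D i : rep ` Obj A" and cl: "is_colimit (poset_cat I r) K D p tau"
  using orbits_directed_union[OF pK] by blast
 obtain i g where i: "i : I" "g : hom K p (on_obj D i)" "Comp K (tau i) g = Ident K p"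
  using presentable_factor[OF p[unfolded finitely_presentable_def] dp D cl cat_ident[OF catK pK]] .
 obtain a where a: "a : Obj A" "on_obj D i = rep a" using S i(1) by blast
 have "tau i : hom K (rep a) p" using is_colimitD(3)[OF cl] i(1) a(2) by (metis poset_cat_simps(1))
 then show thesis using that a i by metis
qed

text \<open>Yoneda again, with the direction reversed: an arrow out of \<open>rep a\<close> is
  determined by where it sends the generator, and the elements of \<open>rep b\<close> with label
  \<open>a\<close> are the arrows \<open>b \<rightarrow> a\<close>.\<close>

lemma rep_arrow:
 assumes a: "a : Obj A" and b: "b : Obj A" and u: "u : hom K (rep a) (rep b)"
 obtains alpha where "alpha : hom A b a" "acts (T (rep b)) alpha (gen b)" "fn u (gen a) = act (T (rep b)) alpha (gen b)"
proof -
 obtain alpha where alpha: "acts (T (rep b)) alpha (gen b)" "act (T (rep b)) alpha (gen b) = fn u (gen a)"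
  using repD(4)[OF b fn_El[OF u repD(2)[OF a]]] by blast
 have "Cod A alpha = a"
  using flatD(4)[OF T_flat[OF repD(1)[OF b]] alpha(1)] alpha(2) ahomD(2)[OF fn_hom[OF u] repD(2)[OF a]] repD(3)[OF a] by simp
 moreover have "Dom A alpha = b" using actsD(3)[OF alpha(1)] repD(3)[OF b] by simp
 ultimately show thesis using that alpha actsD(1)[OF alpha(1)] by (simp add: hom_def)
qed

lemma retract_cancel:
 assumes i: "i : hom K p p'" and q: "q : hom K p' p" "Comp K q i = Ident K p"
  and f: "f : hom K p c" and g: "g : hom K p c" and eq: "Comp K f q = Comp K g q"
 shows "f = g"
proof -
 have "f = Comp K (Comp K f q) i" using cat_assoc[OF catK i q(1) f] q(2) cat_ident_right[OF catK f] by simp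
 also have "\<dots> = g" using eq cat_assoc[OF catK i q(1) g] q(2) cat_ident_right[OF catK g] by simp
 finally show ?thesis .
qed

text \<open>The retractions reduce the extension problem to one along an arrow
  \<open>rep a \<rightarrow> rep b\<close>, that is an arrow
  \<open>alpha : b \<rightarrow> a\<close> of \<open>A\<close>: an element labelled \<open>a\<close>
  has to be \<open>alpha\<close> acting on an element labelled \<open>b\<close>, which
  \<open>sat\<close> provides. The equation is obtained after composing with the split epimorphism
  \<open>q\<close>, which is then cancelled.\<close>

lemma saturated_if_sat:
 assumes s: "s : Obj K" and st: "sat (T s)" shows "saturated U K s" unfolding saturated_def
proof (intro conjI s allI impI ballI)
 fix p p' u f assume fp: "finitely_presentable U K p \<and> finitely_presentable U K p'"
  and u: "u : hom K p p'" and f: "f : hom K p s"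
 obtain a i q where a: "a : Obj A" and i: "i : hom K p (rep a)" and q: "q : hom K (rep a) p" "Comp K q i = Ident K p"
  using fp_retract fp by blast
 obtain b i' q' where b: "b : Obj A" and i': "i' : hom K p' (rep b)" and q': "q' : hom K (rep b) p'" "Comp K q' i' = Ident K p'"
  using fp_retract fp by blast
 have iu: "Comp K i' u : hom K p (rep b)" using cat_comp[OF catK u i'] .
 have v: "Comp K (Comp K i' u) q : hom K (rep a) (rep b)" using cat_comp[OF catK q(1) iu] .
 obtain alpha where alpha: "alpha : hom A b a" "acts (T (rep b)) alpha (gen b)" "fn (Comp K (Comp K i' u) q) (gen a) = act (T (rep b)) alpha (gen b)"
  using rep_arrow[OF a b v] .
 have fq: "Comp K f q : hom K (rep a) s" using cat_comp[OF catK q(1) f] .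
 let ?x = "fn (Comp K f q) (gen a)"
 have x: "?x : El (T s)" "lab (T s) ?x = a"
  using fn_El[OF fq repD(2)[OF a]] ahomD(2)[OF fn_hom[OF fq] repD(2)[OF a]] repD(3)[OF a] by auto
 obtain y where y: "acts (T s) alpha y" "act (T s) alpha y = ?x" using st x alpha(1) unfolding sat_def hom_def by blast
 have "lab (T s) y = b" using actsD(3)[OF y(1)] alpha(1) by (simp add: hom_def)
 then obtain G where G: "G : hom K (rep b) s" "fn G (gen b) = y" using rep_hom[OF s actsD(2)[OF y(1)]] by blast
 have Gi: "Comp K G i' : hom K p' s" using cat_comp[OF catK i' G(1)] .
 have eq: "Comp K G (Comp K (Comp K i' u) q) = Comp K f q" by (rule rep_ext[OF a cat_comp[OF catK v G(1)] fq])
   (simp add: fn_comp[OF v G(1) repD(2)[OF a]] alpha(3) ahomD(3)[OF fn_hom[OF G(1)] alpha(2)] G(2) y(2))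
 have "Comp K (Comp K (Comp K G i') u) q = Comp K f q"
  using eq cat_assoc[OF catK q(1) iu G(1)] cat_assoc[OF catK u i' G(1)] by simp
 then have "Comp K (Comp K G i') u = f" using retract_cancel[OF i q cat_comp[OF catK u Gi] f] by blast
 then show "\<exists>g\<in>hom K p' s. Comp K g u = f" using Gi by blast
qed

text \<open>The sections embed both targets into representables and \<open>q\<close> replaces the
  source by one. A span of representables is a cospan of \<open>A\<close>, which \<open>ore\<close>
  completes over some \<open>d\<close>; the two arrows of \<open>A\<close> obtained become arrows
  into \<open>rep d\<close>.\<close>

lemma amalgamation_K: "amalgamation_property (fp_subcat U K)"
proof -
 let ?F = "fp_subcat U K"
 have F: "Obj ?F = Obj K \<inter> {p. finitely_presentable U K p}" "Dom ?F = Dom K" "Cod ?F = Cod K" "Comp ?F = Comp K"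
  "Arr ?F = {f : Arr K. finitely_presentable U K (Dom K f) \<and> finitely_presentable U K (Cod K f)}"
  by (auto simp: fp_subcat_def full_subcat_def)
 show ?thesis unfolding amalgamation_property_def F(2-4)
 proof (intro ballI impI)
  fix f g assume f: "f : Arr ?F" and g: "g : Arr ?F" and eq: "Dom K f = Dom K g"
  define p p' p'' where "p = Dom K f" and "p' = Cod K f" and "p'' = Cod K g"
  have fh: "f : hom K p p'" and gh: "g : hom K p p''" and fp: "finitely_presentable U K p" "finitely_presentable U K p'" "finitely_presentable U K p''"
   using f g eq by (auto simp: F(5) p_def p'_def p''_def hom_def)
  obtain a i q where a: "a : Obj A" and i: "i : hom K p (rep a)" and q: "q : hom K (rep a) p" "Comp K q i = Ident K p"
   using fp_retract fp(1) by blast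
  obtain b i' q' where b: "b : Obj A" and i': "i' : hom K p' (rep b)" using fp_retract fp(2) by metis
  obtain c i'' q'' where c: "c : Obj A" and i'': "i'' : hom K p'' (rep c)" using fp_retract fp(3) by metis
  have iu: "Comp K i' f : hom K p (rep b)" and iv: "Comp K i'' g : hom K p (rep c)"
   using cat_comp[OF catK fh i'] cat_comp[OF catK gh i''] by auto
  have u: "Comp K (Comp K i' f) q : hom K (rep a) (rep b)" and v: "Comp K (Comp K i'' g) q : hom K (rep a) (rep c)"
   using cat_comp[OF catK q(1) iu] cat_comp[OF catK q(1) iv] by auto
  obtain alpha where alpha: "alpha : hom A b a" "acts (T (rep b)) alpha (gen b)" "fn (Comp K (Comp K i' f) q) (gen a) = act (T (rep b)) alpha (gen b)"
   using rep_arrow[OF a b u] .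
  obtain beta where beta: "beta : hom A c a" "acts (T (rep c)) beta (gen c)" "fn (Comp K (Comp K i'' g) q) (gen a) = act (T (rep c)) beta (gen c)"
   using rep_arrow[OF a c v] .
  obtain d h k where h: "h : hom A d b" and k: "k : hom A d c" and hk: "Comp A alpha h = Comp A beta k" using ore[OF alpha(1) beta(1)] by blast
  have d: "d : Obj A" using cat_hom_obj(1)[OF catA h] .
  let ?R = "T (rep d)"
  have fR: "flat ?R" using T_flat[OF repD(1)[OF d]] .
  have ah: "acts ?R h (gen d)" "acts ?R k (gen d)" using h k repD[OF d] by (auto simp: acts_def hom_def)
  have hR: "act ?R h (gen d) : El ?R" "lab ?R (act ?R h (gen d)) = b" "act ?R k (gen d) : El ?R" "lab ?R (act ?R k (gen d)) = c"
   using flatD(3,4)[OF fR ah(1)] flatD(3,4)[OF fR ah(2)] h k by (auto simp: hom_def)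
  obtain H where H: "H : hom K (rep b) (rep d)" "fn H (gen b) = act ?R h (gen d)" using rep_hom[OF repD(1)[OF d] hR(1)] hR(2) by auto
  obtain G where G: "G : hom K (rep c) (rep d)" "fn G (gen c) = act ?R k (gen d)" using rep_hom[OF repD(1)[OF d] hR(3)] hR(4) by auto
  have "act ?R alpha (act ?R h (gen d)) = act ?R beta (act ?R k (gen d))"
   using flatD(5)[OF fR ah(1), of alpha] flatD(5)[OF fR ah(2), of beta] alpha(1) beta(1) h k hk by (simp add: hom_def)
  then have "Comp K H (Comp K (Comp K i' f) q) = Comp K G (Comp K (Comp K i'' g) q)"
   by (intro rep_ext[OF a cat_comp[OF catK u H(1)] cat_comp[OF catK v G(1)]])
    (simp add: fn_comp[OF u H(1) repD(2)[OF a]] fn_comp[OF v G(1) repD(2)[OF a]] alpha(3) beta(3)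
     ahomD(3)[OF fn_hom[OF H(1)] alpha(2)] ahomD(3)[OF fn_hom[OF G(1)] beta(2)] H(2) G(2))
  then have "Comp K (Comp K (Comp K H i') f) q = Comp K (Comp K (Comp K G i'') g) q"
   using cat_assoc[OF catK q(1) iu H(1)] cat_assoc[OF catK q(1) iv G(1)] cat_assoc[OF catK fh i' H(1)] cat_assoc[OF catK gh i'' G(1)] by simp
  moreover have Hi: "Comp K H i' : hom K p' (rep d)" and Gi: "Comp K G i'' : hom K p'' (rep d)"
   using cat_comp[OF catK i' H(1)] cat_comp[OF catK i'' G(1)] by auto
  ultimately have e: "Comp K (Comp K H i') f = Comp K (Comp K G i'') g"
   using retract_cancel[OF i q cat_comp[OF catK fh Hi] cat_comp[OF catK gh Gi]] by blast
  have fd: "finitely_presentable U K (rep d)"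
   unfolding finitely_presentable_def by (rule elem_presentable_imp_presentable[OF elem_presentable_rep[OF d]]) simp_all
  have "Comp K H i' : hom ?F (Cod K f) (rep d)" "Comp K G i'' : hom ?F (Cod K g) (rep d)" "rep d : Obj ?F"
   using Hi Gi fp fd repD(1)[OF d] by (auto simp: hom_def F p'_def p''_def)
  then show "\<exists>w\<in>Obj ?F. \<exists>h\<in>hom ?F (Cod K f) w. \<exists>k\<in>hom ?F (Cod K g) w. Comp K h f = Comp K k g"
   using e by blast
 qed
qed

text \<open>A downward closure argument in the style of Loewenheim and Skolem: besides the action,
  the closure uses chosen common preimages \<open>jn\<close> and chosen preimages \<open>lf\<close>
  under single arrows, so that the result is flat and saturated. Each step applies one operation per
  arrow and per pair, which keeps the size below \<open>L\<close>.\<close>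

lemma small_closed_subset:
 assumes R: "flat R" and s: "sat R" and L: "regular_cardinal L" and AL: "Arr A \<prec> L" and oL: "omega \<prec> L"
  and Y: "Y \<subseteq> El R" "Y \<prec> L"
 obtains Z where "Y \<subseteq> Z" "flat_sub R Z" "sat (sub R Z)" "Z \<prec> L"
proof -
 obtain x0 where x0: "x0 : El R" using flatD(6)[OF R] by blast
 define jn where "jn x y = (SOME z. \<exists>g h. acts R g z \<and> acts R h z \<and> act R g z = x \<and> act R h z = y)" for x y
 have jn: "\<exists>g h. acts R g (jn x y) \<and> acts R h (jn x y) \<and> act R g (jn x y) = x \<and> act R h (jn x y) = y" if "x : El R" "y : El R" for x y
  unfolding jn_def by (rule someI_ex) (use flat_join[OF R that] in metis)
 define lf where "lf g y = (SOME x. acts R g x \<and> act R g x = y)" for g y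
 have lf: "acts R g (lf g y) \<and> act R g (lf g y) = y" if "g : Arr A" "y : El R" "lab R y = Cod A g" for g y
  unfolding lf_def by (rule someI_ex) (use s that in \<open>auto simp: sat_def\<close>)
 \<comment> \<open>The intersection with \<open>El R\<close> discards the arbitrary values that the
   operations take outside their domains.\<close>
 define st where "st W = W \<union> ((\<lambda>(g, x). act R g x) ` (Arr A \<times> W) \<union> (\<lambda>(g, y). lf g y) ` (Arr A \<times> W) \<union> (\<lambda>(x, y). jn x y) ` (W \<times> W)) \<inter> El R" for W
 define W where "W n = (st ^^ n) (insert x0 Y)" for n
 have W0: "W 0 = insert x0 Y" and WS: "W (Suc n) = st (W n)" for n by (simp_all add: W_def)
 have WE: "W n \<subseteq> El R" for n by (induction n) (use x0 Y in \<open>auto simp: W0 WS st_def\<close>)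
 have WL: "W n \<prec> L" for n
 proof (induction n)
  case 0
  show ?case unfolding W0 using regular_Un_lesspoll[OF L regular_finite_lesspoll[OF L, of "{x0}"] Y(2)] by simp
 next
  case (Suc n)
  note t = regular_Times_lesspoll[OF L]
  have i: "f ` B \<prec> L" if "B \<prec> L" for f :: "'z => 'c" and B using lesspoll_trans1[OF image_lepoll that] .
  have u: "W n \<union> ((\<lambda>(g, x). act R g x) ` (Arr A \<times> W n) \<union> (\<lambda>(g, y). lf g y) ` (Arr A \<times> W n) \<union> (\<lambda>(x, y). jn x y) ` (W n \<times> W n)) \<prec> L"
   by (intro regular_Un_lesspoll[OF L] i t AL Suc)
  show ?case unfolding WS st_def by (rule lesspoll_trans1[OF subset_imp_lepoll u]) auto
 qed
 have mono: "W n \<subseteq> W (n + k)" for n k by (induction k) (auto simp: WS st_def)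
 define Z where "Z = (\<Union>n. W n)"
 have ZE: "Z \<subseteq> El R" unfolding Z_def using WE by blast
 \<comment> \<open>Here \<open>omega \<prec> L\<close> enters: countably many stages of size below
   \<open>L\<close> have a union of size below \<open>L\<close>.\<close>
 have ZL: "Z \<prec> L" unfolding Z_def by (rule regular_UN_lesspoll[OF L oL]) (rule WL)
 have Zst: "\<exists>n. x : W n \<and> y : W n" if xy: "x : Z" "y : Z" for x y
 proof -
  obtain m n where "x : W m" "y : W n" using xy unfolding Z_def by blast
  then have "x : W (m + n)" "y : W (m + n)" using mono[of m n] mono[of n m] by (auto simp: add.commute)
  then show ?thesis by blast
 qed
 have Zact: "act R g x : Z" if gx: "acts R g x" "x : Z" for g x
 proof -
  obtain n where n: "x : W n" using gx(2) unfolding Z_def by blast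
  have "act R g x : W (Suc n)" using n actsD(1)[OF gx(1)] flatD(3)[OF R gx(1)] unfolding WS st_def by force
  then show ?thesis unfolding Z_def by blast
 qed
 have Zjn: "jn x y : Z" if xy: "x : Z" "y : Z" for x y
 proof -
  obtain n where n: "x : W n" "y : W n" using Zst[OF xy] by blast
  have "x : El R" "y : El R" using ZE xy by auto
  then have "jn x y : El R" using jn[of x y] actsD(2)[of R _ "jn x y"] by auto
  then have "jn x y : W (Suc n)" using n unfolding WS st_def by force
  then show ?thesis unfolding Z_def by blast
 qed
 have Zlf: "lf g y : Z" if g: "g : Arr A" "y : Z" "lab R y = Cod A g" for g y
 proof -
  obtain n where n: "y : W n" using g(2) unfolding Z_def by blast
  have "y : El R" using ZE g(2) by auto
  then have "lf g y : El R" using lf[OF g(1) _ g(3)] actsD(2)[of R g "lf g y"] by auto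
  then have "lf g y : W (Suc n)" using n g(1) unfolding WS st_def by force
  then show ?thesis unfolding Z_def by blast
 qed
 have Z0: "insert x0 Y \<subseteq> Z" using W0 unfolding Z_def by blast
 show thesis
 proof (rule that[of Z])
  show "Y \<subseteq> Z" using Z0 by blast
  show "flat_sub R Z" unfolding flat_sub_def
  proof (intro conjI allI impI ballI ZE)
   show "Z \<noteq> {}" using Z0 by blast
   show "act R g x : Z" if "acts R g x \<and> x : Z" for g x using Zact that by blast
   show "\<exists>z\<in>Z. \<exists>g h. acts R g z \<and> acts R h z \<and> act R g z = x \<and> act R h z = y" if "x : Z" "y : Z" for x y
    using jn[of x y] Zjn[OF that] that ZE by blast
  qed
  show "sat (sub R Z)" unfolding sat_def acts_sub[OF ZE] sub_simps using lf Zlf ZE by blast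
  show "Z \<prec> L" by (rule ZL)
 qed
qed

text \<open>The saturated flat subsets of size below \<open>L\<close> are \<open>L\<close>-directed:
  by regularity the union of fewer than \<open>L\<close> of them is again of size below
  \<open>L\<close>, and it is then enclosed in another one. Their carriers are moved inside
  \<open>L\<close> so that the generators form a small set.\<close>

lemma sat_directed_union:
 fixes L :: "'u set"
 assumes c: "c : Obj K" and s: "sat (T c)" and L: "regular_cardinal L" and AL: "Arr A \<prec> L" and oL: "omega \<prec> L"
 shows "\<exists>(I :: 'u set) r D tau. directed_poset U L I r \<and> is_functor (poset_cat I r) K D \<and>
   (\<forall>i\<in>I. on_obj D i : {s : Obj K. El (T s) \<subseteq> L \<and> El (T s) \<prec> L \<and> sat (T s)}) \<and> is_colimit (poset_cat I r) K D c tau"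
proof (rule directed_union[OF c, where \<W> = "{Z. flat_sub (T c) Z \<and> sat (sub (T c) Z) \<and> Z \<prec> L}"])
 note fc = T_flat[OF c]
 let ?W = "{Z. flat_sub (T c) Z \<and> sat (sub (T c) Z) \<and> Z \<prec> L}"
 show sub: "V \<subseteq> El (T c)" if "V : ?W" for V using that unfolding flat_sub_def by blast
 have ex: "\<exists>V\<in>?W. Y \<subseteq> V" if "Y \<subseteq> El (T c)" "Y \<prec> L" for Y using small_closed_subset[OF fc s L AL oL that] by blast
 show "\<Union>?W = El (T c)"
 proof
  show "\<Union>?W \<subseteq> El (T c)" using sub by blast
  show "El (T c) \<subseteq> \<Union>?W"
  proof
   fix x assume "x : El (T c)"
   then obtain V where "V : ?W" "{x} \<subseteq> V" using ex[of "{x}"] regular_finite_lesspoll[OF L, of "{x}"] by auto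
   then show "x : \<Union>?W" by blast
  qed
 qed
 show "infinite L" using L unfolding regular_cardinal_def by blast
 show "\<exists>V\<in>?W. \<Union>\<X> \<subseteq> V" if X: "\<X> \<subseteq> ?W" "\<X> \<prec> L" for \<X>
 proof (rule ex)
  show "\<Union>\<X> \<subseteq> El (T c)" using X(1) sub by blast
  have "(\<Union>V\<in>\<X>. V) \<prec> L" by (rule regular_UN_lesspoll[OF L X(2)]) (use X(1) in blast)
  then show "\<Union>\<X> \<prec> L" by simp
 qed
 fix V assume V: "V : ?W"
 have fV: "flat (sub (T c) V)" "(\<lambda>x. x) : ahom (sub (T c) V) (T c)" using flat_subD[OF fc] V by auto
 have VL: "El (sub (T c) V) \<lesssim> L" using V lesspoll_imp_lepoll[of V L] by simp
 have smV: "sm (El (sub (T c) V))" using sm_subset[OF T_sm[OF c] sub[OF V]] by simp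
 obtain w phi psi where w: "w : Obj K" "phi : ahom (sub (T c) V) (T w)" "psi : ahom (T w) (sub (T c) V)" "phi ` V = El (T w)"
  "!!x. x : V ==> psi (phi x) = x" "El (T w) \<subseteq> L" "sat (T w)"
  using realize_within[OF fV(1) VL smV] V by (metis (no_types, lifting) mem_Collect_eq sub_simps(1))
 obtain m where m: "m : hom K w c" "!!x. x : El (T w) ==> fn m x = psi x" using fn_surj[OF w(1) c ahom_comp[OF w(3) fV(2)]] by blast
 have "fn m ` El (T w) = V"
 proof -
  have "fn m ` El (T w) = psi ` El (T w)" using m(2) by (rule image_cong[OF refl])
  also have "\<dots> = (\<lambda>x. psi (phi x)) ` V" unfolding w(4)[symmetric] image_image ..
  also have "\<dots> = V" using w(5) by simp
  finally show ?thesis .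
 qed
 moreover have "El (T w) \<prec> L" using lesspoll_trans1[OF image_lepoll, of V L phi] V unfolding w(4) by simp
 ultimately show "\<exists>s\<in>{s : Obj K. El (T s) \<subseteq> L \<and> El (T s) \<prec> L \<and> sat (T s)}. \<exists>m\<in>hom K s c. fn m ` El (T s) = V"
  using w m(1) by blast
qed

text \<open>Says that any category embedded as the saturated flat sets is a candidate. Directed
  colimits in \<open>K\<close> keep saturation, so their vertices are isomorphic to images under
  \<open>j\<close>; accessibility holds at any small regular \<open>L\<close> above
  \<open>omega\<close> and the arrows of \<open>A\<close>.\<close>

lemma candidate_saturated_if:
 assumes ff: "fully_faithful X K j"
  and js: "!!x. x : Obj X ==> sat (T (on_obj j x))"
  and ess: "!!c. c : Obj K ==> sat (T c) ==> \<exists>x\<in>Obj X. \<exists>theta\<in>hom K c (on_obj j x). is_iso K theta"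
 shows "candidate_saturated U X"
proof -
 note j = fully_faithfulD(1)[OF ff]
 have closed: "\<exists>x\<in>Obj X. \<exists>tau. is_colimit (poset_cat I r) K (comp_functor (poset_cat I r) j D) (on_obj j x) tau"
  if dp: "directed_poset U omega I r" and D: "is_functor (poset_cat I r) X D" for I :: "'u set" and r D
 proof -
  let ?D = "comp_functor (poset_cat I r) j D"
  note D' = is_functor_comp[OF D j]
  obtain c tau where cl: "is_colimit (poset_cat I r) K ?D c tau" using colimit_exists[OF dp infinite_UNIV_nat D'] by blast
  have "sat (T c)"
   by (rule colimit_sat[OF dp infinite_UNIV_nat D' cl]) (use js functor_obj[OF D] in \<open>simp add: comp_functor_obj\<close>)
  then obtain x theta where x: "x : Obj X" "theta : hom K c (on_obj j x)" "is_iso K theta" using ess is_colimitD(2)[OF cl] by blast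
  then show ?thesis using is_colimit_iso[OF functor_cats(1)[OF D'] catK D' cl x(2,3)] by blast
 qed
 note dc = fully_faithful_directed_colimits[OF ff closed]
 obtain L :: "'u set" where L: "regular_cardinal L" "sm L" "Arr A \<prec> L" "omega \<prec> L" using regular_above[OF sm_Arr] .
 have Li: "infinite L" using L(1) unfolding regular_cardinal_def by blast
 let ?S = "{s : Obj K. El (T s) \<subseteq> L \<and> El (T s) \<prec> L \<and> sat (T s)}"
 have "accessible_at U L X"
 proof (rule fully_faithful_accessible[OF ff dc Li locally_small_K])
  \<comment> \<open>\<open>T\<close> is injective and a normalized flat set is determined by its
    graph, here a subset of the small set \<open>Arr A \<times> L \<times> L\<close>.\<close>
  show "sm ?S"
  proof (rule sm_inj)
   show "inj_on (\<lambda>s. graph (T s)) ?S"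
    by (rule inj_onI) (metis (mono_tags, lifting) T_flat T_inj T_norm graph_inj inj_onD mem_Collect_eq)
   show "(\<lambda>s. graph (T s)) ` ?S \<subseteq> Pow (Arr A \<times> L \<times> L)" using graph_subset[OF T_flat] by blast
   show "sm (Pow (Arr A \<times> L \<times> L))" by (intro sm_Pow sm_Times sm_Arr L(2))
  qed
  \<comment> \<open>The carrier has fewer than \<open>L\<close> elements, so all of it serves as the
    generating set.\<close>
  show "elem_presentable U L K s" if "s : ?S" for s
  proof (rule generated_elem_presentable[OF _ Li, of s "El (T s)"])
   fix x assume x: "x : El (T s)"
   note f = flatD(1,2)[OF T_flat x]
   have "acts (T s) (Ident A (lab (T s) x)) x" using cat_ident[OF catA f(1)] that x by (simp add: acts_def hom_def)
   then show "\<exists>g z. z : El (T s) \<and> acts (T s) g z \<and> act (T s) g z = x" using f(2) that x by blast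
  qed (use that in auto)
  show "\<exists>x\<in>Obj X. \<exists>theta\<in>hom K s (on_obj j x). is_iso K theta" if "s : ?S" for s using ess that by blast
  show "\<exists>(I :: 'u set) r D tau. directed_poset U L I r \<and> is_functor (poset_cat I r) K D \<and>
   (\<forall>i\<in>I. on_obj D i : ?S) \<and> is_colimit (poset_cat I r) K D (on_obj j x) tau" if "x : Obj X" for x
   using sat_directed_union[OF functor_obj[OF j that] js[OF that] L(1,3,4)] .
 qed
 then have X: "Acc_omega U X" using L dc(1) unfolding Acc_omega_def accessible_def by blast
 have "on_obj j ` Obj X \<subseteq> Obj (Sat_omega U K)"
  using functor_obj[OF j] js saturated_if_sat by (auto simp: Sat_omega_def full_subcat_def)
 then show ?thesis using X j dc(2) Acc_omega_K finitely_accessible_K amalgamation_K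
  unfolding candidate_saturated_def Acc_omega_functor_def by blast
qed

end

section \<open>Sheaves on a site\<close>

locale site =
 fixes C :: "('c, 'd) cat" and J :: "'c => 'd set set"
 assumes catC: "category C" and topJ: "grothendieck_topology C J"
begin

abbreviation cmp (infixl "\<cdot>" 70) where "f \<cdot> g \<equiv> Comp C f g"

lemma cmp_hom: "f : hom C b c ==> g : hom C a b ==> f \<cdot> g : hom C a c" using cat_comp[OF catC] .

lemma cmp_assoc: "f : hom C c d ==> g : hom C b c ==> h : hom C a b ==> f \<cdot> g \<cdot> h = f \<cdot> (g \<cdot> h)"
 using cat_assoc[OF catC] by metis

lemma cmp_ident: "f : hom C a b ==> f \<cdot> Ident C a = f" "f : hom C a b ==> Ident C b \<cdot> f = f"
 using cat_ident_right[OF catC] cat_ident_left[OF catC] by blast+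

lemma hom_objs: "f : hom C a b ==> a : Obj C" "f : hom C a b ==> b : Obj C" using cat_hom_obj[OF catC] by blast+

lemma ident_hom: "c : Obj C ==> Ident C c : hom C c c" using cat_ident[OF catC] .

lemma cover_sieve: "c : Obj C ==> S : J c ==> sieve C c S" using topJ unfolding grothendieck_topology_def by blast

lemma cover_hom: "c : Obj C ==> S : J c ==> f : S ==> f : hom C (Dom C f) c"
 using cover_sieve unfolding sieve_def hom_def by blast

lemma cover_cmp: "c : Obj C ==> S : J c ==> f : S ==> g : hom C b (Dom C f) ==> f \<cdot> g : S"
 using cover_sieve unfolding sieve_def hom_def by blast

lemma cover_pullback: "h : hom C b c ==> S : J c ==> pullback_sieve C h S : J b"
 using topJ unfolding grothendieck_topology_def hom_def by blast

lemma pullback_sieve_sieve: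
 assumes R: "sieve C c R" and h: "h : hom C b c" shows "sieve C b (pullback_sieve C h R)"
proof -
 have "h \<cdot> (g \<cdot> k) : R" if "g : Arr C" "Cod C g = b" "h \<cdot> g : R" "k : Arr C" "Cod C k = Dom C g" for g k
 proof -
  have g: "g : hom C (Dom C g) b" and k: "k : hom C (Dom C k) (Dom C g)" using that by (auto simp: hom_def)
  have "Dom C (h \<cdot> g) = Dom C g" using cmp_hom[OF h g] by (rule homD)
  then have "h \<cdot> g \<cdot> k : R" using R that unfolding sieve_def by simp
  then show ?thesis using cmp_assoc[OF h g k] by simp
 qed
 moreover have "g \<cdot> k : Arr C \<and> Cod C (g \<cdot> k) = b" if "g : Arr C" "Cod C g = b" "k : Arr C" "Cod C k = Dom C g" for g k
  using cmp_hom[of g "Dom C g" b k "Dom C k"] that by (simp add: hom_def)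
 ultimately show ?thesis using h unfolding sieve_def pullback_sieve_def by (auto simp: hom_def)
qed

text \<open>Pulled back along a member of \<open>S\<close>, the larger sieve becomes maximal; the
  transitivity axiom then makes it a cover.\<close>

lemma cover_superset:
 assumes c: "c : Obj C" and S: "S : J c" and R: "sieve C c R" and sub: "S \<subseteq> R" shows "R : J c"
proof -
 have "pullback_sieve C h R : J (Dom C h)" if h: "h : S" for h
 proof -
  have hh: "h : hom C (Dom C h) c" using cover_hom[OF c S h] .
  have "pullback_sieve C h R = maximal_sieve C (Dom C h)"
   using cover_cmp[OF c S h] sub unfolding pullback_sieve_def maximal_sieve_def hom_def by blast
  then show ?thesis using topJ hom_objs(1)[OF hh] unfolding grothendieck_topology_def by simp
 qed
 then show ?thesis using topJ c S R unfolding grothendieck_topology_def by blast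
qed

text \<open>To be read as: \<open>Q\<close> holds locally at \<open>c\<close>. The rules below,
  those of a local quantifier, allow sieves to be left out of most later arguments.\<close>

definition cov :: "'c => ('d => bool) => bool" where
 "cov c Q \<longleftrightarrow> (\<exists>S\<in>J c. \<forall>f\<in>S. Q f)"

lemma cov_mono:
 assumes "c : Obj C" "cov c Q" "!!f b. f : hom C b c ==> Q f ==> R f" shows "cov c R"
 using assms cover_hom unfolding cov_def by meson

lemma cov_top:
 assumes c: "c : Obj C" and Q: "!!f b. f : hom C b c ==> Q f" shows "cov c Q" unfolding cov_def
proof (rule bexI[of _ "maximal_sieve C c"])
 show "\<forall>f\<in>maximal_sieve C c. Q f" using Q hom_self unfolding maximal_sieve_def by fastforce
 show "maximal_sieve C c : J c" using topJ c unfolding grothendieck_topology_def by blast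
qed

lemma cov_pullback:
 assumes h: "h : hom C b c" and Q: "cov c Q" shows "cov b (\<lambda>g. Q (h \<cdot> g))"
proof -
 obtain S where S: "S : J c" "\<forall>f\<in>S. Q f" using Q unfolding cov_def by blast
 have "\<forall>g\<in>pullback_sieve C h S. Q (h \<cdot> g)" using S(2) unfolding pullback_sieve_def by blast
 then show ?thesis using cover_pullback[OF h S(1)] unfolding cov_def by blast
qed

text \<open>The composites \<open>f \<cdot> g\<close> with \<open>f\<close> in the given cover and
  \<open>g\<close> in the cover chosen for \<open>f\<close> form a sieve. Its pullback along
  \<open>f\<close> contains the chosen cover, so the transitivity axiom applies.\<close>

lemma cov_trans:
 assumes c: "c : Obj C" and Q: "cov c Q" and R: "!!f b. f : hom C b c ==> Q f ==> cov b (\<lambda>g. R (f \<cdot> g))"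
 shows "cov c R"
proof -
 obtain S where S: "S : J c" "\<forall>f\<in>S. Q f" using Q unfolding cov_def by blast
 have "\<exists>S'\<in>J (Dom C f). \<forall>g\<in>S'. R (f \<cdot> g)" if "f : S" for f
  using R[OF cover_hom[OF c S(1) that]] S(2) that unfolding cov_def by blast
 then obtain S' where S': "!!f. f : S ==> S' f : J (Dom C f)" "!!f g. f : S ==> g : S' f ==> R (f \<cdot> g)" by metis
 define Z where "Z = {f \<cdot> g | f g. f : S \<and> g : S' f}"
 have fg: "f : hom C (Dom C f) c" "g : hom C (Dom C g) (Dom C f)" "Dom C f : Obj C" if "f : S" "g : S' f" for f g
 proof -
  show f: "f : hom C (Dom C f) c" using cover_hom[OF c S(1) that(1)] .
  show "Dom C f : Obj C" using hom_objs(1)[OF f] .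
  then show "g : hom C (Dom C g) (Dom C f)" using cover_hom[OF _ S'(1)[OF that(1)] that(2)] by blast
 qed
 have sZ: "sieve C c Z" unfolding sieve_def
 proof (intro conjI ballI impI)
  show "Z \<subseteq> {f : Arr C. Cod C f = c}"
  proof
   fix z assume "z : Z"
   then obtain f g where "f : S" "g : S' f" "z = f \<cdot> g" unfolding Z_def by blast
   then have "z : hom C (Dom C g) c" using cmp_hom fg by metis
   then show "z : {f : Arr C. Cod C f = c}" by (simp add: hom_def)
  qed
  fix z k assume z: "z : Z" and k: "k : Arr C" "Cod C k = Dom C z"
  obtain f g where f: "f : S" "g : S' f" "z = f \<cdot> g" using z unfolding Z_def by blast
  note h = fg[OF f(1,2)]
  have kh: "k : hom C (Dom C k) (Dom C g)" using k f(3) homD(2)[OF cmp_hom[OF h(1,2)]] by (simp add: hom_def)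
  have "g \<cdot> k : S' f" using cover_cmp[OF h(3) S'(1)[OF f(1)] f(2) kh] .
  then show "z \<cdot> k : Z" using cmp_assoc[OF h(1,2) kh] f unfolding Z_def by blast
 qed
 have "pullback_sieve C f Z : J (Dom C f)" if f: "f : S" for f
 proof -
  have fh: "f : hom C (Dom C f) c" using cover_hom[OF c S(1) f] .
  have "S' f \<subseteq> pullback_sieve C f Z"
  proof
   fix g assume g: "g : S' f"
   show "g : pullback_sieve C f Z" using fg(2)[OF f g] f g unfolding pullback_sieve_def Z_def hom_def by blast
  qed
  then show ?thesis using cover_superset[OF hom_objs(1)[OF fh] S'(1)[OF f] pullback_sieve_sieve[OF sZ fh]] by blast
 qed
 then have "Z : J c" using topJ c S(1) sZ unfolding grothendieck_topology_def by blast
 moreover have "\<forall>z\<in>Z. R z" using S'(2) unfolding Z_def by auto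
 ultimately show ?thesis unfolding cov_def by (rule_tac bexI)
qed

text \<open>The cover for \<open>R\<close> is pulled back along the arrows where \<open>Q\<close>
  holds, so \<open>Q\<close> has to persist under composition with further arrows.\<close>

lemma cov_conj:
 assumes c: "c : Obj C" and "cov c Q" "cov c R"
  and st: "!!f g a b. f : hom C b c ==> g : hom C a b ==> Q f ==> Q (f \<cdot> g)"
 shows "cov c (\<lambda>f. Q f \<and> R f)"
proof (rule cov_trans[OF c assms(2)])
 fix f b assume f: "f : hom C b c" "Q f"
 show "cov b (\<lambda>g. Q (f \<cdot> g) \<and> R (f \<cdot> g))"
  by (rule cov_mono[OF hom_objs(1)[OF f(1)] cov_pullback[OF f(1) assms(3)]]) (use st f in blast)
qed

text \<open>Sheaves as bare families of sets of an arbitrary type with restriction functions. This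
  lets pairs, relations, functions and arrows of \<open>E\<close> be used as sections; they are
  encoded in \<open>'u\<close> only when an object of the topos is to be extracted.\<close>

definition esheaf :: "('c => 'x set) => ('d => 'x => 'x) => bool" where
 "esheaf P rho \<longleftrightarrow>
   (\<forall>a b f x. f : hom C a b \<and> x : P b --> rho f x : P a) \<and>
   (\<forall>c\<in>Obj C. \<forall>x\<in>P c. rho (Ident C c) x = x) \<and>
   (\<forall>a b c f g x. f : hom C b c \<and> g : hom C a b \<and> x : P c --> rho (f \<cdot> g) x = rho g (rho f x)) \<and>
   (\<forall>c\<in>Obj C. \<forall>S\<in>J c. \<forall>x. (\<forall>f\<in>S. x f : P (Dom C f)) \<and>
    (\<forall>f\<in>S. \<forall>b. \<forall>g\<in>hom C b (Dom C f). rho g (x f) = x (f \<cdot> g)) -->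
    (\<exists>!y. y : P c \<and> (\<forall>f\<in>S. rho f y = x f)))"

lemma esheafD:
 assumes "esheaf P rho"
 shows "f : hom C a b ==> x : P b ==> rho f x : P a"
  "c : Obj C ==> x : P c ==> rho (Ident C c) x = x"
  "f : hom C b c ==> g : hom C a b ==> x : P c ==> rho (f \<cdot> g) x = rho g (rho f x)"
proof -
 note 1 = conjunct1[OF assms[unfolded esheaf_def]] and 23 = conjunct2[OF assms[unfolded esheaf_def]]
 note 2 = conjunct1[OF 23] and 3 = conjunct1[OF conjunct2[OF 23]]
 show "f : hom C a b ==> x : P b ==> rho f x : P a" using 1 by blast
 show "c : Obj C ==> x : P c ==> rho (Ident C c) x = x" using 2 by blast
 show "f : hom C b c ==> g : hom C a b ==> x : P c ==> rho (f \<cdot> g) x = rho g (rho f x)" using 3 by blast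
qed

lemma esheaf_glue:
 assumes P: "esheaf P rho" and c: "c : Obj C" and S: "S : J c"
  and x: "!!f. f : S ==> x f : P (Dom C f)"
   "!!f b g. f : S ==> g : hom C b (Dom C f) ==> rho g (x f) = x (f \<cdot> g)"
 shows "\<exists>!y. y : P c \<and> (\<forall>f\<in>S. rho f y = x f)"
proof -
 have "\<forall>c\<in>Obj C. \<forall>S\<in>J c. \<forall>x. (\<forall>f\<in>S. x f : P (Dom C f)) \<and>
    (\<forall>f\<in>S. \<forall>b. \<forall>g\<in>hom C b (Dom C f). rho g (x f) = x (f \<cdot> g)) -->
    (\<exists>!y. y : P c \<and> (\<forall>f\<in>S. rho f y = x f))" using P unfolding esheaf_def by (elim conjE)
 then show ?thesis using c S x by simp
qed

lemma esheaf_separated: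
 assumes P: "esheaf P rho" and c: "c : Obj C" and x: "x : P c" "y : P c" and eq: "cov c (\<lambda>f. rho f x = rho f y)"
 shows "x = y"
proof -
 obtain S where S: "S : J c" "\<forall>f\<in>S. rho f x = rho f y" using eq unfolding cov_def by blast
 have u: "\<exists>!z. z : P c \<and> (\<forall>f\<in>S. rho f z = rho f x)"
 proof (rule esheaf_glue[OF P c S(1)])
  show "rho f x : P (Dom C f)" if "f : S" for f using esheafD(1)[OF P cover_hom[OF c S(1) that] x(1)] .
  show "rho g (rho f x) = rho (f \<cdot> g) x" if "f : S" "g : hom C b (Dom C f)" for f b g
   using esheafD(3)[OF P cover_hom[OF c S(1) that(1)] that(2) x(1)] by simp
 qed
 from u obtain w where w: "!!z. z : P c \<and> (\<forall>f\<in>S. rho f z = rho f x) ==> z = w" by (elim ex1E) blast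
 have "x = w" by (rule w) (use x in simp)
 moreover have "y = w" by (rule w) (use x S(2) in simp)
 ultimately show ?thesis by simp
qed

text \<open>Gluing of locally defined elements: \<open>L f z\<close> says that the element sought restricts along \<open>f\<close> to \<open>z\<close>.\<close>

lemma esheaf_amalgamate:
 assumes P: "esheaf P rho" and c: "c : Obj C"
  and L: "!!f z b. f : hom C b c ==> L f z ==> z : P b"
  and st: "!!f g z a b. f : hom C b c ==> g : hom C a b ==> L f z ==> L (f \<cdot> g) (rho g z)"
  and fn: "!!f z z' b. f : hom C b c ==> L f z ==> L f z' ==> z = z'"
  and cv: "cov c (\<lambda>f. \<exists>z. L f z)"
 shows "\<exists>y\<in>P c. \<forall>f b z. f : hom C b c --> L f z --> rho f y = z"
proof -
 define S where "S = {f : Arr C. Cod C f = c \<and> (\<exists>z. L f z)}"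
 have Sh: "f : hom C (Dom C f) c" if "f : S" for f using that by (simp add: S_def hom_def)
 have sS: "sieve C c S" unfolding sieve_def
 proof (intro conjI ballI impI)
  show "S \<subseteq> {f : Arr C. Cod C f = c}" unfolding S_def by blast
  fix f g assume f: "f : S" and g: "g : Arr C" "Cod C g = Dom C f"
  have gh: "g : hom C (Dom C g) (Dom C f)" using g by (simp add: hom_def)
  obtain z where z: "L f z" using f unfolding S_def by blast
  have "f \<cdot> g : hom C (Dom C g) c" using cmp_hom[OF Sh[OF f] gh] .
  then show "f \<cdot> g : S" using st[OF Sh[OF f] gh z] unfolding S_def hom_def by blast
 qed
 have SJ: "S : J c"
 proof -
  obtain S0 where S0: "S0 : J c" "\<forall>f\<in>S0. \<exists>z. L f z" using cv unfolding cov_def by blast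
  have "S0 \<subseteq> S" using S0 cover_hom[OF c S0(1)] unfolding S_def hom_def by blast
  then show ?thesis using cover_superset[OF c S0(1) sS] by blast
 qed
 define x where "x f = (THE z. L f z)" for f
 have x: "L f (x f)" if f: "f : S" for f
 proof -
  obtain z where z: "L f z" using f unfolding S_def by blast
  show ?thesis unfolding x_def by (rule theI[of _ z]) (use z fn[OF Sh[OF f]] in auto)
 qed
 have "\<exists>!y. y : P c \<and> (\<forall>f\<in>S. rho f y = x f)"
 proof (rule esheaf_glue[OF P c SJ])
  show "x f : P (Dom C f)" if "f : S" for f using L[OF Sh[OF that] x[OF that]] .
  fix f b g assume f: "f : S" and g: "g : hom C b (Dom C f)"
  have fg: "f \<cdot> g : S" using cover_cmp[OF c SJ f g] .
  show "rho g (x f) = x (f \<cdot> g)" using fn[OF Sh[OF fg] st[OF Sh[OF f] g x[OF f]] x[OF fg]] .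
 qed
 then obtain y where y: "y : P c" "\<forall>f\<in>S. rho f y = x f" by blast
 have "rho f y = z" if "f : hom C b c" "L f z" for f b z
 proof -
  have "f : S" using that unfolding S_def hom_def by blast
  then show ?thesis using y(2) x fn[OF that(1) _ that(2)] by metis
 qed
 then show ?thesis using y(1) by blast
qed

definition esheaf_iso :: "('c => 'x set) => ('d => 'x => 'x) => ('c => 'y set) => ('d => 'y => 'y) => ('c => 'x => 'y) => bool" where
 "esheaf_iso P rho Q sigma theta \<longleftrightarrow> (\<forall>c\<in>Obj C. bij_betw (theta c) (P c) (Q c)) \<and>
   (\<forall>a b f x. f : hom C a b \<and> x : P b --> theta a (rho f x) = sigma f (theta b x))"

lemma esheaf_transport:
 assumes P: "esheaf P rho" and theta: "!!c. c : Obj C ==> bij_betw (theta c) (P c) (Q c)"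
  and nat: "!!a b f x. f : hom C a b ==> x : P b ==> theta a (rho f x) = sigma f (theta b x)"
 shows "esheaf Q sigma"
proof -
 have ex: "\<exists>x\<in>P c. y = theta c x" if "c : Obj C" "y : Q c" for c y
  using bij_betw_imp_surj_on[OF theta[OF that(1)]] that(2) by blast
 have mem: "theta c x : Q c" if "c : Obj C" "x : P c" for c x using bij_betwE[OF theta[OF that(1)]] that(2) by blast
 have inj: "x = x'" if "c : Obj C" "x : P c" "x' : P c" "theta c x = theta c x'" for c x x'
  using bij_betw_imp_inj_on[OF theta[OF that(1)]] that(2-4) by (meson inj_onD)
 have res: "sigma f y : Q a" if "f : hom C a b" "y : Q b" for a b f y
  using ex[OF hom_objs(2)[OF that(1)] that(2)] nat[OF that(1)] mem[OF hom_objs(1)[OF that(1)]] esheafD(1)[OF P that(1)] by metis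
 show ?thesis unfolding esheaf_def
 proof (intro conjI allI impI ballI)
  show "sigma f y : Q a" if "f : hom C a b \<and> y : Q b" for a b f y using res that by blast
  show "sigma (Ident C c) y = y" if c: "c : Obj C" and y: "y : Q c" for c y
   using ex[OF c y] nat[OF ident_hom[OF c]] esheafD(2)[OF P c] by metis
  show "sigma (f \<cdot> g) y = sigma g (sigma f y)" if "f : hom C b c \<and> g : hom C a b \<and> y : Q c" for a b c f g y
  proof -
   have f: "f : hom C b c" and g: "g : hom C a b" and y: "y : Q c" using that by auto
   obtain x where x: "x : P c" "y = theta c x" using ex[OF hom_objs(2)[OF f] y] by blast
   show ?thesis
    using nat[OF cmp_hom[OF f g] x(1)] esheafD(3)[OF P f g x(1)] nat[OF g esheafD(1)[OF P f x(1)]] nat[OF f x(1)] x(2) by simp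
  qed
  fix c S y assume c: "c : Obj C" and S: "S : J c"
   and y: "(\<forall>f\<in>S. y f : Q (Dom C f)) \<and> (\<forall>f\<in>S. \<forall>b. \<forall>g\<in>hom C b (Dom C f). sigma g (y f) = y (f \<cdot> g))"
  have fh: "f : hom C (Dom C f) c" if "f : S" for f using cover_hom[OF c S that] .
  have "\<forall>f\<in>S. \<exists>x\<in>P (Dom C f). y f = theta (Dom C f) x" using ex hom_objs(1)[OF fh] y by blast
  then obtain x where x: "!!f. f : S ==> x f : P (Dom C f)" "!!f. f : S ==> y f = theta (Dom C f) (x f)" by metis
  have "rho g (x f) = x (f \<cdot> g)" if f: "f : S" and g: "g : hom C b (Dom C f)" for f b g
  proof (rule inj)
   have fg: "f \<cdot> g : S" using cover_cmp[OF c S f g] .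
   have d: "Dom C (f \<cdot> g) = b" using homD(2)[OF cmp_hom[OF fh[OF f] g]] .
   show "b : Obj C" using hom_objs(1)[OF g] .
   show "rho g (x f) : P b" using esheafD(1)[OF P g x(1)[OF f]] .
   show "x (f \<cdot> g) : P b" using x(1)[OF fg] d by simp
   have "sigma g (y f) = y (f \<cdot> g)" using y f g by blast
   then show "theta b (rho g (x f)) = theta b (x (f \<cdot> g))" using nat[OF g x(1)[OF f]] x(2)[OF f] x(2)[OF fg] d by simp
  qed
  then have u: "\<exists>!z. z : P c \<and> (\<forall>f\<in>S. rho f z = x f)" using esheaf_glue[OF P c S x(1)] by blast
  have iff: "(\<forall>f\<in>S. sigma f (theta c z) = y f) \<longleftrightarrow> (\<forall>f\<in>S. rho f z = x f)" if z: "z : P c" for z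
  proof (intro ball_cong refl)
   fix f assume f: "f : S"
   show "sigma f (theta c z) = y f \<longleftrightarrow> rho f z = x f"
    using nat[OF fh[OF f] z] x(2)[OF f] inj[OF hom_objs(1)[OF fh[OF f]] esheafD(1)[OF P fh[OF f] z] x(1)[OF f]] by metis
  qed
  obtain z where z: "z : P c" "\<forall>f\<in>S. rho f z = x f" using u by blast
  show "\<exists>!y'. y' : Q c \<and> (\<forall>f\<in>S. sigma f y' = y f)"
  proof (rule ex1I[of _ "theta c z"])
   show "theta c z : Q c \<and> (\<forall>f\<in>S. sigma f (theta c z) = y f)" using mem[OF c z(1)] iff z by blast
   fix y' assume y': "y' : Q c \<and> (\<forall>f\<in>S. sigma f y' = y f)"
   then obtain z' where z': "z' : P c" "y' = theta c z'" using ex[OF c] by blast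
   then show "y' = theta c z" using iff[OF z'(1)] y' u z by blast
  qed
 qed
qed

text \<open>An element over \<open>c\<close> is a relation between arrows into \<open>c\<close> and arrows into \<open>d\<close> with common domain that is
 locally the graph of a map \<open>c \<rightarrow> d\<close> of the base category; saturation under local membership makes
 the relation unique, so no quotient is needed.\<close>

definition ay :: "'c => 'c => ('d \<times> 'd) set set" where
 "ay d c = {T. (\<forall>(f, g)\<in>T. \<exists>b. f : hom C b c \<and> g : hom C b d) \<and>
   (\<forall>f g a b h. (f, g) : T \<and> f : hom C b c \<and> h : hom C a b --> (f \<cdot> h, g \<cdot> h) : T) \<and>
   (\<forall>f g g' b. (f, g) : T \<and> (f, g') : T \<and> f : hom C b c --> cov b (\<lambda>h. g \<cdot> h = g' \<cdot> h)) \<and>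
   cov c (\<lambda>f. \<exists>g. (f, g) : T) \<and>
   (\<forall>f g b. f : hom C b c \<and> g : hom C b d \<and> cov b (\<lambda>h. (f \<cdot> h, g \<cdot> h) : T) --> (f, g) : T)}"

definition ayr :: "'c => 'd => ('d \<times> 'd) set => ('d \<times> 'd) set" where
 "ayr d k T = {(f, g). \<exists>b. f : hom C b (Dom C k) \<and> g : hom C b d \<and> (k \<cdot> f, g) : T}"

lemma ayD:
 assumes "T : ay d c"
 shows "(f, g) : T ==> \<exists>b. f : hom C b c \<and> g : hom C b d"
  "(f, g) : T ==> f : hom C b c ==> g : hom C b d"
  "(f, g) : T ==> f : hom C b c ==> h : hom C a b ==> (f \<cdot> h, g \<cdot> h) : T"
  "(f, g) : T ==> (f, g') : T ==> f : hom C b c ==> cov b (\<lambda>h. g \<cdot> h = g' \<cdot> h)"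
  "cov c (\<lambda>f. \<exists>g. (f, g) : T)"
  "f : hom C b c ==> g : hom C b d ==> cov b (\<lambda>h. (f \<cdot> h, g \<cdot> h) : T) ==> (f, g) : T"
proof -
 note A = assms[unfolded ay_def mem_Collect_eq]
 note 1 = conjunct1[OF A] and A1 = conjunct2[OF A]
 note 2 = conjunct1[OF A1] and A2 = conjunct2[OF A1]
 note 3 = conjunct1[OF A2] and A3 = conjunct2[OF A2]
 note 4 = conjunct1[OF A3] and 5 = conjunct2[OF A3]
 show a: "\<exists>b. f : hom C b c \<and> g : hom C b d" if "(f, g) : T" using 1 that by blast
 show "(f, g) : T ==> f : hom C b c ==> g : hom C b d" using a homD(2) by metis
 show "(f, g) : T ==> f : hom C b c ==> h : hom C a b ==> (f \<cdot> h, g \<cdot> h) : T" using 2 by blast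
 show "(f, g) : T ==> (f, g') : T ==> f : hom C b c ==> cov b (\<lambda>h. g \<cdot> h = g' \<cdot> h)" using 3 by blast
 show "cov c (\<lambda>f. \<exists>g. (f, g) : T)" by (rule 4)
 show "f : hom C b c ==> g : hom C b d ==> cov b (\<lambda>h. (f \<cdot> h, g \<cdot> h) : T) ==> (f, g) : T" using 5 by blast
qed

lemma ayI:
 assumes "!!f g. (f, g) : T ==> \<exists>b. f : hom C b c \<and> g : hom C b d"
  "!!f g a b h. (f, g) : T ==> f : hom C b c ==> h : hom C a b ==> (f \<cdot> h, g \<cdot> h) : T"
  "!!f g g' b. (f, g) : T ==> (f, g') : T ==> f : hom C b c ==> cov b (\<lambda>h. g \<cdot> h = g' \<cdot> h)"
  "cov c (\<lambda>f. \<exists>g. (f, g) : T)"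
  "!!f g b. f : hom C b c ==> g : hom C b d ==> cov b (\<lambda>h. (f \<cdot> h, g \<cdot> h) : T) ==> (f, g) : T"
 shows "T : ay d c" unfolding ay_def mem_Collect_eq using assms by (intro conjI) blast+

lemma ayr_iff:
 assumes "k : hom C c' c" "f : hom C b c'" "g : hom C b d"
 shows "(f, g) : ayr d k T \<longleftrightarrow> (k \<cdot> f, g) : T"
 unfolding ayr_def using homD(2)[OF assms(1)] assms(2,3) by auto

lemma ayrE:
 assumes "(f, g) : ayr d k T" "k : hom C c' c"
 obtains b where "f : hom C b c'" "g : hom C b d" "(k \<cdot> f, g) : T"
 using assms homD(2)[OF assms(2)] unfolding ayr_def by auto

lemma ayr_mem:
 assumes T: "T : ay d c" and k: "k : hom C c' c" shows "ayr d k T : ay d c'"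
proof (rule ayI)
 show "\<exists>b. f : hom C b c' \<and> g : hom C b d" if "(f, g) : ayr d k T" for f g using ayrE[OF that k] by metis
 show "(f \<cdot> h, g \<cdot> h) : ayr d k T" if fg: "(f, g) : ayr d k T" and f: "f : hom C b c'" and h: "h : hom C a b" for f g a b h
 proof -
  have kfg: "(k \<cdot> f, g) : T" and g: "g : hom C b d" using ayrE[OF fg k] homD(2)[OF f] homD(2) by metis+
  have "(k \<cdot> f \<cdot> h, g \<cdot> h) : T" using ayD(3)[OF T kfg cmp_hom[OF k f] h] .
  then show ?thesis using ayr_iff[OF k cmp_hom[OF f h] cmp_hom[OF g h]] cmp_assoc[OF k f h] by simp
 qed
 show "cov b (\<lambda>h. g \<cdot> h = g' \<cdot> h)" if "(f, g) : ayr d k T" "(f, g') : ayr d k T" and f: "f : hom C b c'" for f g g' b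
  using ayD(4)[OF T _ _ cmp_hom[OF k f]] ayrE[OF that(1) k] ayrE[OF that(2) k] by metis
 show "cov c' (\<lambda>f. \<exists>g. (f, g) : ayr d k T)"
 proof (rule cov_mono[OF hom_objs(1)[OF k] cov_pullback[OF k ayD(5)[OF T]]])
  fix f b assume f: "f : hom C b c'" and "\<exists>g. (k \<cdot> f, g) : T"
  then obtain g where g: "(k \<cdot> f, g) : T" by blast
  show "\<exists>g. (f, g) : ayr d k T" using ayr_iff[OF k f ayD(2)[OF T g cmp_hom[OF k f]]] g by blast
 qed
 show "(f, g) : ayr d k T" if f: "f : hom C b c'" and g: "g : hom C b d" and cv: "cov b (\<lambda>h. (f \<cdot> h, g \<cdot> h) : ayr d k T)" for f g b
 proof -
  have "cov b (\<lambda>h. (k \<cdot> f \<cdot> h, g \<cdot> h) : T)" by (rule cov_mono[OF hom_objs(1)[OF f] cv])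
    (use ayr_iff[OF k cmp_hom[OF f] cmp_hom[OF g]] cmp_assoc[OF k f] in simp)
  then show ?thesis using ayr_iff[OF k f g] ayD(6)[OF T cmp_hom[OF k f] g] by blast
 qed
qed

lemma ayr_ident: assumes T: "T : ay d c" and c: "c : Obj C" shows "ayr d (Ident C c) T = T"
proof -
 have "(f, g) : ayr d (Ident C c) T \<longleftrightarrow> (f, g) : T" for f g
 proof
  assume "(f, g) : ayr d (Ident C c) T"
  then show "(f, g) : T" using cmp_ident(2) by (elim ayrE[OF _ ident_hom[OF c]]) metis
 next
  assume fg: "(f, g) : T"
  then obtain b where "f : hom C b c" "g : hom C b d" using ayD(1)[OF T] by blast
  then show "(f, g) : ayr d (Ident C c) T" using ayr_iff[OF ident_hom[OF c]] cmp_ident(2) fg by metis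
 qed
 then show ?thesis by auto
qed

lemma ayr_cmp:
 assumes k: "k : hom C b c" and l: "l : hom C a b" shows "ayr d (k \<cdot> l) T = ayr d l (ayr d k T)"
proof -
 have "(f, g) : ayr d (k \<cdot> l) T \<longleftrightarrow> (f, g) : ayr d l (ayr d k T)" for f g
 proof
  assume "(f, g) : ayr d (k \<cdot> l) T"
  then obtain e where e: "f : hom C e a" "g : hom C e d" "(k \<cdot> l \<cdot> f, g) : T" by (rule ayrE[OF _ cmp_hom[OF k l]])
  then show "(f, g) : ayr d l (ayr d k T)"
   using ayr_iff[OF l e(1,2)] ayr_iff[OF k cmp_hom[OF l e(1)] e(2)] cmp_assoc[OF k l e(1)] by simp
 next
  assume "(f, g) : ayr d l (ayr d k T)"
  then obtain e where e: "f : hom C e a" "g : hom C e d" "(l \<cdot> f, g) : ayr d k T" by (rule ayrE[OF _ l])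
  then show "(f, g) : ayr d (k \<cdot> l) T"
   using ayr_iff[OF cmp_hom[OF k l] e(1,2)] ayr_iff[OF k cmp_hom[OF l e(1)] e(2)] cmp_assoc[OF k l e(1)] by simp
 qed
 then show ?thesis by auto
qed

text \<open>Moves any pair to one whose first component is an identity, at the price of restricting
  the relation; matching families can then be compared at identities alone.\<close>

lemma ay_pair_ident:
 assumes T: "T : ay d c" and f: "f : hom C b c" and g: "g : hom C b d"
 shows "(f, g) : T \<longleftrightarrow> (Ident C b, g) : ayr d f T"
 using ayr_iff[OF f ident_hom[OF hom_objs(1)[OF f]] g] cmp_ident(1)[OF f] by simp

text \<open>The glued relation consists of the pairs that, on a cover, are prescribed by the member
  of the family over the composite. Saturation under local membership makes it restrict exactly to
  the given members and makes it unique.\<close>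

lemma esheaf_ay: "esheaf (ay d) (ayr d)" unfolding esheaf_def
proof (intro conjI allI ballI impI)
 show "ayr d f x : ay d a" if "f : hom C a b \<and> x : ay d b" for a b f x using ayr_mem that by blast
 show "ayr d (Ident C c) x = x" if "c : Obj C" "x : ay d c" for c x using ayr_ident that by blast
 show "ayr d (f \<cdot> g) x = ayr d g (ayr d f x)" if "f : hom C b c \<and> g : hom C a b \<and> x : ay d c" for a b c f g x
  using ayr_cmp that by blast
 fix c S T assume c: "c : Obj C" and S: "S : J c"
  and T: "(\<forall>f\<in>S. T f : ay d (Dom C f)) \<and> (\<forall>f\<in>S. \<forall>b. \<forall>g\<in>hom C b (Dom C f). ayr d g (T f) = T (f \<cdot> g))"
 have Sh: "f : hom C (Dom C f) c" if "f : S" for f using cover_hom[OF c S that] .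
 have Tm: "T f : ay d b" if "f : S" "f : hom C b c" for f b using T that homD(2)[OF that(2)] by blast
 have Tr: "ayr d g (T f) = T (f \<cdot> g)" if "f : S" "f : hom C b c" "g : hom C a b" for f b g a
  using T that homD(2)[OF that(2)] by blast
 have covS: "cov b (\<lambda>k. h \<cdot> k : S)" if "h : hom C b c" for h b
  using cov_pullback[OF that, of "\<lambda>f. f : S"] S unfolding cov_def by blast
 \<comment> \<open>The arrow \<open>h\<close> need not belong to \<open>S\<close>; it is enough that
   on a cover \<open>h \<cdot> k\<close> does, and there \<open>y \<cdot> k\<close> has to be the
   value that \<open>T (h \<cdot> k)\<close> takes at the identity.\<close>
 define L where "L b h y \<longleftrightarrow> cov b (\<lambda>k. h \<cdot> k : S \<and> (Ident C (Dom C k), y \<cdot> k) : T (h \<cdot> k))" for b h y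
 \<comment> \<open>Over an arrow of \<open>S\<close> itself the local condition collapses to
   membership, since \<open>T h\<close> is saturated.\<close>
 have L_S: "L b h y \<longleftrightarrow> (Ident C b, y) : T h" if h: "h : S" "h : hom C b c" and y: "y : hom C b d" for b h y
 proof -
  have b: "b : Obj C" using hom_objs(1)[OF h(2)] .
  note Th = Tm[OF h]
  have eq: "(Ident C (Dom C k), y \<cdot> k) : T (h \<cdot> k) \<longleftrightarrow> (k, y \<cdot> k) : T h" if k: "k : hom C a b" for k a
   using ay_pair_ident[OF Th k cmp_hom[OF y k]] Tr[OF h k] homD(2)[OF k] by simp
  show ?thesis
  proof
   assume "L b h y"
   then have "cov b (\<lambda>k. (Ident C b \<cdot> k, y \<cdot> k) : T h)"
    unfolding L_def by (rule cov_mono[OF b]) (use eq cmp_ident(2) in auto)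
   then show "(Ident C b, y) : T h" using ayD(6)[OF Th ident_hom[OF b] y] by blast
  next
   assume i: "(Ident C b, y) : T h"
   show "L b h y" unfolding L_def
   proof (rule cov_top[OF b])
    fix k a assume k: "k : hom C a b"
    have "(k, y \<cdot> k) : T h" using ayD(3)[OF Th i ident_hom[OF b] k] cmp_ident(2)[OF k] by simp
    moreover have "h \<cdot> k : S" using cover_cmp[OF c S h(1)] k homD(2)[OF h(2)] by blast
    ultimately show "h \<cdot> k : S \<and> (Ident C (Dom C k), y \<cdot> k) : T (h \<cdot> k)" using eq[OF k] by blast
   qed
  qed
 qed
 have L_pull: "L a (h \<cdot> m) (y \<cdot> m)" if h: "h : hom C b c" and y: "y : hom C b d" and m: "m : hom C a b" and l: "L b h y" for a b h y m
 proof -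
  have "cov a (\<lambda>k. h \<cdot> (m \<cdot> k) : S \<and> (Ident C (Dom C (m \<cdot> k)), y \<cdot> (m \<cdot> k)) : T (h \<cdot> (m \<cdot> k)))"
   using cov_pullback[OF m l[unfolded L_def]] .
  then show ?thesis unfolding L_def
  proof (rule cov_mono[OF hom_objs(1)[OF m]])
   fix k e assume k: "k : hom C e a" and kk: "h \<cdot> (m \<cdot> k) : S \<and> (Ident C (Dom C (m \<cdot> k)), y \<cdot> (m \<cdot> k)) : T (h \<cdot> (m \<cdot> k))"
   show "h \<cdot> m \<cdot> k : S \<and> (Ident C (Dom C k), y \<cdot> m \<cdot> k) : T (h \<cdot> m \<cdot> k)"
    using kk cmp_assoc[OF h m k] cmp_assoc[OF y m k] homD(2)[OF cmp_hom[OF m k]] homD(2)[OF k] by simp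
  qed
 qed
 have L_local: "L b h y" if h: "h : hom C b c" and y: "y : hom C b d" and cv: "cov b (\<lambda>k. L (Dom C k) (h \<cdot> k) (y \<cdot> k))" for b h y
  unfolding L_def
 proof (rule cov_trans[OF hom_objs(1)[OF h] cv])
  fix k a assume k: "k : hom C a b" and l: "L (Dom C k) (h \<cdot> k) (y \<cdot> k)"
  have "cov a (\<lambda>m. h \<cdot> k \<cdot> m : S \<and> (Ident C (Dom C m), y \<cdot> k \<cdot> m) : T (h \<cdot> k \<cdot> m))"
   using l homD(2)[OF k] unfolding L_def by simp
  then show "cov a (\<lambda>m. h \<cdot> (k \<cdot> m) : S \<and> (Ident C (Dom C (k \<cdot> m)), y \<cdot> (k \<cdot> m)) : T (h \<cdot> (k \<cdot> m)))"
  proof (rule cov_mono[OF hom_objs(1)[OF k]])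
   fix m e assume m: "m : hom C e a" and mm: "h \<cdot> k \<cdot> m : S \<and> (Ident C (Dom C m), y \<cdot> k \<cdot> m) : T (h \<cdot> k \<cdot> m)"
   show "h \<cdot> (k \<cdot> m) : S \<and> (Ident C (Dom C (k \<cdot> m)), y \<cdot> (k \<cdot> m)) : T (h \<cdot> (k \<cdot> m))"
    using mm cmp_assoc[OF h k m] cmp_assoc[OF y k m] homD(2)[OF cmp_hom[OF k m]] homD(2)[OF m] by simp
  qed
 qed
 define G where "G = {(h, y). \<exists>b. h : hom C b c \<and> y : hom C b d \<and> L b h y}"
 have GE: "\<exists>b. h : hom C b c \<and> y : hom C b d \<and> L b h y" if "(h, y) : G" for h y using that unfolding G_def by blast
 have GE': "y : hom C b d \<and> L b h y" if hy: "(h, y) : G" "h : hom C b c" for h y b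
 proof -
  obtain b' where "h : hom C b' c" "y : hom C b' d" "L b' h y" using GE[OF hy(1)] by blast
  moreover have "b' = b" using homD(2)[OF \<open>h : hom C b' c\<close>] homD(2)[OF hy(2)] by simp
  ultimately show ?thesis by simp
 qed
 have G_iff: "(h, y) : G \<longleftrightarrow> L b h y" if "h : hom C b c" "y : hom C b d" for h y b
  using that GE' unfolding G_def by blast
 have GG: "G : ay d c"
 proof (rule ayI)
  show "\<exists>b. f : hom C b c \<and> g : hom C b d" if "(f, g) : G" for f g using GE[OF that] by blast
  show "(f \<cdot> h, g \<cdot> h) : G" if "(f, g) : G" "f : hom C b c" "h : hom C a b" for f g a b h
   using GE'[OF that(1,2)] L_pull[OF that(2) _ that(3)] G_iff cmp_hom[OF _ that(3)] that(2) by blast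
  show "cov b (\<lambda>h. g \<cdot> h = g' \<cdot> h)" if fg: "(f, g) : G" "(f, g') : G" and f: "f : hom C b c" for f g g' b
  proof -
   have b: "b : Obj C" using hom_objs(1)[OF f] .
   have g: "g : hom C b d" "L b f g" "g' : hom C b d" "L b f g'" using GE'[OF fg(1) f] GE'[OF fg(2) f] by auto
   show ?thesis
   proof (rule cov_trans[OF b g(2)[unfolded L_def]])
    fix k a assume k: "k : hom C a b" and gk: "f \<cdot> k : S \<and> (Ident C (Dom C k), g \<cdot> k) : T (f \<cdot> k)"
    have fk: "f \<cdot> k : hom C a c" using cmp_hom[OF f k] .
    have g'k: "(Ident C a, g' \<cdot> k) : T (f \<cdot> k)"
     using L_S[OF _ fk cmp_hom[OF g(3) k]] L_pull[OF f g(3) k g(4)] gk by blast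
    have "(Ident C a, g \<cdot> k) : T (f \<cdot> k)" using gk homD(2)[OF k] by simp
    then have "cov a (\<lambda>h. g \<cdot> k \<cdot> h = g' \<cdot> k \<cdot> h)"
     using ayD(4)[OF Tm[OF _ fk] _ g'k ident_hom[OF hom_objs(1)[OF k]]] gk by blast
    then show "cov a (\<lambda>h. g \<cdot> (k \<cdot> h) = g' \<cdot> (k \<cdot> h))"
     by (rule cov_mono[OF hom_objs(1)[OF k]]) (use cmp_assoc[OF g(1) k] cmp_assoc[OF g(3) k] in simp)
   qed
  qed
  show "cov c (\<lambda>f. \<exists>g. (f, g) : G)"
  proof (rule cov_trans[OF c])
   show "cov c (\<lambda>f. f : S)" using S unfolding cov_def by blast
   fix f b assume f: "f : hom C b c" "f : S"
   show "cov b (\<lambda>g. \<exists>h. (f \<cdot> g, h) : G)"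
   proof (rule cov_mono[OF hom_objs(1)[OF f(1)] ayD(5)[OF Tm[OF f(2,1)]]])
    fix m a assume m: "m : hom C a b" and "\<exists>y. (m, y) : T f"
    then obtain y where y: "(m, y) : T f" by blast
    have yh: "y : hom C a d" using ayD(2)[OF Tm[OF f(2,1)] y m] .
    have fm: "f \<cdot> m : hom C a c" "f \<cdot> m : S" using cmp_hom[OF f(1) m] cover_cmp[OF c S f(2)] m homD(2)[OF f(1)] by auto
    have "(Ident C a, y) : T (f \<cdot> m)" using ay_pair_ident[OF Tm[OF f(2,1)] m yh] y Tr[OF f(2,1) m] by simp
    then show "\<exists>h. (f \<cdot> m, h) : G" using L_S[OF fm(2,1) yh] G_iff[OF fm(1) yh] by blast
   qed
  qed
  show "(f, g) : G" if f: "f : hom C b c" and g: "g : hom C b d" and cv: "cov b (\<lambda>h. (f \<cdot> h, g \<cdot> h) : G)" for f g b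
  proof -
   have "cov b (\<lambda>k. L (Dom C k) (f \<cdot> k) (g \<cdot> k))"
    by (rule cov_mono[OF hom_objs(1)[OF f] cv]) (use G_iff cmp_hom[OF f] cmp_hom[OF g] homD(2) in metis)
   then show ?thesis using L_local[OF f g] G_iff[OF f g] by blast
  qed
 qed
 have GT: "ayr d f G = T f" if f: "f : S" for f
 proof -
  note fh = Sh[OF f] let ?b = "Dom C f"
  have iff: "(m, y) : ayr d f G \<longleftrightarrow> (m, y) : T f" if m: "m : hom C a ?b" and y: "y : hom C a d" for m y a
  proof -
   have fm: "f \<cdot> m : hom C a c" "f \<cdot> m : S" using cmp_hom[OF fh m] cover_cmp[OF c S f m] by auto
   show ?thesis
    using ayr_iff[OF fh m y] G_iff[OF fm(1) y] L_S[OF fm(2,1) y] ay_pair_ident[OF Tm[OF f fh] m y] Tr[OF f fh m] by simp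
  qed
  have "(m, y) : ayr d f G \<longleftrightarrow> (m, y) : T f" for m y
   using iff ayD(1)[OF ayr_mem[OF GG fh]] ayD(1)[OF Tm[OF f fh]] by metis
  then show ?thesis by auto
 qed
 show "\<exists>!y. y : ay d c \<and> (\<forall>f\<in>S. ayr d f y = T f)"
 proof (rule ex1I[of _ G])
  show "G : ay d c \<and> (\<forall>f\<in>S. ayr d f G = T f)" using GG GT by blast
  fix T' assume T': "T' : ay d c \<and> (\<forall>f\<in>S. ayr d f T' = T f)"
  then have T'c: "T' : ay d c" by blast
  have eq: "(f, g) : T' \<longleftrightarrow> (f, g) : G" if f: "f : S" "f : hom C b c" and g: "g : hom C b d" for f g b
   using ay_pair_ident[OF T'c f(2) g] ay_pair_ident[OF GG f(2) g] T' GT[OF f(1)] f(1) by simp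
  \<comment> \<open>On a cover the first component lands in \<open>S\<close>, where the two
    relations agree; saturation of \<open>Q'\<close> then returns membership of the pair.\<close>
  have sub: "(h, y) : Q'" if Q: "Q : ay d c" "Q' : ay d c" and hy: "(h, y) : Q" and le: "!!f g b. f : S ==> f : hom C b c ==> g : hom C b d ==> (f, g) : Q ==> (f, g) : Q'" for Q Q' h y
  proof -
   obtain b where h: "h : hom C b c" and y: "y : hom C b d" using ayD(1)[OF Q(1) hy] by blast
   have "cov b (\<lambda>k. (h \<cdot> k, y \<cdot> k) : Q')" by (rule cov_mono[OF hom_objs(1)[OF h] covS[OF h]])
     (use le cmp_hom[OF h] cmp_hom[OF y] ayD(3)[OF Q(1) hy h] in blast)
   then show ?thesis using ayD(6)[OF Q(2) h y] by blast
  qed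
  have "T' \<subseteq> G" using sub[OF T'c GG] eq by auto
  moreover have "G \<subseteq> T'" using sub[OF GG T'c] eq by auto
  ultimately show "T' = G" by blast
 qed
qed

text \<open>The saturated graph of the identity of \<open>d\<close>: the universal section of the
  sheaf associated with the functor represented by \<open>d\<close>.\<close>

definition ayu :: "'c => ('d \<times> 'd) set" where
 "ayu d = {(f, g). \<exists>b. f : hom C b d \<and> g : hom C b d \<and> cov b (\<lambda>h. f \<cdot> h = g \<cdot> h)}"

lemma ayuD:
 assumes "(f, g) : ayu d" "f : hom C b d"
 shows "g : hom C b d" "cov b (\<lambda>h. f \<cdot> h = g \<cdot> h)"
proof -
 obtain b' where b': "f : hom C b' d" "g : hom C b' d" "cov b' (\<lambda>h. f \<cdot> h = g \<cdot> h)" using assms(1) unfolding ayu_def by blast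
 have "b' = b" using homD(2)[OF b'(1)] homD(2)[OF assms(2)] by simp
 then show "g : hom C b d" "cov b (\<lambda>h. f \<cdot> h = g \<cdot> h)" using b' by auto
qed

lemma ayu_iff: "f : hom C b d ==> g : hom C b d ==> (f, g) : ayu d \<longleftrightarrow> cov b (\<lambda>h. f \<cdot> h = g \<cdot> h)"
 using ayuD(2) unfolding ayu_def by blast

lemma ayu_mem:
 assumes d: "d : Obj C" shows "ayu d : ay d d"
proof (rule ayI)
 show "\<exists>b. f : hom C b d \<and> g : hom C b d" if "(f, g) : ayu d" for f g using that unfolding ayu_def by blast
 show "(f \<cdot> h, g \<cdot> h) : ayu d" if fg: "(f, g) : ayu d" and f: "f : hom C b d" and h: "h : hom C a b" for f g a b h
 proof -
  note g = ayuD(1)[OF fg f] and cv = ayuD(2)[OF fg f]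
  have "cov a (\<lambda>k. f \<cdot> h \<cdot> k = g \<cdot> h \<cdot> k)"
   by (rule cov_mono[OF hom_objs(1)[OF h] cov_pullback[OF h cv]]) (use cmp_assoc[OF f h] cmp_assoc[OF g h] in simp)
  then show ?thesis using ayu_iff[OF cmp_hom[OF f h] cmp_hom[OF g h]] by blast
 qed
 show "cov b (\<lambda>h. g \<cdot> h = g' \<cdot> h)" if fg: "(f, g) : ayu d" "(f, g') : ayu d" and f: "f : hom C b d" for f g g' b
 proof -
  note g = ayuD[OF fg(1) f] ayuD[OF fg(2) f]
  have "cov b (\<lambda>h. f \<cdot> h = g \<cdot> h \<and> f \<cdot> h = g' \<cdot> h)"
  proof (rule cov_conj[OF hom_objs(1)[OF f] g(2,4)])
   fix h k a e assume h: "h : hom C e b" and k: "k : hom C a e" and eq: "f \<cdot> h = g \<cdot> h"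
   show "f \<cdot> (h \<cdot> k) = g \<cdot> (h \<cdot> k)" using cmp_assoc[OF f h k] cmp_assoc[OF g(1) h k] eq by simp
  qed
  then show ?thesis by (rule cov_mono[OF hom_objs(1)[OF f]]) metis
 qed
 show "cov d (\<lambda>f. \<exists>g. (f, g) : ayu d)"
 proof (rule cov_top[OF d])
  fix f b assume f: "f : hom C b d"
  have "(f, f) : ayu d" using ayu_iff[OF f f] cov_top[OF hom_objs(1)[OF f]] by simp
  then show "\<exists>g. (f, g) : ayu d" by blast
 qed
 show "(f, g) : ayu d" if f: "f : hom C b d" and g: "g : hom C b d" and cv: "cov b (\<lambda>h. (f \<cdot> h, g \<cdot> h) : ayu d)" for f g b
 proof -
  have "cov b (\<lambda>h. f \<cdot> h = g \<cdot> h)"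
  proof (rule cov_trans[OF hom_objs(1)[OF f] cv])
   fix h a assume h: "h : hom C a b" and "(f \<cdot> h, g \<cdot> h) : ayu d"
   then have "cov a (\<lambda>k. f \<cdot> h \<cdot> k = g \<cdot> h \<cdot> k)" using ayu_iff[OF cmp_hom[OF f h] cmp_hom[OF g h]] by blast
   then show "cov a (\<lambda>k. f \<cdot> (h \<cdot> k) = g \<cdot> (h \<cdot> k))"
    by (rule cov_mono[OF hom_objs(1)[OF h]]) (use cmp_assoc[OF f h] cmp_assoc[OF g h] in simp)
  qed
  then show ?thesis using ayu_iff[OF f g] by blast
 qed
qed

text \<open>Anything that \<open>T\<close> pairs with \<open>f \<cdot> m\<close> agrees locally with
  \<open>g \<cdot> m\<close>, and conversely by saturation. So a pair in \<open>T\<close> expresses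
  that \<open>T\<close>, restricted along its first component, is the section represented by the
  second.\<close>

lemma ay_pair_iff:
 assumes T: "T : ay d c" and f: "f : hom C b c" and g: "g : hom C b d"
 shows "(f, g) : T \<longleftrightarrow> ayr d f T = ayr d g (ayu d)"
proof
 have u: "ayu d : ay d d" using ayu_mem[OF hom_objs(2)[OF g]] .
 assume fg: "(f, g) : T"
 have iff: "(m, n) : ayr d f T \<longleftrightarrow> (m, n) : ayr d g (ayu d)" if m: "m : hom C a b" and n: "n : hom C a d" for m n a
 proof -
  note fm = cmp_hom[OF f m] and gm = cmp_hom[OF g m]
  have p: "(f \<cdot> m, g \<cdot> m) : T" using ayD(3)[OF T fg f m] .
  have "(f \<cdot> m, n) : T \<longleftrightarrow> cov a (\<lambda>h. g \<cdot> m \<cdot> h = n \<cdot> h)"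
  proof
   assume "(f \<cdot> m, n) : T"
   then show "cov a (\<lambda>h. g \<cdot> m \<cdot> h = n \<cdot> h)" using ayD(4)[OF T p _ fm] by blast
  next
   assume cv: "cov a (\<lambda>h. g \<cdot> m \<cdot> h = n \<cdot> h)"
   have "cov a (\<lambda>h. (f \<cdot> m \<cdot> h, n \<cdot> h) : T)"
    by (rule cov_mono[OF hom_objs(1)[OF m] cv]) (use ayD(3)[OF T p fm] in metis)
   then show "(f \<cdot> m, n) : T" using ayD(6)[OF T fm n] by blast
  qed
  then show ?thesis using ayr_iff[OF f m n] ayr_iff[OF g m n] ayu_iff[OF gm n] by simp
 qed
 have "(m, n) : ayr d f T \<longleftrightarrow> (m, n) : ayr d g (ayu d)" for m n
  using iff ayD(1)[OF ayr_mem[OF T f]] ayD(1)[OF ayr_mem[OF u g]] by metis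
 then show "ayr d f T = ayr d g (ayu d)" by auto
next
 assume eq: "ayr d f T = ayr d g (ayu d)"
 have "(g, g) : ayu d" using ayu_iff[OF g g] cov_top[OF hom_objs(1)[OF g]] by simp
 then have "(Ident C b, g) : ayr d g (ayu d)" using ay_pair_ident[OF ayu_mem[OF hom_objs(2)[OF g]] g g] by blast
 then show "(f, g) : T" using ay_pair_ident[OF T f g] eq by simp
qed

text \<open>Yoneda for the associated sheaf. The image of \<open>T\<close> is glued from the
  restrictions \<open>rho g x\<close> over the pairs \<open>(f, g)\<close> in \<open>T\<close>;
  second components of pairs with the same first one agree locally, and \<open>P\<close> is
  separated, so these local values are unambiguous.\<close>

lemma ay_universal:
 assumes P: "esheaf P rho" and d: "d : Obj C" and x: "x : P d"
 obtains alpha where "!!c T. c : Obj C ==> T : ay d c ==> alpha c T : P c"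
  "!!a b k T. k : hom C a b ==> T : ay d b ==> alpha a (ayr d k T) = rho k (alpha b T)" "alpha d (ayu d) = x"
proof -
 have "\<exists>y\<in>P c. \<forall>f b z. f : hom C b c --> (\<exists>g\<in>hom C b d. (f, g) : T \<and> z = rho g x) --> rho f y = z"
  if c: "c : Obj C" and T: "T : ay d c" for c T
 proof -
  have "\<exists>y\<in>P c. \<forall>f b z. f : hom C b c --> (\<exists>g\<in>hom C (Dom C f) d. (f, g) : T \<and> z = rho g x) --> rho f y = z"
  proof (rule esheaf_amalgamate[OF P c])
   show "z : P b" if "f : hom C b c" "\<exists>g\<in>hom C (Dom C f) d. (f, g) : T \<and> z = rho g x" for f z b
    using that homD(2)[OF that(1)] esheafD(1)[OF P _ x] by auto
   show "\<exists>g'\<in>hom C (Dom C (f \<cdot> g)) d. (f \<cdot> g, g') : T \<and> rho g z = rho g' x"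
    if f: "f : hom C b c" and g: "g : hom C a b" and ex: "\<exists>g\<in>hom C (Dom C f) d. (f, g) : T \<and> z = rho g x" for f g z a b
   proof -
    obtain h where h: "h : hom C b d" "(f, h) : T" "z = rho h x" using ex homD(2)[OF f] by auto
    show ?thesis
     using ayD(3)[OF T h(2) f g] cmp_hom[OF h(1) g] homD(2)[OF cmp_hom[OF f g]] esheafD(3)[OF P h(1) g x] h(3) by auto
   qed
   show "z = z'" if f: "f : hom C b c" and ex: "\<exists>g\<in>hom C (Dom C f) d. (f, g) : T \<and> z = rho g x"
    "\<exists>g\<in>hom C (Dom C f) d. (f, g) : T \<and> z' = rho g x" for f z z' b
   proof -
    obtain g g' where g: "g : hom C b d" "(f, g) : T" "z = rho g x" and g': "g' : hom C b d" "(f, g') : T" "z' = rho g' x"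
     using ex homD(2)[OF f] by auto
    have "cov b (\<lambda>h. rho h z = rho h z')" by (rule cov_mono[OF hom_objs(1)[OF f] ayD(4)[OF T g(2) g'(2) f]])
      (use esheafD(3)[OF P g(1) _ x] esheafD(3)[OF P g'(1) _ x] g(3) g'(3) in metis)
    then show ?thesis
     using esheaf_separated[OF P hom_objs(1)[OF f]] esheafD(1)[OF P g(1) x] esheafD(1)[OF P g'(1) x] g(3) g'(3) by blast
   qed
   show "cov c (\<lambda>f. \<exists>z. \<exists>g\<in>hom C (Dom C f) d. (f, g) : T \<and> z = rho g x)"
    by (rule cov_mono[OF c ayD(5)[OF T]]) (use ayD(2)[OF T] homD(2) in metis)
  qed
  then show ?thesis using homD(2) by metis
 qed
 then obtain alpha where alpha: "!!c T. c : Obj C ==> T : ay d c ==> alpha c T : P c"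
  "!!c T f b g. c : Obj C ==> T : ay d c ==> f : hom C b c ==> g : hom C b d ==> (f, g) : T ==> rho f (alpha c T) = rho g x"
  by metis
 have nat: "alpha a (ayr d k T) = rho k (alpha b T)" if k: "k : hom C a b" and T: "T : ay d b" for a b k T
 proof (rule esheaf_separated[OF P hom_objs(1)[OF k]])
  note a = hom_objs(1)[OF k] and b = hom_objs(2)[OF k] note kT = ayr_mem[OF T k]
  show "alpha a (ayr d k T) : P a" "rho k (alpha b T) : P a" using alpha(1)[OF a kT] esheafD(1)[OF P k alpha(1)[OF b T]] by auto
  show "cov a (\<lambda>f. rho f (alpha a (ayr d k T)) = rho f (rho k (alpha b T)))"
  proof (rule cov_mono[OF a ayD(5)[OF kT]])
   fix f e assume f: "f : hom C e a" and "\<exists>g. (f, g) : ayr d k T"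
   then obtain g where g: "(f, g) : ayr d k T" by blast
   have gh: "g : hom C e d" using ayD(2)[OF kT g f] .
   have "(k \<cdot> f, g) : T" using ayr_iff[OF k f gh] g by blast
   then show "rho f (alpha a (ayr d k T)) = rho f (rho k (alpha b T))"
    using alpha(2)[OF b T cmp_hom[OF k f] gh] alpha(2)[OF a kT f gh g] esheafD(3)[OF P k f alpha(1)[OF b T]] by simp
  qed
 qed
 have "(Ident C d, Ident C d) : ayu d" using ayu_iff[OF ident_hom[OF d] ident_hom[OF d]] cov_top[OF d] by simp
 then have "alpha d (ayu d) = x"
  using alpha(2)[OF d ayu_mem[OF d] ident_hom[OF d] ident_hom[OF d]] esheafD(2)[OF P d x] esheafD(2)[OF P d alpha(1)[OF d ayu_mem[OF d]]] by simp
 then show thesis using that alpha(1) nat by blast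
qed

text \<open>On the cover where \<open>T\<close> has values its restrictions are restrictions of
  \<open>ayu d\<close>, so the two maps agree locally, and separatedness concludes.\<close>

lemma ay_ext:
 assumes P: "esheaf P rho" and d: "d : Obj C"
  and alpha: "!!c T. c : Obj C ==> T : ay d c ==> alpha c T : P c"
   "!!a b k T. k : hom C a b ==> T : ay d b ==> alpha a (ayr d k T) = rho k (alpha b T)"
  and beta: "!!c T. c : Obj C ==> T : ay d c ==> beta c T : P c"
   "!!a b k T. k : hom C a b ==> T : ay d b ==> beta a (ayr d k T) = rho k (beta b T)"
  and eq: "alpha d (ayu d) = beta d (ayu d)" and c: "c : Obj C" and T: "T : ay d c"
 shows "alpha c T = beta c T"
proof (rule esheaf_separated[OF P c alpha(1)[OF c T] beta(1)[OF c T]])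
 show "cov c (\<lambda>f. rho f (alpha c T) = rho f (beta c T))"
 proof (rule cov_mono[OF c ayD(5)[OF T]])
  fix f b assume f: "f : hom C b c" and "\<exists>g. (f, g) : T"
  then obtain g where fg: "(f, g) : T" by blast
  note g = ayD(2)[OF T fg f]
  have r: "ayr d f T = ayr d g (ayu d)" using ay_pair_iff[OF T f g] fg by blast
  show "rho f (alpha c T) = rho f (beta c T)"
   using alpha(2)[OF f T] beta(2)[OF f T] alpha(2)[OF g ayu_mem[OF d]] beta(2)[OF g ayu_mem[OF d]] eq r by simp
 qed
qed

end

section \<open>Natural transformations, equivalences and functors to sets\<close>

lemma nat_transD:
 assumes "eta : nat_trans C D F G"
 shows "a : Obj C ==> eta a : hom D (on_obj F a) (on_obj G a)"
  "f : hom C a b ==> Comp D (on_arr G f) (eta a) = Comp D (eta b) (on_arr F f)"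
  "eta : extensional (Obj C)" using assms unfolding nat_trans_def hom_def by auto

lemma nat_isosD:
 assumes "eta : nat_isos C D F G" shows "eta : nat_trans C D F G" "a : Obj C ==> is_iso D (eta a)"
 using assms unfolding nat_isos_def by auto

lemma id_functor_simps [simp]:
 "a : Obj C ==> on_obj (id_functor C) a = a" "f : Arr C ==> on_arr (id_functor C) f = f" by (simp_all add: id_functor_def)

lemma iso_cancel_left:
 assumes C: "category C" and h: "h : hom C b c" "is_iso C h" and f: "f : hom C a b" and g: "g : hom C a b"
  and eq: "Comp C h f = Comp C h g"
 shows "f = g"
proof -
 obtain k where k: "k : hom C c b" "Comp C k h = Ident C b" using is_isoE[OF h(2,1)] by metis
 have "Comp C k (Comp C h f) = f" "Comp C k (Comp C h g) = g"
  using cat_assoc[OF C f h(1) k(1)] cat_assoc[OF C g h(1) k(1)] k(2) cat_ident_left[OF C f] cat_ident_left[OF C g] by simp_all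
 then show ?thesis using eq by metis
qed

lemma iso_cancel_right:
 assumes C: "category C" and h: "h : hom C a b" "is_iso C h" and f: "f : hom C b c" and g: "g : hom C b c"
  and eq: "Comp C f h = Comp C g h"
 shows "f = g"
proof -
 obtain k where k: "k : hom C b a" "Comp C h k = Ident C b" using is_isoE[OF h(2,1)] by metis
 have "Comp C (Comp C f h) k = f" "Comp C (Comp C g h) k = g"
  using cat_assoc[OF C k(1) h(1) f] cat_assoc[OF C k(1) h(1) g] k(2) cat_ident_right[OF C f] cat_ident_right[OF C g] by simp_all
 then show ?thesis using eq by metis
qed

lemma equivalence_faithful:
 assumes F: "is_functor C D F" and G: "is_functor D C G"
  and eta: "eta : nat_isos C C (id_functor C) (comp_functor C G F)"
  and f: "f : hom C a b" and g: "g : hom C a b" and eq: "on_arr F f = on_arr F g"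
 shows "f = g"
proof (rule iso_cancel_left[OF functor_cats(1)[OF F] _ nat_isosD(2)[OF eta] f g])
 note C = functor_cats(1)[OF F]
 show b: "b : Obj C" using cat_hom_obj(2)[OF C f] .
 show "eta b : hom C b (on_obj G (on_obj F b))" using nat_transD(1)[OF nat_isosD(1)[OF eta] b] b by (simp add: comp_functor_obj)
 have "Comp C (on_arr G (on_arr F f)) (eta a) = Comp C (eta b) f" "Comp C (on_arr G (on_arr F g)) (eta a) = Comp C (eta b) g"
  using nat_transD(2)[OF nat_isosD(1)[OF eta] f] nat_transD(2)[OF nat_isosD(1)[OF eta] g] homD(1)[OF f] homD(1)[OF g]
  by (simp_all add: comp_functor_arr)
 then show "Comp C (eta b) f = Comp C (eta b) g" using eq by metis
qed

lemma equivalence_fully_faithful: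
 assumes "equivalent_cats C D"
 obtains F where "fully_faithful C D F" "!!d. d : Obj D ==> \<exists>c\<in>Obj C. \<exists>theta\<in>hom D (on_obj F c) d. is_iso D theta"
proof -
 obtain F G eta eps where F: "is_functor C D F" and G: "is_functor D C G"
  and eta: "eta : nat_isos C C (id_functor C) (comp_functor C G F)"
  and eps: "eps : nat_isos D D (comp_functor D F G) (id_functor D)" using assms unfolding equivalent_cats_def by blast
 note C = functor_cats(1)[OF F] and D = functor_cats(2)[OF F]
 have eps1: "eps d : hom D (on_obj F (on_obj G d)) d" "is_iso D (eps d)" if "d : Obj D" for d
  using nat_transD(1)[OF nat_isosD(1)[OF eps] that] nat_isosD(2)[OF eps that] that by (simp_all add: comp_functor_obj)
 have eta1: "eta c : hom C c (on_obj G (on_obj F c))" "is_iso C (eta c)" if "c : Obj C" for c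
  using nat_transD(1)[OF nat_isosD(1)[OF eta] that] nat_isosD(2)[OF eta that] that by (simp_all add: comp_functor_obj)
 have Gf: "f = g" if f: "f : hom D a b" and g: "g : hom D a b" and eq: "on_arr G f = on_arr G g" for f g a b
 proof (rule iso_cancel_right[OF D _ _ f g])
  have a: "a : Obj D" using cat_hom_obj(1)[OF D f] .
  show "eps a : hom D (on_obj F (on_obj G a)) a" "is_iso D (eps a)" using eps1[OF a] by auto
  have "Comp D f (eps a) = Comp D (eps b) (on_arr F (on_arr G f))" "Comp D g (eps a) = Comp D (eps b) (on_arr F (on_arr G g))"
   using nat_transD(2)[OF nat_isosD(1)[OF eps] f] nat_transD(2)[OF nat_isosD(1)[OF eps] g] homD(1)[OF f] homD(1)[OF g]
   by (simp_all add: comp_functor_arr)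
  then show "Comp D f (eps a) = Comp D g (eps a)" using eq by metis
 qed
 have full: "\<exists>f\<in>hom C x y. on_arr F f = h" if x: "x : Obj C" and y: "y : Obj C" and h: "h : hom D (on_obj F x) (on_obj F y)" for x y h
 proof -
  obtain k where k: "k : hom C (on_obj G (on_obj F y)) y" "Comp C (eta y) k = Ident C (on_obj G (on_obj F y))"
   using is_isoE[OF eta1(2,1)[OF y]] by metis
  note Gh = functor_hom[OF G h]
  note Ghx = cat_comp[OF C eta1(1)[OF x] Gh]
  \<comment> \<open>The preimage forced by naturality of \<open>eta\<close>: the image of
    \<open>h\<close> under \<open>G\<close>, conjugated by the unit isomorphisms.\<close>
  let ?f = "Comp C k (Comp C (on_arr G h) (eta x))"
  have f: "?f : hom C x y" using cat_comp[OF C Ghx k(1)] .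
  note GF = functor_hom[OF G functor_hom[OF F f]]
  have "Comp C (on_arr G (on_arr F ?f)) (eta x) = Comp C (eta y) ?f"
   using nat_transD(2)[OF nat_isosD(1)[OF eta] f] homD(1)[OF f] by (simp add: comp_functor_arr)
  also have "\<dots> = Comp C (on_arr G h) (eta x)"
   using cat_assoc[OF C Ghx k(1) eta1(1)[OF y]] k(2) cat_ident_left[OF C Ghx] by simp
  finally have "on_arr G (on_arr F ?f) = on_arr G h" using iso_cancel_right[OF C eta1[OF x] GF Gh] by blast
  then show ?thesis using Gf[OF functor_hom[OF F f] h] f by blast
 qed
 have "fully_faithful C D F" unfolding fully_faithful_def bij_betw_def
 proof (intro conjI ballI F)
  fix x y assume x: "x : Obj C" and y: "y : Obj C"
  show "inj_on (on_arr F) (hom C x y)" by (rule inj_onI) (rule equivalence_faithful[OF F G eta])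
  show "on_arr F ` hom C x y = hom D (on_obj F x) (on_obj F y)" using functor_hom[OF F] full[OF x y] by blast
 qed
 then show thesis using that eps1 functor_obj[OF G] by blast
qed

lemma functor_cat_simps:
 "Obj (functor_cat C D X T) = X" "Ident (functor_cat C D X T) x = (x, \<lambda>a\<in>Obj C. Ident D (on_obj (T x) a), x)"
 "Comp (functor_cat C D X T) (y', theta, z) (x, eta, y) = (x, \<lambda>a\<in>Obj C. Comp D (theta a) (eta a), z)"
 by (simp_all add: functor_cat_def)

lemma hom_functor_cat:
 "t : hom (functor_cat C D X T) x y \<longleftrightarrow> x : X \<and> y : X \<and> (\<exists>eta\<in>nat_trans C D (T x) (T y). t = (x, eta, y))"
 by (auto simp: hom_def functor_cat_def)

lemma op_cat_simps [simp]:
 "Obj (op_cat C) = Obj C" "Arr (op_cat C) = Arr C" "Dom (op_cat C) = Cod C" "Cod (op_cat C) = Dom C"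
 "Ident (op_cat C) = Ident C" "Comp (op_cat C) g f = Comp C f g" by (simp_all add: op_cat_def)

lemma hom_op_cat: "hom (op_cat C) a b = hom C b a" by (auto simp: hom_def)

lemma category_op_cat: assumes C: "category C" shows "category (op_cat C)"
proof (rule categoryI, unfold hom_op_cat op_cat_simps)
 show "Cod C f : Obj C \<and> Dom C f : Obj C" if "f : Arr C" for f using cat_hom_obj[OF C hom_self[OF that]] by blast
 show "Ident C a : hom C a a" if "a : Obj C" for a using cat_ident[OF C that] .
 show "Comp C f g : hom C c a" if "f : hom C b a" "g : hom C c b" for f g a b c using cat_comp[OF C that(2,1)] .
 show "Comp C (Ident C a) f = f \<and> Comp C f (Ident C b) = f" if "f : hom C b a" for f a b
  using cat_ident_left[OF C that] cat_ident_right[OF C that] by blast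
 show "Comp C (Comp C f g) h = Comp C f (Comp C g h)" if "f : hom C b a" "g : hom C c b" "h : hom C d c" for f g h a b c d
  using cat_assoc[OF C that(3,2,1)] by simp
qed

lemma app_simp [simp]: "app (A, f, B) = f" by (simp add: app_def)

lemma category_sets_cat: "category (sets_cat P)"
proof (rule categoryI)
 show "Dom (sets_cat P) f : Obj (sets_cat P) \<and> Cod (sets_cat P) f : Obj (sets_cat P)" if "f : Arr (sets_cat P)" for f
  using that by (auto simp: sets_cat_def)
 show "Ident (sets_cat P) a : hom (sets_cat P) a a" if "a : Obj (sets_cat P)" for a using that by (auto simp: hom_sets_cat)
 show "Comp (sets_cat P) g f : hom (sets_cat P) a c" if "f : hom (sets_cat P) a b" "g : hom (sets_cat P) b c" for f g a b c
  using that by (fastforce simp: hom_sets_cat compose_def)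
 show "Comp (sets_cat P) f (Ident (sets_cat P) a) = f \<and> Comp (sets_cat P) (Ident (sets_cat P) b) f = f" if "f : hom (sets_cat P) a b" for f a b
  using that by (fastforce simp: hom_sets_cat compose_def fun_eq_iff PiE_def extensional_def Pi_def)
 show "Comp (sets_cat P) h (Comp (sets_cat P) g f) = Comp (sets_cat P) (Comp (sets_cat P) h g) f"
  if "f : hom (sets_cat P) a b" "g : hom (sets_cat P) b c" "h : hom (sets_cat P) c d" for f g h a b c d
  using that by (fastforce simp: hom_sets_cat compose_def fun_eq_iff PiE_def extensional_def Pi_def)
qed

lemma category_Set_cat: "category (Set_cat U)" unfolding Set_cat_def by (rule category_sets_cat)

lemma Obj_Set_cat: "Obj (Set_cat U) = {A. small U A}" by (simp add: Set_cat_def)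

lemma Set_hom:
 assumes "s : hom (Set_cat U) A B"
 shows "app s : A \<rightarrow>\<^sub>E B" "x : A ==> app s x : B" "s = (A, app s, B)" "small U A" "small U B"
 using hom_sets_catD[OF assms[unfolded Set_cat_def]] by (auto simp: Set_cat_def)

lemma Set_homI: "small U A ==> small U B ==> f : A \<rightarrow>\<^sub>E B ==> (A, f, B) : hom (Set_cat U) A B"
 by (simp add: Set_cat_def hom_sets_cat)

lemma Set_ext:
 assumes "s : hom (Set_cat U) A B" "t : hom (Set_cat U) A B" "!!x. x : A ==> app s x = app t x"
 shows "s = t"
proof -
 have "app s = app t" using Set_hom(1)[OF assms(1)] Set_hom(1)[OF assms(2)] assms(3) by (rule PiE_ext)
 then show ?thesis using Set_hom(3)[OF assms(1)] Set_hom(3)[OF assms(2)] by metis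
qed

lemma Set_comp:
 assumes "s : hom (Set_cat U) A B" "t : hom (Set_cat U) B D" "x : A"
 shows "app (Comp (Set_cat U) t s) x = app t (app s x)"
proof -
 have "Comp (Set_cat U) t s = (A, compose A (app t) (app s), D)"
  by (subst Set_hom(3)[OF assms(1)], subst Set_hom(3)[OF assms(2)]) (simp add: Set_cat_def)
 then show ?thesis using assms(3) by (simp add: compose_def)
qed

lemma Set_ident: "x : A ==> app (Ident (Set_cat U) A) x = x" by (simp add: Set_cat_def)

lemma Set_functor_app:
 assumes "is_functor C (Set_cat U) F"
 shows "f : hom C a b ==> x : on_obj F a ==> fapp F f x : on_obj F b"
  "f : hom C a b ==> g : hom C b c ==> x : on_obj F a ==> fapp F (Comp C g f) x = fapp F g (fapp F f x)"
  "a : Obj C ==> x : on_obj F a ==> fapp F (Ident C a) x = x"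
  "a : Obj C ==> small U (on_obj F a)"
proof -
 show "f : hom C a b ==> x : on_obj F a ==> fapp F f x : on_obj F b" using Set_hom(2)[OF functor_hom[OF assms]] .
 show "f : hom C a b ==> g : hom C b c ==> x : on_obj F a ==> fapp F (Comp C g f) x = fapp F g (fapp F f x)"
  using functor_comp[OF assms] Set_comp[OF functor_hom[OF assms] functor_hom[OF assms]] by metis
 show "a : Obj C ==> x : on_obj F a ==> fapp F (Ident C a) x = x" using functor_ident[OF assms] Set_ident by metis
 show "a : Obj C ==> small U (on_obj F a)" using functor_obj[OF assms] by (simp add: Obj_Set_cat)
qed

text \<open>Hides the bundled, extensional form of arrows between sets: functors can from now on be
  given by families of sets and functions on their elements.\<close>

lemma Set_functor_exists:
 fixes P :: "'o => 'u set" and U :: "'u itself"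
 assumes C: "category C" and P: "!!a. a : Obj C ==> small U (P a)"
  and rho: "!!f a b x. f : hom C a b ==> x : P a ==> rho f x : P b"
  and id: "!!a x. a : Obj C ==> x : P a ==> rho (Ident C a) x = x"
  and comp: "!!f g a b c x. f : hom C a b ==> g : hom C b c ==> x : P a ==> rho (Comp C g f) x = rho g (rho f x)"
 shows "\<exists>F. is_functor C (Set_cat U) F \<and> (\<forall>a\<in>Obj C. on_obj F a = P a) \<and>
  (\<forall>f a b x. f : hom C a b --> x : P a --> fapp F f x = rho f x)"
proof -
 let ?F = "\<lparr>on_obj = restrict P (Obj C), on_arr = (\<lambda>f\<in>Arr C. (P (Dom C f), restrict (rho f) (P (Dom C f)), P (Cod C f)))\<rparr>"
 have obj: "on_obj ?F a = P a" if "a : Obj C" for a using that by simp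
 have arr: "on_arr ?F f = (P a, restrict (rho f) (P a), P b)" if "f : hom C a b" for f a b using that by (simp add: hom_def)
 have h: "on_arr ?F f : hom (Set_cat U) (P a) (P b)" if f: "f : hom C a b" for f a b
  unfolding arr[OF f] by (rule Set_homI) (use P rho[OF f] cat_hom_obj[OF C f] in auto)
 have ap: "fapp ?F f x = rho f x" if "f : hom C a b" "x : P a" for f a b x unfolding arr[OF that(1)] using that(2) by simp
 have "is_functor C (Set_cat U) ?F"
 proof (rule functorI[OF C category_Set_cat])
  show "on_obj ?F : extensional (Obj C)" "on_arr ?F : extensional (Arr C)" by simp_all
  show "on_obj ?F a : Obj (Set_cat U)" if "a : Obj C" for a using P that by (simp add: Obj_Set_cat)
  show "on_arr ?F f : hom (Set_cat U) (on_obj ?F a) (on_obj ?F b)" if f: "f : hom C a b" for f a b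
   unfolding obj[OF cat_hom_obj(1)[OF C f]] obj[OF cat_hom_obj(2)[OF C f]] by (rule h[OF f])
  show "on_arr ?F (Ident C a) = Ident (Set_cat U) (on_obj ?F a)" if a: "a : Obj C" for a
   unfolding obj[OF a] arr[OF cat_ident[OF C a]] using restrict_ext[of "P a" "rho (Ident C a)" "\<lambda>x. x", OF id[OF a]] by (simp add: Set_cat_def)
  show "on_arr ?F (Comp C g f) = Comp (Set_cat U) (on_arr ?F g) (on_arr ?F f)" if f: "f : hom C a b" and g: "g : hom C b c" for f g a b c
  proof (rule Set_ext[OF h[OF cat_comp[OF C f g]] cat_comp[OF category_Set_cat h[OF f] h[OF g]]])
   fix x assume x: "x : P a"
   show "fapp ?F (Comp C g f) x = app (Comp (Set_cat U) (on_arr ?F g) (on_arr ?F f)) x"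
    unfolding Set_comp[OF h[OF f] h[OF g] x] ap[OF f x] ap[OF g rho[OF f x]] ap[OF cat_comp[OF C f g] x] using comp[OF f g x] .
  qed
 qed
 moreover have "\<forall>a\<in>Obj C. on_obj ?F a = P a" by simp
 moreover have "\<forall>f a b x. f : hom C a b --> x : P a --> fapp ?F f x = rho f x" using ap by blast
 ultimately show ?thesis by blast
qed

lemma Set_nat_trans_app:
 assumes "eta : nat_trans C (Set_cat U) F G" "is_functor C (Set_cat U) F" "is_functor C (Set_cat U) G"
 shows "a : Obj C ==> x : on_obj F a ==> app (eta a) x : on_obj G a"
  "f : hom C a b ==> x : on_obj F a ==> fapp G f (app (eta a) x) = app (eta b) (fapp F f x)"
proof -
 note n = nat_transD[OF assms(1)]
 show "a : Obj C ==> x : on_obj F a ==> app (eta a) x : on_obj G a" using Set_hom(2)[OF n(1)] .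
 assume f: "f : hom C a b" and x: "x : on_obj F a"
 have a: "a : Obj C" "b : Obj C" using cat_hom_obj[OF functor_cats(1)[OF assms(2)] f] by auto
 show "fapp G f (app (eta a) x) = app (eta b) (fapp F f x)"
  using Set_comp[OF n(1)[OF a(1)] functor_hom[OF assms(3) f] x] Set_comp[OF functor_hom[OF assms(2) f] n(1)[OF a(2)] x] n(2)[OF f] by simp
qed

lemma Set_nat_trans_exists:
 assumes F: "is_functor C (Set_cat U) F" and G: "is_functor C (Set_cat U) G"
  and alpha: "!!a x. a : Obj C ==> x : on_obj F a ==> alpha a x : on_obj G a"
  and nat: "!!f a b x. f : hom C a b ==> x : on_obj F a ==> fapp G f (alpha a x) = alpha b (fapp F f x)"
 shows "\<exists>eta\<in>nat_trans C (Set_cat U) F G. \<forall>a\<in>Obj C. \<forall>x\<in>on_obj F a. app (eta a) x = alpha a x"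
proof -
 note C = functor_cats(1)[OF F]
 let ?eta = "\<lambda>a\<in>Obj C. (on_obj F a, restrict (alpha a) (on_obj F a), on_obj G a)"
 have h: "?eta a : hom (Set_cat U) (on_obj F a) (on_obj G a)" if a: "a : Obj C" for a
 proof -
  have "(on_obj F a, restrict (alpha a) (on_obj F a), on_obj G a) : hom (Set_cat U) (on_obj F a) (on_obj G a)"
   by (rule Set_homI) (use Set_functor_app(4)[OF F a] Set_functor_app(4)[OF G a] alpha[OF a] in auto)
  then show ?thesis using a by simp
 qed
 have ap: "app (?eta a) x = alpha a x" if "a : Obj C" "x : on_obj F a" for a x using that by simp
 have "?eta : nat_trans C (Set_cat U) F G" unfolding nat_trans_def mem_Collect_eq
 proof (intro conjI ballI)
  show "?eta : extensional (Obj C)" by simp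
  show "?eta a : hom (Set_cat U) (on_obj F a) (on_obj G a)" if "a : Obj C" for a using h[OF that] .
  fix f assume "f : Arr C"
  then have f: "f : hom C (Dom C f) (Cod C f)" by (rule hom_self)
  note o = cat_hom_obj[OF C f]
  note Ff = functor_hom[OF F f] and Gf = functor_hom[OF G f]
  show "Comp (Set_cat U) (on_arr G f) (?eta (Dom C f)) = Comp (Set_cat U) (?eta (Cod C f)) (on_arr F f)"
  proof (rule Set_ext[OF cat_comp[OF category_Set_cat h[OF o(1)] Gf] cat_comp[OF category_Set_cat Ff h[OF o(2)]]])
   fix x assume x: "x : on_obj F (Dom C f)"
   show "app (Comp (Set_cat U) (on_arr G f) (?eta (Dom C f))) x = app (Comp (Set_cat U) (?eta (Cod C f)) (on_arr F f)) x"
    unfolding Set_comp[OF h[OF o(1)] Gf x] Set_comp[OF Ff h[OF o(2)] x] ap[OF o(1) x] ap[OF o(2) Set_functor_app(1)[OF F f x]]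
    using nat[OF f x] .
  qed
 qed
 then show ?thesis using ap by blast
qed

lemma Set_nat_trans_ext:
 assumes "eta : nat_trans C (Set_cat U) F G" "theta : nat_trans C (Set_cat U) F G"
  "!!a x. a : Obj C ==> x : on_obj F a ==> app (eta a) x = app (theta a) x"
 shows "eta = theta"
proof (rule extensionalityI[OF nat_transD(3)[OF assms(1)] nat_transD(3)[OF assms(2)]])
 show "eta a = theta a" if a: "a : Obj C" for a
  by (rule Set_ext[OF nat_transD(1)[OF assms(1) a] nat_transD(1)[OF assms(2) a]]) (rule assms(3)[OF a])
qed

section \<open>Small sheaves and a concrete model of the topos\<close>

locale universe_site = universe U + site C J for U :: "'u itself" and C :: "('c, 'd) cat" and J
begin

text \<open>The fibres are encoded in \<open>'u\<close> one at a time and may overlap there;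
  restriction therefore consults source and target of \<open>f\<close> to know which encodings to
  undo and to apply.\<close>

lemma esheaf_encode:
 fixes P :: "'c => 'x set"
 assumes P: "esheaf P rho" and s: "!!c. c : Obj C ==> sm (P c)"
 shows "\<exists>(Q :: 'c => 'u set) sigma i. esheaf Q sigma \<and> (\<forall>c\<in>Obj C. sm (Q c)) \<and> esheaf_iso Q sigma P rho i"
proof -
 have "\<exists>e :: 'x => 'u. inj_on e (P c) \<and> sm (e ` P c)" if "c : Obj C" for c using sm_obtain_inj[OF s[OF that]] by metis
 then obtain e :: "'c => 'x => 'u" where e: "!!c. c : Obj C ==> inj_on (e c) (P c)" "!!c. c : Obj C ==> sm (e c ` P c)" by metis
 define i where "i c = inv_into (P c) (e c)" for c
 have ie: "i c (e c x) = x" if "c : Obj C" "x : P c" for c x unfolding i_def using e(1)[OF that(1)] that(2) by simp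
 let ?sigma = "\<lambda>f z. e (Dom C f) (rho f (i (Cod C f) z))"
 have Q: "esheaf (\<lambda>c. e c ` P c) ?sigma"
 proof (rule esheaf_transport[OF P])
  show "bij_betw (e c) (P c) (e c ` P c)" if "c : Obj C" for c using e(1)[OF that] by (simp add: bij_betw_def)
  show "e a (rho f x) = ?sigma f (e b x)" if "f : hom C a b" "x : P b" for a b f x
   using ie[OF hom_objs(2)[OF that(1)] that(2)] homD(2,3)[OF that(1)] by simp
 qed
 have "esheaf_iso (\<lambda>c. e c ` P c) ?sigma P rho i" unfolding esheaf_iso_def
 proof (intro conjI ballI allI impI)
  show "bij_betw (i c) (e c ` P c) (P c)" if c: "c : Obj C" for c
   unfolding i_def using e(1)[OF c] by (simp add: bij_betw_inv_into inj_on_imp_bij_betw)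
  fix a b f x assume "f : hom C a b \<and> x : e b ` P b"
  then obtain p where f: "f : hom C a b" and p: "p : P b" "x = e b p" by blast
  then show "i a (?sigma f x) = rho f (i b x)"
   using ie[OF hom_objs(2)[OF f] p(1)] ie[OF hom_objs(1)[OF f] esheafD(1)[OF P f p(1)]] homD(2,3)[OF f] by simp
 qed
 then show ?thesis using Q e(2) by (intro exI conjI) auto
qed

lemma esheaf_iso_comp:
 assumes 1: "esheaf_iso P rho Q sigma theta" and 2: "esheaf_iso Q sigma Z tau i"
 shows "esheaf_iso P rho Z tau (\<lambda>c x. i c (theta c x))" unfolding esheaf_iso_def
proof (intro conjI ballI allI impI)
 fix c assume c: "c : Obj C"
 have "bij_betw (theta c) (P c) (Q c)" "bij_betw (i c) (Q c) (Z c)" using 1 2 c unfolding esheaf_iso_def by blast+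
 from bij_betw_trans[OF this] show "bij_betw (\<lambda>x. i c (theta c x)) (P c) (Z c)" unfolding comp_def .
next
 fix a b f x assume "f : hom C a b \<and> x : P b"
 then have f: "f : hom C a b" and x: "x : P b" by auto
 have "theta b x : Q b" using 1 hom_objs(2)[OF f] x unfolding esheaf_iso_def bij_betw_def by blast
 then show "i a (theta a (rho f x)) = tau f (i b (theta b x))" using 1 2 f x unfolding esheaf_iso_def by metis
qed

end

text \<open>What is kept of an equivalence of \<open>E\<close> with the small sheaves on a site:
  \<open>V e\<close> and \<open>R e\<close> are the sections and restrictions of the sheaf of
  \<open>e\<close>, and \<open>W t\<close> is the action of an arrow on sections. The last three
  assumptions are faithfulness, fullness and essential surjectivity.\<close>

locale sheaf_model = universe_site U C J
 for U :: "'u itself" and C :: "('c, 'd) cat" and J +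
 fixes E :: "('o, 'm) cat" and V :: "'o => 'c => 'u set" and R :: "'o => 'd => 'u => 'u" and W :: "'m => 'c => 'u => 'u"
 assumes catE: "category E" and sm_ArrC: "sm (Arr C)"
  and V_sheaf: "e : Obj E ==> esheaf (V e) (R e)"
  and V_sm: "e : Obj E ==> c : Obj C ==> sm (V e c)"
  and W_mem: "t : hom E e e' ==> c : Obj C ==> x : V e c ==> W t c x : V e' c"
  and W_nat: "t : hom E e e' ==> f : hom C a b ==> x : V e b ==> W t a (R e f x) = R e' f (W t b x)"
  and W_ident: "e : Obj E ==> c : Obj C ==> x : V e c ==> W (Ident E e) c x = x"
  and W_comp: "s : hom E e e' ==> t : hom E e' e'' ==> c : Obj C ==> x : V e c ==> W (Comp E t s) c x = W t c (W s c x)"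
  and W_faithful: "s : hom E e e' ==> t : hom E e e' ==>
   (!!c x. c : Obj C ==> x : V e c ==> W s c x = W t c x) ==> s = t"
  and W_full: "e : Obj E ==> e' : Obj E ==> (!!c x. c : Obj C ==> x : V e c ==> alpha c x : V e' c) ==>
   (!!f a b x. f : hom C a b ==> x : V e b ==> alpha a (R e f x) = R e' f (alpha b x)) ==>
   \<exists>t\<in>hom E e e'. \<forall>c\<in>Obj C. \<forall>x\<in>V e c. W t c x = alpha c x"
  and V_rep: "esheaf (P :: 'c => 'u set) rho ==> (!!c. c : Obj C ==> sm (P c)) ==>
   \<exists>e\<in>Obj E. \<exists>theta. esheaf_iso (V e) (R e) P rho theta"

locale small_site = universe_site U C J for U :: "'u itself" and C :: "('c, 'd) cat" and J +
 assumes sm_ArrC': "sm (Arr C)"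
begin

abbreviation "SH \<equiv> sheaf_cat U C J"

lemma sheaf_esheaf:
 assumes "is_sheaf U C J P"
 shows "esheaf (on_obj P) (\<lambda>f. fapp P f)" "is_functor (op_cat C) (Set_cat U) P"
proof -
 show F: "is_functor (op_cat C) (Set_cat U) P" using assms unfolding is_sheaf_def presheaf_def by blast
 note a = Set_functor_app[OF F, unfolded hom_op_cat]
 show "esheaf (on_obj P) (\<lambda>f. fapp P f)" unfolding esheaf_def
 proof (intro conjI allI ballI impI)
  show "fapp P f x : on_obj P a" if "f : hom C a b \<and> x : on_obj P b" for a b f x using a(1) that by blast
  show "fapp P (Ident C c) x = x" if "c : Obj C" "x : on_obj P c" for c x using a(3) that by simp
  show "fapp P (f \<cdot> g) x = fapp P g (fapp P f x)" if "f : hom C b c \<and> g : hom C a b \<and> x : on_obj P c" for a b c f g x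
  proof -
   have "fapp P (Comp (op_cat C) g f) x = fapp P g (fapp P f x)" using a(2) that by blast
   then show ?thesis by simp
  qed
  fix c S x assume c: "c : Obj C" and S: "S : J c"
   and x: "(\<forall>f\<in>S. x f : on_obj P (Dom C f)) \<and> (\<forall>f\<in>S. \<forall>b. \<forall>g\<in>hom C b (Dom C f). fapp P g (x f) = x (f \<cdot> g))"
  have "matching_family C P S x" unfolding matching_family_def using x by (auto simp: hom_def)
  then show "\<exists>!y. y : on_obj P c \<and> (\<forall>f\<in>S. fapp P f y = x f)"
   using assms c S unfolding is_sheaf_def by blast
 qed
qed

lemma esheaf_sheaf:
 fixes P :: "'c => 'u set"
 assumes P: "esheaf P rho" and s: "!!c. c : Obj C ==> sm (P c)"
 shows "\<exists>F. is_sheaf U C J F \<and> (\<forall>c\<in>Obj C. on_obj F c = P c) \<and> (\<forall>f a b x. f : hom C a b --> x : P b --> fapp F f x = rho f x)"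
proof -
 note e = esheafD[OF P]
 have "\<exists>F. is_functor (op_cat C) (Set_cat U) F \<and> (\<forall>a\<in>Obj (op_cat C). on_obj F a = P a) \<and>
  (\<forall>f a b x. f : hom (op_cat C) a b --> x : P a --> fapp F f x = rho f x)"
  by (rule Set_functor_exists[OF category_op_cat[OF catC]]) (use s e in \<open>auto simp: hom_op_cat\<close>)
 then obtain F where F0: "is_functor (op_cat C) (Set_cat U) F" "\<forall>a\<in>Obj (op_cat C). on_obj F a = P a"
  "\<forall>f a b x. f : hom (op_cat C) a b --> x : P a --> fapp F f x = rho f x" by blast
 have F: "is_functor (op_cat C) (Set_cat U) F" "!!c. c : Obj C ==> on_obj F c = P c"
  "!!f a b x. f : hom C a b ==> x : P b ==> fapp F f x = rho f x" using F0 unfolding hom_op_cat op_cat_simps by blast+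
 have "is_sheaf U C J F" unfolding is_sheaf_def presheaf_def
 proof (intro conjI F(1) ballI allI impI)
  fix c S x assume c: "c : Obj C" and S: "S : J c" and x: "matching_family C F S x"
  note Sh = cover_hom[OF c S]
  have x1: "x f : P (Dom C f)" if "f : S" for f
   using x that F(2)[OF hom_objs(1)[OF Sh[OF that]]] unfolding matching_family_def by metis
  have "\<exists>!y. y : P c \<and> (\<forall>f\<in>S. rho f y = x f)"
  proof (rule esheaf_glue[OF P c S x1])
   show "rho g (x f) = x (f \<cdot> g)" if f: "f : S" and g: "g : hom C b (Dom C f)" for f b g
    using x f homD(1,3)[OF g] F(3)[OF g x1[OF f]] unfolding matching_family_def by metis
  qed
  moreover have "(y : on_obj F c \<and> (\<forall>f\<in>S. fapp F f y = x f)) \<longleftrightarrow> (y : P c \<and> (\<forall>f\<in>S. rho f y = x f))" for y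
   using F(2)[OF c] F(3)[OF Sh] by auto
  ultimately show "\<exists>!y. y : on_obj F c \<and> (\<forall>f\<in>S. fapp F f y = x f)" by simp
 qed
 then show ?thesis using F by blast
qed

lemma hom_SH: "t : hom SH P Q \<longleftrightarrow> is_sheaf U C J P \<and> is_sheaf U C J Q \<and> (\<exists>eta\<in>nat_trans (op_cat C) (Set_cat U) P Q. t = (P, eta, Q))"
 unfolding sheaf_cat_def hom_functor_cat by simp

lemma topos_model:
 fixes E :: "('o, 'm) cat"
 assumes ff: "fully_faithful E SH F" and ess: "!!d. d : Obj SH ==> \<exists>c\<in>Obj E. \<exists>theta\<in>hom SH (on_obj F c) d. is_iso SH theta"
 shows "sheaf_model U C J E (\<lambda>e. on_obj (on_obj F e)) (\<lambda>e f. fapp (on_obj F e) f)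
  (\<lambda>t c. app (fst (snd (on_arr F t)) c))"
proof -
 note F = fully_faithfulD(1)[OF ff]
 let ?V = "\<lambda>e. on_obj (on_obj F e)" and ?R = "\<lambda>e f. fapp (on_obj F e) f"
 \<comment> \<open>An arrow of the sheaf category is a triple with the natural transformation in the
   middle.\<close>
 let ?ev = "\<lambda>t c. app (fst (snd t) c)" let ?W = "\<lambda>t. ?ev (on_arr F t)"
 have sh: "is_sheaf U C J (on_obj F e)" if "e : Obj E" for e
  using functor_obj[OF F that] by (simp add: sheaf_cat_def functor_cat_simps)
 have ev: "fst (snd t) : nat_trans (op_cat C) (Set_cat U) P Q" "t = (P, fst (snd t), Q)" "is_sheaf U C J P" "is_sheaf U C J Q"
  if "t : hom SH P Q" for t P Q using that unfolding hom_SH by auto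
 have ev_nat: "c : Obj C ==> x : on_obj P c ==> ?ev t c x : on_obj Q c"
  "f : hom C a b ==> x : on_obj P b ==> ?ev t a (fapp P f x) = fapp Q f (?ev t b x)"
  if t: "t : hom SH P Q" for t P Q c x f a b
  using Set_nat_trans_app[OF ev(1)[OF t] sheaf_esheaf(2)[OF ev(3)[OF t]] sheaf_esheaf(2)[OF ev(4)[OF t]], unfolded hom_op_cat]
  by auto
 have ev_comp: "?ev (Comp SH t s) c x = ?ev t c (?ev s c x)"
  if s: "s : hom SH P Q" and t: "t : hom SH Q Z" and c: "c : Obj C" and x: "x : on_obj P c" for s t P Q Z c x
 proof -
  have "Comp SH t s = (P, \<lambda>a\<in>Obj C. Comp (Set_cat U) (fst (snd t) a) (fst (snd s) a), Z)"
   by (subst ev(2)[OF s], subst ev(2)[OF t]) (simp add: sheaf_cat_def functor_cat_simps)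
  then show ?thesis using Set_comp[OF nat_transD(1)[OF ev(1)[OF s]] nat_transD(1)[OF ev(1)[OF t]] x] c by simp
 qed
 have ev_id: "?ev (Ident SH P) c x = x" if "c : Obj C" "x : on_obj P c" for P c x
  using that Set_ident by (simp add: sheaf_cat_def functor_cat_simps)
 have ev_ext: "s = t" if s: "s : hom SH P Q" and t: "t : hom SH P Q" and eq: "!!c x. c : Obj C ==> x : on_obj P c ==> ?ev s c x = ?ev t c x" for s t P Q
 proof -
  have "fst (snd s) = fst (snd t)" by (rule Set_nat_trans_ext[OF ev(1)[OF s] ev(1)[OF t]]) (use eq in simp)
  then show ?thesis using ev(2)[OF s] ev(2)[OF t] by metis
 qed
 show ?thesis
 proof
  show "category E" using functor_cats(1)[OF F] .
  show "sm (Arr C)" by (rule sm_ArrC')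
  show "esheaf (?V e) (?R e)" if "e : Obj E" for e using sheaf_esheaf(1)[OF sh[OF that]] .
  show "sm (?V e c)" if "e : Obj E" "c : Obj C" for e c
   using Set_functor_app(4)[OF sheaf_esheaf(2)[OF sh[OF that(1)]]] that(2) by simp
  show "?W t c x : ?V e' c" if "t : hom E e e'" "c : Obj C" "x : ?V e c" for t e e' c x
   using ev_nat(1)[OF functor_hom[OF F that(1)] that(2,3)] .
  show "?W t a (?R e f x) = ?R e' f (?W t b x)" if "t : hom E e e'" "f : hom C a b" "x : ?V e b" for t e e' f a b x
   using ev_nat(2)[OF functor_hom[OF F that(1)] that(2,3)] .
  show "?W (Ident E e) c x = x" if "e : Obj E" "c : Obj C" "x : ?V e c" for e c x
   using ev_id[OF that(2,3)] functor_ident[OF F that(1)] by simp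
  show "?W (Comp E t s) c x = ?W t c (?W s c x)" if "s : hom E e e'" "t : hom E e' e''" "c : Obj C" "x : ?V e c" for s e e' t e'' c x
   using ev_comp[OF functor_hom[OF F that(1)] functor_hom[OF F that(2)] that(3,4)] functor_comp[OF F that(1,2)] by simp
  show "s = t" if "s : hom E e e'" "t : hom E e e'" "!!c x. c : Obj C ==> x : ?V e c ==> ?W s c x = ?W t c x" for s e e' t
   using fully_faithfulD(2)[OF ff that(1,2)] ev_ext[OF functor_hom[OF F that(1)] functor_hom[OF F that(2)]] that(3) by blast
  show "\<exists>t\<in>hom E e e'. \<forall>c\<in>Obj C. \<forall>x\<in>?V e c. ?W t c x = alpha c x"
   if e: "e : Obj E" "e' : Obj E" and alpha: "!!c x. c : Obj C ==> x : ?V e c ==> alpha c x : ?V e' c"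
    "!!f a b x. f : hom C a b ==> x : ?V e b ==> alpha a (?R e f x) = ?R e' f (alpha b x)" for e e' alpha
  proof -
   have "\<exists>eta\<in>nat_trans (op_cat C) (Set_cat U) (on_obj F e) (on_obj F e'). \<forall>a\<in>Obj (op_cat C). \<forall>x\<in>on_obj (on_obj F e) a. app (eta a) x = alpha a x"
    by (rule Set_nat_trans_exists[OF sheaf_esheaf(2)[OF sh[OF e(1)]] sheaf_esheaf(2)[OF sh[OF e(2)]]]) (use alpha in \<open>auto simp: hom_op_cat\<close>)
   then obtain eta where eta: "eta : nat_trans (op_cat C) (Set_cat U) (on_obj F e) (on_obj F e')"
    "!!a x. a : Obj C ==> x : ?V e a ==> app (eta a) x = alpha a x" by auto
   have "(on_obj F e, eta, on_obj F e') : hom SH (on_obj F e) (on_obj F e')" using eta(1) sh e unfolding hom_SH by blast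
   then obtain t where t: "t : hom E e e'" "on_arr F t = (on_obj F e, eta, on_obj F e')" using fully_faithfulD(3)[OF ff e] by blast
   then show ?thesis using eta(2) by (intro bexI[of _ t]) simp_all
  qed
  show "\<exists>e\<in>Obj E. \<exists>theta. esheaf_iso (?V e) (?R e) P rho theta" if P: "esheaf P rho" and s: "!!c. c : Obj C ==> sm (P c)" for P :: "'c => 'u set" and rho
  proof -
   obtain Q where Q: "is_sheaf U C J Q" "!!c. c : Obj C ==> on_obj Q c = P c" "!!f a b x. f : hom C a b ==> x : P b ==> fapp Q f x = rho f x"
    using esheaf_sheaf[OF P s] by blast
   have "Q : Obj SH" using Q(1) by (simp add: sheaf_cat_def functor_cat_simps)
   then obtain e theta where e: "e : Obj E" "theta : hom SH (on_obj F e) Q" "is_iso SH theta" using ess by blast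
   obtain psi where psi: "psi : hom SH Q (on_obj F e)" "Comp SH psi theta = Ident SH (on_obj F e)" "Comp SH theta psi = Ident SH Q"
    using is_isoE[OF e(3,2)] .
   have "esheaf_iso (?V e) (?R e) P rho (?ev theta)" unfolding esheaf_iso_def
   proof (intro conjI ballI allI impI)
    fix c assume c: "c : Obj C"
    have 1: "?ev psi c (?ev theta c x) = x" if "x : ?V e c" for x
     using ev_comp[OF e(2) psi(1) c that] psi(2) ev_id[OF c that] by simp
    have 2: "?ev theta c (?ev psi c x) = x" if "x : P c" for x
     using ev_comp[OF psi(1) e(2) c, of x] psi(3) ev_id[OF c, of x Q] that Q(2)[OF c] by simp
    show "bij_betw (?ev theta c) (?V e c) (P c)" by (rule bij_betw_byWitness[where f' = "?ev psi c"])
      (use 1 2 ev_nat(1)[OF e(2) c] ev_nat(1)[OF psi(1) c] Q(2)[OF c] in auto)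
   next
    fix a b f x assume "f : hom C a b \<and> x : ?V e b"
    then have f: "f : hom C a b" and x: "x : ?V e b" by auto
    show "?ev theta a (?R e f x) = rho f (?ev theta b x)"
     using ev_nat(2)[OF e(2) f x] Q(3)[OF f] ev_nat(1)[OF e(2) hom_objs(2)[OF f] x] Q(2)[OF hom_objs(2)[OF f]] by simp
   qed
   then show ?thesis using e(1) by blast
  qed
 qed
qed

end

lemma (in universe) grothendieck_topos_model:
 fixes E :: "('o, 'm) cat"
 assumes "grothendieck_topos U E"
 shows "\<exists>(C :: ('u, 'u) cat) J V R W. sheaf_model U C J E V R W"
proof -
 obtain C :: "('u, 'u) cat" and J where C: "small_category U C" "grothendieck_topology C J" and eq: "equivalent_cats E (sheaf_cat U C J)"
  using assms unfolding grothendieck_topos_def by blast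
 interpret small_site U C J by unfold_locales (use C in \<open>auto simp: small_category_def\<close>)
 obtain F where "fully_faithful E SH F" "!!d. d : Obj SH ==> \<exists>c\<in>Obj E. \<exists>theta\<in>hom SH (on_obj F c) d. is_iso SH theta"
  using equivalence_fully_faithful[OF eq] by metis
 then show ?thesis using topos_model by blast
qed

text \<open>The objects \<open>y0 c\<close> stand for the sheafified representables, and the
  sections of \<open>e\<close> over \<open>c\<close> have become arrows
  \<open>y0 c \<rightarrow> e\<close>, so that Yoneda is built in. Fullness and faithfulness of
  \<open>y1\<close> are only local, the topology being arbitrary. Apart from the decomposition into
  atoms, \<open>E\<close> is used from here on only through these properties.\<close>

locale dense_site = universe_site U C J
 for U :: "'u itself" and C :: "('c, 'd) cat" and J +
 fixes E :: "('o, 'm) cat" and y0 :: "'c => 'o" and y1 :: "'d => 'm"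
 assumes catE: "category E" and sm_ArrC: "sm (Arr C)"
  and y_obj: "c : Obj C ==> y0 c : Obj E"
  and y_hom: "f : hom C a b ==> y1 f : hom E (y0 a) (y0 b)"
  and y_comp: "f : hom C b c ==> g : hom C a b ==> y1 (Comp C f g) = Comp E (y1 f) (y1 g)"
  and y_full: "c : Obj C ==> d : Obj C ==> t : hom E (y0 c) (y0 d) ==>
   cov c (\<lambda>f. \<exists>g\<in>hom C (Dom C f) d. Comp E t (y1 f) = y1 g)"
  and y_faithful: "f : hom C c d ==> g : hom C c d ==> y1 f = y1 g ==> cov c (\<lambda>h. Comp C f h = Comp C g h)"
  and y_sheaf: "e : Obj E ==> esheaf (\<lambda>c. hom E (y0 c) e) (\<lambda>f xi. Comp E xi (y1 f))"
  and y_sm: "c : Obj C ==> e : Obj E ==> sm (hom E (y0 c) e)"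
  and y_rep: "esheaf (P :: 'c => 'u set) rho ==> (!!c. c : Obj C ==> sm (P c)) ==>
   \<exists>e\<in>Obj E. \<exists>theta. esheaf_iso (\<lambda>c. hom E (y0 c) e) (\<lambda>f xi. Comp E xi (y1 f)) P rho theta"
  and y_ext: "s : hom E e e' ==> t : hom E e e' ==>
   (!!c xi. c : Obj C ==> xi : hom E (y0 c) e ==> Comp E s xi = Comp E t xi) ==> s = t"
  and y_dense: "e : Obj E ==> e' : Obj E ==>
   (!!c xi. c : Obj C ==> xi : hom E (y0 c) e ==> alpha c xi : hom E (y0 c) e') ==>
   (!!f a b xi. f : hom C a b ==> xi : hom E (y0 b) e ==> alpha a (Comp E xi (y1 f)) = Comp E (alpha b xi) (y1 f)) ==>
   \<exists>t\<in>hom E e e'. \<forall>c\<in>Obj C. \<forall>xi\<in>hom E (y0 c) e. Comp E t xi = alpha c xi"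

section \<open>The dense family of sheafified representables\<close>

context sheaf_model
begin

lemma sm_ay: "sm (ay d c)"
proof (rule sm_subset[OF sm_Pow[OF sm_Times[OF sm_ArrC sm_ArrC]]])
 show "ay d c \<subseteq> Pow (Arr C \<times> Arr C)"
 proof (intro subsetI PowI)
  fix T p assume "T : ay d c" "p : T"
  then show "p : Arr C \<times> Arr C" using ayD(1)[of T d c "fst p" "snd p"] homD(1) by (cases p) fastforce
 qed
qed

lemma V_rep_any:
 fixes P :: "'c => 'x set"
 assumes P: "esheaf P rho" and s: "!!c. c : Obj C ==> sm (P c)"
 shows "\<exists>e\<in>Obj E. \<exists>theta. esheaf_iso (V e) (R e) P rho theta"
proof -
 obtain Q :: "'c => 'u set" and sigma i where Q: "esheaf Q sigma" "\<forall>c\<in>Obj C. sm (Q c)" "esheaf_iso Q sigma P rho i"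
  using esheaf_encode[OF P s] by blast
 have "\<exists>e\<in>Obj E. \<exists>theta. esheaf_iso (V e) (R e) Q sigma theta" by (rule V_rep[OF Q(1)]) (use Q(2) in blast)
 then show ?thesis using esheaf_iso_comp[OF _ Q(3)] by blast
qed

text \<open>\<open>e\<close> represents the sections over \<open>d\<close>, with universal section
  \<open>u\<close>. The last two clauses recall that it is the sheafification of a representable:
  locally every section is a restriction of \<open>u\<close>, and arrows with the same restriction
  of \<open>u\<close> are locally equal.\<close>

definition universal :: "'c => 'o => 'u => bool" where
 "universal d e u \<longleftrightarrow> e : Obj E \<and> u : V e d \<and>
   (\<forall>e'\<in>Obj E. \<forall>x\<in>V e' d. \<exists>t\<in>hom E e e'. W t d u = x) \<and>
   (\<forall>e'. \<forall>s\<in>hom E e e'. \<forall>t\<in>hom E e e'. W s d u = W t d u --> s = t) \<and>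
   (\<forall>c\<in>Obj C. \<forall>z\<in>V e c. cov c (\<lambda>f. \<exists>g\<in>hom C (Dom C f) d. R e f z = R e g u)) \<and>
   (\<forall>c f g. f : hom C c d \<and> g : hom C c d \<and> R e f u = R e g u --> cov c (\<lambda>h. f \<cdot> h = g \<cdot> h))"

text \<open>The object that represents the sheaf \<open>ay d\<close>, with the section that
  corresponds to \<open>ayu d\<close>; each clause is the matching fact on \<open>ay\<close> carried
  along the isomorphism \<open>theta\<close> and its inverse \<open>psi\<close>.\<close>

lemma universal_exists:
 assumes d: "d : Obj C" shows "\<exists>e u. universal d e u"
proof -
 obtain e theta where e: "e : Obj E" and theta: "esheaf_iso (V e) (R e) (ay d) (ayr d) theta" using V_rep_any[OF esheaf_ay sm_ay] by blast
 have bij: "bij_betw (theta c) (V e c) (ay d c)" if "c : Obj C" for c using theta that unfolding esheaf_iso_def by blast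
 have nat: "theta a (R e f x) = ayr d f (theta b x)" if "f : hom C a b" "x : V e b" for a b f x using theta that unfolding esheaf_iso_def by blast
 define psi where "psi c = inv_into (V e c) (theta c)" for c
 have psi1: "psi c (theta c x) = x" if "c : Obj C" "x : V e c" for c x
  unfolding psi_def using bij_betw_inv_into_left[OF bij[OF that(1)] that(2)] .
 have psi2: "theta c (psi c T) = T" "psi c T : V e c" if "c : Obj C" "T : ay d c" for c T
  unfolding psi_def using bij_betw_inv_into_right[OF bij[OF that(1)] that(2)] bij_betwE[OF bij_betw_inv_into[OF bij[OF that(1)]]] that(2) by auto
 have thetam: "theta c x : ay d c" if "c : Obj C" "x : V e c" for c x using bij_betwE[OF bij[OF that(1)]] that(2) by blast
 have psin: "psi a (ayr d f T) = R e f (psi b T)" if f: "f : hom C a b" and T: "T : ay d b" for a b f T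
 proof -
  note b = hom_objs(2)[OF f] and a = hom_objs(1)[OF f]
  have "theta a (R e f (psi b T)) = ayr d f T" using nat[OF f psi2(2)[OF b T]] psi2(1)[OF b T] by simp
  then show ?thesis using psi1[OF a esheafD(1)[OF V_sheaf[OF e] f psi2(2)[OF b T]]] by metis
 qed
 note ud = ayu_mem[OF d]
 define u where "u = psi d (ayu d)"
 have u: "u : V e d" "theta d u = ayu d" unfolding u_def using psi2[OF d ud] by auto
 have thetainj: "x = x'" if "c : Obj C" "x : V e c" "x' : V e c" "theta c x = theta c x'" for c x x' using psi1 that by metis
 have "universal d e u" unfolding universal_def
 proof (intro conjI ballI allI impI e u(1))
  fix e' x assume e': "e' : Obj E" and x: "x : V e' d"
  obtain alpha where alpha: "!!c T. c : Obj C ==> T : ay d c ==> alpha c T : V e' c"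
   "!!a b k T. k : hom C a b ==> T : ay d b ==> alpha a (ayr d k T) = R e' k (alpha b T)" "alpha d (ayu d) = x"
   using ay_universal[OF V_sheaf[OF e'] d x] by blast
  have "\<exists>t\<in>hom E e e'. \<forall>c\<in>Obj C. \<forall>z\<in>V e c. W t c z = alpha c (theta c z)"
   by (rule W_full[OF e e']) (use alpha thetam nat hom_objs(2) in auto)
  then show "\<exists>t\<in>hom E e e'. W t d u = x" using alpha(3) d u by metis
 next
  fix e' s t assume s: "s : hom E e e'" and t: "t : hom E e e'" and eq: "W s d u = W t d u"
  note e' = cat_hom_obj(2)[OF catE s]
  have m: "W s c (psi c T) = W t c (psi c T)" if c: "c : Obj C" and T: "T : ay d c" for c T
  proof (rule ay_ext[OF V_sheaf[OF e'] d _ _ _ _ _ c T])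
   show "W s c (psi c T) : V e' c" if "c : Obj C" "T : ay d c" for c T using W_mem[OF s that(1) psi2(2)[OF that]] .
   show "W t c (psi c T) : V e' c" if "c : Obj C" "T : ay d c" for c T using W_mem[OF t that(1) psi2(2)[OF that]] .
   show "W s a (psi a (ayr d k T)) = R e' k (W s b (psi b T))" if "k : hom C a b" "T : ay d b" for a b k T
    using psin[OF that] W_nat[OF s that(1) psi2(2)[OF hom_objs(2)[OF that(1)] that(2)]] by simp
   show "W t a (psi a (ayr d k T)) = R e' k (W t b (psi b T))" if "k : hom C a b" "T : ay d b" for a b k T
    using psin[OF that] W_nat[OF t that(1) psi2(2)[OF hom_objs(2)[OF that(1)] that(2)]] by simp
   show "W s d (psi d (ayu d)) = W t d (psi d (ayu d))" using eq unfolding u_def .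
  qed
  show "s = t" by (rule W_faithful[OF s t]) (use m[OF _ thetam] psi1 in metis)
 next
  fix c z assume c: "c : Obj C" and z: "z : V e c"
  note Tz = thetam[OF c z]
  show "cov c (\<lambda>f. \<exists>g\<in>hom C (Dom C f) d. R e f z = R e g u)"
  proof (rule cov_mono[OF c ayD(5)[OF Tz]])
   fix f b assume f: "f : hom C b c" and "\<exists>g. (f, g) : theta c z"
   then obtain g where g: "(f, g) : theta c z" by blast
   note gh = ayD(2)[OF Tz g f]
   have "theta b (R e f z) = theta b (R e g u)" using ay_pair_iff[OF Tz f gh] g nat[OF f z] nat[OF gh u(1)] u(2) by simp
   then have "R e f z = R e g u"
    using thetainj[OF hom_objs(1)[OF f] esheafD(1)[OF V_sheaf[OF e] f z] esheafD(1)[OF V_sheaf[OF e] gh u(1)]] by blast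
   then show "\<exists>g\<in>hom C (Dom C f) d. R e f z = R e g u" using gh homD(2)[OF f] by metis
  qed
 next
  fix c f g assume "f : hom C c d \<and> g : hom C c d \<and> R e f u = R e g u"
  then have f: "f : hom C c d" and g: "g : hom C c d" and eq: "R e f u = R e g u" by auto
  have "ayr d f (ayu d) = ayr d g (ayu d)" using nat[OF f u(1)] nat[OF g u(1)] eq u(2) by simp
  then have "(f, g) : ayu d" using ay_pair_iff[OF ud f g] by blast
  then show "cov c (\<lambda>h. f \<cdot> h = g \<cdot> h)" using ayu_iff[OF f g] by blast
 qed
 then show ?thesis by blast
qed

text \<open>With a universal section chosen over each object of the site, evaluation at it
  identifies arrows \<open>y c \<rightarrow> e\<close> with sections. Under this identification the
  properties of \<open>V\<close>, \<open>R\<close> and \<open>W\<close> turn into those of a dense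
  family.\<close>

lemma dense_site_exists: "\<exists>y0 y1. dense_site U C J E y0 y1"
proof -
 obtain y u where yu: "!!c. c : Obj C ==> universal c (y c) (u c)" using universal_exists by metis
 have y: "y c : Obj E" "u c : V (y c) c" if "c : Obj C" for c using yu[OF that] unfolding universal_def by blast+
 have ex: "\<exists>t\<in>hom E (y c) e. W t c (u c) = x" if "c : Obj C" "e : Obj E" "x : V e c" for c e x
  using yu[OF that(1)] that(2,3) unfolding universal_def by blast
 have uq: "s = t" if "c : Obj C" "s : hom E (y c) e" "t : hom E (y c) e" "W s c (u c) = W t c (u c)" for c e s t
  using yu[OF that(1)] that(2-4) unfolding universal_def by blast
 have loc: "cov c (\<lambda>f. \<exists>g\<in>hom C (Dom C f) d. R (y d) f z = R (y d) g (u d))" if "d : Obj C" "c : Obj C" "z : V (y d) c" for c d z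
  using yu[OF that(1)] that(2,3) unfolding universal_def by blast
 have fai: "cov c (\<lambda>h. f \<cdot> h = g \<cdot> h)" if "f : hom C c d" "g : hom C c d" "R (y d) f (u d) = R (y d) g (u d)" for c d f g
  using yu[OF hom_objs(2)[OF that(1)]] that unfolding universal_def by blast
 have y1_ex: "\<exists>t. t : hom E (y a) (y b) \<and> W t a (u a) = R (y b) f (u b)" if f: "f : hom C a b" for f a b
  using ex[OF hom_objs(1)[OF f] y(1)[OF hom_objs(2)[OF f]] esheafD(1)[OF V_sheaf[OF y(1)[OF hom_objs(2)[OF f]]] f y(2)[OF hom_objs(2)[OF f]]]]
  by blast
 \<comment> \<open>The arrow that classifies the restriction along \<open>f\<close> of the universal
   section over its target.\<close>
 define y1 where "y1 f = (SOME t. t : hom E (y (Dom C f)) (y (Cod C f)) \<and>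
  W t (Dom C f) (u (Dom C f)) = R (y (Cod C f)) f (u (Cod C f)))" for f
 have y1': "y1 f : hom E (y a) (y b) \<and> W (y1 f) a (u a) = R (y b) f (u b)" if f: "f : hom C a b" for f a b
  unfolding y1_def homD(2,3)[OF f] by (rule someI_ex[OF y1_ex[OF f]])
 have y1: "!!f a b. f : hom C a b ==> y1 f : hom E (y a) (y b)"
  "!!f a b. f : hom C a b ==> W (y1 f) a (u a) = R (y b) f (u b)" using y1' by blast+
 \<comment> \<open>The Yoneda bijection; \<open>le\<close> below is its inverse.\<close>
 define el where "el c xi = W xi c (u c)" for c xi
 have el_mem: "el c xi : V e c" if "c : Obj C" "xi : hom E (y c) e" for c xi e
  unfolding el_def using W_mem[OF that(2,1) y(2)[OF that(1)]] .
 have el_bij: "bij_betw (el c) (hom E (y c) e) (V e c)" if c: "c : Obj C" and e: "e : Obj E" for c e unfolding bij_betw_def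
 proof
  show "inj_on (el c) (hom E (y c) e)" by (rule inj_onI) (use uq[OF c] in \<open>simp add: el_def\<close>)
  show "el c ` hom E (y c) e = V e c" using el_mem[OF c] ex[OF c e] unfolding el_def by blast
 qed
 have el_comp: "el c (Comp E t xi) = W t c (el c xi)" if "c : Obj C" "xi : hom E (y c) e" "t : hom E e e'" for c xi e t e'
  unfolding el_def using W_comp[OF that(2,3,1) y(2)[OF that(1)]] .
 have el_res: "el a (Comp E xi (y1 f)) = R e f (el b xi)" if f: "f : hom C a b" and xi: "xi : hom E (y b) e" for f a b xi e
  using el_comp[OF hom_objs(1)[OF f] y1(1)[OF f] xi] y1(2)[OF f] W_nat[OF xi f y(2)[OF hom_objs(2)[OF f]]] unfolding el_def by simp
 have el_inj: "s = t" if "c : Obj C" "s : hom E (y c) e" "t : hom E (y c) e" "el c s = el c t" for c e s t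
  using uq that unfolding el_def by blast
 define le where "le c e = inv_into (hom E (y c) e) (el c)" for c e
 have le: "le c e x : hom E (y c) e" "el c (le c e x) = x" if "c : Obj C" "e : Obj E" "x : V e c" for c e x
  unfolding le_def using bij_betwE[OF bij_betw_inv_into[OF el_bij[OF that(1,2)]]] bij_betw_inv_into_right[OF el_bij[OF that(1,2)]] that(3) by auto
 have le_res: "le a e (R e f x) = Comp E (le b e x) (y1 f)" if f: "f : hom C a b" and e: "e : Obj E" and x: "x : V e b" for f a b e x
 proof (rule el_inj[OF hom_objs(1)[OF f]])
  note lx = le[OF hom_objs(2)[OF f] e x] and rx = le[OF hom_objs(1)[OF f] e esheafD(1)[OF V_sheaf[OF e] f x]]
  show "le a e (R e f x) : hom E (y a) e" using rx(1) .
  show "Comp E (le b e x) (y1 f) : hom E (y a) e" using cat_comp[OF catE y1(1)[OF f] lx(1)] .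
  show "el a (le a e (R e f x)) = el a (Comp E (le b e x) (y1 f))" using rx(2) el_res[OF f lx(1)] lx(2) by simp
 qed
 have sheaf: "esheaf (\<lambda>c. hom E (y c) e) (\<lambda>f xi. Comp E xi (y1 f))" if e: "e : Obj E" for e
 proof (rule esheaf_transport[OF V_sheaf[OF e], where theta = "\<lambda>c. le c e"])
  show "bij_betw (le c e) (V e c) (hom E (y c) e)" if "c : Obj C" for c
   unfolding le_def by (rule bij_betw_inv_into[OF el_bij[OF that e]])
  show "le a e (R e f x) = Comp E (le b e x) (y1 f)" if "f : hom C a b" "x : V e b" for a b f x using le_res[OF that(1) e that(2)] .
 qed
 have "dense_site U C J E y y1"
 proof
  show "category E" by (rule catE)
  show "sm (Arr C)" by (rule sm_ArrC)
  show "y c : Obj E" if "c : Obj C" for c using y(1)[OF that] .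
  show "y1 f : hom E (y a) (y b)" if "f : hom C a b" for f a b using y1(1)[OF that] .
  show "y1 (f \<cdot> g) = Comp E (y1 f) (y1 g)" if f: "f : hom C b c" and g: "g : hom C a b" for f b c g a
  proof (rule el_inj[OF hom_objs(1)[OF g] y1(1)[OF cmp_hom[OF f g]] cat_comp[OF catE y1(1)[OF g] y1(1)[OF f]]])
   show "el a (y1 (f \<cdot> g)) = el a (Comp E (y1 f) (y1 g))"
    using y1(2)[OF cmp_hom[OF f g]] el_res[OF g y1(1)[OF f]] y1(2)[OF f]
     esheafD(3)[OF V_sheaf[OF y(1)[OF hom_objs(2)[OF f]]] f g y(2)[OF hom_objs(2)[OF f]]] unfolding el_def by simp
  qed
  show "cov c (\<lambda>f. \<exists>g\<in>hom C (Dom C f) d. Comp E t (y1 f) = y1 g)" if c: "c : Obj C" and d: "d : Obj C" and t: "t : hom E (y c) (y d)" for c d t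
  proof (rule cov_mono[OF c loc[OF d c el_mem[OF c t]]])
   fix f b assume f: "f : hom C b c" and "\<exists>g\<in>hom C (Dom C f) d. R (y d) f (el c t) = R (y d) g (u d)"
   then obtain g where g: "g : hom C b d" "R (y d) f (el c t) = R (y d) g (u d)" using homD(2)[OF f] by auto
   have "Comp E t (y1 f) = y1 g" by (rule el_inj[OF hom_objs(1)[OF f] cat_comp[OF catE y1(1)[OF f] t] y1(1)[OF g(1)]])
     (use el_res[OF f t] g(2) y1(2)[OF g(1)] in \<open>simp add: el_def\<close>)
   then show "\<exists>g\<in>hom C (Dom C f) d. Comp E t (y1 f) = y1 g" using g(1) homD(2)[OF f] by auto
  qed
  show "cov c (\<lambda>h. f \<cdot> h = g \<cdot> h)" if "f : hom C c d" "g : hom C c d" "y1 f = y1 g" for f c d g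
   using fai[OF that(1,2)] y1(2)[OF that(1)] y1(2)[OF that(2)] that(3) by simp
  show "esheaf (\<lambda>c. hom E (y c) e) (\<lambda>f xi. Comp E xi (y1 f))" if "e : Obj E" for e using sheaf[OF that] .
  show "sm (hom E (y c) e)" if "c : Obj C" "e : Obj E" for c e
   using el_bij[OF that] V_sm[OF that(2,1)] sm_inj unfolding bij_betw_def by blast
  show "\<exists>e\<in>Obj E. \<exists>theta. esheaf_iso (\<lambda>c. hom E (y c) e) (\<lambda>f xi. Comp E xi (y1 f)) P rho theta"
   if P: "esheaf P rho" and s: "!!c. c : Obj C ==> sm (P c)" for P :: "'c => 'u set" and rho
  proof -
   obtain e theta where e: "e : Obj E" and theta: "esheaf_iso (V e) (R e) P rho theta" using V_rep[OF P s] by blast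
   have "esheaf_iso (\<lambda>c. hom E (y c) e) (\<lambda>f xi. Comp E xi (y1 f)) P rho (\<lambda>c xi. theta c (el c xi))"
    unfolding esheaf_iso_def
   proof (intro conjI ballI allI impI)
    show "bij_betw (\<lambda>xi. theta c (el c xi)) (hom E (y c) e) (P c)" if c: "c : Obj C" for c
     using bij_betw_trans[OF el_bij[OF c e], of "theta c" "P c"] theta c unfolding esheaf_iso_def comp_def by blast
    fix a b f xi assume "f : hom C a b \<and> xi : hom E (y b) e"
    then have f: "f : hom C a b" and xi: "xi : hom E (y b) e" by auto
    show "theta a (el a (Comp E xi (y1 f))) = rho f (theta b (el b xi))"
     using el_res[OF f xi] theta f el_mem[OF hom_objs(2)[OF f] xi] unfolding esheaf_iso_def by metis
   qed
   then show ?thesis using e by blast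
  qed
  show "s = t" if s: "s : hom E e e'" and t: "t : hom E e e'"
   and eq: "!!c xi. c : Obj C ==> xi : hom E (y c) e ==> Comp E s xi = Comp E t xi" for s e e' t
  proof (rule W_faithful[OF s t])
   fix c x assume c: "c : Obj C" and x: "x : V e c"
   note l = le[OF c cat_hom_obj(1)[OF catE s] x]
   show "W s c x = W t c x" using el_comp[OF c l(1) s] el_comp[OF c l(1) t] eq[OF c l(1)] l(2) by simp
  qed
  show "\<exists>t\<in>hom E e e'. \<forall>c\<in>Obj C. \<forall>xi\<in>hom E (y c) e. Comp E t xi = alpha c xi"
   if e: "e : Obj E" "e' : Obj E" and alpha: "!!c xi. c : Obj C ==> xi : hom E (y c) e ==> alpha c xi : hom E (y c) e'"
    "!!f a b xi. f : hom C a b ==> xi : hom E (y b) e ==> alpha a (Comp E xi (y1 f)) = Comp E (alpha b xi) (y1 f)" for e e' alpha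
  proof -
   have "\<exists>t\<in>hom E e e'. \<forall>c\<in>Obj C. \<forall>x\<in>V e c. W t c x = el c (alpha c (le c e x))"
   proof (rule W_full[OF e])
    show "el c (alpha c (le c e x)) : V e' c" if "c : Obj C" "x : V e c" for c x
     using el_mem[OF that(1) alpha(1)[OF that(1) le(1)[OF that(1) e(1) that(2)]]] .
    show "el a (alpha a (le a e (R e f x))) = R e' f (el b (alpha b (le b e x)))" if f: "f : hom C a b" and x: "x : V e b" for f a b x
    proof -
     note l = le(1)[OF hom_objs(2)[OF f] e(1) x]
     show ?thesis using le_res[OF f e(1) x] alpha(2)[OF f l] el_res[OF f alpha(1)[OF hom_objs(2)[OF f] l]] by simp
    qed
   qed
   then obtain t where t: "t : hom E e e'" "!!c x. c : Obj C ==> x : V e c ==> W t c x = el c (alpha c (le c e x))" by blast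
   have "Comp E t xi = alpha c xi" if c: "c : Obj C" and xi: "xi : hom E (y c) e" for c xi
   proof (rule el_inj[OF c cat_comp[OF catE xi t(1)] alpha(1)[OF c xi]])
    have "le c e (el c xi) = xi" using el_inj[OF c le(1)[OF c e(1) el_mem[OF c xi]] xi] le(2)[OF c e(1) el_mem[OF c xi]] by blast
    then show "el c (Comp E t xi) = el c (alpha c xi)" using el_comp[OF c xi t(1)] t(2)[OF c el_mem[OF c xi]] by simp
   qed
   then show ?thesis using t(1) by blast
  qed
 qed
 then show ?thesis by blast
qed

end

section \<open>Atoms\<close>

context site
begin

text \<open>Gluing is done in each component; that the glued pair satisfies \<open>Z\<close> is the
  locality hypothesis. All finite limits and subobjects used later are instances.\<close>

lemma esheaf_subproduct:
 assumes P: "esheaf P rho" and Q: "esheaf Q sigma"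
  and st: "!!f a b x y. f : hom C a b ==> x : P b ==> y : Q b ==> Z b x y ==> Z a (rho f x) (sigma f y)"
  and loc: "!!c x y. c : Obj C ==> x : P c ==> y : Q c ==> cov c (\<lambda>f. Z (Dom C f) (rho f x) (sigma f y)) ==> Z c x y"
 shows "esheaf (\<lambda>c. {(x, y). x : P c \<and> y : Q c \<and> Z c x y}) (\<lambda>f (x, y). (rho f x, sigma f y))"
 unfolding esheaf_def
proof (intro conjI allI ballI impI)
 show "(\<lambda>(x, y). (rho f x, sigma f y)) p : {(x, y). x : P a \<and> y : Q a \<and> Z a x y}"
  if "f : hom C a b \<and> p : {(x, y). x : P b \<and> y : Q b \<and> Z b x y}" for a b f p
  using that esheafD(1)[OF P] esheafD(1)[OF Q] st by auto
 show "(\<lambda>(x, y). (rho (Ident C c) x, sigma (Ident C c) y)) p = p" if "c : Obj C" "p : {(x, y). x : P c \<and> y : Q c \<and> Z c x y}" for c p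
  using that esheafD(2)[OF P] esheafD(2)[OF Q] by auto
 show "(\<lambda>(x, y). (rho (f \<cdot> g) x, sigma (f \<cdot> g) y)) p = (\<lambda>(x, y). (rho g x, sigma g y)) ((\<lambda>(x, y). (rho f x, sigma f y)) p)"
  if "f : hom C b c \<and> g : hom C a b \<and> p : {(x, y). x : P c \<and> y : Q c \<and> Z c x y}" for a b c f g p
  using that esheafD(3)[OF P] esheafD(3)[OF Q] by auto
 fix c S p assume c: "c : Obj C" and S: "S : J c"
  and p: "(\<forall>f\<in>S. p f : {(x, y). x : P (Dom C f) \<and> y : Q (Dom C f) \<and> Z (Dom C f) x y}) \<and>
   (\<forall>f\<in>S. \<forall>b. \<forall>g\<in>hom C b (Dom C f). (\<lambda>(x, y). (rho g x, sigma g y)) (p f) = p (f \<cdot> g))"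
 have m: "fst (p f) : P (Dom C f)" "snd (p f) : Q (Dom C f)" "Z (Dom C f) (fst (p f)) (snd (p f))" if "f : S" for f
  using p that by (auto simp: split_beta)
 have r: "rho g (fst (p f)) = fst (p (f \<cdot> g))" "sigma g (snd (p f)) = snd (p (f \<cdot> g))" if "f : S" "g : hom C b (Dom C f)" for f g b
 proof -
  have "(rho g (fst (p f)), sigma g (snd (p f))) = p (f \<cdot> g)" using p that by (simp add: split_beta)
  then show "rho g (fst (p f)) = fst (p (f \<cdot> g))" "sigma g (snd (p f)) = snd (p (f \<cdot> g))" by (metis fst_conv snd_conv)+
 qed
 have ux: "\<exists>!x. x : P c \<and> (\<forall>f\<in>S. rho f x = fst (p f))" by (rule esheaf_glue[OF P c S m(1) r(1)])
 have uy: "\<exists>!y. y : Q c \<and> (\<forall>f\<in>S. sigma f y = snd (p f))" by (rule esheaf_glue[OF Q c S m(2) r(2)])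
 obtain x where x: "x : P c" "\<forall>f\<in>S. rho f x = fst (p f)" using ux by blast
 obtain y where y: "y : Q c" "\<forall>f\<in>S. sigma f y = snd (p f)" using uy by blast
 have "cov c (\<lambda>f. Z (Dom C f) (rho f x) (sigma f y))" unfolding cov_def using m(3) x(2) y(2) by (intro bexI[OF _ S]) simp
 then have z: "Z c x y" using loc[OF c x(1) y(1)] by blast
 show "\<exists>!q. q : {(x, y). x : P c \<and> y : Q c \<and> Z c x y} \<and> (\<forall>f\<in>S. (\<lambda>(x, y). (rho f x, sigma f y)) q = p f)"
 proof (rule ex1I[of _ "(x, y)"])
  show "(x, y) : {(x, y). x : P c \<and> y : Q c \<and> Z c x y} \<and> (\<forall>f\<in>S. (\<lambda>(x, y). (rho f x, sigma f y)) (x, y) = p f)"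
   using x y z by simp
  fix q assume q: "q : {(x, y). x : P c \<and> y : Q c \<and> Z c x y} \<and> (\<forall>f\<in>S. (\<lambda>(x, y). (rho f x, sigma f y)) q = p f)"
  obtain x' y' where q': "q = (x', y')" by (cases q)
  have "x' : P c \<and> (\<forall>f\<in>S. rho f x' = fst (p f))" "y' : Q c \<and> (\<forall>f\<in>S. sigma f y' = snd (p f))"
   using q unfolding q' by (auto simp: prod_eq_iff)
  then have "x' = x" "y' = y" using ux uy x y by blast+
  then show "q = (x, y)" using q' by simp
 qed
qed

text \<open>A stable and local predicate on objects of the site is a subsheaf of the terminal sheaf;
  the type \<open>unit\<close> makes sections unique.\<close>

lemma esheaf_truth:
 assumes st: "!!f a b. f : hom C a b ==> Z b ==> Z a"
  and loc: "!!c. c : Obj C ==> cov c (\<lambda>f. Z (Dom C f)) ==> Z c"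
 shows "esheaf (\<lambda>c. {u :: unit. Z c}) (\<lambda>_ u. u)" unfolding esheaf_def
proof (intro conjI allI ballI impI)
 show "x : {u :: unit. Z a}" if "f : hom C a b \<and> x : {u :: unit. Z b}" for a b f x
  using st[of f a b] that by (simp split: if_splits)
 fix c S and x :: "'d => unit" assume c: "c : Obj C" and S: "S : J c"
  and x: "(\<forall>f\<in>S. x f : {u. Z (Dom C f)}) \<and> (\<forall>f\<in>S. \<forall>b. \<forall>g\<in>hom C b (Dom C f). x f = x (f \<cdot> g))"
 have "cov c (\<lambda>f. Z (Dom C f))" unfolding cov_def using S x by blast
 then have "Z c" using loc[OF c] by blast
 then show "\<exists>!y :: unit. y : {u. Z c} \<and> (\<forall>f\<in>S. y = x f)" by auto
qed simp_all

text \<open>\<open>cov c (\<lambda>_. False)\<close> says that the empty sieve covers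
  \<open>c\<close>. Over such an object every sheaf has exactly one section, so only the others can
  witness that an object of the topos is not initial.\<close>

definition nondeg :: "'c => bool" where
 "nondeg c \<longleftrightarrow> c : Obj C \<and> \<not> cov c (\<lambda>_. False)"

text \<open>If every arrow of the cover had a degenerate source, transitivity would make
  \<open>c\<close> degenerate.\<close>

lemma cov_nondeg:
 assumes c: "nondeg c" and Q: "cov c Q" obtains f b where "f : hom C b c" "nondeg b" "Q f"
proof -
 have "\<exists>f b. f : hom C b c \<and> nondeg b \<and> Q f"
 proof (rule ccontr)
  assume neg: "\<not> (\<exists>f b. f : hom C b c \<and> nondeg b \<and> Q f)"
  have "cov c (\<lambda>_. False)"
  proof (rule cov_trans[OF _ Q])
   show "c : Obj C" using c by (simp add: nondeg_def)
   show "cov b (\<lambda>_. False)" if "f : hom C b c" "Q f" for f b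
    using neg that hom_objs(1)[OF that(1)] unfolding nondeg_def by blast
  qed
  then show False using c by (simp add: nondeg_def)
 qed
 then show thesis using that by blast
qed

end

section \<open>Finite limits and subobjects by generalized elements\<close>

context dense_site
begin

abbreviation ecmp (infixl "\<odot>" 70) where "g \<odot> f \<equiv> Comp E g f"

lemma e_hom: "f : hom E a b ==> g : hom E b c ==> g \<odot> f : hom E a c" using cat_comp[OF catE] .

lemma e_assoc: "f : hom E a b ==> g : hom E b c ==> h : hom E c d ==> h \<odot> g \<odot> f = h \<odot> (g \<odot> f)"
 using cat_assoc[OF catE] by metis

lemma e_objs: "f : hom E a b ==> a : Obj E" "f : hom E a b ==> b : Obj E" using cat_hom_obj[OF catE] by blast+

lemma y_rep_any:
 fixes P :: "'c => 'x set"
 assumes P: "esheaf P rho" and s: "!!c. c : Obj C ==> sm (P c)"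
 shows "\<exists>e\<in>Obj E. \<exists>theta. esheaf_iso (\<lambda>c. hom E (y0 c) e) (\<lambda>f xi. xi \<odot> y1 f) P rho theta"
proof -
 obtain Q :: "'c => 'u set" and sigma i where Q: "esheaf Q sigma" "\<forall>c\<in>Obj C. sm (Q c)" "esheaf_iso Q sigma P rho i"
  using esheaf_encode[OF P s] by blast
 have "\<exists>e\<in>Obj E. \<exists>theta. esheaf_iso (\<lambda>c. hom E (y0 c) e) (\<lambda>f xi. xi \<odot> y1 f) Q sigma theta" by (rule y_rep[OF Q(1)]) (use Q(2) in blast)
 then show ?thesis using esheaf_iso_comp[OF _ Q(3)] by blast
qed

lemma esheaf_isoD:
 assumes "esheaf_iso (\<lambda>c. hom E (y0 c) e) (\<lambda>f xi. xi \<odot> y1 f) P rho theta"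
 shows "c : Obj C ==> xi : hom E (y0 c) e ==> theta c xi : P c"
  "f : hom C a b ==> xi : hom E (y0 b) e ==> theta a (xi \<odot> y1 f) = rho f (theta b xi)"
  "c : Obj C ==> xi : hom E (y0 c) e ==> zeta : hom E (y0 c) e ==> theta c xi = theta c zeta ==> xi = zeta"
  "c : Obj C ==> p : P c ==> \<exists>xi\<in>hom E (y0 c) e. theta c xi = p"
proof -
 have b: "bij_betw (theta c) (hom E (y0 c) e) (P c)" if "c : Obj C" for c using assms that unfolding esheaf_iso_def by blast
 show "c : Obj C ==> xi : hom E (y0 c) e ==> theta c xi : P c" using bij_betwE[OF b] by blast
 show "f : hom C a b ==> xi : hom E (y0 b) e ==> theta a (xi \<odot> y1 f) = rho f (theta b xi)"
  using assms unfolding esheaf_iso_def by blast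
 show "c : Obj C ==> xi : hom E (y0 c) e ==> zeta : hom E (y0 c) e ==> theta c xi = theta c zeta ==> xi = zeta"
  using bij_betw_imp_inj_on[OF b] by (meson inj_onD)
 show "\<exists>xi\<in>hom E (y0 c) e. theta c xi = p" if "c : Obj C" "p : P c"
 proof -
  have "p : theta c ` hom E (y0 c) e" using bij_betw_imp_surj_on[OF b[OF that(1)]] that(2) by simp
  then show ?thesis by force
 qed
qed

text \<open>Products, equalizers, pullbacks and subobjects are all obtained from this lemma by a choice of \<open>Z\<close>.\<close>

lemma subproduct_exists:
 assumes a: "a : Obj E" and b: "b : Obj E"
  and st: "!!f c d xi zeta. f : hom C c d ==> xi : hom E (y0 d) a ==> zeta : hom E (y0 d) b ==> Z d xi zeta ==> Z c (xi \<odot> y1 f) (zeta \<odot> y1 f)"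
  and loc: "!!c xi zeta. c : Obj C ==> xi : hom E (y0 c) a ==> zeta : hom E (y0 c) b ==>
   cov c (\<lambda>f. Z (Dom C f) (xi \<odot> y1 f) (zeta \<odot> y1 f)) ==> Z c xi zeta"
 obtains p m n where "p : Obj E" "m : hom E p a" "n : hom E p b"
  "!!c xi. c : Obj C ==> xi : hom E (y0 c) p ==> Z c (m \<odot> xi) (n \<odot> xi)"
  "!!z s t. s : hom E z a ==> t : hom E z b ==> (!!c xi. c : Obj C ==> xi : hom E (y0 c) z ==> Z c (s \<odot> xi) (t \<odot> xi)) ==>
   \<exists>k\<in>hom E z p. m \<odot> k = s \<and> n \<odot> k = t"
  "!!z k l. k : hom E z p ==> l : hom E z p ==> m \<odot> k = m \<odot> l ==> n \<odot> k = n \<odot> l ==> k = l"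
proof -
 let ?P = "\<lambda>c. {(xi, zeta). xi : hom E (y0 c) a \<and> zeta : hom E (y0 c) b \<and> Z c xi zeta}"
 let ?r = "\<lambda>f (xi, zeta). (xi \<odot> y1 f, zeta \<odot> y1 f)"
 have P: "esheaf ?P ?r" by (rule esheaf_subproduct[OF y_sheaf[OF a] y_sheaf[OF b], of Z]) (use st loc in blast)+
 have "sm (?P c)" if "c : Obj C" for c by (rule sm_subset[OF sm_Times[OF y_sm[OF that a] y_sm[OF that b]]]) auto
 then obtain p theta where p: "p : Obj E" and theta: "esheaf_iso (\<lambda>c. hom E (y0 c) p) (\<lambda>f xi. xi \<odot> y1 f) ?P ?r theta"
  using y_rep_any[OF P] by blast
 note I = esheaf_isoD[OF theta]
 have thetam: "fst (theta c xi) : hom E (y0 c) a" "snd (theta c xi) : hom E (y0 c) b" "Z c (fst (theta c xi)) (snd (theta c xi))"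
  if "c : Obj C" "xi : hom E (y0 c) p" for c xi using I(1)[OF that] by auto
 have thetar: "fst (theta c (xi \<odot> y1 f)) = fst (theta d xi) \<odot> y1 f" "snd (theta c (xi \<odot> y1 f)) = snd (theta d xi) \<odot> y1 f"
  if "f : hom C c d" "xi : hom E (y0 d) p" for f c d xi using I(2)[OF that] by (simp_all add: split_beta)
 obtain m where m: "m : hom E p a" "!!c xi. c : Obj C ==> xi : hom E (y0 c) p ==> m \<odot> xi = fst (theta c xi)"
  using y_dense[OF p a, of "\<lambda>c xi. fst (theta c xi)"] thetam(1) thetar(1) by blast
 obtain n where n: "n : hom E p b" "!!c xi. c : Obj C ==> xi : hom E (y0 c) p ==> n \<odot> xi = snd (theta c xi)"
  using y_dense[OF p b, of "\<lambda>c xi. snd (theta c xi)"] thetam(2) thetar(2) by blast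
 have uniq: "k = l" if k: "k : hom E z p" and l: "l : hom E z p" and eq: "m \<odot> k = m \<odot> l" "n \<odot> k = n \<odot> l" for z k l
 proof (rule y_ext[OF k l])
  fix c xi assume c: "c : Obj C" and xi: "xi : hom E (y0 c) z"
  note kx = e_hom[OF xi k] and lx = e_hom[OF xi l]
  show "k \<odot> xi = l \<odot> xi"
  proof (rule I(3)[OF c kx lx])
   have "m \<odot> (k \<odot> xi) = m \<odot> (l \<odot> xi)" "n \<odot> (k \<odot> xi) = n \<odot> (l \<odot> xi)"
    using eq e_assoc[OF xi k m(1)] e_assoc[OF xi l m(1)] e_assoc[OF xi k n(1)] e_assoc[OF xi l n(1)] by simp_all
   then show "theta c (k \<odot> xi) = theta c (l \<odot> xi)"
    unfolding m(2)[OF c kx] m(2)[OF c lx] n(2)[OF c kx] n(2)[OF c lx] by (rule prod_eqI)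
  qed
 qed
 have fac: "\<exists>k\<in>hom E z p. m \<odot> k = s \<and> n \<odot> k = t"
  if s: "s : hom E z a" and t: "t : hom E z b" and Zst: "!!c xi. c : Obj C ==> xi : hom E (y0 c) z ==> Z c (s \<odot> xi) (t \<odot> xi)" for z s t
 proof -
  have "\<exists>zeta\<in>hom E (y0 c) p. theta c zeta = (s \<odot> xi, t \<odot> xi)" if "c : Obj C" "xi : hom E (y0 c) z" for c xi
   using I(4)[OF that(1)] e_hom[OF that(2) s] e_hom[OF that(2) t] Zst[OF that] by simp
  then obtain beta where beta: "!!c xi. c : Obj C ==> xi : hom E (y0 c) z ==> beta c xi : hom E (y0 c) p"
   "!!c xi. c : Obj C ==> xi : hom E (y0 c) z ==> theta c (beta c xi) = (s \<odot> xi, t \<odot> xi)" by metis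
  have "beta c (xi \<odot> y1 f) = beta d xi \<odot> y1 f" if f: "f : hom C c d" and xi: "xi : hom E (y0 d) z" for f c d xi
  proof (rule I(3)[OF hom_objs(1)[OF f]])
   note c = hom_objs(1)[OF f] and d = hom_objs(2)[OF f] note xif = e_hom[OF y_hom[OF f] xi]
   show "beta c (xi \<odot> y1 f) : hom E (y0 c) p" "beta d xi \<odot> y1 f : hom E (y0 c) p"
    using beta(1)[OF c xif] e_hom[OF y_hom[OF f] beta(1)[OF d xi]] by auto
   show "theta c (beta c (xi \<odot> y1 f)) = theta c (beta d xi \<odot> y1 f)"
    unfolding beta(2)[OF c xif] I(2)[OF f beta(1)[OF d xi]] beta(2)[OF d xi]
    using e_assoc[OF y_hom[OF f] xi s] e_assoc[OF y_hom[OF f] xi t] by simp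
  qed
  then obtain k where k: "k : hom E z p" "!!c xi. c : Obj C ==> xi : hom E (y0 c) z ==> k \<odot> xi = beta c xi"
   using y_dense[OF e_objs(1)[OF s] p, of beta] beta(1) by blast
  have "m \<odot> k = s"
   by (rule y_ext[OF e_hom[OF k(1) m(1)] s]) (simp add: e_assoc[OF _ k(1) m(1)] k(2) m(2)[OF _ beta(1)] beta(2))
  moreover have "n \<odot> k = t"
   by (rule y_ext[OF e_hom[OF k(1) n(1)] t]) (simp add: e_assoc[OF _ k(1) n(1)] k(2) n(2)[OF _ beta(1)] beta(2))
  ultimately show ?thesis using k(1) by blast
 qed
 show thesis
 proof (rule that[OF p m(1) n(1)])
  show "Z c (m \<odot> xi) (n \<odot> xi)" if "c : Obj C" "xi : hom E (y0 c) p" for c xi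
   using thetam(3)[OF that] m(2)[OF that] n(2)[OF that] by simp
 qed (fact fac, fact uniq)
qed

text \<open>Subterminal objects. Two instances are used: the predicate that is always true gives the
  terminal object, and degeneracy gives an object with generalized elements exactly over the
  degenerate \<open>c\<close>.\<close>

lemma truth_exists:
 assumes st: "!!f a b. f : hom C a b ==> Z b ==> Z a"
  and loc: "!!c. c : Obj C ==> cov c (\<lambda>f. Z (Dom C f)) ==> Z c"
 obtains e where "e : Obj E" "!!c. c : Obj C ==> hom E (y0 c) e \<noteq> {} \<longleftrightarrow> Z c"
  "!!z s t. s : hom E z e ==> t : hom E z e ==> s = t"
  "!!z. z : Obj E ==> (!!c. c : Obj C ==> hom E (y0 c) z \<noteq> {} ==> Z c) ==> hom E z e \<noteq> {}"
proof -
 have P: "esheaf (\<lambda>c. {u :: unit. Z c}) (\<lambda>_ u. u)" by (rule esheaf_truth) (fact st, fact loc)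
 have "sm {u :: unit. Z c}" for c by (rule sm_finite) simp
 then obtain e theta where e: "e : Obj E" and theta: "esheaf_iso (\<lambda>c. hom E (y0 c) e) (\<lambda>f xi. xi \<odot> y1 f) (\<lambda>c. {u :: unit. Z c}) (\<lambda>_ u. u) theta"
  using y_rep_any[OF P] by blast
 note I = esheaf_isoD[OF theta]
 have ne: "hom E (y0 c) e \<noteq> {} \<longleftrightarrow> Z c" if "c : Obj C" for c using I(1,4)[OF that] by blast
 have eq1: "xi = zeta" if "c : Obj C" "xi : hom E (y0 c) e" "zeta : hom E (y0 c) e" for c xi zeta using I(3)[OF that] by simp
 show thesis
 proof (rule that[OF e ne])
  show "s = t" if s: "s : hom E z e" and t: "t : hom E z e" for z s t
   by (rule y_ext[OF s t]) (rule eq1[OF _ e_hom[OF _ s] e_hom[OF _ t]])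
  fix z assume z: "z : Obj E" and Zz: "!!c. c : Obj C ==> hom E (y0 c) z \<noteq> {} ==> Z c"
  define alpha where "alpha c xi = (SOME zeta. zeta : hom E (y0 c) e)" for c and xi :: 'm
  have alpha: "alpha c xi : hom E (y0 c) e" if "c : Obj C" "xi : hom E (y0 c) z" for c xi
  proof -
   have "\<exists>zeta. zeta : hom E (y0 c) e" using ne[OF that(1)] Zz[OF that(1)] that(2) by blast
   then show ?thesis unfolding alpha_def by (rule someI_ex)
  qed
  have "\<exists>t\<in>hom E z e. \<forall>c\<in>Obj C. \<forall>xi\<in>hom E (y0 c) z. t \<odot> xi = alpha c xi"
  proof (rule y_dense[OF z e alpha])
   show "alpha a (xi \<odot> y1 f) = alpha b xi \<odot> y1 f" if f: "f : hom C a b" and xi: "xi : hom E (y0 b) z" for f a b xi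
    by (rule eq1[OF hom_objs(1)[OF f] alpha[OF hom_objs(1)[OF f] e_hom[OF y_hom[OF f] xi]] e_hom[OF y_hom[OF f] alpha[OF hom_objs(2)[OF f] xi]]])
  qed
  then show "hom E z e \<noteq> {}" by blast
 qed
qed

lemma terminal_exists:
 obtains e where "e : Obj E" "!!z. z : Obj E ==> \<exists>!t. t : hom E z e"
proof -
 show thesis
 proof (rule truth_exists[of "\<lambda>_. True"])
  fix e assume e: "e : Obj E" "!!z s t. s : hom E z e ==> t : hom E z e ==> s = t"
   "!!z. z : Obj E ==> (!!c. c : Obj C ==> hom E (y0 c) z \<noteq> {} ==> True) ==> hom E z e \<noteq> {}"
  show thesis
  proof (rule that[OF e(1)])
   fix z assume "z : Obj E"
   then obtain t where "t : hom E z e" using e(3) by blast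
   then show "\<exists>!t. t : hom E z e" using e(2) by blast
  qed
 qed simp_all
qed

lemma product_exists:
 assumes "a : Obj E" "b : Obj E"
 obtains p m n where "p : Obj E" "m : hom E p a" "n : hom E p b"
  "!!z s t. s : hom E z a ==> t : hom E z b ==> \<exists>!k. k : hom E z p \<and> m \<odot> k = s \<and> n \<odot> k = t"
proof -
 obtain p m n where p: "p : Obj E" "m : hom E p a" "n : hom E p b"
  "!!z s t. s : hom E z a ==> t : hom E z b ==> \<exists>k\<in>hom E z p. m \<odot> k = s \<and> n \<odot> k = t"
  "!!z k l. k : hom E z p ==> l : hom E z p ==> m \<odot> k = m \<odot> l ==> n \<odot> k = n \<odot> l ==> k = l"
  using subproduct_exists[OF assms, of "\<lambda>_ _ _. True"] by (metis (full_types))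
 show thesis
 proof (rule that[OF p(1-3)])
  fix z s t assume "s : hom E z a" "t : hom E z b"
  then obtain k where k: "k : hom E z p" "m \<odot> k = s" "n \<odot> k = t" using p(4) by blast
  then show "\<exists>!k. k : hom E z p \<and> m \<odot> k = s \<and> n \<odot> k = t" using p(5) by (intro ex1I[of _ k]) auto
 qed
qed

lemma y_separated:
 assumes c: "c : Obj C" and x: "xi : hom E (y0 c) e" "zeta : hom E (y0 c) e" and cv: "cov c (\<lambda>f. xi \<odot> y1 f = zeta \<odot> y1 f)"
 shows "xi = zeta" using esheaf_separated[OF y_sheaf[OF e_objs(2)[OF x(1)]] c x cv] .

lemma subobject_exists:
 assumes e: "e : Obj E"
  and st: "!!f c d xi. f : hom C c d ==> xi : hom E (y0 d) e ==> Q d xi ==> Q c (xi \<odot> y1 f)"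
  and loc: "!!c xi. c : Obj C ==> xi : hom E (y0 c) e ==> cov c (\<lambda>f. Q (Dom C f) (xi \<odot> y1 f)) ==> Q c xi"
 obtains p m where "p : Obj E" "m : hom E p e" "monic E m" "!!c xi. c : Obj C ==> xi : hom E (y0 c) p ==> Q c (m \<odot> xi)"
  "!!z s. s : hom E z e ==> (!!c xi. c : Obj C ==> xi : hom E (y0 c) z ==> Q c (s \<odot> xi)) ==> \<exists>k\<in>hom E z p. m \<odot> k = s"
proof -
 \<comment> \<open>The instance is the diagonal of \<open>e\<close> cut down by \<open>Q\<close>, so
   that both projections coincide and uniqueness of factorizations becomes monicity.\<close>
 obtain p m n where p: "p : Obj E" "m : hom E p e" "n : hom E p e"
  "!!c xi. c : Obj C ==> xi : hom E (y0 c) p ==> m \<odot> xi = n \<odot> xi \<and> Q c (m \<odot> xi)"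
  "!!z s t. s : hom E z e ==> t : hom E z e ==> (!!c xi. c : Obj C ==> xi : hom E (y0 c) z ==> s \<odot> xi = t \<odot> xi \<and> Q c (s \<odot> xi)) ==>
   \<exists>k\<in>hom E z p. m \<odot> k = s \<and> n \<odot> k = t"
  "!!z k l. k : hom E z p ==> l : hom E z p ==> m \<odot> k = m \<odot> l ==> n \<odot> k = n \<odot> l ==> k = l"
 proof (rule subproduct_exists[OF e e, of "\<lambda>c xi zeta. xi = zeta \<and> Q c xi"])
  show "xi \<odot> y1 f = zeta \<odot> y1 f \<and> Q c (xi \<odot> y1 f)" if "f : hom C c d" "xi : hom E (y0 d) e" "zeta : hom E (y0 d) e" "xi = zeta \<and> Q d xi" for f c d xi zeta
   using st that by blast
  show "xi = zeta \<and> Q c xi" if c: "c : Obj C" and x: "xi : hom E (y0 c) e" "zeta : hom E (y0 c) e"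
   and cv: "cov c (\<lambda>f. xi \<odot> y1 f = zeta \<odot> y1 f \<and> Q (Dom C f) (xi \<odot> y1 f))" for c xi zeta
   using y_separated[OF c x cov_mono[OF c cv]] loc[OF c x(1) cov_mono[OF c cv]] by blast
 qed blast
 have mn: "m = n" by (rule y_ext[OF p(2,3)]) (use p(4) in blast)
 show thesis
 proof (rule that[OF p(1,2)])
  show "monic E m" unfolding monic_def using homD[OF p(2)] p(6) mn by auto
  show "Q c (m \<odot> xi)" if "c : Obj C" "xi : hom E (y0 c) p" for c xi using p(4)[OF that] by blast
  show "\<exists>k\<in>hom E z p. m \<odot> k = s" if "s : hom E z e" "!!c xi. c : Obj C ==> xi : hom E (y0 c) z ==> Q c (s \<odot> xi)" for z s
   using p(5)[OF that(1,1)] that(2) by blast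
 qed
qed

lemma equalizer_exists:
 assumes s: "s : hom E e e'" and t: "t : hom E e e'"
 obtains p m where "p : Obj E" "m : hom E p e" "monic E m" "s \<odot> m = t \<odot> m"
  "!!z k. k : hom E z e ==> s \<odot> k = t \<odot> k ==> \<exists>l\<in>hom E z p. m \<odot> l = k"
proof -
 obtain p m where p: "p : Obj E" "m : hom E p e" "monic E m" "!!c xi. c : Obj C ==> xi : hom E (y0 c) p ==> s \<odot> (m \<odot> xi) = t \<odot> (m \<odot> xi)"
  "!!z k. k : hom E z e ==> (!!c xi. c : Obj C ==> xi : hom E (y0 c) z ==> s \<odot> (k \<odot> xi) = t \<odot> (k \<odot> xi)) ==> \<exists>l\<in>hom E z p. m \<odot> l = k"
 proof (rule subobject_exists[OF e_objs(1)[OF s], of "\<lambda>c xi. s \<odot> xi = t \<odot> xi"])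
  show "s \<odot> (xi \<odot> y1 f) = t \<odot> (xi \<odot> y1 f)" if "f : hom C c d" "xi : hom E (y0 d) e" "s \<odot> xi = t \<odot> xi" for f c d xi
   using e_assoc[OF y_hom[OF that(1)] that(2) s] e_assoc[OF y_hom[OF that(1)] that(2) t] that(3) by simp
  show "s \<odot> xi = t \<odot> xi" if c: "c : Obj C" and xi: "xi : hom E (y0 c) e" and cv: "cov c (\<lambda>f. s \<odot> (xi \<odot> y1 f) = t \<odot> (xi \<odot> y1 f))" for c xi
  proof (rule y_separated[OF c e_hom[OF xi s] e_hom[OF xi t] cov_mono[OF c cv]])
   fix f b assume f: "f : hom C b c" and "s \<odot> (xi \<odot> y1 f) = t \<odot> (xi \<odot> y1 f)"
   then show "s \<odot> xi \<odot> y1 f = t \<odot> xi \<odot> y1 f" using e_assoc[OF y_hom[OF f] xi s] e_assoc[OF y_hom[OF f] xi t] by simp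
  qed
 qed blast
 show thesis
 proof (rule that[OF p(1-3)])
  show "s \<odot> m = t \<odot> m"
   by (rule y_ext[OF e_hom[OF p(2) s] e_hom[OF p(2) t]]) (use p(4) e_assoc[OF _ p(2) s] e_assoc[OF _ p(2) t] in simp)
  show "\<exists>l\<in>hom E z p. m \<odot> l = k" if k: "k : hom E z e" and eq: "s \<odot> k = t \<odot> k" for z k
   by (rule p(5)[OF k]) (use e_assoc[OF _ k s] e_assoc[OF _ k t] eq in metis)
 qed
qed

text \<open>If all generalized elements of \<open>e\<close> lie over degenerate objects, there is
  exactly one way to send each of them anywhere, so \<open>e\<close> is initial. Conversely, an
  initial \<open>e\<close> would map to the subterminal object of degeneracy and carry a
  nondegenerate element along.\<close>

lemma not_initial_iff:
 assumes e: "e : Obj E" shows "\<not> initial E e \<longleftrightarrow> (\<exists>c. nondeg c \<and> hom E (y0 c) e \<noteq> {})"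
proof
 assume ni: "\<not> initial E e"
 show "\<exists>c. nondeg c \<and> hom E (y0 c) e \<noteq> {}"
 proof (rule ccontr)
  assume neg: "\<nexists>c. nondeg c \<and> hom E (y0 c) e \<noteq> {}"
  then have deg: "cov c (\<lambda>_. False)" if "c : Obj C" "xi : hom E (y0 c) e" for c xi using that unfolding nondeg_def by blast
  have eq1: "xi = zeta" if "c : Obj C" "cov c (\<lambda>_. False)" "xi : hom E (y0 c) b" "zeta : hom E (y0 c) b" for c xi zeta b
   by (rule y_separated[OF that(1,3,4) cov_mono[OF that(1,2)]]) simp
  have ex: "\<exists>xi. xi : hom E (y0 c) b" if "b : Obj E" "c : Obj C" "cov c (\<lambda>_. False)" for b c
   using esheaf_amalgamate[OF y_sheaf[OF that(1)] that(2), of "\<lambda>_ _. False"] that(3) by auto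
  have "initial E e" unfolding initial_def
  proof (intro conjI ballI e)
   fix b assume b: "b : Obj E"
   define alpha where "alpha c xi = (SOME zeta. zeta : hom E (y0 c) b)" for c and xi :: 'm
   have alpha: "alpha c xi : hom E (y0 c) b" if "c : Obj C" "xi : hom E (y0 c) e" for c xi
    unfolding alpha_def using someI_ex[OF ex[OF b that(1) deg[OF that]]] .
   have "\<exists>t\<in>hom E e b. \<forall>c\<in>Obj C. \<forall>xi\<in>hom E (y0 c) e. t \<odot> xi = alpha c xi"
   proof (rule y_dense[OF e b alpha])
    show "alpha a (xi \<odot> y1 f) = alpha d xi \<odot> y1 f" if f: "f : hom C a d" and xi: "xi : hom E (y0 d) e" for f a d xi
    proof -
     note x = e_hom[OF y_hom[OF f] xi]
     show ?thesis by (rule eq1[OF hom_objs(1)[OF f] deg[OF hom_objs(1)[OF f] x] alpha[OF hom_objs(1)[OF f] x] e_hom[OF y_hom[OF f] alpha[OF hom_objs(2)[OF f] xi]]])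
    qed
   qed
   then obtain t where t: "t : hom E e b" by blast
   show "\<exists>!f. f : hom E e b"
   proof (rule ex1I[of _ t])
    show "t : hom E e b" by (rule t)
    fix s assume s: "s : hom E e b"
    show "s = t" by (rule y_ext[OF s t]) (rule eq1[OF _ deg e_hom[OF _ s] e_hom[OF _ t]])
   qed
  qed
  then show False using ni by blast
 qed
next
 assume "\<exists>c. nondeg c \<and> hom E (y0 c) e \<noteq> {}"
 then obtain c xi where c: "nondeg c" and xi: "xi : hom E (y0 c) e" by blast
 obtain z where z: "z : Obj E" "!!c. c : Obj C ==> hom E (y0 c) z \<noteq> {} \<longleftrightarrow> cov c (\<lambda>_. False)"
 proof (rule truth_exists[of "\<lambda>c. cov c (\<lambda>_. False)"])
  show "cov a (\<lambda>_. False)" if "f : hom C a b" "cov b (\<lambda>_. False)" for f a b using cov_pullback[OF that] .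
  show "cov c (\<lambda>_. False)" if "c : Obj C" "cov c (\<lambda>f. cov (Dom C f) (\<lambda>_. False))" for c
   by (rule cov_trans[OF that]) (use homD(2) in metis)
 qed blast
 show "\<not> initial E e"
 proof
  assume "initial E e"
  then obtain t where "t : hom E e z" using z(1) unfolding initial_def by blast
  then have "hom E (y0 c) z \<noteq> {}" using e_hom[OF xi] by blast
  then show False using z(2) c unfolding nondeg_def by blast
 qed
qed

text \<open>The generalized elements that satisfy \<open>Q\<close> locally form a subobject of
  \<open>a\<close>. The nondegenerate \<open>zeta\<close> keeps it from being initial, so by
  atomicity it is all of \<open>a\<close>: on an atom, a property that holds somewhere holds locally
  everywhere.\<close>

lemma atom_local:
 assumes a: "atom E a"
  and st: "!!f c d xi. f : hom C c d ==> xi : hom E (y0 d) a ==> Q d xi ==> Q c (xi \<odot> y1 f)"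
  and ex: "nondeg k" "zeta : hom E (y0 k) a" "Q k zeta"
  and c: "c : Obj C" and xi: "xi : hom E (y0 c) a"
 shows "cov c (\<lambda>f. Q (Dom C f) (xi \<odot> y1 f))"
proof -
 have ao: "a : Obj E" using a unfolding atom_def by blast
 define L where "L c xi \<longleftrightarrow> cov c (\<lambda>f. Q (Dom C f) (xi \<odot> y1 f))" for c xi
 have QL: "L d xi" if "d : Obj C" "xi : hom E (y0 d) a" "Q d xi" for d xi
  unfolding L_def by (rule cov_top[OF that(1)]) (use st[OF _ that(2,3)] homD(2) in metis)
 obtain p m where p: "p : Obj E" "m : hom E p a" "monic E m" "!!c xi. c : Obj C ==> xi : hom E (y0 c) p ==> L c (m \<odot> xi)"
  "!!z s. s : hom E z a ==> (!!c xi. c : Obj C ==> xi : hom E (y0 c) z ==> L c (s \<odot> xi)) ==> \<exists>k\<in>hom E z p. m \<odot> k = s"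
 proof (rule subobject_exists[OF ao, of L])
  show "L c (xi \<odot> y1 f)" if f: "f : hom C c d" and xi: "xi : hom E (y0 d) a" and l: "L d xi" for f c d xi
  proof -
   have "cov c (\<lambda>g. Q (Dom C (f \<cdot> g)) (xi \<odot> y1 (f \<cdot> g)))" using cov_pullback[OF f l[unfolded L_def]] .
   then show ?thesis unfolding L_def
   proof (rule cov_mono[OF hom_objs(1)[OF f]])
    fix g b assume g: "g : hom C b c" and q: "Q (Dom C (f \<cdot> g)) (xi \<odot> y1 (f \<cdot> g))"
    show "Q (Dom C g) (xi \<odot> y1 f \<odot> y1 g)"
     using q homD(2)[OF cmp_hom[OF f g]] homD(2)[OF g] y_comp[OF f g] e_assoc[OF y_hom[OF g] y_hom[OF f] xi] by simp
   qed
  qed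
  show "L c xi" if c: "c : Obj C" and xi: "xi : hom E (y0 c) a" and cv: "cov c (\<lambda>f. L (Dom C f) (xi \<odot> y1 f))" for c xi
   unfolding L_def
  proof (rule cov_trans[OF c cv])
   fix f b assume f: "f : hom C b c" and l: "L (Dom C f) (xi \<odot> y1 f)"
   have "cov b (\<lambda>g. Q (Dom C g) (xi \<odot> y1 f \<odot> y1 g))" using l homD(2)[OF f] unfolding L_def by simp
   then show "cov b (\<lambda>g. Q (Dom C (f \<cdot> g)) (xi \<odot> y1 (f \<cdot> g)))"
   proof (rule cov_mono[OF hom_objs(1)[OF f]])
    fix g e assume g: "g : hom C e b" and q: "Q (Dom C g) (xi \<odot> y1 f \<odot> y1 g)"
    show "Q (Dom C (f \<cdot> g)) (xi \<odot> y1 (f \<cdot> g))"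
     using q homD(2)[OF cmp_hom[OF f g]] homD(2)[OF g] y_comp[OF f g] e_assoc[OF y_hom[OF g] y_hom[OF f] xi] by simp
   qed
  qed
 qed blast
 have k: "k : Obj C" using ex(1) unfolding nondeg_def by blast
 have "\<exists>l\<in>hom E (y0 k) p. m \<odot> l = zeta"
 proof (rule p(5)[OF ex(2)])
  fix c xi assume c: "c : Obj C" and xi: "xi : hom E (y0 c) (y0 k)"
  note zx = e_hom[OF xi ex(2)]
  \<comment> \<open>An arrow \<open>y0 c \<rightarrow> y0 k\<close> comes from the site only
    locally, so stability of \<open>Q\<close> along site arrows gives \<open>L\<close> here.\<close>
  show "L c (zeta \<odot> xi)" unfolding L_def
  proof (rule cov_mono[OF c y_full[OF c k xi]])
   fix f b assume f: "f : hom C b c" and "\<exists>g\<in>hom C (Dom C f) k. xi \<odot> y1 f = y1 g"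
   then obtain g where g: "g : hom C b k" "xi \<odot> y1 f = y1 g" using homD(2)[OF f] by auto
   show "Q (Dom C f) (zeta \<odot> xi \<odot> y1 f)"
    using st[OF g(1) ex(2,3)] e_assoc[OF y_hom[OF f] xi ex(2)] g(2) homD(2)[OF f] by simp
  qed
 qed
 then have "\<not> initial E p" using not_initial_iff[OF p(1)] ex(1) by blast
 then have "is_iso E m" using a p(3) homD[OF p(2)] unfolding atom_def by blast
 then obtain n where n: "n : hom E a p" "m \<odot> n = Ident E a" using is_isoE[OF _ p(2)] by metis
 have "m \<odot> (n \<odot> xi) = xi" using e_assoc[OF xi n(1) p(2)] n(2) cat_ident_left[OF catE xi] by simp
 then show ?thesis using p(4)[OF c e_hom[OF xi n(1)]] unfolding L_def by simp
qed

text \<open>Being of the form \<open>f \<odot> zeta\<close> is a property that some nondegenerate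
  element of the atom \<open>c\<close> has, hence locally all have it. So \<open>s\<close> and
  \<open>t\<close> agree locally on every generalized element.\<close>

lemma atom_epi:
 assumes a: "\<not> initial E a" and c: "atom E c" and f: "f : hom E a c" and s: "s : hom E c e" and t: "t : hom E c e" and eq: "s \<odot> f = t \<odot> f"
 shows "s = t"
proof (rule y_ext[OF s t])
 obtain k eta where k: "nondeg k" "eta : hom E (y0 k) a" using not_initial_iff[OF e_objs(1)[OF f]] a by blast
 fix d xi assume d: "d : Obj C" and xi: "xi : hom E (y0 d) c"
 let ?Q = "\<lambda>d xi. \<exists>zeta\<in>hom E (y0 d) a. xi = f \<odot> zeta"
 have cv: "cov d (\<lambda>g. ?Q (Dom C g) (xi \<odot> y1 g))"
 proof (rule atom_local[OF c _ k(1) e_hom[OF k(2) f] _ d xi, of ?Q])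
  show "?Q b (xi \<odot> y1 g)" if g: "g : hom C b d" and q: "?Q d xi" for g b d xi
   using q e_assoc[OF y_hom[OF g] _ f] e_hom[OF y_hom[OF g]] by metis
  show "?Q k (f \<odot> eta)" using k(2) by blast
 qed
 show "s \<odot> xi = t \<odot> xi"
 proof (rule y_separated[OF d e_hom[OF xi s] e_hom[OF xi t] cov_mono[OF d cv]])
  fix g b assume g: "g : hom C b d" and "?Q (Dom C g) (xi \<odot> y1 g)"
  then obtain zeta where z: "zeta : hom E (y0 b) a" "xi \<odot> y1 g = f \<odot> zeta" using homD(2)[OF g] by auto
  show "s \<odot> xi \<odot> y1 g = t \<odot> xi \<odot> y1 g"
   using e_assoc[OF y_hom[OF g] xi s] e_assoc[OF y_hom[OF g] xi t] z(2) e_assoc[OF z(1) f s] e_assoc[OF z(1) f t] eq by simp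
 qed
qed

text \<open>The pullback has an element: a nondegenerate element of \<open>b\<close> is mapped by
  \<open>g\<close> into the atom \<open>c\<close>, where it lifts along \<open>f\<close> on a cover,
  and some arrow of that cover has a nondegenerate source.\<close>

lemma atom_pullback:
 assumes a: "\<not> initial E a" and b: "\<not> initial E b" and c: "atom E c" and f: "f : hom E a c" and g: "g : hom E b c"
 obtains p m n where "m : hom E p a" "n : hom E p b" "f \<odot> m = g \<odot> n" "\<not> initial E p"
proof -
 obtain p m n where p: "p : Obj E" "m : hom E p a" "n : hom E p b"
  "!!d xi. d : Obj C ==> xi : hom E (y0 d) p ==> f \<odot> (m \<odot> xi) = g \<odot> (n \<odot> xi)"
  "!!z s t. s : hom E z a ==> t : hom E z b ==> (!!d xi. d : Obj C ==> xi : hom E (y0 d) z ==> f \<odot> (s \<odot> xi) = g \<odot> (t \<odot> xi)) ==>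
   \<exists>k\<in>hom E z p. m \<odot> k = s \<and> n \<odot> k = t"
 proof (rule subproduct_exists[OF e_objs(1)[OF f] e_objs(1)[OF g], of "\<lambda>d xi zeta. f \<odot> xi = g \<odot> zeta"])
  show "f \<odot> (xi \<odot> y1 h) = g \<odot> (zeta \<odot> y1 h)" if "h : hom C e d" "xi : hom E (y0 d) a" "zeta : hom E (y0 d) b" "f \<odot> xi = g \<odot> zeta" for h e d xi zeta
   using e_assoc[OF y_hom[OF that(1)] that(2) f] e_assoc[OF y_hom[OF that(1)] that(3) g] that(4) by simp
  show "f \<odot> xi = g \<odot> zeta" if d: "d : Obj C" and xi: "xi : hom E (y0 d) a" and zeta: "zeta : hom E (y0 d) b"
   and cv: "cov d (\<lambda>h. f \<odot> (xi \<odot> y1 h) = g \<odot> (zeta \<odot> y1 h))" for d xi zeta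
  proof (rule y_separated[OF d e_hom[OF xi f] e_hom[OF zeta g] cov_mono[OF d cv]])
   fix h e assume h: "h : hom C e d" and "f \<odot> (xi \<odot> y1 h) = g \<odot> (zeta \<odot> y1 h)"
   then show "f \<odot> xi \<odot> y1 h = g \<odot> zeta \<odot> y1 h" using e_assoc[OF y_hom[OF h] xi f] e_assoc[OF y_hom[OF h] zeta g] by simp
  qed
 qed blast
 obtain k eta where k: "nondeg k" "eta : hom E (y0 k) a" using not_initial_iff[OF e_objs(1)[OF f]] a by blast
 obtain l xi where l: "nondeg l" "xi : hom E (y0 l) b" using not_initial_iff[OF e_objs(1)[OF g]] b by blast
 have lo: "l : Obj C" using l(1) unfolding nondeg_def by blast
 let ?Q = "\<lambda>d xi. \<exists>zeta\<in>hom E (y0 d) a. xi = f \<odot> zeta"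
 have "cov l (\<lambda>h. ?Q (Dom C h) (g \<odot> xi \<odot> y1 h))"
 proof (rule atom_local[OF c _ k(1) e_hom[OF k(2) f] _ lo e_hom[OF l(2) g], of ?Q])
  show "?Q b (xi \<odot> y1 g)" if g: "g : hom C b d" and q: "?Q d xi" for g b d xi
   using q e_assoc[OF y_hom[OF g] _ f] e_hom[OF y_hom[OF g]] by metis
  show "?Q k (f \<odot> eta)" using k(2) by blast
 qed
 then obtain h d where h: "h : hom C d l" "nondeg d" "?Q (Dom C h) (g \<odot> xi \<odot> y1 h)" using cov_nondeg[OF l(1)] by blast
 then obtain zeta where z: "zeta : hom E (y0 d) a" "g \<odot> xi \<odot> y1 h = f \<odot> zeta" using homD(2)[OF h(1)] by auto
 note xh = e_hom[OF y_hom[OF h(1)] l(2)]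
 have eq: "f \<odot> zeta = g \<odot> (xi \<odot> y1 h)" using z(2) e_assoc[OF y_hom[OF h(1)] l(2) g] by simp
 have "\<exists>k\<in>hom E (y0 d) p. m \<odot> k = zeta \<and> n \<odot> k = xi \<odot> y1 h"
  by (rule p(5)[OF z(1) xh]) (use e_assoc[OF _ z(1) f] e_assoc[OF _ xh g] eq in metis)
 then have "\<not> initial E p" using not_initial_iff[OF p(1)] h(2) by blast
 moreover have "f \<odot> m = g \<odot> n"
  by (rule y_ext[OF e_hom[OF p(2) f] e_hom[OF p(3) g]]) (use p(4) e_assoc[OF _ p(2) f] e_assoc[OF _ p(3) g] in simp)
 ultimately show thesis using that p(2,3) by blast
qed

end

section \<open>A small set of atoms\<close>

lemma full_subcat_simps [simp]:
 "Obj (full_subcat C X) = Obj C \<inter> X" "Dom (full_subcat C X) = Dom C" "Cod (full_subcat C X) = Cod C"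
 "Ident (full_subcat C X) = Ident C" "Comp (full_subcat C X) = Comp C" by (simp_all add: full_subcat_def)

lemma hom_full_subcat: "f : hom (full_subcat C X) a b \<longleftrightarrow> a : X \<and> b : X \<and> f : hom C a b"
 by (auto simp: hom_def full_subcat_def)

lemma category_full_subcat:
 assumes C: "category C" shows "category (full_subcat C X)"
proof (rule categoryI, unfold hom_full_subcat full_subcat_simps)
 show "Dom C f : Obj C \<inter> X \<and> Cod C f : Obj C \<inter> X" if "f : Arr (full_subcat C X)" for f
  using that cat_hom_obj[OF C hom_self, of f] by (auto simp: full_subcat_def)
 show "Comp C h (Comp C g f) = Comp C (Comp C h g) f"
  if "a : X \<and> b : X \<and> f : hom C a b" "b : X \<and> c : X \<and> g : hom C b c" "c : X \<and> d : X \<and> h : hom C c d" for f g h a b c d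
  using cat_assoc[OF C] that by blast
qed (use cat_ident[OF C] cat_comp[OF C] cat_ident_left[OF C] cat_ident_right[OF C] in blast)+

lemma discrete_cat_simps [simp]:
 "Obj (discrete_cat I) = I" "Arr (discrete_cat I) = I" "Dom (discrete_cat I) i = i" "Cod (discrete_cat I) i = i"
 "Ident (discrete_cat I) i = i" "Comp (discrete_cat I) j i = i" by (simp_all add: discrete_cat_def)

lemma category_discrete_cat: "category (discrete_cat I)" unfolding category_def hom_def by simp

text \<open>The set \<open>As\<close> has to be small, for flat sets on it to be small, and yet
  large enough to be jointly epic on every object and to reach every object that is not
  initial.\<close>

locale atomic_site = dense_site U C J E y0 y1
 for U :: "'u itself" and C :: "('c, 'd) cat" and J and E :: "('o, 'm) cat" and y0 y1 +
 fixes As :: "'o set"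
 assumes As_atom: "a : As ==> atom E a" and As_sm: "sm As"
  and As_epic: "s : hom E x e ==> t : hom E x e ==> (!!a m. a : As ==> m : hom E a x ==> Comp E s m = Comp E t m) ==> s = t"
  and As_inhab: "e : Obj E ==> \<not> initial E e ==> \<exists>a\<in>As. hom E a e \<noteq> {}"

text \<open>It suffices to collect the atoms in one decomposition of each \<open>y0 c\<close>: the
  site is small, and every object is probed by arrows from the \<open>y0 c\<close>, which are probed
  in turn by their components.\<close>

lemma (in dense_site) atomic_site_exists:
 assumes dec: "!!x. x : Obj E ==> \<exists>(I :: 'u set) A iota. sm I \<and> is_functor (discrete_cat I) E A \<and>
   (\<forall>i\<in>I. atom E (on_obj A i)) \<and> is_colimit (discrete_cat I) E A x iota"
 shows "\<exists>As. atomic_site U C J E y0 y1 As"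
proof -
 have "\<exists>(I :: 'u set) A iota. sm I \<and> is_functor (discrete_cat I) E A \<and>
   (\<forall>i\<in>I. atom E (on_obj A i)) \<and> is_colimit (discrete_cat I) E A (y0 c) iota" if "c : Obj C" for c
  using dec[OF y_obj[OF that]] .
 then obtain I :: "'c => 'u set" and A iota where I: "!!c. c : Obj C ==> sm (I c)" "!!c. c : Obj C ==> is_functor (discrete_cat (I c)) E (A c)"
  "!!c i. c : Obj C ==> i : I c ==> atom E (on_obj (A c) i)"
  "!!c. c : Obj C ==> is_colimit (discrete_cat (I c)) E (A c) (y0 c) (iota c)" by metis
 define As where "As = (\<Union>c\<in>Obj C. on_obj (A c) ` I c)"
 have mem: "on_obj (A c) i : As" "iota c i : hom E (on_obj (A c) i) (y0 c)" if "c : Obj C" "i : I c" for c i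
  using that is_colimitD(3)[OF I(4)[OF that(1)]] unfolding As_def by auto
 have "atomic_site U C J E y0 y1 As"
 proof
  show "atom E a" if "a : As" for a using that I(3) unfolding As_def by blast
  show "sm As" unfolding As_def by (intro sm_UN sm_image sm_Obj_if_sm_Arr[OF catC sm_ArrC] I(1))
  show "s = t" if s: "s : hom E x e" and t: "t : hom E x e" and eq: "!!a m. a : As ==> m : hom E a x ==> s \<odot> m = t \<odot> m" for s x e t
  proof (rule y_ext[OF s t])
   fix c xi assume c: "c : Obj C" and xi: "xi : hom E (y0 c) x"
   show "s \<odot> xi = t \<odot> xi"
   proof (rule is_colimit_ext[OF category_discrete_cat catE I(2)[OF c] I(4)[OF c] e_hom[OF xi s] e_hom[OF xi t]])
    fix i assume "i : Obj (discrete_cat (I c))"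
    then have i: "i : I c" by simp
    note m = mem[OF c i]
    show "s \<odot> xi \<odot> iota c i = t \<odot> xi \<odot> iota c i"
     using e_assoc[OF m(2) xi s] e_assoc[OF m(2) xi t] eq[OF m(1) e_hom[OF m(2) xi]] by simp
   qed
  qed
  show "\<exists>a\<in>As. hom E a e \<noteq> {}" if e: "e : Obj E" and ni: "\<not> initial E e" for e
  proof -
   obtain c xi where c: "nondeg c" and xi: "xi : hom E (y0 c) e" using ni not_initial_iff[OF e] by blast
   have co: "c : Obj C" using c unfolding nondeg_def by blast
   \<comment> \<open>An empty coproduct would make \<open>y0 c\<close> initial, although its
     identity is an element over the nondegenerate \<open>c\<close>.\<close>
   have "I c \<noteq> {}"
   proof
    assume emp: "I c = {}"
    have "initial E (y0 c)" unfolding initial_def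
    proof (intro conjI ballI y_obj[OF co])
     fix b assume "b : Obj E"
     then have "is_cocone (discrete_cat (I c)) E (A c) b (\<lambda>_. undefined)" unfolding is_cocone_def emp by simp
     then have "\<exists>!h. h : hom E (y0 c) b \<and> (\<forall>i\<in>Obj (discrete_cat (I c)). h \<odot> iota c i = undefined)"
      using I(4)[OF co] unfolding is_colimit_def by blast
     then show "\<exists>!f. f : hom E (y0 c) b" using emp by simp
    qed
    moreover have "hom E (y0 c) (y0 c) \<noteq> {}" using cat_ident[OF catE y_obj[OF co]] by blast
    ultimately show False using not_initial_iff[OF y_obj[OF co]] c by blast
   qed
   then obtain i where i: "i : I c" by blast
   show ?thesis using mem(1)[OF co i] e_hom[OF mem(2)[OF co i] xi] by blast
  qed
 qed
 then show ?thesis by blast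
qed

context atomic_site
begin

abbreviation "A \<equiv> full_subcat E As"

lemma As_Obj: "a : As ==> a : Obj E" and As_ni: "a : As ==> \<not> initial E a" using As_atom unfolding atom_def by blast+

text \<open>An arrow is determined by its effect on generalized elements, which is a small family of
  functions between small sets.\<close>

lemma sm_hom: assumes a: "a : Obj E" and b: "b : Obj E" shows "sm (hom E a b)"
proof -
 let ?r = "\<lambda>f. \<lambda>c\<in>Obj C. \<lambda>xi\<in>hom E (y0 c) a. f \<odot> xi"
 have "inj_on ?r (hom E a b)"
 proof (rule inj_onI)
  fix f g assume f: "f : hom E a b" and g: "g : hom E a b" and eq: "?r f = ?r g"
  show "f = g"
  proof (rule y_ext[OF f g])
   fix c xi assume "c : Obj C" "xi : hom E (y0 c) a"
   then show "f \<odot> xi = g \<odot> xi" using fun_cong[OF fun_cong[OF eq, of c], of xi] by simp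
  qed
 qed
 moreover have "?r ` hom E a b \<subseteq> (\<Pi>\<^sub>E c\<in>Obj C. hom E (y0 c) a \<rightarrow>\<^sub>E hom E (y0 c) b)"
  using e_hom by (auto simp: PiE_def Pi_def)
 moreover have "sm (\<Pi>\<^sub>E c\<in>Obj C. hom E (y0 c) a \<rightarrow>\<^sub>E hom E (y0 c) b)"
  by (intro sm_PiE sm_Obj_if_sm_Arr[OF catC sm_ArrC] y_sm a b)
 ultimately show ?thesis by (rule sm_inj)
qed

sublocale At: epi_site U A
proof
 show "category A" by (rule category_full_subcat[OF catE])
 show "sm (Arr A)"
 proof (rule sm_subset)
  show "sm (\<Union>a\<in>As. \<Union>b\<in>As. hom E a b)" by (intro sm_UN As_sm sm_hom As_Obj)
  show "Arr A \<subseteq> (\<Union>a\<in>As. \<Union>b\<in>As. hom E a b)" by (auto simp: full_subcat_def hom_def)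
 qed
 show "g = h" if "f : hom A a b" "g : hom A b c" "h : hom A b c" "Comp A g f = Comp A h f" for f a b g c h
  using that atom_epi[OF As_ni As_atom, of a b f g c h] by (simp add: hom_full_subcat)
 show "\<exists>d. \<exists>h\<in>hom A d a. \<exists>k\<in>hom A d b. Comp A f h = Comp A g k" if "f : hom A a c" "g : hom A b c" for f a c g b
 proof -
  have f: "f : hom E a c" "a : As" "c : As" and g: "g : hom E b c" "b : As" using that by (auto simp: hom_full_subcat)
  obtain p m n where p: "m : hom E p a" "n : hom E p b" "f \<odot> m = g \<odot> n" "\<not> initial E p"
   using atom_pullback[OF As_ni[OF f(2)] As_ni[OF g(2)] As_atom[OF f(3)] f(1) g(1)] .
  \<comment> \<open>The pullback of two atoms need not be an atom, but it is not initial, so an atom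
    of \<open>As\<close> maps to it; that is all \<open>ore\<close> asks for.\<close>
  obtain d q where d: "d : As" "q : hom E d p" using As_inhab[OF e_objs(1)[OF p(1)] p(4)] by blast
  have "f \<odot> (m \<odot> q) = g \<odot> (n \<odot> q)" using e_assoc[OF d(2) p(1) f(1)] e_assoc[OF d(2) p(2) g(1)] p(3) by simp
  moreover have "m \<odot> q : hom A d a" "n \<odot> q : hom A d b"
   using e_hom[OF d(2) p(1)] e_hom[OF d(2) p(2)] d(1) f(2) g(2) by (auto simp: hom_full_subcat)
  ultimately show ?thesis by (intro exI[of _ d] bexI[of _ "m \<odot> q"] bexI[of _ "n \<odot> q"]) simp_all
 qed
qed

end

text \<open>Left adjoints turn jointly epic families into jointly surjective ones. If
  \<open>u\<close> were missed, two functions that differ only at \<open>u\<close> would agree after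
  every \<open>L m\<close>; their transposes then agree on the family, so they are equal. The family
  may be empty, which covers the initial object.\<close>

lemma left_adjoint_epic:
 fixes U :: "'u itself" and L :: "('o, 'm, 'u set, 'u setarr) fctr"
 assumes adj: "adjunction E (Set_cat U) L R eta eps" and x: "x : Obj E"
  and two: "small U {p, q :: 'u}" "p \<noteq> q"
  and N: "!!m. m : N ==> m : hom E (Dom E m) x"
  and epic: "!!e s t. s : hom E x e ==> t : hom E x e ==> (!!m. m : N ==> Comp E s m = Comp E t m) ==> s = t"
  and u: "u : on_obj L x"
 shows "\<exists>m\<in>N. \<exists>y\<in>on_obj L (Dom E m). fapp L m y = u"
proof (rule ccontr)
 assume neg: "\<not> (\<exists>m\<in>N. \<exists>y\<in>on_obj L (Dom E m). fapp L m y = u)"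
 let ?S = "Set_cat U" and ?X = "{p, q}"
 have L: "is_functor E ?S L" and R: "is_functor ?S E R"
  and eta: "eta : nat_trans E E (id_functor E) (comp_functor E R L)"
  and eps: "eps : nat_trans ?S ?S (comp_functor ?S L R) (id_functor ?S)"
  and tri: "!!c. c : Obj E ==> Comp ?S (eps (on_obj L c)) (on_arr L (eta c)) = Ident ?S (on_obj L c)"
  using adj unfolding adjunction_def by auto
 note E = functor_cats(1)[OF L] and S = category_Set_cat[of U]
 have eta1: "eta c : hom E c (on_obj R (on_obj L c))" if "c : Obj E" for c
  using nat_transD(1)[OF eta that] that by (simp add: comp_functor_obj)
 have eta2: "Comp E (on_arr R (on_arr L f)) (eta a) = Comp E (eta b) f" if "f : hom E a b" for f a b
  using nat_transD(2)[OF eta that] homD(1)[OF that] by (simp add: comp_functor_arr)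
 have eps1: "eps X : hom ?S (on_obj L (on_obj R X)) X" if "X : Obj ?S" for X
  using nat_transD(1)[OF eps that] that by (simp add: comp_functor_obj)
 have eps2: "Comp ?S h (eps X) = Comp ?S (eps Y) (on_arr L (on_arr R h))" if "h : hom ?S X Y" for h X Y
  using nat_transD(2)[OF eps that] homD(1)[OF that] by (simp add: comp_functor_arr)
 have Lx: "on_obj L x : Obj ?S" using functor_obj[OF L x] .
 define tr where "tr s = Comp E (on_arr R s) (eta x)" for s
 have tr: "tr s : hom E x (on_obj R X)" "s = Comp ?S (eps X) (on_arr L (tr s))" if s: "s : hom ?S (on_obj L x) X" for s X
 proof -
  show "tr s : hom E x (on_obj R X)" unfolding tr_def using cat_comp[OF E eta1[OF x] functor_hom[OF R s]] .
  have X: "X : Obj ?S" using cat_hom_obj(2)[OF S s] .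
  note LR = functor_hom[OF L functor_hom[OF R s]] and Leta = functor_hom[OF L eta1[OF x]]
  have "Comp ?S (eps X) (on_arr L (tr s)) = Comp ?S (Comp ?S (eps X) (on_arr L (on_arr R s))) (on_arr L (eta x))"
   unfolding tr_def functor_comp[OF L eta1[OF x] functor_hom[OF R s]] using cat_assoc[OF S Leta LR eps1[OF X]] .
  also have "\<dots> = Comp ?S s (Comp ?S (eps (on_obj L x)) (on_arr L (eta x)))"
   unfolding eps2[OF s, symmetric] using cat_assoc[OF S Leta eps1[OF Lx] s] by simp
  also have "\<dots> = s" unfolding tri[OF x] using cat_ident_right[OF S s] .
  finally show "s = Comp ?S (eps X) (on_arr L (tr s))" by simp
 qed
 have tr_comp: "Comp E (tr s) m = Comp E (on_arr R (Comp ?S s (on_arr L m))) (eta (Dom E m))"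
  if s: "s : hom ?S (on_obj L x) X" and m: "m : hom E (Dom E m) x" for s X m
 proof -
  note d = cat_hom_obj(1)[OF E m] note Lm = functor_hom[OF L m]
  show ?thesis unfolding tr_def functor_comp[OF R Lm s]
   using cat_assoc[OF E m eta1[OF x] functor_hom[OF R s]] cat_assoc[OF E eta1[OF d] functor_hom[OF R Lm] functor_hom[OF R s]] eta2[OF m]
   by simp
 qed
 have sL: "small U (on_obj L x)" using Lx by (simp add: Obj_Set_cat)
 \<comment> \<open>One function is constantly \<open>p\<close>, the other takes the value
   \<open>q\<close> at \<open>u\<close> alone; this is why two distinct points of \<open>'u\<close>
   were assumed.\<close>
 define s where "s = (on_obj L x, \<lambda>v\<in>on_obj L x. p, ?X)"
 define t where "t = (on_obj L x, \<lambda>v\<in>on_obj L x. if v = u then q else p, ?X)"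
 have s: "s : hom ?S (on_obj L x) ?X" unfolding s_def by (rule Set_homI[OF sL two(1)]) auto
 have t: "t : hom ?S (on_obj L x) ?X" unfolding t_def by (rule Set_homI[OF sL two(1)]) auto
 have "Comp ?S s (on_arr L m) = Comp ?S t (on_arr L m)" if m: "m : N" for m
 proof -
  note Lm = functor_hom[OF L N[OF m]]
  show ?thesis
  proof (rule Set_ext[OF cat_comp[OF S Lm s] cat_comp[OF S Lm t]])
   fix y assume y: "y : on_obj L (Dom E m)"
   have "fapp L m y \<noteq> u" using neg m y by blast
   then show "app (Comp ?S s (on_arr L m)) y = app (Comp ?S t (on_arr L m)) y"
    unfolding Set_comp[OF Lm s y] Set_comp[OF Lm t y] using Set_hom(2)[OF Lm y] by (simp add: s_def t_def)
  qed
 qed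
 then have "tr s = tr t" by (intro epic[OF tr(1)[OF s] tr(1)[OF t]]) (simp add: tr_comp[OF s N] tr_comp[OF t N])
 then have "s = t" using tr(2)[OF s] tr(2)[OF t] by metis
 then have "app s u = app t u" by simp
 then show False using two(2) u by (simp add: s_def t_def)
qed

text \<open>A compatible family of elements is a cone whose vertex is a one-point set, and the
  preserved limit receives it.\<close>

lemma lex_elements:
 fixes U :: "'u itself" and L :: "('o, 'm, 'u set, 'u setarr) fctr" and D :: "(nat, nat) cat"
 assumes L: "is_functor E (Set_cat U) L" and lex: "preserves_finite_limits E (Set_cat U) L"
  and D: "category D" "finite (Obj D)" "finite (Arr D)" and G: "is_functor D E G" and lim: "is_limit D E G c tau"
  and one: "small U {p :: 'u}"
  and u: "!!i. i : Obj D ==> u i : on_obj L (on_obj G i)"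
   "!!f. f : Arr D ==> fapp L (on_arr G f) (u (Dom D f)) = u (Cod D f)"
 shows "\<exists>z\<in>on_obj L c. \<forall>i\<in>Obj D. fapp L (tau i) z = u i"
proof -
 let ?S = "Set_cat U" and ?LG = "comp_functor D L G"
 have lim': "is_limit D ?S ?LG (on_obj L c) (\<lambda>i. on_arr L (tau i))"
  using lex D G lim unfolding preserves_finite_limits_def by blast
 let ?sigma = "\<lambda>i. ({p}, \<lambda>v\<in>{p}. u i, on_obj L (on_obj G i))"
 have h: "?sigma i : hom ?S {p} (on_obj L (on_obj G i))" if "i : Obj D" for i
  by (rule Set_homI[OF one]) (use u(1)[OF that] functor_obj[OF L functor_obj[OF G that]] in \<open>auto simp: Obj_Set_cat\<close>)
 have "is_cone D ?S ?LG {p} ?sigma" unfolding is_cone_def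
 proof (intro conjI ballI)
  show "{p} : Obj ?S" using one by (simp add: Obj_Set_cat)
  show "?sigma i : hom ?S {p} (on_obj ?LG i)" if "i : Obj D" for i using h[OF that] that by (simp add: comp_functor_obj)
  fix f assume f: "f : Arr D"
  note fh = hom_self[OF f] note o = cat_hom_obj[OF D(1) fh]
  note Lf = functor_hom[OF L functor_hom[OF G fh]]
  have "Comp ?S (on_arr L (on_arr G f)) (?sigma (Dom D f)) = ?sigma (Cod D f)"
  proof (rule Set_ext[OF cat_comp[OF category_Set_cat h[OF o(1)] Lf] h[OF o(2)]])
   fix v assume v: "v : {p}"
   show "app (Comp ?S (on_arr L (on_arr G f)) (?sigma (Dom D f))) v = app (?sigma (Cod D f)) v"
    unfolding Set_comp[OF h[OF o(1)] Lf v] using u(2)[OF f] v by simp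
  qed
  then show "Comp ?S (on_arr ?LG f) (?sigma (Dom D f)) = ?sigma (Cod D f)" using f by (simp add: comp_functor_arr)
 qed
 then obtain k where k: "k : hom ?S {p} (on_obj L c)" "\<forall>i\<in>Obj D. Comp ?S (on_arr L (tau i)) k = ?sigma i"
  using lim' unfolding is_limit_def by blast
 have "fapp L (tau i) (app k p) = u i" if i: "i : Obj D" for i
 proof -
  have "tau i : hom E c (on_obj G i)" using lim i unfolding is_limit_def is_cone_def by blast
  note Lt = functor_hom[OF L this]
  have "app (Comp ?S (on_arr L (tau i)) k) p = app (?sigma i) p" using k(2) i by simp
  then show ?thesis using Set_comp[OF k(1) Lt, of p] by simp
 qed
 then show ?thesis using Set_hom(2)[OF k(1), of p] by blast
qed

section \<open>Inverse images of points in terms of elements\<close>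

context atomic_site
begin

text \<open>The consequences of left exactness and of the right adjoint from which the functor can
  be recovered from its values on \<open>As\<close>. The second clause makes values on
  \<open>As\<close> suffice, the third is saturation, and the others are flatness.\<close>

definition point_fctr :: "('o, 'm, 'u set, 'u setarr) fctr => bool" where
 "point_fctr F \<longleftrightarrow> is_functor E (Set_cat U) F \<and>
   (\<forall>x\<in>Obj E. \<forall>u\<in>on_obj F x. \<exists>a\<in>As. \<exists>m\<in>hom E a x. \<exists>y\<in>on_obj F a. fapp F m y = u) \<and>
   (\<forall>a\<in>As. \<forall>b\<in>As. \<forall>g\<in>hom E a b. \<forall>y\<in>on_obj F b. \<exists>x\<in>on_obj F a. fapp F g x = y) \<and>
   (\<exists>a\<in>As. on_obj F a \<noteq> {}) \<and>
   (\<forall>a\<in>Obj E. \<forall>b\<in>Obj E. \<forall>x\<in>on_obj F a. \<forall>y\<in>on_obj F b. \<exists>d\<in>As. \<exists>z\<in>on_obj F d. \<exists>m\<in>hom E d a. \<exists>n\<in>hom E d b.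
    fapp F m z = x \<and> fapp F n z = y) \<and>
   (\<forall>b\<in>As. \<forall>e. \<forall>s\<in>hom E b e. \<forall>t\<in>hom E b e. \<forall>z\<in>on_obj F b. fapp F s z = fapp F t z --> s = t)"

lemma two_points: obtains p q :: 'u where "sm {p, q}" "p \<noteq> q"
proof -
 obtain e :: "nat => 'u" where "inj e" using infinite_univ infinite_countable_subset by blast
 then have "e 0 \<noteq> e 1" by (simp add: inj_eq)
 then show thesis using that[of "e 0" "e 1"] sm_finite[of "{e 0, e 1}"] by simp
qed

text \<open>The surjectivity statements come from the right adjoint: atoms are jointly epic, an
  arrow between atoms is epic, and the empty family is jointly epic on an initial object. The rest
  comes from the terminal object, binary products and equalizers, each followed by a covering with
  atoms where one is asked for.\<close>

lemma geometric_morphism_point_fctr: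
 assumes gm: "geometric_morphism (Set_cat U) E f" shows "point_fctr (inverse_image f)"
proof -
 let ?F = "inverse_image f" and ?S = "Set_cat U"
 have adj: "adjunction E ?S ?F (direct_image f) (adj_unit f) (adj_counit f)" and lex: "preserves_finite_limits E ?S ?F"
  using gm unfolding geometric_morphism_def by auto
 have F: "is_functor E ?S ?F" using adj unfolding adjunction_def by blast
 obtain p q :: 'u where pq: "sm {p, q}" "p \<noteq> q" using two_points .
 have one: "sm {p}" by (rule sm_finite) simp
 note epic = left_adjoint_epic[OF adj _ pq]
 note els = lex_elements[OF F lex _ _ _ _ _ one]
 have cover: "\<exists>a\<in>As. \<exists>m\<in>hom E a x. \<exists>y\<in>on_obj ?F a. fapp ?F m y = u" if x: "x : Obj E" and u: "u : on_obj ?F x" for x u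
 proof -
  have "\<exists>m\<in>{m : Arr E. Dom E m : As \<and> Cod E m = x}. \<exists>y\<in>on_obj ?F (Dom E m). fapp ?F m y = u"
  proof (rule epic[OF x _ _ u])
   show "m : hom E (Dom E m) x" if "m : {m : Arr E. Dom E m : As \<and> Cod E m = x}" for m using that by (simp add: hom_def)
   show "s = t" if s: "s : hom E x e" and t: "t : hom E x e"
    and eq: "!!m. m : {m : Arr E. Dom E m : As \<and> Cod E m = x} ==> s \<odot> m = t \<odot> m" for e s t
    by (rule As_epic[OF s t]) (use eq in \<open>auto simp: hom_def\<close>)
  qed
  then show ?thesis unfolding hom_def by blast
 qed
 have init: "on_obj ?F e = {}" if "initial E e" for e
 proof (rule ccontr)
  assume "on_obj ?F e \<noteq> {}"
  then obtain u where u: "u : on_obj ?F e" by blast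
  have "\<exists>m\<in>{}. \<exists>y\<in>on_obj ?F (Dom E m). fapp ?F m y = u"
  proof (rule epic[OF _ _ _ u])
   show "e : Obj E" using that unfolding initial_def by blast
   show "s = t" if s: "s : hom E e d" and t: "t : hom E e d" for d s t
    using \<open>initial E e\<close> e_objs(2)[OF s] s t unfolding initial_def by blast
  qed simp
  then show False by blast
 qed
 have sat: "\<exists>x\<in>on_obj ?F a. fapp ?F g x = y" if a: "a : As" and b: "b : As" and g: "g : hom E a b" and y: "y : on_obj ?F b" for a b g y
 proof -
  have "\<exists>m\<in>{g}. \<exists>x\<in>on_obj ?F (Dom E m). fapp ?F m x = y"
  proof (rule epic[OF As_Obj[OF b] _ _ y])
   show "m : hom E (Dom E m) b" if "m : {g}" for m using that g homD(2)[OF g] by simp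
   show "s = t" if "s : hom E b e" "t : hom E b e" "!!m. m : {g} ==> s \<odot> m = t \<odot> m" for e s t
    using atom_epi[OF As_ni[OF a] As_atom[OF b] g that(1,2)] that(3) by simp
  qed
  then show ?thesis using homD(2)[OF g] by simp
 qed
 have ne: "\<exists>a\<in>As. on_obj ?F a \<noteq> {}"
 proof -
  obtain e where e: "e : Obj E" "!!z. z : Obj E ==> \<exists>!t. t : hom E z e" using terminal_exists by metis
  let ?D = "discrete_cat ({} :: nat set)" and ?G = "\<lparr>on_obj = (\<lambda>_. undefined), on_arr = (\<lambda>_. undefined)\<rparr>"
  have G: "is_functor ?D E ?G" unfolding is_functor_def using catE category_discrete_cat by simp
  have "is_limit ?D E ?G e (\<lambda>_. undefined)" unfolding is_limit_def is_cone_def using e by simp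
  from els[OF category_discrete_cat _ _ G this] obtain z where z: "z : on_obj ?F e" by auto
  then show ?thesis using cover[OF e(1) z] by blast
 qed
 have join: "\<exists>d\<in>As. \<exists>z\<in>on_obj ?F d. \<exists>m\<in>hom E d a. \<exists>n\<in>hom E d b. fapp ?F m z = x \<and> fapp ?F n z = y"
  if a: "a : Obj E" and b: "b : Obj E" and x: "x : on_obj ?F a" and y: "y : on_obj ?F b" for a b x y
 proof -
  obtain r m n where r: "r : Obj E" "m : hom E r a" "n : hom E r b"
   "!!z s t. s : hom E z a ==> t : hom E z b ==> \<exists>!k. k : hom E z r \<and> m \<odot> k = s \<and> n \<odot> k = t"
   by (rule product_exists[OF a b]) (rule that)
  let ?I = "{0, 1 :: nat}" let ?D = "discrete_cat ?I"
  let ?g = "\<lambda>i. if i = 0 then a else b" let ?tau = "\<lambda>i. if i = 0 then m else n"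
  let ?G = "\<lparr>on_obj = (\<lambda>i\<in>?I. ?g i), on_arr = (\<lambda>i\<in>?I. Ident E (?g i))\<rparr>"
  have G: "is_functor ?D E ?G" unfolding is_functor_def
   using category_discrete_cat catE a b cat_ident[OF catE] cat_ident_left[OF catE cat_ident[OF catE]] by auto
  have lim: "is_limit ?D E ?G r ?tau" unfolding is_limit_def
  proof (intro conjI allI impI)
   show "is_cone ?D E ?G r ?tau" unfolding is_cone_def using r cat_ident_left[OF catE] by auto
   fix z sigma assume "is_cone ?D E ?G z sigma"
   then have "sigma 0 : hom E z a" "sigma 1 : hom E z b" unfolding is_cone_def by auto
   from r(4)[OF this] show "\<exists>!h. h : hom E z r \<and> (\<forall>i\<in>Obj ?D. ?tau i \<odot> h = sigma i)" by simp
  qed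
  have "\<exists>z\<in>on_obj ?F r. \<forall>i\<in>Obj ?D. fapp ?F (?tau i) z = (if i = 0 then x else y)"
   by (rule els[OF category_discrete_cat _ _ G lim])
    (use x y Set_functor_app(3)[OF F a x] Set_functor_app(3)[OF F b y] in auto)
  then obtain z where z: "z : on_obj ?F r" "fapp ?F m z = x" "fapp ?F n z = y" by auto
  obtain d k w where d: "d : As" "k : hom E d r" "w : on_obj ?F d" "fapp ?F k w = z" using cover[OF r(1) z(1)] by blast
  have "fapp ?F (m \<odot> k) w = x" "fapp ?F (n \<odot> k) w = y"
   using Set_functor_app(2)[OF F d(2) r(2) d(3)] Set_functor_app(2)[OF F d(2) r(3) d(3)] d(4) z by auto
  then show ?thesis using d e_hom[OF d(2) r(2)] e_hom[OF d(2) r(3)] by blast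
 qed
 have thin: "s = t" if b: "b : As" and s: "s : hom E b e" and t: "t : hom E b e" and z: "z : on_obj ?F b"
  and eq: "fapp ?F s z = fapp ?F t z" for b e s t z
 proof -
  obtain r m where r: "r : Obj E" "m : hom E r b" "monic E m" "s \<odot> m = t \<odot> m"
   "!!z k. k : hom E z b ==> s \<odot> k = t \<odot> k ==> \<exists>l\<in>hom E z r. m \<odot> l = k" by (rule equalizer_exists[OF s t]) (rule that)
  have bo: "b : Obj E" and eo: "e : Obj E" using e_objs[OF s] by auto
  \<comment> \<open>The shape of a parallel pair: the arrows 0 and 1 are the identities of the two
    objects, 2 and 3 go from 0 to 1. In a composite one factor is always an identity, and it is the
    first one exactly when \<open>f < 2\<close> or both are.\<close>
  define D :: "(nat, nat) cat" where "D = \<lparr>Obj = {0, 1}, Arr = {0, 1, 2, 3}, Dom = (\<lambda>f. if f = 1 then 1 else 0),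
   Cod = (\<lambda>f. if f = 0 then 0 else 1), Ident = (\<lambda>i. i), Comp = (\<lambda>g f. if f < 2 then g else f)\<rparr>"
  have D: "Obj D = {0, 1}" "Arr D = {0, 1, 2, 3}" "Dom D f = (if f = 1 then 1 else 0)" "Cod D f = (if f = 0 then 0 else 1)"
   "Ident D i = i" "Comp D g f = (if f < 2 then g else f)" for f g i by (simp_all add: D_def)
  have catD: "category D" unfolding category_def hom_def D by auto
  let ?g = "\<lambda>i. if i = 0 then b else e"
  let ?a = "\<lambda>f. if f = 0 then Ident E b else if f = 1 then Ident E e else if f = 2 then s else t"
  let ?G = "\<lparr>on_obj = (\<lambda>i\<in>{0, 1 :: nat}. ?g i), on_arr = (\<lambda>f\<in>{0, 1, 2, 3 :: nat}. ?a f)\<rparr>"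
  have ids: "Ident E b : hom E b b" "Ident E e : hom E e e" using cat_ident[OF catE] bo eo by auto
  note il = cat_ident_left[OF catE] and ir = cat_ident_right[OF catE]
  have G: "is_functor D E ?G" unfolding is_functor_def D
   using catD catE bo eo ids s t il[OF ids(1)] il[OF ids(2)] il[OF s] il[OF t] ir[OF s] ir[OF t] by auto
  let ?tau = "\<lambda>i. if i = (0 :: nat) then m else s \<odot> m"
  note sm = e_hom[OF r(2) s]
  have lim: "is_limit D E ?G r ?tau" unfolding is_limit_def
  proof (intro conjI allI impI)
   show "is_cone D E ?G r ?tau" unfolding is_cone_def D using r(1,2,4) sm il[OF r(2)] il[OF sm] by auto
   fix z sigma assume "is_cone D E ?G z sigma"
   then have sigma: "sigma 0 : hom E z b" "sigma 1 : hom E z e" "s \<odot> sigma 0 = sigma 1" "t \<odot> sigma 0 = sigma 1"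
    unfolding is_cone_def D by auto
   obtain l where l: "l : hom E z r" "m \<odot> l = sigma 0" using r(5)[OF sigma(1)] sigma(3,4) by auto
   show "\<exists>!h. h : hom E z r \<and> (\<forall>i\<in>Obj D. ?tau i \<odot> h = sigma i)"
   proof (rule ex1I[of _ l])
    show "l : hom E z r \<and> (\<forall>i\<in>Obj D. ?tau i \<odot> l = sigma i)" unfolding D using l e_assoc[OF l(1) r(2) s] sigma(3) by auto
    fix h assume h: "h : hom E z r \<and> (\<forall>i\<in>Obj D. ?tau i \<odot> h = sigma i)"
    then have "m \<odot> h = m \<odot> l" using l unfolding D by auto
    then show "h = l" using r(3) h l(1) e_objs(1)[OF l(1)] homD[OF r(2)] unfolding monic_def by auto
   qed
  qed
  have "\<exists>z'\<in>on_obj ?F r. \<forall>i\<in>Obj D. fapp ?F (?tau i) z' = (if i = 0 then z else fapp ?F s z)"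
  proof (rule els[OF catD _ _ G lim])
   show "finite (Obj D)" "finite (Arr D)" unfolding D by auto
   show "(if i = 0 then z else fapp ?F s z) : on_obj ?F (on_obj ?G i)" if "i : Obj D" for i
    using that z Set_functor_app(1)[OF F s z] unfolding D by auto
   show "fapp ?F (on_arr ?G f) (if Dom D f = 0 then z else fapp ?F s z) = (if Cod D f = 0 then z else fapp ?F s z)"
    if "f : Arr D" for f
    using that eq Set_functor_app(3)[OF F bo z] Set_functor_app(3)[OF F eo Set_functor_app(1)[OF F s z]] unfolding D by auto
  qed
  \<comment> \<open>The common value gives the equalizer an element in the fibre, so it is not
    initial; as a subobject of an atom it is everything, whence \<open>s = t\<close>.\<close>
  then have "on_obj ?F r \<noteq> {}" by blast
  then have "\<not> initial E r" using init by blast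
  then have "is_iso E m" using As_atom[OF b] r(3) homD[OF r(2)] unfolding atom_def by blast
  then obtain n where n: "n : hom E b r" "m \<odot> n = Ident E b" using is_isoE[OF _ r(2)] by metis
  have "s = s \<odot> m \<odot> n" "t = t \<odot> m \<odot> n" using e_assoc[OF n(1) r(2) s] e_assoc[OF n(1) r(2) t] n(2) ir[OF s] ir[OF t] by auto
  then show ?thesis using r(4) by metis
 qed
 show ?thesis unfolding point_fctr_def
  by (intro conjI ballI allI impI) (fact F, erule (1) cover, erule (3) sat, fact ne, erule (3) join, erule (4) thin)
qed

end

section \<open>Points\<close>

lemma category_functor_cat:
 assumes T: "!!x. x : X ==> is_functor C D (T x)" and D: "category D"
 shows "category (functor_cat C D X T)"
proof (rule categoryI)
 let ?F = "functor_cat C D X T"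
 show "Dom ?F t : Obj ?F \<and> Cod ?F t : Obj ?F" if "t : Arr ?F" for t using that by (auto simp: functor_cat_def)
 have nat: "(\<lambda>a\<in>Obj C. Comp D (theta a) (eta a)) : nat_trans C D (T x) (T z)"
  if xyz: "x : X" "y : X" "z : X" and eta: "eta : nat_trans C D (T x) (T y)" and theta: "theta : nat_trans C D (T y) (T z)" for x y z eta theta
 proof -
  have C: "category C" using functor_cats(1)[OF T[OF xyz(1)]] .
  show ?thesis unfolding nat_trans_def mem_Collect_eq
  proof (intro conjI ballI)
   show "(\<lambda>a\<in>Obj C. Comp D (theta a) (eta a)) a : hom D (on_obj (T x) a) (on_obj (T z) a)" if "a : Obj C" for a
    using cat_comp[OF D nat_transD(1)[OF eta that] nat_transD(1)[OF theta that]] that by simp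
   fix f assume "f : Arr C"
   then have f: "f : hom C (Dom C f) (Cod C f)" by (rule hom_self)
   note o = cat_hom_obj[OF C f]
   note e = nat_transD(1)[OF eta o(1)] nat_transD(1)[OF eta o(2)] and t = nat_transD(1)[OF theta o(1)] nat_transD(1)[OF theta o(2)]
   note Fx = functor_hom[OF T[OF xyz(1)] f] and Fy = functor_hom[OF T[OF xyz(2)] f] and Fz = functor_hom[OF T[OF xyz(3)] f]
   show "Comp D (on_arr (T z) f) ((\<lambda>a\<in>Obj C. Comp D (theta a) (eta a)) (Dom C f)) = Comp D ((\<lambda>a\<in>Obj C. Comp D (theta a) (eta a)) (Cod C f)) (on_arr (T x) f)"
    using o cat_assoc[OF D e(1) t(1) Fz] nat_transD(2)[OF theta f] cat_assoc[OF D e(1) Fy t(2)] nat_transD(2)[OF eta f] cat_assoc[OF D Fx e(2) t(2)]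
    by simp
  qed simp
 qed
 show "Ident ?F x : hom ?F x x" if "x : Obj ?F" for x
 proof -
  have x: "x : X" using that by (simp add: functor_cat_simps)
  have C: "category C" using functor_cats(1)[OF T[OF x]] .
  have "(\<lambda>a\<in>Obj C. Ident D (on_obj (T x) a)) : nat_trans C D (T x) (T x)" unfolding nat_trans_def mem_Collect_eq
  proof (intro conjI ballI)
   show "(\<lambda>a\<in>Obj C. Ident D (on_obj (T x) a)) a : hom D (on_obj (T x) a) (on_obj (T x) a)" if "a : Obj C" for a
    using cat_ident[OF D functor_obj[OF T[OF x] that]] that by simp
   fix f assume "f : Arr C"
   then have f: "f : hom C (Dom C f) (Cod C f)" by (rule hom_self)
   show "Comp D (on_arr (T x) f) ((\<lambda>a\<in>Obj C. Ident D (on_obj (T x) a)) (Dom C f)) = Comp D ((\<lambda>a\<in>Obj C. Ident D (on_obj (T x) a)) (Cod C f)) (on_arr (T x) f)"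
    using cat_hom_obj[OF C f] cat_ident_right[OF D functor_hom[OF T[OF x] f]] cat_ident_left[OF D functor_hom[OF T[OF x] f]] by simp
  qed simp
  then show ?thesis using x by (simp add: hom_functor_cat functor_cat_simps)
 qed
 show "Comp ?F g f : hom ?F a c" if "f : hom ?F a b" "g : hom ?F b c" for f g a b c
  using that nat unfolding hom_functor_cat by (auto simp: functor_cat_simps)
 show "Comp ?F f (Ident ?F a) = f \<and> Comp ?F (Ident ?F b) f = f" if "f : hom ?F a b" for f a b
 proof -
  obtain eta where eta: "a : X" "b : X" "eta : nat_trans C D (T a) (T b)" "f = (a, eta, b)" using \<open>f : hom ?F a b\<close> unfolding hom_functor_cat by blast
  have "(\<lambda>i\<in>Obj C. Comp D (eta i) ((\<lambda>i\<in>Obj C. Ident D (on_obj (T a) i)) i)) = eta"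
   "(\<lambda>i\<in>Obj C. Comp D ((\<lambda>i\<in>Obj C. Ident D (on_obj (T b) i)) i) (eta i)) = eta"
   by (rule extensionalityI[OF _ nat_transD(3)[OF eta(3)]];
     simp add: cat_ident_right[OF D nat_transD(1)[OF eta(3)]] cat_ident_left[OF D nat_transD(1)[OF eta(3)]])+
  then show ?thesis unfolding eta(4) functor_cat_simps by simp
 qed
 show "Comp ?F h (Comp ?F g f) = Comp ?F (Comp ?F h g) f"
  if f: "f : hom ?F a b" and g: "g : hom ?F b c" and h: "h : hom ?F c d" for f g h a b c d
 proof -
  obtain eta theta zeta where n: "eta : nat_trans C D (T a) (T b)" "f = (a, eta, b)" "theta : nat_trans C D (T b) (T c)" "g = (b, theta, c)"
   "zeta : nat_trans C D (T c) (T d)" "h = (c, zeta, d)" using f g h unfolding hom_functor_cat by blast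
  have "(\<lambda>i\<in>Obj C. Comp D (zeta i) ((\<lambda>i\<in>Obj C. Comp D (theta i) (eta i)) i)) = (\<lambda>i\<in>Obj C. Comp D ((\<lambda>i\<in>Obj C. Comp D (zeta i) (theta i)) i) (eta i))"
   by (rule restrict_ext) (simp add: cat_assoc[OF D nat_transD(1)[OF n(1)] nat_transD(1)[OF n(3)] nat_transD(1)[OF n(5)]])
  then show ?thesis unfolding n functor_cat_simps by simp
 qed
qed

section \<open>Embedding a category of flat sets into \<open>K\<close>\<close>

context flat_cat
begin

text \<open>Separates the encoding in \<open>'u\<close> from the study of points: the flat sets
  \<open>P x\<close> may live on any type, and each is replaced by an isomorphic object of
  \<open>K\<close>. The surjections \<open>phi\<close> are kept in the conclusion because essential
  surjectivity is later read off from them.\<close>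

lemma fully_faithful_from_asets:
 fixes X :: "('x, 'y) cat" and P :: "'x => ('z, 'a, 'b) aset" and pm :: "'y => 'z => 'z"
 assumes X: "category X" and P: "!!x. x : Obj X ==> flat (P x)" and Ps: "!!x. x : Obj X ==> sm (El (P x))"
  and pm: "!!t x y. t : hom X x y ==> pm t : ahom (P x) (P y)"
  and pm_id: "!!x p. x : Obj X ==> p : El (P x) ==> pm (Ident X x) p = p"
  and pm_comp: "!!s t x y z p. s : hom X x y ==> t : hom X y z ==> p : El (P x) ==> pm (Comp X t s) p = pm t (pm s p)"
  and faithful: "!!s t x y. s : hom X x y ==> t : hom X x y ==> (!!p. p : El (P x) ==> pm s p = pm t p) ==> s = t"
  and full: "!!x y phi. x : Obj X ==> y : Obj X ==> phi : ahom (P x) (P y) ==> \<exists>t\<in>hom X x y. \<forall>p\<in>El (P x). pm t p = phi p"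
 shows "\<exists>j. fully_faithful X K j \<and> (\<forall>x\<in>Obj X. (\<exists>phi\<in>ahom (P x) (T (on_obj j x)). phi ` El (P x) = El (T (on_obj j x))) \<and>
  (sat (P x) --> sat (T (on_obj j x))))"
proof -
 define Q where "Q x a phi psi \<longleftrightarrow> a : Obj K \<and> phi : ahom (P x) (T a) \<and> psi : ahom (T a) (P x) \<and> phi ` El (P x) = El (T a) \<and>
  (\<forall>p\<in>El (P x). psi (phi p) = p) \<and> (sat (P x) --> sat (T a))" for x a phi psi
 have "\<exists>a phi psi. Q x a phi psi" if "x : Obj X" for x unfolding Q_def by (rule realize[OF P[OF that] Ps[OF that]]) blast
 then obtain a phi psi where Q: "!!x. x : Obj X ==> Q x (a x) (phi x) (psi x)" by metis
 have a: "!!x. x : Obj X ==> a x : Obj K" "!!x. x : Obj X ==> phi x : ahom (P x) (T (a x))"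
  "!!x. x : Obj X ==> psi x : ahom (T (a x)) (P x)" "!!x. x : Obj X ==> phi x ` El (P x) = El (T (a x))"
  "!!x p. x : Obj X ==> p : El (P x) ==> psi x (phi x p) = p" "!!x. x : Obj X ==> sat (P x) ==> sat (T (a x))"
  using Q unfolding Q_def by blast+
 note oX = cat_hom_obj[OF X]
 \<comment> \<open>\<open>h\<close> is \<open>t\<close> seen through the identifications
   \<open>phi\<close>. As \<open>phi\<close> is onto, at most one \<open>h\<close> qualifies, so an
   arbitrary choice for each arrow is automatically functorial.\<close>
 define G where "G t h \<longleftrightarrow> h : hom K (a (Dom X t)) (a (Cod X t)) \<and> (\<forall>p\<in>El (P (Dom X t)). fn h (phi (Dom X t) p) = phi (Cod X t) (pm t p))" for t h
 have G: "G t h \<longleftrightarrow> h : hom K (a x) (a y) \<and> (\<forall>p\<in>El (P x). fn h (phi x p) = phi y (pm t p))" if "t : hom X x y" for t h x y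
  using homD(2,3)[OF that] unfolding G_def by simp
 have Gex: "\<exists>h. G t h" if t: "t : hom X x y" for t x y
 proof -
  note x = oX(1)[OF t] and y = oX(2)[OF t]
  have "(\<lambda>v. phi y (pm t (psi x v))) : ahom (T (a x)) (T (a y))"
   by (rule ahom_comp[OF ahom_comp[OF a(3)[OF x] pm[OF t]] a(2)[OF y]])
  then obtain h where h: "h : hom K (a x) (a y)" "\<forall>v\<in>El (T (a x)). fn h v = phi y (pm t (psi x v))"
   using fn_surj[OF a(1)[OF x] a(1)[OF y]] by blast
  then have "G t h" unfolding G[OF t] using ahomD(1)[OF a(2)[OF x]] a(5)[OF x] by auto
  then show ?thesis by blast
 qed
 have Guq: "h = k" if t: "t : hom X x y" and h: "G t h" and k: "G t k" for t x y h k
 proof -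
  have hk: "h : hom K (a x) (a y)" "k : hom K (a x) (a y)" using h k unfolding G[OF t] by auto
  show ?thesis
  proof (rule fn_inj[OF hk])
   fix v assume "v : El (T (a x))"
   then obtain p where "p : El (P x)" "v = phi x p" using a(4)[OF oX(1)[OF t]] by blast
   then show "fn h v = fn k v" using h k unfolding G[OF t] by simp
  qed
 qed
 define g where "g t = (SOME h. G t h)" for t
 have g: "G t (g t)" if "t : hom X x y" for t x y unfolding g_def using someI_ex[OF Gex[OF that]] .
 have gh: "g t : hom K (a x) (a y)" "p : El (P x) ==> fn (g t) (phi x p) = phi y (pm t p)" if "t : hom X x y" for t x y p
  using g[OF that] unfolding G[OF that] by auto
 define j where "j = \<lparr>on_obj = (\<lambda>x\<in>Obj X. a x), on_arr = (\<lambda>t\<in>Arr X. g t)\<rparr>"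
 have jo: "on_obj j x = a x" if "x : Obj X" for x using that by (simp add: j_def)
 have ja: "on_arr j t = g t" if "t : hom X x y" for t x y using homD(1)[OF that] by (simp add: j_def)
 have "is_functor X K j"
 proof (rule functorI[OF X catK])
  show "on_obj j : extensional (Obj X)" "on_arr j : extensional (Arr X)" by (simp_all add: j_def)
  show "on_obj j x : Obj K" if "x : Obj X" for x using jo[OF that] a(1)[OF that] by simp
  show "on_arr j t : hom K (on_obj j x) (on_obj j y)" if t: "t : hom X x y" for t x y
   using ja[OF t] jo[OF oX(1)[OF t]] jo[OF oX(2)[OF t]] gh(1)[OF t] by simp
  show "on_arr j (Ident X x) = Ident K (on_obj j x)" if x: "x : Obj X" for x
  proof -
   note i = cat_ident[OF X x]
   have "G (Ident X x) (Ident K (a x))" unfolding G[OF i]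
    using cat_ident[OF catK a(1)[OF x]] fn_ident[OF a(1)[OF x]] ahomD(1)[OF a(2)[OF x]] pm_id[OF x] by simp
   then show ?thesis using Guq[OF i g[OF i]] ja[OF i] jo[OF x] by simp
  qed
  show "on_arr j (Comp X t s) = Comp K (on_arr j t) (on_arr j s)" if s: "s : hom X x y" and t: "t : hom X y z" for s t x y z
  proof -
   note st = cat_comp[OF X s t]
   have "G (Comp X t s) (Comp K (g t) (g s))" unfolding G[OF st]
    using cat_comp[OF catK gh(1)[OF s] gh(1)[OF t]] fn_comp[OF gh(1)[OF s] gh(1)[OF t]] ahomD(1)[OF a(2)[OF oX(1)[OF s]]]
     gh(2)[OF s] gh(2)[OF t] ahomD(1)[OF pm[OF s]] pm_comp[OF s t] by simp
   then show ?thesis using Guq[OF st g[OF st]] ja[OF st] ja[OF s] ja[OF t] by simp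
  qed
 qed
 moreover have "bij_betw (on_arr j) (hom X x y) (hom K (on_obj j x) (on_obj j y))" if x: "x : Obj X" and y: "y : Obj X" for x y
  unfolding bij_betw_def jo[OF x] jo[OF y]
 proof
  have phii: "p = q" if "p : El (P y)" "q : El (P y)" "phi y p = phi y q" for p q using a(5)[OF y] that by metis
  show "inj_on (on_arr j) (hom X x y)"
  proof (rule inj_onI)
   fix s t assume s: "s : hom X x y" and t: "t : hom X x y" and eq: "on_arr j s = on_arr j t"
   show "s = t"
   proof (rule faithful[OF s t])
    fix p assume p: "p : El (P x)"
    have "phi y (pm s p) = phi y (pm t p)" using gh(2)[OF s p] gh(2)[OF t p] eq ja[OF s] ja[OF t] by simp
    then show "pm s p = pm t p" using phii ahomD(1)[OF pm[OF s] p] ahomD(1)[OF pm[OF t] p] by blast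
   qed
  qed
  show "on_arr j ` hom X x y = hom K (a x) (a y)"
  proof
   show "on_arr j ` hom X x y \<subseteq> hom K (a x) (a y)" using gh(1) ja by auto
   show "hom K (a x) (a y) \<subseteq> on_arr j ` hom X x y"
   proof
    fix h assume h: "h : hom K (a x) (a y)"
    have "(\<lambda>p. psi y (fn h (phi x p))) : ahom (P x) (P y)"
     by (rule ahom_comp[OF ahom_comp[OF a(2)[OF x] fn_hom[OF h]] a(3)[OF y]])
    then obtain t where t: "t : hom X x y" "\<forall>p\<in>El (P x). pm t p = psi y (fn h (phi x p))" using full[OF x y] by blast
    have phipsi: "phi y (psi y v) = v" if "v : El (T (a y))" for v
    proof -
     obtain p where "p : El (P y)" "v = phi y p" using \<open>v : El (T (a y))\<close> a(4)[OF y] by blast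
     then show ?thesis using a(5)[OF y] by simp
    qed
    have "G t h" unfolding G[OF t(1)] using h t(2) phipsi fn_El[OF h] ahomD(1)[OF a(2)[OF x]] by simp
    then have "h = on_arr j t" using Guq[OF t(1) _ g[OF t(1)]] ja[OF t(1)] by simp
    then show "h : on_arr j ` hom X x y" using t(1) by blast
   qed
  qed
 qed
 ultimately have "fully_faithful X K j" unfolding fully_faithful_def by blast
 moreover have "(\<exists>phi\<in>ahom (P x) (T (on_obj j x)). phi ` El (P x) = El (T (on_obj j x))) \<and> (sat (P x) --> sat (T (on_obj j x)))"
  if "x : Obj X" for x unfolding jo[OF that] using a(2,4,6)[OF that] by blast
 ultimately show ?thesis by blast
qed

end

section \<open>From points to saturated flat sets\<close>

context atomic_site
begin

text \<open>The restriction of \<open>F\<close> to the chosen atoms; carrying the atom along makes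
  the fibres disjoint.\<close>

definition PA :: "('o, 'm, 'u set, 'u setarr) fctr => ('o \<times> 'u, 'o, 'm) aset" where
 "PA F = \<lparr>El = {(a, y). a : As \<and> y : on_obj F a}, lab = fst, act = (\<lambda>g (a, y). (Cod E g, fapp F g y))\<rparr>"

lemma PA_simps [simp]:
 "El (PA F) = {(a, y). a : As \<and> y : on_obj F a}" "lab (PA F) = fst" "act (PA F) g (a, y) = (Cod E g, fapp F g y)"
 by (simp_all add: PA_def)

lemma acts_PA: "At.acts (PA F) g (a, y) \<longleftrightarrow> a : As \<and> y : on_obj F a \<and> Cod E g : As \<and> g : hom E a (Cod E g)"
 unfolding At.acts_def by (auto simp: full_subcat_def hom_def)

lemma point_fctrD:
 assumes "point_fctr F"
 shows "is_functor E (Set_cat U) F"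
  "x : Obj E ==> u : on_obj F x ==> \<exists>a\<in>As. \<exists>m\<in>hom E a x. \<exists>y\<in>on_obj F a. fapp F m y = u"
  "a : As ==> b : As ==> g : hom E a b ==> v : on_obj F b ==> \<exists>z\<in>on_obj F a. fapp F g z = v"
  "\<exists>a\<in>As. on_obj F a \<noteq> {}"
  "a : Obj E ==> b : Obj E ==> v : on_obj F a ==> w : on_obj F b ==>
   \<exists>d\<in>As. \<exists>z\<in>on_obj F d. \<exists>m\<in>hom E d a. \<exists>n\<in>hom E d b. fapp F m z = v \<and> fapp F n z = w"
  "b : As ==> s : hom E b e ==> t : hom E b e ==> z : on_obj F b ==> fapp F s z = fapp F t z ==> s = t"
 using assms unfolding point_fctr_def by blast+

lemma PA_flat:
 assumes F: "point_fctr F" shows "At.flat (PA F)" "At.sat (PA F)" "sm (El (PA F))"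
proof -
 note P = point_fctrD[OF F] note f = P(1) note a = Set_functor_app[OF f]
 show "At.flat (PA F)"
 proof (rule At.flatI)
  fix p assume "p : El (PA F)"
  then obtain b y where p: "p = (b, y)" "b : As" "y : on_obj F b" by auto
  show "lab (PA F) p : Obj A \<and> act (PA F) (Ident A (lab (PA F) p)) p = p"
   using p As_Obj[OF p(2)] a(3)[OF As_Obj[OF p(2)] p(3)] homD(3)[OF cat_ident[OF catE As_Obj[OF p(2)]]] by simp
 next
  fix g p assume gp: "At.acts (PA F) g p"
  obtain b y where p: "p = (b, y)" by (cases p)
  have g: "b : As" "y : on_obj F b" "Cod E g : As" "g : hom E b (Cod E g)" using gp unfolding p acts_PA by auto
  show "act (PA F) g p : El (PA F) \<and> lab (PA F) (act (PA F) g p) = Cod A g" using p g a(1)[OF g(4,2)] by simp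
  fix h assume "h : Arr A" "Dom A h = Cod A g"
  then have h: "h : hom E (Cod E g) (Cod E h)" by (auto simp: full_subcat_def hom_def)
  show "act (PA F) (Comp A h g) p = act (PA F) h (act (PA F) g p)"
   using p a(2)[OF g(4) h g(2)] homD(3)[OF e_hom[OF g(4) h]] by simp
 next
  show "El (PA F) \<noteq> {}" using P(4) by auto
 next
  fix p q assume "p : El (PA F)" "q : El (PA F)"
  then obtain b x c y where p: "p = (b, x)" "b : As" "x : on_obj F b" and q: "q = (c, y)" "c : As" "y : on_obj F c" by auto
  obtain d z m n where d: "d : As" "z : on_obj F d" "m : hom E d b" "n : hom E d c" "fapp F m z = x" "fapp F n z = y"
   using P(5)[OF As_Obj[OF p(2)] As_Obj[OF q(2)] p(3) q(3)] by blast
  have "At.acts (PA F) m (d, z) \<and> At.acts (PA F) n (d, z) \<and> act (PA F) m (d, z) = p \<and> act (PA F) n (d, z) = q"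
   using d p q homD(3)[OF d(3)] homD(3)[OF d(4)] by (simp add: acts_PA)
  then show "\<exists>z g h. At.acts (PA F) g z \<and> At.acts (PA F) h z \<and> act (PA F) g z = p \<and> act (PA F) h z = q" by blast
 next
  fix g h p assume gp: "At.acts (PA F) g p" and hp: "At.acts (PA F) h p" and eq: "act (PA F) g p = act (PA F) h p"
  obtain b y where p: "p = (b, y)" by (cases p)
  have g: "b : As" "y : on_obj F b" "g : hom E b (Cod E g)" "h : hom E b (Cod E g)" "fapp F g y = fapp F h y"
   using gp hp eq unfolding p acts_PA by auto
  show "g = h" using P(6)[OF g(1,3,4,2,5)] .
 qed
 show "At.sat (PA F)" unfolding At.sat_def
 proof (intro ballI impI)
  fix g p assume g: "g : Arr A" and p: "p : El (PA F)" "lab (PA F) p = Cod A g"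
  obtain b y where p': "p = (b, y)" "b : As" "y : on_obj F b" using p(1) by auto
  have gh: "Dom E g : As" "g : hom E (Dom E g) b" using g p(2) p' by (auto simp: full_subcat_def hom_def)
  obtain x where x: "x : on_obj F (Dom E g)" "fapp F g x = y" using P(3)[OF gh(1) p'(2) gh(2) p'(3)] by blast
  have "At.acts (PA F) g (Dom E g, x) \<and> act (PA F) g (Dom E g, x) = p"
   using gh p' x homD(3)[OF gh(2)] by (simp add: acts_PA)
  then show "\<exists>x. At.acts (PA F) g x \<and> act (PA F) g x = p" by blast
 qed
 have "El (PA F) = Sigma As (on_obj F)" by auto
 then show "sm (El (PA F))" using sm_Sigma[OF As_sm a(4)[OF As_Obj]] by simp
qed

lemma pt_inverse: "f : Obj (pt U E) ==> point_fctr (inverse_image f)"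
 using geometric_morphism_point_fctr by (simp add: pt_def functor_cat_simps)

lemma hom_pt: "t : hom (pt U E) f g \<longleftrightarrow> f : Obj (pt U E) \<and> g : Obj (pt U E) \<and>
  (\<exists>eta\<in>nat_trans E (Set_cat U) (inverse_image f) (inverse_image g). t = (f, eta, g))"
 by (simp add: pt_def hom_functor_cat functor_cat_simps)

lemma category_pt: "category (pt U E)" unfolding pt_def
 by (rule category_functor_cat[OF _ category_Set_cat]) (use point_fctrD(1)[OF geometric_morphism_point_fctr] in simp)

text \<open>Every element of a fibre is the image of an element over an atom, so a transformation is
  determined on atoms. For fullness, a homomorphism given on atoms is extended to \<open>e\<close>
  by sending the image of \<open>y\<close> under \<open>m\<close> to the image of its value under
  \<open>m\<close>.\<close>

lemma pt_fully_faithful: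
 assumes K: "flat_cat U A K T fn"
 shows "\<exists>j. fully_faithful (pt U E) K j \<and> (\<forall>f\<in>Obj (pt U E).
  (\<exists>phi\<in>At.ahom (PA (inverse_image f)) (T (on_obj j f)). phi ` El (PA (inverse_image f)) = El (T (on_obj j f))) \<and>
  (At.sat (PA (inverse_image f)) --> At.sat (T (on_obj j f))))"
proof -
 interpret K: flat_cat U A K T fn by (rule K)
 let ?I = "inverse_image"
 let ?pm = "\<lambda>t (a, y). (a, app (fst (snd t) a) y)"
 have E: "t = (f, fst (snd t), g)" "fst (snd t) : nat_trans E (Set_cat U) (?I f) (?I g)" "point_fctr (?I f)" "point_fctr (?I g)"
  if "t : hom (pt U E) f g" for t f g using that pt_inverse unfolding hom_pt by auto
 have ap: "a : Obj E ==> x : on_obj (?I f) a ==> app (fst (snd t) a) x : on_obj (?I g) a"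
  "m : hom E a b ==> x : on_obj (?I f) a ==> fapp (?I g) m (app (fst (snd t) a) x) = app (fst (snd t) b) (fapp (?I f) m x)"
  if t: "t : hom (pt U E) f g" for t f g a b m x
  using Set_nat_trans_app[OF E(2)[OF t] point_fctrD(1)[OF E(3)[OF t]] point_fctrD(1)[OF E(4)[OF t]]] by auto
 show ?thesis
 proof (rule K.fully_faithful_from_asets[OF category_pt, where pm = ?pm])
  show "At.flat (PA (?I f))" "sm (El (PA (?I f)))" if "f : Obj (pt U E)" for f using PA_flat[OF pt_inverse[OF that]] by auto
  show "?pm t : At.ahom (PA (?I f)) (PA (?I g))" if t: "t : hom (pt U E) f g" for t f g
  proof (rule At.ahomI)
   show "?pm t p : El (PA (?I g))" "lab (PA (?I g)) (?pm t p) = lab (PA (?I f)) p" if "p : El (PA (?I f))" for p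
    using that ap(1)[OF t As_Obj] by auto
   fix k p assume kp: "At.acts (PA (?I f)) k p"
   obtain b y where p: "p = (b, y)" by (cases p)
   have k: "b : As" "y : on_obj (?I f) b" "k : hom E b (Cod E k)" using kp unfolding p acts_PA by auto
   show "?pm t (act (PA (?I f)) k p) = act (PA (?I g)) k (?pm t p)" using ap(2)[OF t k(3,2)] p by simp
  qed
  show "?pm (Ident (pt U E) f) p = p" if "f : Obj (pt U E)" "p : El (PA (?I f))" for f p
   using that(2) As_Obj by (auto simp: pt_def functor_cat_simps Set_ident)
  show "?pm (Comp (pt U E) t s) p = ?pm t (?pm s p)"
   if s: "s : hom (pt U E) f g" and t: "t : hom (pt U E) g h" and p: "p : El (PA (?I f))" for s t f g h p
  proof -
   obtain b y where p': "p = (b, y)" "b : As" "y : on_obj (?I f) b" using p by auto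
   note b = As_Obj[OF p'(2)]
   have "Comp (pt U E) t s = (f, \<lambda>a\<in>Obj E. Comp (Set_cat U) (fst (snd t) a) (fst (snd s) a), h)"
    by (subst E(1)[OF s], subst E(1)[OF t]) (simp add: pt_def functor_cat_simps)
   then show ?thesis using Set_comp[OF nat_transD(1)[OF E(2)[OF s] b] nat_transD(1)[OF E(2)[OF t] b] p'(3)] b p'(1) by simp
  qed
  show "s = t" if s: "s : hom (pt U E) f g" and t: "t : hom (pt U E) f g" and eq: "!!p. p : El (PA (?I f)) ==> ?pm s p = ?pm t p" for s t f g
  proof -
   have "fst (snd s) = fst (snd t)"
   proof (rule Set_nat_trans_ext[OF E(2)[OF s] E(2)[OF t]])
    fix e u assume e: "e : Obj E" and u: "u : on_obj (?I f) e"
    obtain a m y where a: "a : As" "m : hom E a e" "y : on_obj (?I f) a" "fapp (?I f) m y = u"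
     using point_fctrD(2)[OF E(3)[OF s] e u] by blast
    have "app (fst (snd s) a) y = app (fst (snd t) a) y" using eq[of "(a, y)"] a by simp
    then show "app (fst (snd s) e) u = app (fst (snd t) e) u" using ap(2)[OF s a(2,3)] ap(2)[OF t a(2,3)] a(4) by simp
   qed
   then show ?thesis using E(1)[OF s] E(1)[OF t] by metis
  qed
  show "\<exists>t\<in>hom (pt U E) f g. \<forall>p\<in>El (PA (?I f)). ?pm t p = phi p"
   if f: "f : Obj (pt U E)" and g: "g : Obj (pt U E)" and phi: "phi : At.ahom (PA (?I f)) (PA (?I g))" for f g phi
  proof -
   note Pf = point_fctrD[OF pt_inverse[OF f]] and Pg = point_fctrD[OF pt_inverse[OF g]]
   note Ff = Set_functor_app[OF Pf(1)] and Fg = Set_functor_app[OF Pg(1)]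
   define phi' where "phi' a y = snd (phi (a, y))" for a y
   have phi1: "phi' a y : on_obj (?I g) a" "phi (a, y) = (a, phi' a y)" if "a : As" "y : on_obj (?I f) a" for a y
   proof -
    have "phi (a, y) : El (PA (?I g))" "lab (PA (?I g)) (phi (a, y)) = a" using At.ahomD(1,2)[OF phi, of "(a, y)"] that by auto
    then show "phi' a y : on_obj (?I g) a" "phi (a, y) = (a, phi' a y)" unfolding phi'_def by (cases "phi (a, y)"; auto)+
   qed
   have phi2: "phi' b (fapp (?I f) k y) = fapp (?I g) k (phi' a y)"
    if "a : As" "b : As" "k : hom E a b" "y : on_obj (?I f) a" for a b k y
   proof -
    have "At.acts (PA (?I f)) k (a, y)" using that homD(3)[OF that(3)] by (simp add: acts_PA)
    from At.ahomD(3)[OF phi this] show ?thesis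
     using homD(3)[OF that(3)] phi1(2)[OF that(1,4)] phi1(2)[OF that(2) Ff(1)[OF that(3,4)]] by simp
   qed
   \<comment> \<open>Two presentations of the same element are compared over an atom
     \<open>d\<close> that maps to both sources; there the two composites to \<open>e\<close> agree
     on one element, hence are equal.\<close>
   have wd: "fapp (?I g) m (phi' a y) = fapp (?I g) m' (phi' a' y')"
    if m: "a : As" "m : hom E a e" "y : on_obj (?I f) a" and m': "a' : As" "m' : hom E a' e" "y' : on_obj (?I f) a'"
     and eq: "fapp (?I f) m y = fapp (?I f) m' y'" for e a m y a' m' y'
   proof -
    obtain d z p q where d: "d : As" "z : on_obj (?I f) d" "p : hom E d a" "q : hom E d a'"
     "fapp (?I f) p z = y" "fapp (?I f) q z = y'" using Pf(5)[OF As_Obj[OF m(1)] As_Obj[OF m'(1)] m(3) m'(3)] by blast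
    have "m \<odot> p = m' \<odot> q" by (rule Pf(6)[OF d(1) e_hom[OF d(3) m(2)] e_hom[OF d(4) m'(2)] d(2)])
      (simp add: Ff(2)[OF d(3) m(2) d(2)] Ff(2)[OF d(4) m'(2) d(2)] d(5,6) eq)
    then show ?thesis using Fg(2)[OF d(3) m(2) phi1(1)[OF d(1,2)]] Fg(2)[OF d(4) m'(2) phi1(1)[OF d(1,2)]]
      phi2[OF d(1) m(1) d(3) d(2)] phi2[OF d(1) m'(1) d(4) d(2)] d(5,6) by simp
   qed
   have "\<exists>v. v : on_obj (?I g) e \<and> (\<forall>a m y. a : As --> m : hom E a e --> y : on_obj (?I f) a -->
    fapp (?I f) m y = u --> fapp (?I g) m (phi' a y) = v)" if e: "e : Obj E" and u: "u : on_obj (?I f) e" for e u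
   proof -
    obtain a m y where a: "a : As" "m : hom E a e" "y : on_obj (?I f) a" "fapp (?I f) m y = u" using Pf(2)[OF e u] by blast
    then show ?thesis using Fg(1)[OF a(2) phi1(1)[OF a(1,3)]] wd by (intro exI[of _ "fapp (?I g) m (phi' a y)"]) metis
   qed
   then obtain alpha where alpha: "!!e u. e : Obj E ==> u : on_obj (?I f) e ==> alpha e u : on_obj (?I g) e"
    "!!e u a m y. e : Obj E ==> u : on_obj (?I f) e ==> a : As ==> m : hom E a e ==> y : on_obj (?I f) a ==>
     fapp (?I f) m y = u ==> fapp (?I g) m (phi' a y) = alpha e u" by metis
   have "\<exists>eta\<in>nat_trans E (Set_cat U) (?I f) (?I g). \<forall>a\<in>Obj E. \<forall>x\<in>on_obj (?I f) a. app (eta a) x = alpha a x"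
   proof (rule Set_nat_trans_exists[OF Pf(1) Pg(1) alpha(1)])
    fix t e e' u assume t: "t : hom E e e'" and u: "u : on_obj (?I f) e"
    note e = e_objs(1)[OF t] and e' = e_objs(2)[OF t]
    obtain a m y where a: "a : As" "m : hom E a e" "y : on_obj (?I f) a" "fapp (?I f) m y = u" using Pf(2)[OF e u] by blast
    have "fapp (?I f) (t \<odot> m) y = fapp (?I f) t u" using Ff(2)[OF a(2) t a(3)] a(4) by simp
    from alpha(2)[OF e' Ff(1)[OF t u] a(1) e_hom[OF a(2) t] a(3) this]
    show "fapp (?I g) t (alpha e u) = alpha e' (fapp (?I f) t u)"
     using Fg(2)[OF a(2) t phi1(1)[OF a(1,3)]] alpha(2)[OF e u a] by simp
   qed
   then obtain eta where eta: "eta : nat_trans E (Set_cat U) (?I f) (?I g)" "\<forall>a\<in>Obj E. \<forall>x\<in>on_obj (?I f) a. app (eta a) x = alpha a x" by blast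
   have "?pm (f, eta, g) p = phi p" if "p : El (PA (?I f))" for p
   proof -
    obtain a y where p: "p = (a, y)" "a : As" "y : on_obj (?I f) a" using \<open>p : El (PA (?I f))\<close> by auto
    note ao = As_Obj[OF p(2)]
    have "alpha a y = phi' a y"
     using alpha(2)[OF ao p(3) p(2) cat_ident[OF catE ao] p(3) Ff(3)[OF ao p(3)]] Fg(3)[OF ao phi1(1)[OF p(2,3)]] by simp
    then show ?thesis using eta(2) ao p phi1(2)[OF p(2,3)] by simp
   qed
   moreover have "(f, eta, g) : hom (pt U E) f g" using f g eta(1) unfolding hom_pt by blast
   ultimately show ?thesis by blast
  qed
 qed
qed

end

text \<open>\<open>cl m x\<close> is the class of the arrow \<open>m\<close> at the element
  \<open>x\<close> in the filtered colimit that defines \<open>F\<close>. \<open>cl_act\<close> is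
  the identification made there, and \<open>cl_inj\<close> says that nothing is identified at a
  fixed element, since transition arrows are epic.\<close>

locale sat_point = atomic_site U C J E y0 y1 As
 for U :: "'u itself" and C :: "('c, 'd) cat" and J and E :: "('o, 'm) cat" and y0 y1 As +
 fixes R :: "('r, 'o, 'm) aset" and F :: "('o, 'm, 'u set, 'u setarr) fctr" and cl :: "'m => 'r => 'u"
 assumes R_flat: "At.flat R" and R_sat: "At.sat R" and F: "is_functor E (Set_cat U) F"
  and cl_mem: "x : El R ==> m : hom E (lab R x) e ==> cl m x : on_obj F e"
  and cl_surj: "e : Obj E ==> v : on_obj F e ==> \<exists>x\<in>El R. \<exists>m\<in>hom E (lab R x) e. v = cl m x"
  and cl_arr: "x : El R ==> m : hom E (lab R x) e ==> t : hom E e e' ==> fapp F t (cl m x) = cl (Comp E t m) x"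
  and cl_act: "At.acts R g z ==> m : hom E (Cod E g) e ==> cl m (act R g z) = cl (Comp E m g) z"
  and cl_inj: "x : El R ==> m : hom E (lab R x) e ==> n : hom E (lab R x) e ==> cl m x = cl n x ==> m = n"

section \<open>From saturated flat sets to functors\<close>

context atomic_site
begin

lemma flat_acts:
 assumes R: "At.flat R" and g: "At.acts R g z"
 shows "z : El R" "act R g z : El R" "lab R (act R g z) = Cod E g" "lab R z : As" "Cod E g : As" "g : hom E (lab R z) (Cod E g)"
proof -
 note a = At.actsD[OF g]
 show "z : El R" "act R g z : El R" "lab R (act R g z) = Cod E g" using a(2) At.flatD(3,4)[OF R g] by auto
 show "lab R z : As" "Cod E g : As" "g : hom E (lab R z) (Cod E g)" using a by (auto simp: full_subcat_def hom_def)
qed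

lemma flat_lab: "At.flat R ==> x : El R ==> lab R x : As" using At.flatD(1) by (metis IntD2 full_subcat_simps(1))

lemma acts_if_hom: "z : El R ==> lab R z : As ==> b : As ==> g : hom E (lab R z) b ==> At.acts R g z"
 unfolding At.acts_def by (auto simp: full_subcat_def hom_def)

lemma flat_act_comp:
 assumes R: "At.flat R" and g: "At.acts R g z" and h: "h : hom E (Cod E g) b" "b : As"
 shows "At.acts R (h \<odot> g) z" "At.acts R h (act R g z)" "act R (h \<odot> g) z = act R h (act R g z)"
proof -
 note f = flat_acts[OF R g]
 show "At.acts R (h \<odot> g) z" using acts_if_hom[OF f(1,4) h(2) e_hom[OF f(6) h(1)]] .
 have "lab R (act R g z) : As" using f(3,5) by simp
 moreover have "h : hom E (lab R (act R g z)) b" using h(1) f(3) by simp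
 ultimately show "At.acts R h (act R g z)" using acts_if_hom[OF f(2) _ h(2)] by blast
 have "h : Arr A" "Dom A h = Cod A g" using h f(5) by (auto simp: full_subcat_def hom_def)
 then show "act R (h \<odot> g) z = act R h (act R g z)" using At.flatD(5)[OF R g] by simp
qed

text \<open>The fibre of the point over \<open>e\<close> is the colimit of \<open>hom E (lab R x) e\<close> over the category of elements of \<open>R\<close>.\<close>

lemma sat_point_exists:
 fixes R :: "('r, 'o, 'm) aset"
 assumes R: "At.flat R" and sat: "At.sat R" and small: "sm (El R)"
 shows "\<exists>F cl. sat_point U C J E y0 y1 As R F cl"
proof -
 define D where "D e = Sigma (El R) (\<lambda>x. hom E (lab R x) e)" for e
 \<comment> \<open>Two arrows are identified when they agree after passing to a common preimage of
   their elements; one such step is already transitive because the category of elements is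
   cofiltered.\<close>
 define eqv where "eqv p q \<longleftrightarrow> (\<exists>z g h. At.acts R g z \<and> At.acts R h z \<and> act R g z = fst p \<and> act R h z = fst q \<and> snd p \<odot> g = snd q \<odot> h)" for p q
 have eqvI: "eqv (act R g z, m) (act R h z, n)" if "At.acts R g z" "At.acts R h z" "m \<odot> g = n \<odot> h" for g z m h n
  unfolding eqv_def using that by auto
 have idD: "At.acts R (Ident E (lab R x)) x" "act R (Ident E (lab R x)) x = x" if x: "x : El R" for x
  using acts_if_hom[OF x flat_lab[OF R x] flat_lab[OF R x] cat_ident[OF catE As_Obj[OF flat_lab[OF R x]]]] At.flatD(2)[OF R x] by auto
 have sym: "eqv q p" if "eqv p q" for p q using that unfolding eqv_def by metis
 have trans: "eqv p r" if p: "p : D e" and q: "q : D e" and r: "r : D e" and pq: "eqv p q" and qr: "eqv q r" for p q r e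
 proof -
  obtain x m y n w k where pe: "p = (x, m)" "q = (y, n)" "r = (w, k)" by (cases p; cases q; cases r)
  have h: "m : hom E (lab R x) e" "n : hom E (lab R y) e" "k : hom E (lab R w) e" using p q r unfolding pe D_def by auto
  obtain z g h where z: "At.acts R g z" "At.acts R h z" "act R g z = x" "act R h z = y" "m \<odot> g = n \<odot> h"
   using pq unfolding eqv_def pe by auto
  obtain z' g' h' where z': "At.acts R g' z'" "At.acts R h' z'" "act R g' z' = y" "act R h' z' = w" "n \<odot> g' = k \<odot> h'"
   using qr unfolding eqv_def pe by auto
  obtain u s t where u: "At.acts R s u" "At.acts R t u" "act R s u = z" "act R t u = z'"
   using At.flat_join[OF R At.actsD(2)[OF z(1)] At.actsD(2)[OF z'(1)]] .
  note S = flat_acts[OF R u(1)] and T = flat_acts[OF R u(2)]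
  have cs: "Cod E s = lab R z" and ct: "Cod E t = lab R z'" using S(3) T(3) u by auto
  note G = flat_acts[OF R z(1)] and H = flat_acts[OF R z(2)] and G' = flat_acts[OF R z'(1)] and H' = flat_acts[OF R z'(2)]
  have cod: "Cod E g = lab R x" "Cod E h = lab R y" "Cod E g' = lab R y" "Cod E h' = lab R w" using G(3) H(3) G'(3) H'(3) z z' by auto
  note g = G(6)[unfolded cod] and h' = H(6)[unfolded cod] and gg = G'(6)[unfolded cod] and hh = H'(6)[unfolded cod]
  note s = S(6)[unfolded cs] and t = T(6)[unfolded ct]
  note As' = G(5)[unfolded cod] H(5)[unfolded cod] H'(5)[unfolded cod]
  note a1 = flat_act_comp[OF R u(1) g[folded cs] As'(1)] and a2 = flat_act_comp[OF R u(1) h'[folded cs] As'(2)]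
   and a3 = flat_act_comp[OF R u(2) gg[folded ct] As'(2)] and a4 = flat_act_comp[OF R u(2) hh[folded ct] As'(3)]
  \<comment> \<open>Both composites carry \<open>u\<close> to \<open>y\<close>, and in a flat set
    this makes them equal.\<close>
  have "h \<odot> s = g' \<odot> t" by (rule At.flatD(7)[OF R a2(1) a3(1)]) (use a2(3) a3(3) u z z' in simp)
  then have "m \<odot> (g \<odot> s) = k \<odot> (h' \<odot> t)"
   using e_assoc[OF s g h(1)] e_assoc[OF s h' h(2)] e_assoc[OF t gg h(2)] e_assoc[OF t hh h(3)] z(5) z'(5) by metis
  from eqvI[OF a1(1) a4(1) this] show "eqv p r" using a1(3) a4(3) u z z' unfolding pe by simp
 qed
 have refl: "eqv p p" if "p : D e" for p e
  using eqvI[OF idD(1) idD(1), of "fst p" "snd p" "snd p"] idD(2)[of "fst p"] that unfolding D_def by auto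
 have smD: "sm (D e)" if "e : Obj E" for e unfolding D_def by (intro sm_Sigma small sm_hom As_Obj flat_lab[OF R] that)
 define cls where "cls e p = {q : D e. eqv p q}" for e p
 have cls: "cls e p = cls e q \<longleftrightarrow> eqv p q" if p: "p : D e" and q: "q : D e" for e p q
 proof
  show "cls e p = cls e q ==> eqv p q" using refl[OF q] q unfolding cls_def by blast
  show "cls e p = cls e q" if "eqv p q" unfolding cls_def using trans[OF q p _ sym[OF that]] trans[OF p q _ that] by blast
 qed
 have "\<exists>i :: ('r \<times> 'm) set => 'u. inj_on i (cls e ` D e)" if "e : Obj E" for e
  using sm_obtain_inj[OF sm_image[OF smD[OF that]]] by metis
 then obtain i :: "'o => ('r \<times> 'm) set => 'u" where i: "!!e. e : Obj E ==> inj_on (i e) (cls e ` D e)" by metis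
 define cl where "cl m x = i (Cod E m) (cls (Cod E m) (x, m))" for m x
 have cl: "cl m x = cl n y \<longleftrightarrow> eqv (x, m) (y, n)" if p: "(x, m) : D e" and q: "(y, n) : D e" for x m y n e
 proof -
  have mn: "m : hom E (lab R x) e" "n : hom E (lab R y) e" using p q unfolding D_def by auto
  have "cl m x = cl n y \<longleftrightarrow> cls e (x, m) = cls e (y, n)"
   unfolding cl_def homD(3)[OF mn(1)] homD(3)[OF mn(2)] using inj_on_eq_iff[OF i[OF e_objs(2)[OF mn(1)]]] p q by blast
  then show ?thesis using cls[OF p q] by simp
 qed
 have post: "eqv (x, t \<odot> m) (y, t \<odot> n)" "(x, t \<odot> m) : D e'"
  if p: "(x, m) : D e" and q: "(y, n) : D e" and eq: "eqv (x, m) (y, n)" and t: "t : hom E e e'" for x m y n t e e'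
 proof -
  have mn: "m : hom E (lab R x) e" "n : hom E (lab R y) e" "x : El R" using p q unfolding D_def by auto
  show "(x, t \<odot> m) : D e'" using e_hom[OF mn(1) t] mn(3) unfolding D_def by blast
  obtain z g h where z: "At.acts R g z" "At.acts R h z" "act R g z = x" "act R h z = y" "m \<odot> g = n \<odot> h"
   using eq unfolding eqv_def by auto
  have "g : hom E (lab R z) (lab R x)" "h : hom E (lab R z) (lab R y)"
   using flat_acts(3,6)[OF R z(1)] flat_acts(3,6)[OF R z(2)] z(3,4) by auto
  then have "t \<odot> m \<odot> g = t \<odot> n \<odot> h" using e_assoc mn t z(5) by metis
  from eqvI[OF z(1,2) this] show "eqv (x, t \<odot> m) (y, t \<odot> n)" using z by simp
 qed
 define V where "V e = (\<lambda>(x, m). cl m x) ` D e" for e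
 define r where "r e v = (SOME p. p : D e \<and> cl (snd p) (fst p) = v)" for e v
 define rho where "rho t v = (let p = r (Dom E t) v in cl (t \<odot> snd p) (fst p))" for t v
 have rho: "rho t (cl m x) = cl (t \<odot> m) x" if p: "(x, m) : D e" and t: "t : hom E e e'" for t m x e e'
 proof -
  obtain y n where q: "r e (cl m x) = (y, n)" by (cases "r e (cl m x)")
  have "r e (cl m x) : D e \<and> cl (snd (r e (cl m x))) (fst (r e (cl m x))) = cl m x"
   unfolding r_def by (rule someI[of _ "(x, m)"]) (use p in simp)
  then have yn: "(y, n) : D e" "cl n y = cl m x" using q by auto
  have e: "eqv (y, n) (x, m)" using cl[OF yn(1) p] yn(2) by blast
  note po = post[OF yn(1) p e t]
  have "cl (t \<odot> n) y = cl (t \<odot> m) x" using cl[OF po(2) post(2)[OF p p refl[OF p] t]] po(1) by blast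
  then show ?thesis unfolding rho_def homD(2)[OF t] q by simp
 qed
 have VE: "\<exists>x m. (x, m) : D e \<and> v = cl m x" if "v : V e" for v e using that unfolding V_def by auto
 have VI: "cl m x : V e" if "(x, m) : D e" for m x e using that unfolding V_def by force
 have "\<exists>F. is_functor E (Set_cat U) F \<and> (\<forall>a\<in>Obj E. on_obj F a = V a) \<and>
  (\<forall>f a b x. f : hom E a b --> x : V a --> fapp F f x = rho f x)"
 proof (rule Set_functor_exists[OF catE])
  show "sm (V a)" if "a : Obj E" for a unfolding V_def by (rule sm_image[OF smD[OF that]])
  show "rho f v : V b" if f: "f : hom E a b" and v: "v : V a" for f a b v
  proof -
   obtain x m where x: "(x, m) : D a" "v = cl m x" using VE[OF v] by blast
   show ?thesis unfolding x(2) rho[OF x(1) f] by (rule VI[OF post(2)[OF x(1,1) refl[OF x(1)] f]])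
  qed
  show "rho (Ident E a) v = v" if a: "a : Obj E" and v: "v : V a" for a v
  proof -
   obtain x m where x: "(x, m) : D a" "v = cl m x" using VE[OF v] by blast
   have "m : hom E (lab R x) a" using x unfolding D_def by blast
   then show ?thesis unfolding x(2) rho[OF x(1) cat_ident[OF catE a]] using cat_ident_left[OF catE] by metis
  qed
  show "rho (g \<odot> f) v = rho g (rho f v)" if f: "f : hom E a b" and g: "g : hom E b c" and v: "v : V a" for f g a b c v
  proof -
   obtain x m where x: "(x, m) : D a" "v = cl m x" using VE[OF v] by blast
   have m: "m : hom E (lab R x) a" using x unfolding D_def by blast
   show ?thesis
    unfolding x(2) rho[OF x(1) f] rho[OF post(2)[OF x(1,1) refl[OF x(1)] f] g] rho[OF x(1) e_hom[OF f g]] e_assoc[OF m f g] ..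
  qed
 qed
 then obtain F where F: "is_functor E (Set_cat U) F" "!!a. a : Obj E ==> on_obj F a = V a"
  "!!f a b x. f : hom E a b ==> x : V a ==> fapp F f x = rho f x" by blast
 have "sat_point U C J E y0 y1 As R F cl"
 proof
  show "At.flat R" "At.sat R" "is_functor E (Set_cat U) F" by fact+
  show "cl m x : on_obj F e" if x: "x : El R" and m: "m : hom E (lab R x) e" for x m e
   unfolding F(2)[OF e_objs(2)[OF m]] using VI[of x m e] x m unfolding D_def by blast
  show "\<exists>x\<in>El R. \<exists>m\<in>hom E (lab R x) e. v = cl m x" if "e : Obj E" "v : on_obj F e" for e v
   using VE[of v e] that F(2) unfolding D_def by auto
  show "fapp F t (cl m x) = cl (t \<odot> m) x" if x: "x : El R" and m: "m : hom E (lab R x) e" and t: "t : hom E e e'" for x m e t e'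
  proof -
   have d: "(x, m) : D e" using x m unfolding D_def by blast
   show ?thesis using F(3)[OF t VI[OF d]] rho[OF d t] by simp
  qed
  show "cl m (act R g z) = cl (m \<odot> g) z" if g: "At.acts R g z" and m: "m : hom E (Cod E g) e" for g z m e
  proof -
   note f = flat_acts[OF R g] note i = idD[OF f(1)]
   note mg = e_hom[OF f(6) m]
   have "eqv (act R g z, m) (act R (Ident E (lab R z)) z, m \<odot> g)"
    by (rule eqvI[OF g i(1)]) (use cat_ident_right[OF catE mg] in simp)
   moreover have "(act R g z, m) : D e" "(z, m \<odot> g) : D e" using m f mg unfolding D_def by auto
   ultimately show ?thesis using cl i(2) by auto
  qed
  show "m = n" if x: "x : El R" and m: "m : hom E (lab R x) e" and n: "n : hom E (lab R x) e" and eq: "cl m x = cl n x" for x m e n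
  proof -
   have "(x, m) : D e" "(x, n) : D e" using x m n unfolding D_def by auto
   then have "eqv (x, m) (x, n)" using cl eq by blast
   then obtain z g h where z: "At.acts R g z" "At.acts R h z" "act R g z = x" "act R h z = x" "m \<odot> g = n \<odot> h"
    unfolding eqv_def by auto
   \<comment> \<open>Both arrows carry \<open>z\<close> to \<open>x\<close>; the remaining equation
     \<open>m \<odot> g = n \<odot> g\<close> is cancelled because arrows between atoms are
     epic.\<close>
   have "g = h" using At.flatD(7)[OF R z(1,2)] z(3,4) by simp
   moreover note f = flat_acts[OF R z(1)]
   have "g : hom E (lab R z) (lab R x)" using f(3,6) z(3) by simp
   ultimately show ?thesis using atom_epi[OF As_ni[OF f(4)] As_atom[OF flat_lab[OF R x]] _ m n] z(5) by blast
  qed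
 qed
 then show ?thesis by blast
qed

end

lemma Set_limit:
 assumes G: "is_functor J (Set_cat U) G" and c: "is_cone J (Set_cat U) G X tau"
  and u: "!!x. (!!i. i : Obj J ==> x i : on_obj G i) ==>
   (!!f. f : Arr J ==> fapp G f (x (Dom J f)) = x (Cod J f)) ==> \<exists>!y. y : X \<and> (\<forall>i\<in>Obj J. app (tau i) y = x i)"
 shows "is_limit J (Set_cat U) G X tau" unfolding is_limit_def
proof (intro conjI allI impI c)
 fix Y sigma assume s: "is_cone J (Set_cat U) G Y sigma"
 have J: "category J" using functor_cats(1)[OF G] .
 have X: "small U X" and Y: "small U Y" using c s unfolding is_cone_def by (auto simp: Obj_Set_cat)
 have t: "tau i : hom (Set_cat U) X (on_obj G i)" if "i : Obj J" for i using c that unfolding is_cone_def by blast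
 have s1: "sigma i : hom (Set_cat U) Y (on_obj G i)" if "i : Obj J" for i using s that unfolding is_cone_def by blast
 have ex: "\<exists>!y. y : X \<and> (\<forall>i\<in>Obj J. app (tau i) y = app (sigma i) z)" if z: "z : Y" for z
 proof (rule u)
  show "app (sigma i) z : on_obj G i" if "i : Obj J" for i using Set_hom(2)[OF s1[OF that] z] .
  fix f assume f: "f : Arr J"
  have fh: "f : hom J (Dom J f) (Cod J f)" using hom_self[OF f] .
  have "Comp (Set_cat U) (on_arr G f) (sigma (Dom J f)) = sigma (Cod J f)" using s f unfolding is_cone_def by blast
  then show "fapp G f (app (sigma (Dom J f)) z) = app (sigma (Cod J f)) z"
   using Set_comp[OF s1[OF cat_hom_obj(1)[OF J fh]] functor_hom[OF G fh] z] by simp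
 qed
 define h where "h z = (THE y. y : X \<and> (\<forall>i\<in>Obj J. app (tau i) y = app (sigma i) z))" for z
 have h: "h z : X \<and> (\<forall>i\<in>Obj J. app (tau i) (h z) = app (sigma i) z)" if "z : Y" for z
  unfolding h_def by (rule theI'[OF ex[OF that]])
 let ?h = "(Y, restrict h Y, X)"
 have hh: "?h : hom (Set_cat U) Y X" by (rule Set_homI[OF Y X]) (use h in auto)
 show "\<exists>!h. h : hom (Set_cat U) Y X \<and> (\<forall>i\<in>Obj J. Comp (Set_cat U) (tau i) h = sigma i)"
 proof (rule ex1I[of _ ?h], intro conjI ballI hh)
  show "Comp (Set_cat U) (tau i) ?h = sigma i" if i: "i : Obj J" for i
  proof (rule Set_ext[OF cat_comp[OF category_Set_cat hh t[OF i]] s1[OF i]])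
   show "app (Comp (Set_cat U) (tau i) ?h) z = app (sigma i) z" if "z : Y" for z
    using Set_comp[OF hh t[OF i] that] h[OF that] i that by simp
  qed
  fix k assume k: "k : hom (Set_cat U) Y X \<and> (\<forall>i\<in>Obj J. Comp (Set_cat U) (tau i) k = sigma i)"
  show "k = ?h"
  proof (rule Set_ext[OF conjunct1[OF k] hh])
   fix z assume z: "z : Y"
   have "app (tau i) (app k z) = app (sigma i) z" if "i : Obj J" for i
    using Set_comp[OF conjunct1[OF k] t[OF that] z] k that by simp
   then have "app k z = h z" using ex[OF z] h[OF z] Set_hom(2)[OF conjunct1[OF k] z] by blast
   then show "app k z = app ?h z" using z by simp
  qed
 qed
qed

text \<open>Transposes exist and are unique, so the right adjoint on arrows and the unit are defined
  as transposes, and every law is checked after applying \<open>L\<close> and composing with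
  \<open>e\<close>.\<close>

lemma adjunction_from_universal_arrows:
 assumes L: "is_functor C D L" and r: "!!d. d : Obj D ==> r d : Obj C"
  and e: "!!d. d : Obj D ==> e d : hom D (on_obj L (r d)) d"
  and u: "!!d c p. d : Obj D ==> c : Obj C ==> p : hom D (on_obj L c) d ==> \<exists>!t. t : hom C c (r d) \<and> Comp D (e d) (on_arr L t) = p"
 shows "\<exists>R eta eps. adjunction C D L R eta eps"
proof -
 note C = functor_cats(1)[OF L] and D = functor_cats(2)[OF L]
 note oC = cat_hom_obj[OF C] and oD = cat_hom_obj[OF D]
 define tr where "tr d c p = (THE t. t : hom C c (r d) \<and> Comp D (e d) (on_arr L t) = p)" for d c p
 have tr: "tr d c p : hom C c (r d) \<and> Comp D (e d) (on_arr L (tr d c p)) = p"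
  if "d : Obj D" "c : Obj C" "p : hom D (on_obj L c) d" for d c p unfolding tr_def by (rule theI'[OF u[OF that]])
 have eq: "s = t" if d: "d : Obj D" and s: "s : hom C c (r d)" and t: "t : hom C c (r d)"
  and st: "Comp D (e d) (on_arr L s) = Comp D (e d) (on_arr L t)" for d c s t
  using u[OF d oC(1)[OF s] cat_comp[OF D functor_hom[OF L s] e[OF d]]] s t st by metis
 define R where "R = \<lparr>on_obj = (\<lambda>d\<in>Obj D. r d), on_arr = (\<lambda>q\<in>Arr D. tr (Cod D q) (r (Dom D q)) (Comp D q (e (Dom D q))))\<rparr>"
 have Ro: "on_obj R d = r d" if "d : Obj D" for d using that by (simp add: R_def)
 have Ra: "on_arr R q : hom C (r a) (r b)" "Comp D (e b) (on_arr L (on_arr R q)) = Comp D q (e a)" if q: "q : hom D a b" for q a b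
 proof -
  have "on_arr R q = tr b (r a) (Comp D q (e a))" using homD[OF q] by (simp add: R_def)
  then show "on_arr R q : hom C (r a) (r b)" "Comp D (e b) (on_arr L (on_arr R q)) = Comp D q (e a)"
   using tr[OF oD(2)[OF q] r[OF oD(1)[OF q]] cat_comp[OF D e[OF oD(1)[OF q]] q]] by auto
 qed
 have Le: "Comp D (e d) (on_arr L (Comp C t s)) = Comp D (Comp D (e d) (on_arr L t)) (on_arr L s)"
  if "d : Obj D" "s : hom C a b" "t : hom C b (r d)" for d s t a b
  using functor_comp[OF L that(2,3)] cat_assoc[OF D functor_hom[OF L that(2)] functor_hom[OF L that(3)] e[OF that(1)]] by simp
 have R: "is_functor D C R"
 proof (rule functorI[OF D C])
  show "on_obj R : extensional (Obj D)" "on_arr R : extensional (Arr D)" by (simp_all add: R_def)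
  show "on_obj R d : Obj C" if "d : Obj D" for d using r Ro that by simp
  show "on_arr R q : hom C (on_obj R a) (on_obj R b)" if q: "q : hom D a b" for q a b
   using Ra(1)[OF q] Ro[OF oD(1)[OF q]] Ro[OF oD(2)[OF q]] by simp
  show "on_arr R (Ident D d) = Ident C (on_obj R d)" if d: "d : Obj D" for d
  proof -
   note i = cat_ident[OF D d] and ir = cat_ident[OF C r[OF d]]
   have "Comp D (e d) (on_arr L (on_arr R (Ident D d))) = Comp D (e d) (on_arr L (Ident C (r d)))"
    using Ra(2)[OF i] functor_ident[OF L r[OF d]] cat_ident_left[OF D e[OF d]] cat_ident_right[OF D e[OF d]] by simp
   then show ?thesis using eq[OF d Ra(1)[OF i] ir] Ro[OF d] by simp
  qed
  show "on_arr R (Comp D q p) = Comp C (on_arr R q) (on_arr R p)" if p: "p : hom D a b" and q: "q : hom D b c" for p q a b c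
  proof (rule eq[OF oD(2)[OF q] Ra(1)[OF cat_comp[OF D p q]] cat_comp[OF C Ra(1)[OF p] Ra(1)[OF q]]])
   note ea = e[OF oD(1)[OF p]] and eb = e[OF oD(1)[OF q]]
   show "Comp D (e c) (on_arr L (on_arr R (Comp D q p))) = Comp D (e c) (on_arr L (Comp C (on_arr R q) (on_arr R p)))"
    using Ra(2)[OF cat_comp[OF D p q]] Le[OF oD(2)[OF q] Ra(1)[OF p] Ra(1)[OF q]] Ra(2)[OF q] Ra(2)[OF p]
     cat_assoc[OF D ea p q] cat_assoc[OF D functor_hom[OF L Ra(1)[OF p]] eb q] by simp
  qed
 qed
 define eta where "eta = (\<lambda>c\<in>Obj C. tr (on_obj L c) c (Ident D (on_obj L c)))"
 have eta: "eta c : hom C c (r (on_obj L c))" "Comp D (e (on_obj L c)) (on_arr L (eta c)) = Ident D (on_obj L c)" if c: "c : Obj C" for c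
  using tr[OF functor_obj[OF L c] c cat_ident[OF D functor_obj[OF L c]]] c unfolding eta_def by auto
 have "adjunction C D L R eta (\<lambda>d\<in>Obj D. e d)" unfolding adjunction_def
 proof (intro conjI L R ballI)
  show "eta : nat_trans C C (id_functor C) (comp_functor C R L)" unfolding nat_trans_def mem_Collect_eq
  proof (intro conjI ballI)
   show "eta : extensional (Obj C)" by (simp add: eta_def)
   show "eta c : hom C (on_obj (id_functor C) c) (on_obj (comp_functor C R L) c)" if "c : Obj C" for c
    using eta(1)[OF that] that Ro[OF functor_obj[OF L that]] by (simp add: comp_functor_obj)
   fix f assume "f : Arr C"
   then have f: "f : hom C (Dom C f) (Cod C f)" by (rule hom_self)
   note o = oC[OF f] and Lf = functor_hom[OF L f]
   note h = eta(1)[OF o(1)] eta(1)[OF o(2)] Ra(1)[OF Lf]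
   have "Comp C (on_arr R (on_arr L f)) (eta (Dom C f)) = Comp C (eta (Cod C f)) f"
   proof (rule eq[OF functor_obj[OF L o(2)] cat_comp[OF C h(1,3)] cat_comp[OF C f h(2)]])
    note x = functor_obj[OF L o(1)] functor_obj[OF L o(2)]
    show "Comp D (e (on_obj L (Cod C f))) (on_arr L (Comp C (on_arr R (on_arr L f)) (eta (Dom C f)))) =
     Comp D (e (on_obj L (Cod C f))) (on_arr L (Comp C (eta (Cod C f)) f))"
     using Le[OF x(2) h(1,3)] Le[OF x(2) f h(2)] Ra(2)[OF Lf] eta(2)[OF o(1)] eta(2)[OF o(2)]
      cat_assoc[OF D functor_hom[OF L h(1)] e[OF x(1)] Lf] cat_ident_left[OF D Lf] cat_ident_right[OF D Lf] by simp
   qed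
   then show "Comp C (on_arr (comp_functor C R L) f) (eta (Dom C f)) = Comp C (eta (Cod C f)) (on_arr (id_functor C) f)"
    using homD(1)[OF f] by (simp add: comp_functor_arr)
  qed
  show "(\<lambda>d\<in>Obj D. e d) : nat_trans D D (comp_functor D L R) (id_functor D)" unfolding nat_trans_def mem_Collect_eq
  proof (intro conjI ballI)
   show "(\<lambda>d\<in>Obj D. e d) d : hom D (on_obj (comp_functor D L R) d) (on_obj (id_functor D) d)" if "d : Obj D" for d
    using e[OF that] that Ro[OF that] by (simp add: comp_functor_obj)
   fix q assume "q : Arr D"
   then have q: "q : hom D (Dom D q) (Cod D q)" by (rule hom_self)
   show "Comp D (on_arr (id_functor D) q) ((\<lambda>d\<in>Obj D. e d) (Dom D q)) = Comp D ((\<lambda>d\<in>Obj D. e d) (Cod D q)) (on_arr (comp_functor D L R) q)"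
    using Ra(2)[OF q] homD(1)[OF q] oD[OF q] by (simp add: comp_functor_arr)
  qed simp
  show "Comp D ((\<lambda>d\<in>Obj D. e d) (on_obj L c)) (on_arr L (eta c)) = Ident D (on_obj L c)" if "c : Obj C" for c
   using eta(2)[OF that] functor_obj[OF L that] by simp
  show "Comp C (on_arr R ((\<lambda>d\<in>Obj D. e d) d)) (eta (on_obj R d)) = Ident C (on_obj R d)" if d: "d : Obj D" for d
  proof -
   note x = r[OF d] and ed = e[OF d] note h = eta(1)[OF x] and Re = Ra(1)[OF ed]
   have "Comp C (on_arr R (e d)) (eta (r d)) = Ident C (r d)" by (rule eq[OF d cat_comp[OF C h Re] cat_ident[OF C x]])
     (use Le[OF d h Re] Ra(2)[OF ed] eta(2)[OF x] cat_assoc[OF D functor_hom[OF L h] e[OF functor_obj[OF L x]] ed]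
      functor_ident[OF L x] in simp)
   then show ?thesis using d Ro[OF d] by simp
  qed
 qed
 then show ?thesis by blast
qed

section \<open>Left exactness of the constructed functor\<close>

context sat_point
begin

lemmas F_app = Set_functor_app[OF F]

lemma lab_As: "x : El R ==> lab R x : As" using flat_lab[OF R_flat] .

text \<open>Passing to a common preimage of two elements of \<open>R\<close> rewrites both classes
  over it; induction extends this to finitely many, which is the filteredness behind left
  exactness.\<close>

lemma common_representative:
 assumes "finite S" "!!i. i : S ==> o' i : Obj E" "!!i. i : S ==> v i : on_obj F (o' i)"
 shows "\<exists>z\<in>El R. \<exists>n. \<forall>i\<in>S. n i : hom E (lab R z) (o' i) \<and> v i = cl (n i) z" using assms
proof (induction S rule: finite_induct)
 case empty
 then show ?case using At.flatD(6)[OF R_flat] by auto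
next
 case (insert j S)
 from insert obtain z n where z: "z : El R" "\<forall>i\<in>S. n i : hom E (lab R z) (o' i) \<and> v i = cl (n i) z" by blast
 obtain x m where x: "x : El R" "m : hom E (lab R x) (o' j)" "v j = cl m x" using cl_surj[of "o' j" "v j"] insert by blast
 obtain u s t where u: "At.acts R s u" "At.acts R t u" "act R s u = z" "act R t u = x" using At.flat_join[OF R_flat z(1) x(1)] .
 note s = flat_acts[OF R_flat u(1)] and t = flat_acts[OF R_flat u(2)]
 have cs: "Cod E s = lab R z" and ct: "Cod E t = lab R x" using s(3) t(3) u by auto
 let ?n = "\<lambda>i. if i = j then m \<odot> t else n i \<odot> s"
 have "?n i : hom E (lab R u) (o' i) \<and> v i = cl (?n i) u" if "i : insert j S" for i
 proof (cases "i = j")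
  case True
  then show ?thesis using e_hom[OF t(6)[unfolded ct] x(2)] cl_act[OF u(2) x(2)[folded ct]] x(3) u(4) by simp
 next
  case False
  then have n: "n i : hom E (lab R z) (o' i)" "v i = cl (n i) z" using that z(2) by auto
  show ?thesis using False e_hom[OF s(6)[unfolded cs] n(1)] cl_act[OF u(1) n(1)[folded cs]] n(2) u(3) by simp
 qed
 then show ?case by (intro bexI[OF _ s(1)] exI[of _ ?n] ballI)
qed

lemma common_representative2:
 assumes "a : Obj E" "b : Obj E" "v : on_obj F a" "w : on_obj F b"
 obtains z m n where "z : El R" "m : hom E (lab R z) a" "n : hom E (lab R z) b" "v = cl m z" "w = cl n z"
proof -
 have "\<exists>z\<in>El R. \<exists>n. \<forall>i\<in>UNIV. n i : hom E (lab R z) (if i then a else b) \<and> (if i then v else w) = cl (n i) z"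
  using common_representative[of UNIV "\<lambda>i. if i then a else b" "\<lambda>i. if i then v else w"] assms by simp
 then obtain z n where z: "z : El R" "!!i. n i : hom E (lab R z) (if i then a else b) \<and> (if i then v else w) = cl (n i) z" by blast
 show thesis using that[OF z(1), of "n True" "n False"] z(2)[of True] z(2)[of False] by simp
qed

text \<open>Filtered colimits commute with finite limits. A compatible family is represented at a
  single \<open>z\<close>, where it becomes a cone in \<open>E\<close> on the label of
  \<open>z\<close>; the limit gives one arrow \<open>k\<close>, and its class at \<open>z\<close> is
  the element sought.\<close>

lemma preserves_finite_limits_F: "preserves_finite_limits E (Set_cat U) F" unfolding preserves_finite_limits_def
proof (intro allI impI)
 fix J :: "(nat, nat) cat" and G c tau
 assume a: "category J \<and> finite (Obj J) \<and> finite (Arr J) \<and> is_functor J E G \<and> is_limit J E G c tau"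
 then have J: "category J" and fin: "finite (Obj J)" and G: "is_functor J E G" and lim: "is_limit J E G c tau" by auto
 let ?S = "Set_cat U" and ?G = "comp_functor J F G"
 have c: "c : Obj E" and t: "!!i. i : Obj J ==> tau i : hom E c (on_obj G i)"
  and tn: "!!f. f : Arr J ==> on_arr G f \<odot> tau (Dom J f) = tau (Cod J f)"
  using lim unfolding is_limit_def is_cone_def by auto
 have univ: "\<exists>!h. h : hom E d c \<and> (\<forall>i\<in>Obj J. tau i \<odot> h = sigma i)" if "is_cone J E G d sigma" for d sigma
  using lim that unfolding is_limit_def by blast
 have FG: "is_functor J ?S ?G" by (rule is_functor_comp[OF G F])
 show "is_limit J ?S ?G (on_obj F c) (\<lambda>i. on_arr F (tau i))"
 proof (rule Set_limit[OF FG])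
  show "is_cone J ?S ?G (on_obj F c) (\<lambda>i. on_arr F (tau i))" unfolding is_cone_def
  proof (intro conjI ballI)
   show "on_obj F c : Obj ?S" by (rule functor_obj[OF F c])
   show "on_arr F (tau i) : hom ?S (on_obj F c) (on_obj ?G i)" if "i : Obj J" for i
    using functor_hom[OF F t[OF that]] that by (simp add: comp_functor_obj)
   fix f assume f: "f : Arr J"
   note fh = hom_self[OF f]
   show "Comp ?S (on_arr ?G f) (on_arr F (tau (Dom J f))) = on_arr F (tau (Cod J f))"
    using functor_comp[OF F t[OF cat_hom_obj(1)[OF J fh]] functor_hom[OF G fh]] tn[OF f] f by (simp add: comp_functor_arr)
  qed
  fix x assume x0: "!!i. i : Obj J ==> x i : on_obj ?G i"
   and xn0: "!!f. f : Arr J ==> fapp ?G f (x (Dom J f)) = x (Cod J f)"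
  have x: "x i : on_obj F (on_obj G i)" if "i : Obj J" for i using x0[OF that] that by (simp add: comp_functor_obj)
  have xn: "fapp F (on_arr G f) (x (Dom J f)) = x (Cod J f)" if "f : Arr J" for f using xn0[OF that] that by (simp add: comp_functor_arr)
  obtain z n where z: "z : El R" "!!i. i : Obj J ==> n i : hom E (lab R z) (on_obj G i)" "!!i. i : Obj J ==> x i = cl (n i) z"
   using common_representative[of _ "on_obj G", OF fin functor_obj[OF G] x] by blast
  note zo = As_Obj[OF lab_As[OF z(1)]]
  \<comment> \<open>Compatibility is an equation between classes at the same element, which
    \<open>cl_inj\<close> turns into an equation of arrows.\<close>
  have "is_cone J E G (lab R z) n" unfolding is_cone_def
  proof (intro conjI ballI zo z(2))
   fix f assume f: "f : Arr J"
   note fh = hom_self[OF f]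
   note d = cat_hom_obj[OF J fh]
   have "cl (on_arr G f \<odot> n (Dom J f)) z = cl (n (Cod J f)) z"
    using cl_arr[OF z(1) z(2)[OF d(1)] functor_hom[OF G fh]] xn[OF f] z(3)[OF d(1)] z(3)[OF d(2)] by simp
   then show "on_arr G f \<odot> n (Dom J f) = n (Cod J f)"
    by (rule cl_inj[OF z(1) e_hom[OF z(2)[OF d(1)] functor_hom[OF G fh]] z(2)[OF d(2)]])
  qed
  from univ[OF this] obtain k where k: "k : hom E (lab R z) c" "!!i. i : Obj J ==> tau i \<odot> k = n i" by blast
  show "\<exists>!y. y : on_obj F c \<and> (\<forall>i\<in>Obj J. fapp F (tau i) y = x i)"
  proof (rule ex1I[of _ "cl k z"])
   show 1: "cl k z : on_obj F c \<and> (\<forall>i\<in>Obj J. fapp F (tau i) (cl k z) = x i)"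
    using cl_mem[OF z(1) k(1)] cl_arr[OF z(1) k(1) t] k(2) z(3) by simp
   fix y assume y: "y : on_obj F c \<and> (\<forall>i\<in>Obj J. fapp F (tau i) y = x i)"
   obtain w p q where w: "w : El R" "p : hom E (lab R w) c" "q : hom E (lab R w) c" "y = cl p w" "cl k z = cl q w"
    using common_representative2[OF c c conjunct1[OF y] conjunct1[OF 1]] by metis
   have pq: "tau i \<odot> p = tau i \<odot> q" if i: "i : Obj J" for i
    by (rule cl_inj[OF w(1) e_hom[OF w(2) t[OF i]] e_hom[OF w(3) t[OF i]]])
     (use cl_arr[OF w(1,2) t[OF i]] cl_arr[OF w(1,3) t[OF i]] y 1 w(4,5) i in metis)
   have "is_cone J E G (lab R w) (\<lambda>i. tau i \<odot> q)" unfolding is_cone_def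
   proof (intro conjI ballI)
    show "lab R w : Obj E" using e_objs(1)[OF w(2)] .
    show "tau i \<odot> q : hom E (lab R w) (on_obj G i)" if "i : Obj J" for i using e_hom[OF w(3) t[OF that]] .
    fix f assume f: "f : Arr J"
    note fh = hom_self[OF f]
    show "on_arr G f \<odot> (tau (Dom J f) \<odot> q) = tau (Cod J f) \<odot> q"
     using e_assoc[OF w(3) t[OF cat_hom_obj(1)[OF J fh]] functor_hom[OF G fh]] tn[OF f] by simp
   qed
   from univ[OF this] have "p = q" using w(2,3) pq by blast
   then show "y = cl k z" using w(4,5) by simp
  qed
 qed
qed

end

section \<open>The right adjoint\<close>

context sat_point
begin

text \<open>An arrow between the objects \<open>y0 c\<close> belongs to the site only after passing
  to a cover; choosing a nondegenerate member of the cover keeps the piece inhabited.\<close>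

lemma refine:
 assumes k: "nondeg k" and zeta: "zeta : hom E (y0 k) a" and n: "n : hom E a (y0 c)" and c: "c : Obj C"
 obtains l h g where "nondeg l" "h : hom C l k" "g : hom C l c" "n \<odot> (zeta \<odot> y1 h) = y1 g"
proof -
 have ko: "k : Obj C" using k unfolding nondeg_def by blast
 obtain h l where h: "h : hom C l k" "nondeg l" "\<exists>g\<in>hom C (Dom C h) c. n \<odot> zeta \<odot> y1 h = y1 g"
  using cov_nondeg[OF k y_full[OF ko c e_hom[OF zeta n]]] .
 then obtain g where "g : hom C l c" "n \<odot> zeta \<odot> y1 h = y1 g" using homD(2)[OF h(1)] by auto
 then show thesis using that[OF h(2,1)] e_assoc[OF y_hom[OF h(1)] zeta n] by simp
qed

lemma chart_exists:
 assumes z: "z : El R"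
 obtains k zeta where "nondeg k" "zeta : hom E (y0 k) (lab R z)"
 using not_initial_iff[OF As_Obj[OF lab_As[OF z]]] As_ni[OF lab_As[OF z]] by blast

text \<open>This is where saturation is used. Some atom \<open>d\<close> maps to \<open>y0 k\<close>
  by \<open>q\<close>, and \<open>zeta \<odot> q\<close> is an arrow of \<open>A\<close>, so
  \<open>z\<close> is its action on some \<open>x\<close>. The class of \<open>q\<close> at
  \<open>x\<close> is the element sought, and it serves every \<open>n\<close> at once.\<close>

lemma lift:
 assumes z: "z : El R" and k: "nondeg k" and zeta: "zeta : hom E (y0 k) (lab R z)"
 obtains v where "v : on_obj F (y0 k)" "!!n e. n : hom E (lab R z) e ==> fapp F (n \<odot> zeta) v = cl n z"
proof -
 have ko: "k : Obj C" using k unfolding nondeg_def by blast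
 have "\<not> initial E (y0 k)" using not_initial_iff[OF y_obj[OF ko]] k cat_ident[OF catE y_obj[OF ko]] by blast
 then obtain d q where d: "d : As" "q : hom E d (y0 k)" using As_inhab[OF y_obj[OF ko]] by blast
 note zetaq = e_hom[OF d(2) zeta]
 have "zeta \<odot> q : Arr A" "Cod A (zeta \<odot> q) = lab R z" using zetaq d(1) lab_As[OF z] by (auto simp: full_subcat_def hom_def)
 then obtain x where x: "At.acts R (zeta \<odot> q) x" "act R (zeta \<odot> q) x = z" using R_sat z unfolding At.sat_def by metis
 note xf = flat_acts[OF R_flat x(1)]
 have lx: "lab R x = d" using xf(6) homD(2)[OF xf(6)] homD(2)[OF zetaq] by simp
 have q: "q : hom E (lab R x) (y0 k)" using d(2) lx by simp
 show thesis
 proof (rule that)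
  show "cl q x : on_obj F (y0 k)" by (rule cl_mem[OF xf(1) q])
  show "fapp F (n \<odot> zeta) (cl q x) = cl n z" if n: "n : hom E (lab R z) e" for n e
   using cl_arr[OF xf(1) q e_hom[OF zeta n]] e_assoc[OF d(2) zeta n] cl_act[OF x(1), of n e] n homD(3)[OF zetaq] x(2) by simp
 qed
qed

lemma F_cover:
 assumes e: "e : Obj E" and v: "v : on_obj F e"
 obtains c xi w where "c : Obj C" "xi : hom E (y0 c) e" "w : on_obj F (y0 c)" "fapp F xi w = v"
proof -
 obtain z m where z: "z : El R" "m : hom E (lab R z) e" "v = cl m z" using cl_surj[OF e v] by blast
 obtain k zeta where k: "nondeg k" "zeta : hom E (y0 k) (lab R z)" using chart_exists[OF z(1)] .
 obtain w where w: "w : on_obj F (y0 k)" "\<forall>n e. n : hom E (lab R z) e --> fapp F (n \<odot> zeta) w = cl n z"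
  using lift[OF z(1) k] by metis
 show thesis
 proof (rule that[OF _ e_hom[OF k(2) z(2)] w(1)])
  show "k : Obj C" using k(1) unfolding nondeg_def by blast
  show "fapp F (m \<odot> zeta) w = v" using w(2) z(2,3) by blast
 qed
qed

text \<open>A representative of \<open>w\<close> at some \<open>z\<close> is restricted to a
  nondegenerate piece where it comes from an arrow of the site. Along that arrow the cover is pulled
  back and a nondegenerate member is taken, to which \<open>lift\<close> brings the element.\<close>

lemma F_cover_site:
 assumes c: "c : Obj C" and w: "w : on_obj F (y0 c)" and Q: "cov c Q"
 obtains f b v where "f : hom C b c" "Q f" "v : on_obj F (y0 b)" "fapp F (y1 f) v = w"
proof -
 obtain z m where z: "z : El R" "m : hom E (lab R z) (y0 c)" "w = cl m z" using cl_surj[OF y_obj[OF c] w] by blast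
 obtain k zeta where k: "nondeg k" "zeta : hom E (y0 k) (lab R z)" using chart_exists[OF z(1)] .
 obtain l h g where l: "nondeg l" "h : hom C l k" "g : hom C l c" "m \<odot> (zeta \<odot> y1 h) = y1 g" using refine[OF k z(2) c] .
 obtain h' b where h': "h' : hom C b l" "nondeg b" "Q (g \<cdot> h')" using cov_nondeg[OF l(1) cov_pullback[OF l(3) Q]] .
 note zeta1 = e_hom[OF y_hom[OF l(2)] k(2)] note zeta2 = e_hom[OF y_hom[OF h'(1)] zeta1]
 obtain v where v: "v : on_obj F (y0 b)" "\<forall>n e. n : hom E (lab R z) e --> fapp F (n \<odot> (zeta \<odot> y1 h \<odot> y1 h')) v = cl n z"
  using lift[OF z(1) h'(2) zeta2] by metis
 have "m \<odot> (zeta \<odot> y1 h \<odot> y1 h') = y1 (g \<cdot> h')"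
  using e_assoc[OF y_hom[OF h'(1)] zeta1 z(2)] l(4) y_comp[OF l(3) h'(1)] by simp
 then show thesis using that[OF cmp_hom[OF l(3) h'(1)] h'(3) v(1)] v(2) z(2,3) by metis
qed

text \<open>At a common representative \<open>z\<close>, equality of the values is an equality of
  arrows by \<open>cl_inj\<close>. Two refinements make both arrows come from the site, and
  \<open>lift\<close> supplies the element over the refined object.\<close>

lemma F_overlap:
 assumes c: "c : Obj C" "c' : Obj C" and xi: "xi : hom E (y0 c) e" "xi' : hom E (y0 c') e"
  and w: "w : on_obj F (y0 c)" "w' : on_obj F (y0 c')" and eq: "fapp F xi w = fapp F xi' w'"
 obtains k g g' u where "g : hom C k c" "g' : hom C k c'" "u : on_obj F (y0 k)"
  "fapp F (y1 g) u = w" "fapp F (y1 g') u = w'" "xi \<odot> y1 g = xi' \<odot> y1 g'"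
proof -
 obtain z n n' where z: "z : El R" "n : hom E (lab R z) (y0 c)" "n' : hom E (lab R z) (y0 c')" "w = cl n z" "w' = cl n' z"
  using common_representative2[OF y_obj[OF c(1)] y_obj[OF c(2)] w] .
 have nn: "xi \<odot> n = xi' \<odot> n'" by (rule cl_inj[OF z(1) e_hom[OF z(2) xi(1)] e_hom[OF z(3) xi(2)]])
   (use cl_arr[OF z(1,2) xi(1)] cl_arr[OF z(1,3) xi(2)] eq z(4,5) in simp)
 obtain k zeta where k: "nondeg k" "zeta : hom E (y0 k) (lab R z)" using chart_exists[OF z(1)] .
 obtain l h g where l: "nondeg l" "h : hom C l k" "g : hom C l c" "n \<odot> (zeta \<odot> y1 h) = y1 g" using refine[OF k z(2) c(1)] .
 note zeta1 = e_hom[OF y_hom[OF l(2)] k(2)]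
 obtain b h' g' where b: "nondeg b" "h' : hom C b l" "g' : hom C b c'" "n' \<odot> (zeta \<odot> y1 h \<odot> y1 h') = y1 g'"
  using refine[OF l(1) zeta1 z(3) c(2)] .
 note zeta2 = e_hom[OF y_hom[OF b(2)] zeta1]
 obtain u where u: "u : on_obj F (y0 b)" "\<forall>n e. n : hom E (lab R z) e --> fapp F (n \<odot> (zeta \<odot> y1 h \<odot> y1 h')) u = cl n z"
  using lift[OF z(1) b(1) zeta2] by metis
 have gh: "n \<odot> (zeta \<odot> y1 h \<odot> y1 h') = y1 (g \<cdot> h')"
  using e_assoc[OF y_hom[OF b(2)] zeta1 z(2)] l(4) y_comp[OF l(3) b(2)] by simp
 show thesis
 proof (rule that[OF cmp_hom[OF l(3) b(2)] b(3) u(1)])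
  show "fapp F (y1 (g \<cdot> h')) u = w" using u(2) z(2,4) gh by metis
  show "fapp F (y1 g') u = w'" using u(2) z(3,5) b(4) by metis
  show "xi \<odot> y1 (g \<cdot> h') = xi' \<odot> y1 g'"
   using e_assoc[OF zeta2 z(2) xi(1)] e_assoc[OF zeta2 z(3) xi(2)] nn gh b(4) by simp
 qed
qed

text \<open>The sheaf of the right adjoint at \<open>X\<close>: the adjunction requires its sections
  over \<open>c\<close> to be the functions from the fibre over \<open>y0 c\<close> to
  \<open>X\<close>.\<close>

definition dual :: "'u set => 'c => ('u => 'u) set" where
 "dual X c = on_obj F (y0 c) \<rightarrow>\<^sub>E X"

definition dualr :: "'d => ('u => 'u) => 'u => 'u" where
 "dualr f r = (\<lambda>w\<in>on_obj F (y0 (Dom C f)). r (fapp F (y1 f) w))"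

lemma dualr_app: "f : hom C a b ==> w : on_obj F (y0 a) ==> dualr f r w = r (fapp F (y1 f) w)" by (simp add: dualr_def hom_def)

lemma dualr_mem: "f : hom C a b ==> r : dual X b ==> dualr f r : dual X a"
 using F_app(1)[OF y_hom] homD(2)[of f C a b] unfolding dual_def dualr_def by auto

lemma dual_eqI:
 "r : dual X c ==> s : dual X c ==> (!!w. w : on_obj F (y0 c) ==> r w = s w) ==> r = s" unfolding dual_def by (rule PiE_ext)

text \<open>The locale asks \<open>y1\<close> to respect composition only; for identities one uses
  that restriction along an identity is trivial in a sheaf, applied to the identity of
  \<open>y0 c\<close>.\<close>

lemma y_ident: assumes c: "c : Obj C" shows "y1 (Ident C c) = Ident E (y0 c)"
proof -
 note i = cat_ident[OF catE y_obj[OF c]]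
 have "Ident E (y0 c) \<odot> y1 (Ident C c) = Ident E (y0 c)" using esheafD(2)[OF y_sheaf[OF y_obj[OF c]] c i] .
 then show ?thesis using cat_ident_left[OF catE y_hom[OF ident_hom[OF c]]] by simp
qed

text \<open>Covers become jointly surjective families of fibres, so a glued function is determined
  by its parts; two preimages of one point are linked over a common object by
  \<open>F_overlap\<close>, so the parts fit together.\<close>

lemma esheaf_dual: "esheaf (dual X) dualr" unfolding esheaf_def
proof (intro conjI allI ballI impI)
 show "dualr f r : dual X a" if "f : hom C a b \<and> r : dual X b" for a b f r using dualr_mem that by blast
 show "dualr (Ident C c) r = r" if c: "c : Obj C" and r: "r : dual X c" for c r
  by (rule dual_eqI[OF dualr_mem[OF ident_hom[OF c] r] r])
   (simp add: dualr_app[OF ident_hom[OF c]] y_ident[OF c] F_app(3)[OF y_obj[OF c]])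
 show "dualr (f \<cdot> g) r = dualr g (dualr f r)" if "f : hom C b c \<and> g : hom C a b \<and> r : dual X c" for a b c f g r
 proof -
  have f: "f : hom C b c" and g: "g : hom C a b" and r: "r : dual X c" using that by auto
  show ?thesis by (rule dual_eqI[OF dualr_mem[OF cmp_hom[OF f g] r] dualr_mem[OF g dualr_mem[OF f r]]])
    (simp add: dualr_app[OF cmp_hom[OF f g]] dualr_app[OF g] dualr_app[OF f F_app(1)[OF y_hom[OF g]]] y_comp[OF f g]
     F_app(2)[OF y_hom[OF g] y_hom[OF f]])
 qed
 fix c S x assume c: "c : Obj C" and S: "S : J c"
  and x: "(\<forall>f\<in>S. x f : dual X (Dom C f)) \<and> (\<forall>f\<in>S. \<forall>b. \<forall>g\<in>hom C b (Dom C f). dualr g (x f) = x (f \<cdot> g))"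
 note Sh = cover_hom[OF c S]
 have res: "x f (fapp F (y1 g) u) = x (f \<cdot> g) u" if "f : S" "g : hom C b (Dom C f)" "u : on_obj F (y0 b)" for f g b u
  using dualr_app[OF that(2,3), of "x f"] x that(1,2) by simp
 have wd: "x f v = x f' v'" if f: "f : S" "f' : S" and v: "v : on_obj F (y0 (Dom C f))" "v' : on_obj F (y0 (Dom C f'))"
  and eq: "fapp F (y1 f) v = fapp F (y1 f') v'" for f f' v v'
 proof -
  note fh = Sh[OF f(1)] and fh' = Sh[OF f(2)]
  obtain k g g' u where k: "g : hom C k (Dom C f)" "g' : hom C k (Dom C f')" "u : on_obj F (y0 k)"
   "fapp F (y1 g) u = v" "fapp F (y1 g') u = v'" "y1 f \<odot> y1 g = y1 f' \<odot> y1 g'"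
   using F_overlap[OF hom_objs(1)[OF fh] hom_objs(1)[OF fh'] y_hom[OF fh] y_hom[OF fh'] v eq] .
  \<comment> \<open>The two composites have the same image in \<open>E\<close> but are only locally
    equal in the site, hence a further passage to a cover.\<close>
  have "cov k (\<lambda>h. f \<cdot> g \<cdot> h = f' \<cdot> g' \<cdot> h)"
   by (rule y_faithful[OF cmp_hom[OF fh k(1)] cmp_hom[OF fh' k(2)]]) (simp add: y_comp[OF fh k(1)] y_comp[OF fh' k(2)] k(6))
  from F_cover_site[OF hom_objs(1)[OF k(1)] k(3) this] obtain h b s where h: "h : hom C b k" "f \<cdot> g \<cdot> h = f' \<cdot> g' \<cdot> h"
   "s : on_obj F (y0 b)" "fapp F (y1 h) s = u" .
  have "x f v = x (f \<cdot> (g \<cdot> h)) s"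
   using res[OF f(1) cmp_hom[OF k(1) h(1)] h(3)] F_app(2)[OF y_hom[OF h(1)] y_hom[OF k(1)] h(3)] y_comp[OF k(1) h(1)] h(4) k(4) by simp
  moreover have "x f' v' = x (f' \<cdot> (g' \<cdot> h)) s"
   using res[OF f(2) cmp_hom[OF k(2) h(1)] h(3)] F_app(2)[OF y_hom[OF h(1)] y_hom[OF k(2)] h(3)] y_comp[OF k(2) h(1)] h(4) k(5) by simp
  moreover have "f \<cdot> (g \<cdot> h) = f' \<cdot> (g' \<cdot> h)" using cmp_assoc[OF fh k(1) h(1)] cmp_assoc[OF fh' k(2) h(1)] h(2) by simp
  ultimately show ?thesis by simp
 qed
 have "cov c (\<lambda>f. f : S)" using S unfolding cov_def by blast
 then have ex: "\<exists>f\<in>S. \<exists>v\<in>on_obj F (y0 (Dom C f)). fapp F (y1 f) v = w" if "w : on_obj F (y0 c)" for w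
  using F_cover_site[OF c that] homD(2) by metis
 define r where "r = (\<lambda>w\<in>on_obj F (y0 c). THE y. \<exists>f\<in>S. \<exists>v\<in>on_obj F (y0 (Dom C f)). fapp F (y1 f) v = w \<and> y = x f v)"
 have r: "r (fapp F (y1 f) v) = x f v" if f: "f : S" and v: "v : on_obj F (y0 (Dom C f))" for f v
 proof -
  let ?P = "\<lambda>y. \<exists>f'\<in>S. \<exists>v'\<in>on_obj F (y0 (Dom C f')). fapp F (y1 f') v' = fapp F (y1 f) v \<and> y = x f' v'"
  have "(THE y. ?P y) = x f v"
  proof (rule the_equality)
   show "?P (x f v)" using f v by blast
   fix y assume "?P y"
   then obtain f' v' where f': "f' : S" "v' : on_obj F (y0 (Dom C f'))" "fapp F (y1 f') v' = fapp F (y1 f) v" "y = x f' v'"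
    by blast
   show "y = x f v" unfolding f'(4) by (rule wd[OF f'(1) f f'(2) v f'(3)])
  qed
  then show ?thesis unfolding r_def using F_app(1)[OF y_hom[OF Sh[OF f]] v] by simp
 qed
 have rX: "r : dual X c" unfolding dual_def
 proof (rule PiE_I)
  fix w assume "w : on_obj F (y0 c)"
  then obtain f v where f: "f : S" "v : on_obj F (y0 (Dom C f))" "fapp F (y1 f) v = w" using ex by blast
  then show "r w : X" using r[OF f(1,2)] x unfolding dual_def by auto
 qed (simp add: r_def)
 show "\<exists>!y. y : dual X c \<and> (\<forall>f\<in>S. dualr f y = x f)"
 proof (rule ex1I[of _ r], intro conjI ballI rX)
  show "dualr f r = x f" if f: "f : S" for f
   by (rule dual_eqI[OF dualr_mem[OF Sh[OF f] rX]]) (use x f r[OF f] dualr_app[OF Sh[OF f]] in auto)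
  fix y assume y: "y : dual X c \<and> (\<forall>f\<in>S. dualr f y = x f)"
  show "y = r"
  proof (rule dual_eqI[OF conjunct1[OF y] rX])
   fix w assume "w : on_obj F (y0 c)"
   then obtain f v where f: "f : S" "v : on_obj F (y0 (Dom C f))" "fapp F (y1 f) v = w" using ex by blast
   then show "y w = r w" using r[OF f(1,2)] y dualr_app[OF Sh[OF f(1)] f(2), of y] by simp
  qed
 qed
qed

text \<open>The object representing \<open>dual X\<close> is the value of the right adjoint. Its
  counit evaluates: a point of the fibre is reached from some \<open>w\<close> by some section
  \<open>xi\<close>, and goes to the value at \<open>w\<close> of the function that
  \<open>xi\<close> stands for. \<open>F_cover\<close> reaches every point and
  \<open>F_overlap\<close> shows consistency.\<close>

lemma universal_arrow_exists:
 assumes X: "X : Obj (Set_cat U)"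
 shows "\<exists>r\<in>Obj E. \<exists>eps\<in>hom (Set_cat U) (on_obj F r) X. \<forall>e\<in>Obj E. \<forall>p\<in>hom (Set_cat U) (on_obj F e) X.
  \<exists>!t. t : hom E e r \<and> Comp (Set_cat U) eps (on_arr F t) = p"
proof -
 let ?S = "Set_cat U"
 have smX: "sm X" using X by (simp add: Obj_Set_cat)
 have "sm (dual X c)" if "c : Obj C" for c unfolding dual_def by (rule sm_PiE[OF F_app(4)[OF y_obj[OF that]] smX])
 from y_rep_any[OF esheaf_dual this] obtain r theta where r: "r : Obj E"
  and theta: "esheaf_iso (\<lambda>c. hom E (y0 c) r) (\<lambda>f xi. xi \<odot> y1 f) (dual X) dualr theta" by blast
 note T = esheaf_isoD[OF theta]
 have wd: "theta c xi w = theta c' xi' w'" if c: "c : Obj C" "c' : Obj C" and xi: "xi : hom E (y0 c) r" "xi' : hom E (y0 c') r"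
  and w: "w : on_obj F (y0 c)" "w' : on_obj F (y0 c')" and eq: "fapp F xi w = fapp F xi' w'" for c c' xi xi' w w'
 proof -
  obtain k g g' u where k: "g : hom C k c" "g' : hom C k c'" "u : on_obj F (y0 k)"
   "fapp F (y1 g) u = w" "fapp F (y1 g') u = w'" "xi \<odot> y1 g = xi' \<odot> y1 g'" using F_overlap[OF c xi w eq] .
  have "theta c xi w = theta k (xi \<odot> y1 g) u" "theta c' xi' w' = theta k (xi' \<odot> y1 g') u"
   using T(2)[OF k(1) xi(1)] T(2)[OF k(2) xi(2)] dualr_app[OF k(1,3)] dualr_app[OF k(2,3)] k(4,5) by auto
  then show ?thesis using k(6) by simp
 qed
 \<comment> \<open>Evaluation; the description is unambiguous by \<open>wd\<close>.\<close>
 define eps where "eps v = (THE x. \<exists>c\<in>Obj C. \<exists>xi\<in>hom E (y0 c) r. \<exists>w\<in>on_obj F (y0 c). fapp F xi w = v \<and> x = theta c xi w)" for v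
 have eps: "eps (fapp F xi w) = theta c xi w" if c: "c : Obj C" and xi: "xi : hom E (y0 c) r" and w: "w : on_obj F (y0 c)" for c xi w
  unfolding eps_def using c xi w wd by (intro the_equality) blast+
 let ?eps = "(on_obj F r, restrict eps (on_obj F r), X)"
 have epsh: "?eps : hom ?S (on_obj F r) X"
 proof (rule Set_homI[OF F_app(4)[OF r] smX])
  have "eps v : X" if v: "v : on_obj F r" for v
  proof -
   obtain c xi w where c: "c : Obj C" "xi : hom E (y0 c) r" "w : on_obj F (y0 c)" "fapp F xi w = v" using F_cover[OF r v] .
   then show ?thesis using eps[OF c(1-3)] T(1)[OF c(1,2)] unfolding dual_def by auto
  qed
  then show "restrict eps (on_obj F r) : on_obj F r \<rightarrow>\<^sub>E X" by auto
 qed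
 have epst: "app (Comp ?S ?eps (on_arr F t)) (fapp F xi w) = theta c (t \<odot> xi) w"
  if t: "t : hom E e r" and c: "c : Obj C" and xi: "xi : hom E (y0 c) e" and w: "w : on_obj F (y0 c)" for t e c xi w
 proof -
  note v = F_app(1)[OF xi w]
  show ?thesis
   using Set_comp[OF functor_hom[OF F t] epsh v] F_app(1)[OF t v] F_app(2)[OF xi t w] eps[OF c e_hom[OF xi t] w] by simp
 qed
 have "\<exists>!t. t : hom E e r \<and> Comp ?S ?eps (on_arr F t) = p" if e: "e : Obj E" and p: "p : hom ?S (on_obj F e) X" for e p
 proof -
  \<comment> \<open>The transpose of \<open>p\<close> on generalized elements: a section of
    \<open>e\<close> yields a function on a fibre, that is a section of
    \<open>dual X\<close>.\<close>
  define beta where "beta c xi = (\<lambda>w\<in>on_obj F (y0 c). app p (fapp F xi w))" for c xi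
  have beta: "beta c xi : dual X c" if "xi : hom E (y0 c) e" for c xi
   unfolding beta_def dual_def using Set_hom(2)[OF p F_app(1)[OF that]] by auto
  have betar: "beta a (xi \<odot> y1 f) = dualr f (beta b xi)" if f: "f : hom C a b" and xi: "xi : hom E (y0 b) e" for f a b xi
   by (rule dual_eqI[OF beta[OF e_hom[OF y_hom[OF f] xi]] dualr_mem[OF f beta[OF xi]]])
    (simp add: dualr_app[OF f] beta_def F_app(1)[OF y_hom[OF f]] F_app(2)[OF y_hom[OF f] xi])
  have "\<exists>alpha. \<forall>c xi. c : Obj C --> xi : hom E (y0 c) e --> alpha c xi : hom E (y0 c) r \<and> theta c (alpha c xi) = beta c xi"
   using T(4)[OF _ beta] by (intro choice allI) blast
  then obtain alpha where alpha: "!!c xi. c : Obj C ==> xi : hom E (y0 c) e ==> alpha c xi : hom E (y0 c) r"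
   "!!c xi. c : Obj C ==> xi : hom E (y0 c) e ==> theta c (alpha c xi) = beta c xi" by blast
  have "\<exists>t\<in>hom E e r. \<forall>c\<in>Obj C. \<forall>xi\<in>hom E (y0 c) e. t \<odot> xi = alpha c xi"
  proof (rule y_dense[OF e r alpha(1)])
   fix f a b xi assume f: "f : hom C a b" and xi: "xi : hom E (y0 b) e"
   note a = hom_objs(1)[OF f] and b = hom_objs(2)[OF f] and xif = e_hom[OF y_hom[OF f] xi]
   show "alpha a (xi \<odot> y1 f) = alpha b xi \<odot> y1 f"
    by (rule T(3)[OF a alpha(1)[OF a xif] e_hom[OF y_hom[OF f] alpha(1)[OF b xi]]])
     (simp add: alpha(2)[OF a xif] T(2)[OF f alpha(1)[OF b xi]] alpha(2)[OF b xi] betar[OF f xi])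
  qed
  then obtain t where t: "t : hom E e r" "!!c xi. c : Obj C ==> xi : hom E (y0 c) e ==> t \<odot> xi = alpha c xi" by blast
  show ?thesis
  proof (rule ex1I[of _ t], intro conjI t(1))
   show "Comp ?S ?eps (on_arr F t) = p"
   proof (rule Set_ext[OF cat_comp[OF category_Set_cat functor_hom[OF F t(1)] epsh] p])
    fix v assume v: "v : on_obj F e"
    obtain c xi w where c: "c : Obj C" "xi : hom E (y0 c) e" "w : on_obj F (y0 c)" "fapp F xi w = v" using F_cover[OF e v] .
    show "app (Comp ?S ?eps (on_arr F t)) v = app p v"
     using epst[OF t(1) c(1-3)] t(2)[OF c(1,2)] alpha(2)[OF c(1,2)] c(3,4) by (simp add: beta_def)
   qed
   fix s assume s: "s : hom E e r \<and> Comp ?S ?eps (on_arr F s) = p"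
   show "s = t"
   proof (rule y_ext[OF conjunct1[OF s] t(1)])
    fix c xi assume c: "c : Obj C" and xi: "xi : hom E (y0 c) e"
    note sxi = e_hom[OF xi conjunct1[OF s]]
    have "theta c (s \<odot> xi) = beta c xi"
     by (rule dual_eqI[OF T(1)[OF c sxi] beta[OF xi]]) (use epst[OF conjunct1[OF s] c xi] s in \<open>simp add: beta_def\<close>)
    then show "s \<odot> xi = t \<odot> xi" using T(3)[OF c sxi alpha(1)[OF c xi]] alpha(2)[OF c xi] t(2)[OF c xi] by simp
   qed
  qed
 qed
 then show ?thesis using r epsh by blast
qed

text \<open>Any right adjoint completes \<open>F\<close> to a point. Arrows of \<open>pt\<close>
  look at inverse images alone, so the choice of the adjoint does not matter up to
  isomorphism.\<close>

lemma inverse_image_F: "\<exists>f\<in>Obj (pt U E). inverse_image f = F"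
proof -
 let ?S = "Set_cat U"
 define Q where "Q X r eps \<longleftrightarrow> r : Obj E \<and> eps : hom ?S (on_obj F r) X \<and>
  (\<forall>e\<in>Obj E. \<forall>p\<in>hom ?S (on_obj F e) X. \<exists>!t. t : hom E e r \<and> Comp ?S eps (on_arr F t) = p)" for X r eps
 have "\<exists>r eps. Q X r eps" if "X : Obj ?S" for X using universal_arrow_exists[OF that] unfolding Q_def by blast
 then obtain r eps where Q: "!!X. X : Obj ?S ==> Q X (r X) (eps X)" by metis
 have "\<exists>G eta eps. adjunction E ?S F G eta eps"
  by (rule adjunction_from_universal_arrows[OF F, of r eps]) (use Q in \<open>unfold Q_def, blast+\<close>)
 then obtain G eta eps' where adj: "adjunction E ?S F G eta eps'" by blast
 let ?f = "\<lparr>inverse_image = F, direct_image = G, adj_unit = eta, adj_counit = eps'\<rparr>"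
 have "geometric_morphism ?S E ?f" unfolding geometric_morphism_def using adj preserves_finite_limits_F by simp
 then have "?f : Obj (pt U E)" by (simp add: pt_def functor_cat_simps)
 moreover have "inverse_image ?f = F" by (rule geom.select_convs)
 ultimately show ?thesis by blast
qed

text \<open>The unit of the correspondence sends \<open>x\<close> to the class of the identity at
  \<open>x\<close>. It is onto because the class of \<open>m\<close> at \<open>x\<close> is the
  class of an identity at the element that \<open>m\<close> makes of \<open>x\<close>.\<close>

lemma ahom_PA: "\<exists>psi\<in>At.ahom R (PA F). psi ` El R = El (PA F)"
proof -
 let ?psi = "\<lambda>x. (lab R x, cl (Ident E (lab R x)) x)"
 have id: "Ident E (lab R x) : hom E (lab R x) (lab R x)" if "x : El R" for x using cat_ident[OF catE As_Obj[OF lab_As[OF that]]] .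
 have act: "?psi (act R g x) = (Cod E g, cl g x)" if g: "At.acts R g x" for g x
 proof -
  note f = flat_acts[OF R_flat g]
  note i = cat_ident[OF catE As_Obj[OF f(5)]]
  show ?thesis using cl_act[OF g i] cat_ident_left[OF catE f(6)] f(3) by simp
 qed
 have psi: "?psi : At.ahom R (PA F)"
 proof (rule At.ahomI)
  show "?psi x : El (PA F)" if "x : El R" for x using that lab_As cl_mem[OF that id[OF that]] by simp
  show "lab (PA F) (?psi x) = lab R x" if "x : El R" for x by simp
  fix g x assume g: "At.acts R g x"
  note f = flat_acts[OF R_flat g]
  show "?psi (act R g x) = act (PA F) g (?psi x)"
   unfolding act[OF g] using cl_arr[OF f(1) id[OF f(1)] f(6)] cat_ident_right[OF catE f(6)] by simp
 qed
 from At.ahomD(1)[OF psi] have "?psi ` El R \<subseteq> El (PA F)" by (rule image_subsetI)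
 moreover have "(a, y) : ?psi ` El R" if a: "a : As" and y: "y : on_obj F a" for a y
 proof -
  obtain x m where x: "x : El R" "m : hom E (lab R x) a" "y = cl m x" using cl_surj[OF As_Obj[OF a] y] by blast
  have g: "At.acts R m x" using acts_if_hom[OF x(1) lab_As[OF x(1)] a x(2)] .
  show ?thesis unfolding x(3) using act[OF g] flat_acts(2)[OF R_flat g] homD(3)[OF x(2)] by (intro image_eqI) auto
 qed
 ultimately have "?psi ` El R = El (PA F)" by auto
 then show ?thesis using psi by blast
qed

end

lemma (in atomic_site) candidate_saturated_pt: "candidate_saturated U (pt U E)"
proof -
 obtain K :: "('u, 'u) cat" and T fn where "flat_cat U A K T fn" using At.flat_cat_exists by blast
 then interpret K: flat_cat U A K T fn .
 obtain j where j: "fully_faithful (pt U E) K j" "\<forall>f\<in>Obj (pt U E).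
   (\<exists>phi\<in>At.ahom (PA (inverse_image f)) (T (on_obj j f)). phi ` El (PA (inverse_image f)) = El (T (on_obj j f))) \<and>
   (At.sat (PA (inverse_image f)) --> At.sat (T (on_obj j f)))" using pt_fully_faithful[OF K.flat_cat_axioms] by blast
 show ?thesis
 proof (rule K.candidate_saturated_if[OF j(1)])
  show "At.sat (T (on_obj j f))" if "f : Obj (pt U E)" for f using j(2) that PA_flat(2)[OF pt_inverse[OF that]] by blast
  fix c assume c: "c : Obj K" and s: "At.sat (T c)"
  obtain F cl where "sat_point U C J E y0 y1 As (T c) F cl" using sat_point_exists[OF K.T_flat[OF c] s K.T_sm[OF c]] by blast
  then interpret S: sat_point U C J E y0 y1 As "T c" F cl .
  obtain f where f: "f : Obj (pt U E)" "inverse_image f = F" using S.inverse_image_F by blast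
  obtain psi where psi: "psi : At.ahom (T c) (PA F)" "psi ` El (T c) = El (PA F)" using S.ahom_PA by blast
  obtain phi where phi: "phi : At.ahom (PA F) (T (on_obj j f))" "phi ` El (PA F) = El (T (on_obj j f))" using j(2) f by blast
  have "on_obj j f : Obj K" using functor_obj[OF fully_faithfulD(1)[OF j(1)] f(1)] .
  \<comment> \<open>The composite of the two surjective homomorphisms is onto, and homomorphisms of
    flat sets are injective; so \<open>c\<close> is isomorphic to the image of the point
    \<open>f\<close>.\<close>
  moreover have "El (T (on_obj j f)) \<subseteq> (\<lambda>x. phi (psi x)) ` El (T c)" using psi(2) phi(2) by (metis image_image order_refl)
  ultimately obtain h where "h : hom K c (on_obj j f)" "is_iso K h"
   using K.bij_is_iso[OF c _ At.ahom_comp[OF psi(1) phi(1)]] by metis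
  then show "\<exists>f\<in>Obj (pt U E). \<exists>h\<in>hom K c (on_obj j f). is_iso K h" using f(1) by blast
 qed
qed

theorem theorem5p0p13:
  fixes E :: "('o, 'm) cat"
  assumes "inaccessible TYPE('u)"
    and "atomic_topos TYPE('u) E"
  shows "candidate_saturated TYPE('u) (pt TYPE('u) E)"
proof -
  interpret universe "TYPE('u)" by standard (rule assms(1))
  obtain C :: "('u, 'u) cat" and J V R W where "sheaf_model TYPE('u) C J E V R W"
    using grothendieck_topos_model[of E] assms(2) unfolding atomic_topos_def by blast
  then interpret sheaf_model "TYPE('u)" C J E V R W .
  obtain y0 y1 where "dense_site TYPE('u) C J E y0 y1" using dense_site_exists by blast
  then interpret dense_site "TYPE('u)" C J E y0 y1 .
  obtain As where "atomic_site TYPE('u) C J E y0 y1 As"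
    using atomic_site_exists assms(2) unfolding atomic_topos_def by blast
  then interpret atomic_site "TYPE('u)" C J E y0 y1 As .
  show ?thesis by (rule candidate_saturated_pt)
qed

end
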